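(* Let $r\in(1,R]$. Almost surely, simultaneously for every $[\alpha,\beta]\subset[0,1]$ (with $\alpha\le\beta$), the set $\Lambda_r(\alpha,\beta)$ is nonempty if and only if $[\alpha,\beta]\subset I(r)$, and in this case $$\min_{q\in\{\alpha,\beta\}}\frac{\ln r-L^*(q)}{q}\ \le\ \dim_{\mathrm H}\Lambda_r(\alpha,\beta)\ \le\ \frac{\ln r-L^*(\alpha)}{\alpha}.$$ Additionally, if $\mu$ is isotropic (i.e. $\mu(a_i)=\mu(a_i^{-1})=\frac{1-\mu(e)}{2d}$ for all $1\le i\le d$), then almost surely $$\dim_{\mathrm H}\Lambda_r(\alpha,\beta)=\min_{q\in\{\alpha,\beta\}}\frac{\ln r-L^*(q)}{q}\qquad\text{for every }[\alpha,\beta]\subset I(r).$$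
   Context: Let $d\ge 2$ and let $\mathbb F$ be the free group of rank $d$ with identity $e$ and symmetric generating set $\mathcal A=\{a_1,\dots,a_d,a_1^{-1},\dots,a_d^{-1}\}$; $|x|$ is the word length of $x\in\mathbb F$. The boundary $\partial\mathbb F$ is the set of rays $\omega=(\omega_0=e,\omega_1,\omega_2,\dots)$ in the Cayley tree of $(\mathbb F,\mathcal A)$ (so $|\omega_m|=m$ and $\omega_m$ is a prefix of $\omega_{m+1}$), with metric $\mathrm d(\omega,\omega')=e^{-|\omega\wedge\omega'|}$ for $\omega\ne\omega'$, where $\omega\wedge\omega'$ is the longest common prefix. $\dim_{\mathrm H}$ is Hausdorff dimension for this metric. Let $\mu$ be a probability measure on $\mathcal A\cup\{e\}$ with $\mu(a)=\mu(a^{-1})>0$ for all $a\in\mathcal A$. Let $(Z_n)_{n\ge0}$ be the $\mu$-random walk on $\mathbb F$ ($Z_0=e$, i.i.d. right multiplications with law $\mu$), and let $R^{-1}=\limsup_n\mathbf P(Z_n=e)^{1/n}<1$ be its spectral radius. $L^*:\mathbb R\to[0,\infty]$ is the (lower semicontinuous) large-deviation rate function of $|Z_n|/n$: for every Borel $B\subset\mathbb R$, $-\inf_{B^\circ}L^*\le\liminf_n\frac1n\ln\mathbf P(|Z_n|/n\in B)\le\limsup_n\frac1n\ln\mathbf P(|Z_n|/n\in B)\le-\inf_{\overline B}L^*$. It is known that $L^*$ is convex, finite precisely on $[0,1]$, $L^*(0)=\ln R$, and $(L^* )'(0)$ (the right derivative) is finite. For $r>1$ set $I(r)=\{q\in[0,1]:L^*(q)\le\ln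 r\}$. If $0\in I(r)$ with $r\le R$ (which forces $r=R$), the expression $\frac{\ln r-L^*(q)}{q}$ at $q=0$ is interpreted as $\lim_{q\downarrow0}\frac{L^*(0)-L^*(q)}{q}=-(L^* )'(0)$. Branching random walk: $\mathcal T$ is a Galton–Watson tree with root $\emptyset$ and offspring distribution $(p_k)_{k\ge0}$ with $p_0=0$, $\sum_k e^{sk}p_k<\infty$ for some $s>0$, and mean $r=\sum_k kp_k$. Given $\mathcal T$, let $(Y_u)_{u\in\mathcal T\setminus\{\emptyset\}}$ be i.i.d. with law $\mu$; put $V(\emptyset)=e$ and $V(u)=Y_{u_1}\cdots Y_{u_n}$ where $(\emptyset,u_1,\dots,u_n=u)$ is the geodesic from $\emptyset$ to $u$. $\partial\mathcal T$ is the set of rays $t=(t_n)_{n\ge0}$ in $\mathcal T$ from the root. For $t\in\partial\mathcal T$ and $\omega\in\partial\mathbb F$, $V(t)=\omega$ means $V(t_n)\to\omega$, i.e. for every $m$, $\omega_m$ is a prefix of $V(t_n)$ for all large $n$. (For $1<r\le R$, almost surely $V(t)$ exists for all $t\in\partial\mathcal T$ and $t\mapsto V(t)$ is injective.) For $0\le\alpha\le\beta\le1$ define $$\Lambda_r(\alpha,\beta)=\Bigl\{\omega\in\partial\mathbb F:\exists\,t\in\partial\mathcal T,\ V(t)=\omega,\ \liminf_{n\to\infty}\tfrac{|V(t_n)|}{n}=\alpha,\ \limsup_{n\to\infty}\tfrac{|V(t_n)|}{n}=\beta\Bigr\}.$$ *)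

theory Defs
  imports "HOL-Probability.Probability" "HOL-Library.Sublist"
begin

text \<open>The free group on the generators \<open>a\<^sub>i\<close>, indexed by \<open>i :: 'g\<close>, realised by reduced words; its rank is
  \<open>CARD('g)\<close>. The letter \<open>(i, True)\<close> stands for \<open>a\<^sub>i\<close> and \<open>(i, False)\<close> for its inverse.\<close>

type_synonym 'g letter = "'g \<times> bool"

definition flip :: "'g letter \<Rightarrow> 'g letter" where
  "flip x = (fst x, \<not> snd x)"

definition reduced :: "'g letter list \<Rightarrow> bool" where
  "reduced = successively (\<lambda>x y. y \<noteq> flip x)"

fun cons_reduce :: "'g letter \<Rightarrow> 'g letter list \<Rightarrow> 'g letter list" where
  "cons_reduce x [] = [x]"
| "cons_reduce x (y # ys) = (if y = flip x then ys else x # y # ys)"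

lemma flip_flip [simp]: "flip (flip x) = x"
  by (simp add: flip_def)

lemma flip_neq [simp]: "flip x \<noteq> x" "x \<noteq> flip x"
  by (auto simp: flip_def prod_eq_iff)

lemma flip_eq_iff [simp]: "flip x = flip y \<longleftrightarrow> x = y"
  by (metis flip_flip)

lemma reduced_Nil [simp]: "reduced []"
  by (simp add: reduced_def)

lemma reduced_single [simp]: "reduced [x]"
  by (simp add: reduced_def)

lemma reduced_Cons_Cons: "reduced (x # y # ys) \<longleftrightarrow> y \<noteq> flip x \<and> reduced (y # ys)"
  by (simp add: reduced_def)

lemma reduced_ConsD: "reduced (x # xs) \<Longrightarrow> reduced xs"
  by (cases xs) (auto simp: reduced_Cons_Cons)

lemma reduced_cons_reduce: "reduced w \<Longrightarrow> reduced (cons_reduce x w)"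
  by (cases w) (auto simp: reduced_Cons_Cons dest: reduced_ConsD)

lemma reduced_foldr: "reduced w \<Longrightarrow> reduced (foldr cons_reduce u w)"
  by (induction u) (auto intro: reduced_cons_reduce)

lemma cons_reduce_flip:
  assumes "reduced w"
  shows "cons_reduce x (cons_reduce (flip x) w) = w"
proof (cases w)
  case (Cons y ys)
  then show ?thesis
    using assms by (cases ys) (auto simp: reduced_Cons_Cons)
qed simp

lemma foldr_cons_reduce:
  assumes "reduced w"
  shows "foldr cons_reduce (cons_reduce x v) w = cons_reduce x (foldr cons_reduce v w)"
  using assms by (cases v) (auto simp: cons_reduce_flip reduced_foldr)

lemma foldr_assoc:
  assumes "reduced w"
  shows "foldr cons_reduce (foldr cons_reduce u v) w = foldr cons_reduce u (foldr cons_reduce v w)"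
  by (induction u) (auto simp: foldr_cons_reduce assms)

lemma foldr_Nil: "reduced u \<Longrightarrow> foldr cons_reduce u [] = u"
proof (induction u)
  case (Cons x u)
  then show ?case by (cases u) (auto simp: reduced_Cons_Cons dest: reduced_ConsD)
qed simp

lemma reduced_rev_flip: "reduced w \<Longrightarrow> reduced (rev (map flip w))"
  unfolding reduced_def successively_rev successively_map
  by (erule successively_mono) (metis flip_flip)

lemma foldr_rev_flip: "foldr cons_reduce (rev (map flip w)) w = []"
  by (induction w) auto

typedef 'g free_group = "{w :: 'g letter list. reduced w}"
  morphisms word Abs_free_group
  by (rule exI[of _ "[]"]) simp

setup_lifting type_definition_free_group

instantiation free_group :: (type) "{monoid_mult, inverse}"
begin

lift_definition one_free_group :: "'a free_group" is "[]" by simp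

lift_definition times_free_group :: "'a free_group \<Rightarrow> 'a free_group \<Rightarrow> 'a free_group"
  is "\<lambda>u v. foldr cons_reduce u v" by (rule reduced_foldr)

lift_definition inverse_free_group :: "'a free_group \<Rightarrow> 'a free_group"
  is "\<lambda>w. rev (map flip w)" by (rule reduced_rev_flip)

definition divide_free_group :: "'a free_group \<Rightarrow> 'a free_group \<Rightarrow> 'a free_group" where
  "divide_free_group x y = x * inverse y"

instance
  by standard (transfer; simp add: foldr_assoc foldr_Nil)+

end

lemma free_group_left_inverse: "inverse x * x = (1 :: 'g free_group)"
  by transfer (rule foldr_rev_flip)

lift_definition gen :: "'g \<Rightarrow> 'g free_group" is "\<lambda>i. [(i, True)]" by simp

definition generators :: "'g free_group set" where
  "generators = range gen \<union> range (\<lambda>i. inverse (gen i))"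

definition word_length :: "'g free_group \<Rightarrow> nat" where
  "word_length x = length (word x)"

definition is_prefix :: "'g free_group \<Rightarrow> 'g free_group \<Rightarrow> bool" where
  "is_prefix x y \<longleftrightarrow> prefix (word x) (word y)"

typedef 'g boundary =
  "{\<omega> :: nat \<Rightarrow> 'g free_group. \<omega> 0 = 1 \<and> (\<forall>m. word_length (\<omega> m) = m \<and> is_prefix (\<omega> m) (\<omega> (Suc m)))}"
  morphisms ray Abs_boundary
proof -
  define c :: "'g letter" where "c = (undefined, True)"
  have red: "reduced (replicate m c)" for m
  proof (induction m)
    case (Suc m)
    then show ?case by (cases m) (auto simp: reduced_Cons_Cons)
  qed simp
  have "word (Abs_free_group (replicate m c)) = replicate m c" for m
    using red by (simp add: Abs_free_group_inverse)
  moreover have "prefix (replicate m c) (replicate (Suc m) c)" for m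
    by (metis prefixI replicate_Suc replicate_append_same)
  ultimately show ?thesis
    by (intro exI[of _ "\<lambda>m. Abs_free_group (replicate m c)"])
      (simp add: word_length_def is_prefix_def one_free_group_def del: replicate_Suc)
qed

definition meet :: "'g boundary \<Rightarrow> 'g boundary \<Rightarrow> 'g free_group" where
  "meet \<omega> \<omega>' = ray \<omega> (GREATEST m. ray \<omega> m = ray \<omega>' m)"

lemma ray_0: "ray \<omega> 0 = 1"
  and word_length_ray: "word_length (ray \<omega> m) = m"
  and is_prefix_ray: "is_prefix (ray \<omega> m) (ray \<omega> (Suc m))"
  using ray[of \<omega>] by auto

lemma ray_eq_Suc:
  assumes "ray \<omega> (Suc m) = ray \<omega>' (Suc m)"
  shows "ray \<omega> m = ray \<omega>' m"
proof -
  have "word (ray \<eta> m) = take m (word (ray \<eta> (Suc m)))" for \<eta> :: "'a boundary"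
    using is_prefix_ray[of \<eta> m] word_length_ray[of \<eta> m]
    by (auto simp: is_prefix_def word_length_def prefix_def)
  then show ?thesis
    using assms by (metis word_inject)
qed

lemma ray_eq_mono: "ray \<omega> n = ray \<omega>' n \<Longrightarrow> m \<le> n \<Longrightarrow> ray \<omega> m = ray \<omega>' m"
  by (induction n rule: nat_induct) (auto simp: le_Suc_eq dest: ray_eq_Suc)

lemma ray_neq:
  assumes "\<omega> \<noteq> \<omega>'"
  obtains k where "\<And>m. ray \<omega> m = ray \<omega>' m \<Longrightarrow> m \<le> k"
proof -
  obtain k where "ray \<omega> k \<noteq> ray \<omega>' k"
    using assms by (metis ext ray_inject)
  then show ?thesis
    using that by (metis nle_le ray_eq_mono)
qed

lemma le_meet_iff:
  assumes "\<omega> \<noteq> \<omega>'"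
  shows "m \<le> word_length (meet \<omega> \<omega>') \<longleftrightarrow> ray \<omega> m = ray \<omega>' m"
proof -
  obtain k where k: "\<And>m. ray \<omega> m = ray \<omega>' m \<Longrightarrow> m \<le> k"
    using ray_neq[OF assms] by blast
  define g where "g = (GREATEST m. ray \<omega> m = ray \<omega>' m)"
  have "ray \<omega> g = ray \<omega>' g"
    unfolding g_def by (rule GreatestI_nat[of _ 0 k]) (auto simp: ray_0 k)
  moreover have "m \<le> g" if "ray \<omega> m = ray \<omega>' m" for m
    unfolding g_def using that k by (intro Greatest_le_nat[of _ m k]) auto
  ultimately show ?thesis
    by (auto simp: meet_def word_length_ray simp flip: g_def intro: ray_eq_mono)
qed

instantiation boundary :: (type) metric_space
begin

definition dist_boundary :: "'a boundary \<Rightarrow> 'a boundary \<Rightarrow> real" where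
  "dist_boundary \<omega> \<omega>' = (if \<omega> = \<omega>' then 0 else exp (- real (word_length (meet \<omega> \<omega>'))))"

definition uniformity_boundary :: "('a boundary \<times> 'a boundary) filter" where
  "uniformity_boundary = (INF e\<in>{0 <..}. principal {(x, y). dist x y < e})"

definition open_boundary :: "'a boundary set \<Rightarrow> bool" where
  "open_boundary U \<longleftrightarrow> (\<forall>x\<in>U. \<forall>\<^sub>F (x', y) in uniformity. x' = x \<longrightarrow> y \<in> U)"

instance
proof
  fix x y z :: "'a boundary"
  show "dist x y = 0 \<longleftrightarrow> x = y"
    by (simp add: dist_boundary_def)
  have le: "min (word_length (meet x z)) (word_length (meet y z)) \<le> word_length (meet x y)"
    if "x \<noteq> y" "x \<noteq> z" "y \<noteq> z"
    using that by (metis le_meet_iff min.cobounded1 min.cobounded2)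
  show "dist x y \<le> dist x z + dist y z"
  proof (cases "x = y \<or> x = z \<or> y = z")
    case True
    have "meet z y = meet y z"
      by (metis (mono_tags, lifting) le_meet_iff le_refl meet_def word_length_ray nle_le)
    with True show ?thesis
      by (auto simp: dist_boundary_def)
  next
    case False
    have "exp (- real (word_length (meet x y)))
        \<le> exp (- real (min (word_length (meet x z)) (word_length (meet y z))))"
      using le False by simp
    also have "\<dots> \<le> exp (- real (word_length (meet x z))) + exp (- real (word_length (meet y z)))"
      by (auto simp: min_def add_increasing add_increasing2)
    finally show ?thesis
      using False by (simp add: dist_boundary_def)
  qed
qed (rule uniformity_boundary_def open_boundary_def)+

end

text \<open>The case distinction makes the zero-dimensional contribution of a nonempty set 1 also when its
  diameter vanishes (note \<open>0 powr 0 = 0\<close>).\<close>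

definition diam_power :: "real \<Rightarrow> 'a::metric_space set \<Rightarrow> ennreal" where
  "diam_power s U = (if U = {} then 0 else if s = 0 then 1 else ennreal (diameter U powr s))"

text \<open>\<open>diameter\<close> is only meaningful for bounded sets.\<close>

definition hausdorff_premeasure :: "real \<Rightarrow> real \<Rightarrow> 'a::metric_space set \<Rightarrow> ennreal" where
  "hausdorff_premeasure \<delta> s A =
     (INF U\<in>{U :: nat \<Rightarrow> 'a set. A \<subseteq> (\<Union>i. U i) \<and> (\<forall>i. bounded (U i) \<and> diameter (U i) \<le> \<delta>)}.
        \<Sum>i. diam_power s (U i))"

definition hausdorff_measure :: "real \<Rightarrow> 'a::metric_space set \<Rightarrow> ennreal" where
  "hausdorff_measure s A = (SUP \<delta>\<in>{0<..}. hausdorff_premeasure \<delta> s A)"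

definition hausdorff_dim :: "'a::metric_space set \<Rightarrow> ereal" where
  "hausdorff_dim A = (INF s\<in>{s. 0 \<le> s \<and> hausdorff_measure s A = 0}. ereal s)"

definition walk :: "'g free_group pmf \<Rightarrow> nat \<Rightarrow> 'g free_group pmf" where
  "walk \<mu> n = map_pmf prod_list (replicate_pmf n \<mu>)"

text \<open>This is the number \<open>1 / R\<close>.\<close>

definition spectral_radius :: "'g free_group pmf \<Rightarrow> ereal" where
  "spectral_radius \<mu> = limsup (\<lambda>n. ereal (root n (pmf (walk \<mu> n) 1)))"

text \<open>Logarithm of a probability, with \<open>ln 0 = -\<infinity>\<close>.\<close>

definition eln :: "real \<Rightarrow> ereal" where
  "eln x = (if x = 0 then - \<infinity> else ereal (ln x))"

definition speed_rate :: "'g free_group pmf \<Rightarrow> real set \<Rightarrow> nat \<Rightarrow> ereal" where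
  "speed_rate \<mu> B n =
     eln (measure_pmf.prob (walk \<mu> n) {x. real (word_length x) / real n \<in> B}) / ereal (real n)"

text \<open>Lower semicontinuity is closedness of the sublevel sets. Together with the large deviation bounds
  it determines \<open>L\<close>.\<close>

definition is_rate_function :: "'g free_group pmf \<Rightarrow> (real \<Rightarrow> ereal) \<Rightarrow> bool" where
  "is_rate_function \<mu> L \<longleftrightarrow>
     (\<forall>q. 0 \<le> L q) \<and>
     (\<forall>c. closed {q. L q \<le> c}) \<and>
     (\<forall>B\<in>sets borel.
        - (INF q\<in>interior B. L q) \<le> liminf (speed_rate \<mu> B) \<and>
        limsup (speed_rate \<mu> B) \<le> - (INF q\<in>closure B. L q))"

definition I_set :: "(real \<Rightarrow> ereal) \<Rightarrow> real \<Rightarrow> real set" where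
  "I_set L r = {q\<in>{0..1}. L q \<le> ereal (ln r)}"

text \<open>The value at \<open>q = 0\<close> is minus the right derivative of \<open>L\<close> at 0; it is only used when \<open>L 0 = ln r\<close>.\<close>

definition dim_bound :: "(real \<Rightarrow> ereal) \<Rightarrow> real \<Rightarrow> real \<Rightarrow> ereal" where
  "dim_bound L r q =
     (if q = 0 then Lim (at_right 0) (\<lambda>q. (L 0 - L q) / ereal q)
      else (ereal (ln r) - L q) / ereal q)"

text \<open>Vertices are Ulam-Harris words: the children of \<open>u\<close> are \<open>u @ [k]\<close> with \<open>k < N u\<close>.\<close>

definition gw_tree :: "(nat list \<Rightarrow> nat) \<Rightarrow> nat list set" where
  "gw_tree N = {u. \<forall>k<length u. u ! k < N (take k u)}"

definition tree_rays :: "nat list set \<Rightarrow> (nat \<Rightarrow> nat list) set" where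
  "tree_rays T = {t. t 0 = [] \<and> (\<forall>n. t n \<in> T \<and> (\<exists>k. t (Suc n) = t n @ [k]))}"

definition position :: "(nat list \<Rightarrow> 'g free_group) \<Rightarrow> nat list \<Rightarrow> 'g free_group" where
  "position Y u = prod_list (map (\<lambda>k. Y (take k u)) [1..<Suc (length u)])"

definition tends_to_boundary :: "(nat \<Rightarrow> 'g free_group) \<Rightarrow> 'g boundary \<Rightarrow> bool" where
  "tends_to_boundary x \<omega> \<longleftrightarrow> (\<forall>m. \<forall>\<^sub>F n in sequentially. is_prefix (ray \<omega> m) (x n))"

definition Lambda ::
  "(nat list \<Rightarrow> nat) \<Rightarrow> (nat list \<Rightarrow> 'g free_group) \<Rightarrow> real \<Rightarrow> real \<Rightarrow> 'g boundary set" where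
  "Lambda N Y \<alpha> \<beta> =
     {\<omega>. \<exists>t\<in>tree_rays (gw_tree N).
        tends_to_boundary (\<lambda>n. position Y (t n)) \<omega> \<and>
        liminf (\<lambda>n. ereal (real (word_length (position Y (t n))) / real n)) = ereal \<alpha> \<and>
        limsup (\<lambda>n. ereal (real (word_length (position Y (t n))) / real n)) = ereal \<beta>}"

text \<open>The offspring numbers \<open>N x u\<close> (of law \<open>p\<close>) and the increments \<open>Y x u\<close> (of law \<open>\<mu>\<close>), attached to
  all Ulam-Harris words, form one independent family. So the increments are i.i.d. given the tree;
  the increment at the root and the data at words outside the tree are never used.\<close>

definition branching_walk ::
  "'w measure \<Rightarrow> nat pmf \<Rightarrow> 'g free_group pmf \<Rightarrow>
   ('w \<Rightarrow> nat list \<Rightarrow> nat) \<Rightarrow> ('w \<Rightarrow> nat list \<Rightarrow> 'g free_group) \<Rightarrow> bool" where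
  "branching_walk M p \<mu> N Y \<longleftrightarrow>
     prob_space M \<and>
     prob_space.indep_vars M (\<lambda>_. count_space UNIV) (\<lambda>u x. (N x u, Y x u)) UNIV \<and>
     (\<forall>u. distr M (count_space UNIV) (\<lambda>x. (N x u, Y x u)) = measure_pmf (pair_pmf p \<mu>))"

end

theory Submission
  imports Defs "HOL-Real_Asymp.Real_Asymp" "HOL-Analysis.Harmonic_Numbers"
begin

text \<open>For the lower bounds, the walk is restricted to words that can be concatenated without
  cancellation. A second moment estimate and independence of disjoint subtrees show that, for \<open>q\<close> with
  \<open>L q < ln r\<close>, blocks of generations reach about \<open>exp (n * (ln r - L q))\<close> new sites at distance
  \<open>n * q\<close>, again and again, with a probability bounded below. There are countably many types of
  blocks, and an environment can be required to allow, at stage \<open>s\<close>, each of the first few types,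
  whatever was chosen before. Almost surely such an environment hangs below some vertex, so the null
  set does not depend on \<open>\<alpha>\<close> and \<open>\<beta>\<close>. Choosing blocks of speed close to \<open>\<alpha>\<close> and to \<open>\<beta>\<close> in phases of
  rapidly increasing length yields a Cantor set of rays in \<open>\<Lambda>\<close>, to which the mass distribution
  principle applies.

  For the upper bounds, the expected number of vertices in generation \<open>n\<close> with a given speed is \<open>r\<^sup>n\<close>
  times the corresponding probability for the walk. The ray limits are covered by the cylinders of the
  vertices of speed close to \<open>\<alpha>\<close>; if \<open>\<alpha> = 0\<close>, by those of all vertices, where supermultiplicativity
  of the first passage generating functions controls the sum. In the isotropic case one also covers by
  the cylinders reached when a path of speed close to \<open>\<beta>\<close> returns to its last common prefix with
  the limit. This is efficient below the exponent \<open>- ln f\<close>, where \<open>f\<close> is the first passage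
  generating function of a letter, and beyond it the cover by all vertices suffices, as
  \<open>(2 * d - 1) * f\<^sup>2 \<le> 1\<close> for \<open>d\<close> generators.\<close>

text \<open>Each count of good words bounds the rate function: \<open>A n m\<close> is
  supermultiplicative, so \<open>L (m / n) <= - ln (A n m) / n\<close>. Convexity of
  \<open>L\<close>, \<open>ln r <= L 0\<close> and the existence of blocks come from this inequality
  and its approximate converse. The endpoint \<open>r = R\<close> is covered because the Green
  function is finite there: a total return weight of one would make every first passage weight equal
  to one, which contradicts \<open>1 < r\<close>. A finite Green function bounds the mean number of
  particles at a site uniformly, and this makes the second moment method work.

  The obstacle to a single null set is that the success probabilities of the countably many block
  types have no common positive lower bound. So a stage asks for finitely many types only, placed in
  disjoint subtrees along a spine, and repeats each block until the failures cost at most half of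
  the probability guaranteed for the spine. The smaller probability of the next stage is compensated
  by longer blocks, while the number of types grows so slowly that a stage stays short compared with
  the past.\<close>

section \<open>Multiplication, length and cancellation of reduced words\<close>

lemma word_one [simp]: "word (1 :: 'g free_group) = []"
  by (simp add: one_free_group.rep_eq)

lemma word_mult: "word (x * y) = foldr cons_reduce (word x) (word y)"
  by (simp add: times_free_group.rep_eq)

lemma word_inverse: "word (inverse x) = rev (map flip (word x))"
  by (simp add: inverse_free_group.rep_eq)

lemma reduced_word [simp]: "reduced (word x)"
  using word[of x] by simp

lemma word_eq_Nil_iff [simp]: "word x = [] \<longleftrightarrow> x = 1"
  by (metis word_inject word_one)

lemma word_length_one [simp]: "word_length 1 = 0"
  by (simp add: word_length_def)

lemma inverse_inverse_free [simp]: "inverse (inverse x) = (x :: 'g free_group)"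
  by (rule word_inject[THEN iffD1]) (simp add: word_inverse rev_map o_def)

lemma word_length_inverse [simp]: "word_length (inverse x) = word_length x"
  by (simp add: word_length_def word_inverse)

lemma left_inverse_free [simp]: "inverse x * x = (1 :: 'g free_group)"
  by (rule free_group_left_inverse)

lemma right_inverse_free [simp]: "x * inverse x = (1 :: 'g free_group)"
  using free_group_left_inverse[of "inverse x"] by simp

lemma inverse_mult_cancel [simp]:
  "inverse x * (x * y) = (y :: 'g free_group)" "x * (inverse x * y) = y"
  by (simp_all flip: mult.assoc)

lemma inverse_one_free [simp]: "inverse (1 :: 'g free_group) = 1"
  by (metis left_inverse_free mult.right_neutral)

lemma mult_left_cancel_free [simp]: "x * y = x * z \<longleftrightarrow> y = (z :: 'g free_group)"
  by (metis inverse_mult_cancel(1))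

lemma mult_right_cancel_free [simp]: "y * x = z * x \<longleftrightarrow> y = (z :: 'g free_group)"
  by (metis mult.assoc mult.right_neutral right_inverse_free)

lemma inverse_mult_free: "inverse (x * y) = inverse y * inverse (x :: 'g free_group)"
  by (metis inverse_mult_cancel(1) left_inverse_free mult.assoc mult_left_cancel_free right_inverse_free)

lift_definition of_letter :: "'g letter \<Rightarrow> 'g free_group" is "\<lambda>x. [x]" by simp

lemma word_of_letter [simp]: "word (of_letter x) = [x]"
  by (simp add: of_letter.rep_eq)

lemma word_length_of_letter [simp]: "word_length (of_letter x) = 1"
  by (simp add: word_length_def)

lemma inverse_of_letter: "inverse (of_letter x) = of_letter (flip x)"
  by (rule word_inject[THEN iffD1]) (simp add: word_inverse)

lemma gen_eq_of_letter: "gen i = of_letter (i, True)"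
  by (rule word_inject[THEN iffD1]) (simp add: gen.rep_eq)

lemma of_letter_inject [simp]: "of_letter x = of_letter y \<longleftrightarrow> x = y"
  by (metis word_of_letter list.inject)

lemma of_letter_neq_one [simp]: "of_letter x \<noteq> 1" "1 \<noteq> of_letter x"
  by (metis word_of_letter word_one list.distinct(1))+

lemma generators_eq: "generators = range (of_letter :: 'g letter \<Rightarrow> _)"
proof -
  have "of_letter x \<in> generators" for x :: "'g letter"
    by (cases x; cases "snd x")
      (auto simp: generators_def image_iff gen_eq_of_letter inverse_of_letter flip_def)
  then show ?thesis
    by (auto simp: generators_def gen_eq_of_letter inverse_of_letter)
qed

lemma finite_generators [simp]: "finite (generators :: 'g::finite free_group set)"
  by (simp add: generators_eq)

lemma foldr_cons_reduce_append:
  "reduced (u @ v) \<Longrightarrow> foldr cons_reduce u v = u @ v"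
proof (induction u)
  case (Cons x u)
  then have "reduced (u @ v)"
    by (auto dest: reduced_ConsD)
  with Cons show ?case
    by (cases "u @ v") (auto simp: reduced_Cons_Cons)
qed simp

definition red_concat :: "'g free_group \<Rightarrow> 'g free_group \<Rightarrow> bool" where
  "red_concat x y \<longleftrightarrow> reduced (word x @ word y)"

lemma word_mult_red: "red_concat x y \<Longrightarrow> word (x * y) = word x @ word y"
  by (simp add: word_mult red_concat_def foldr_cons_reduce_append)

lemma word_length_mult_red: "red_concat x y \<Longrightarrow> word_length (x * y) = word_length x + word_length y"
  by (simp add: word_length_def word_mult_red)

lemma reduced_append_iff:
  "reduced (u @ v) \<longleftrightarrow> reduced u \<and> reduced v \<and> (u \<noteq> [] \<longrightarrow> v \<noteq> [] \<longrightarrow> hd v \<noteq> flip (last u))"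
  by (auto simp: reduced_def successively_append_iff)

lemma red_concat_iff:
  "red_concat x y \<longleftrightarrow> (x \<noteq> 1 \<longrightarrow> y \<noteq> 1 \<longrightarrow> hd (word y) \<noteq> flip (last (word x)))"
  by (auto simp: red_concat_def reduced_append_iff)

lemma red_concat_one [simp]: "red_concat 1 y" "red_concat x 1"
  by (simp_all add: red_concat_def)

lemma length_cons_reduce_le: "length (cons_reduce x v) \<le> Suc (length v)"
  by (cases v) auto

lemma word_length_mult_le: "word_length (x * y) \<le> word_length x + word_length y"
proof -
  have "length (foldr cons_reduce u v) \<le> length u + length v" for u v :: "'a letter list"
  proof (induction u)
    case (Cons a u)
    then show ?case
      using length_cons_reduce_le[of a "foldr cons_reduce u v"] by simp
  qed simp
  then show ?thesis
    by (simp add: word_length_def word_mult)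
qed

lemma word_length_mult_ge: "word_length x \<le> word_length (x * y) + word_length y"
  using word_length_mult_le[of "x * y" "inverse y"] by (simp add: mult.assoc)

lemma word_Abs [simp]: "reduced w \<Longrightarrow> word (Abs_free_group w) = w"
  by (simp add: Abs_free_group_inverse)

text \<open>Both parts of a split reduced word are reduced, so every splitting of the word comes
  from a factorisation of the group element without cancellation.\<close>

lemma factor_word:
  assumes "word x = u @ v"
  obtains y z where "x = y * z" "red_concat y z" "word y = u" "word z = v"
proof -
  have r: "reduced (u @ v)"
    using assms reduced_word[of x] by simp
  then have "reduced u" "reduced v"
    by (auto simp: reduced_append_iff)
  define y z where "y = Abs_free_group u" and "z = Abs_free_group v"
  have w: "word y = u" "word z = v"
    using \<open>reduced u\<close> \<open>reduced v\<close> by (auto simp: y_def z_def)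
  moreover have "red_concat y z"
    using r w by (simp add: red_concat_def)
  moreover have "x = y * z"
    by (rule word_inject[THEN iffD1]) (simp add: assms w word_mult_red[OF \<open>red_concat y z\<close>])
  ultimately show thesis using that by blast
qed

text \<open>Multiplication recurses on the left factor; the effect of a letter on the right is found
  by splitting off the last letter of \<open>x\<close>.\<close>

lemma word_mult_letter:
  "word (x * of_letter y) =
     (if x \<noteq> 1 \<and> last (word x) = flip y then butlast (word x) else word x @ [y])"
proof (cases "x \<noteq> 1 \<and> last (word x) = flip y")
  case True
  then have "word x = butlast (word x) @ [flip y]"
    by (metis append_butlast_last_id word_eq_Nil_iff)
  then obtain u v where uv: "x = u * v" "word u = butlast (word x)" "word v = [flip y]"
    using factor_word by blast
  then have "v = of_letter (flip y)"
    by (metis word_inject word_of_letter)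
  then have "x * of_letter y = u"
    using uv by (metis inverse_of_letter mult.assoc left_inverse_free mult.right_neutral flip_flip)
  then show ?thesis using True uv by auto
next
  case False
  then have "red_concat x (of_letter y)"
    by (auto simp: red_concat_iff)
  then show ?thesis
    using False by (auto simp: word_mult_red)
qed

lemma word_letter_mult: "word (of_letter y * x) = cons_reduce y (word x)"
  by (simp add: word_mult)

instance free_group :: (countable) countable
proof
  show "\<exists>f :: 'a free_group \<Rightarrow> nat. inj f"
    by (rule exI[of _ "\<lambda>x. to_nat (word x)"]) (auto simp: inj_def word_inject)
qed

lemma finite_word_length_eq [simp]: "finite {x :: 'g::finite free_group. word_length x = n}"
proof -
  have "finite {xs :: 'g letter list. length xs = n}"
    using finite_lists_length_eq[of "UNIV :: 'g letter set" n] by simp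
  moreover have "word ` {x. word_length x = n} \<subseteq> {xs :: 'g letter list. length xs = n}"
    by (auto simp: word_length_def)
  ultimately show ?thesis
    by (metis (no_types, lifting) finite_imageD finite_subset inj_onI word_inject)
qed

lemma card_word_length_le:
  "card {x :: 'g::finite free_group. word_length x = n} \<le> (2 * CARD('g)) ^ n"
proof -
  have "card {x :: 'g free_group. word_length x = n} \<le> card {xs :: 'g letter list. set xs \<subseteq> UNIV \<and> length xs = n}"
    by (rule card_inj_on_le[of word])
      (use finite_lists_length_eq[of "UNIV :: 'g letter set" n] in
        \<open>auto simp: inj_on_def word_inject word_length_def\<close>)
  then show ?thesis
    by (subst (asm) card_lists_length_eq) (simp_all add: mult.commute)
qed

subsection \<open>Supermultiplicative walk counts\<close>

lemma ennreal_suminf_swap: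
  fixes f :: "nat \<Rightarrow> nat \<Rightarrow> ennreal"
  shows "(\<Sum>i. \<Sum>j. f i j) = (\<Sum>j. \<Sum>i. f i j)"
  using nn_integral_suminf[of "\<lambda>i j. f i j" "count_space UNIV"]
  by (simp add: nn_integral_count_space_nat)

lemma ennreal_suminf_offset:
  fixes f :: "nat \<Rightarrow> ennreal"
  shows "(\<Sum>n. if i \<le> n then f (n - i) else 0) = (\<Sum>n. f n)"
proof -
  have "(\<Sum>n. if i \<le> n then f (n - i) else 0) = (\<Sum>n. (if i \<le> n + i then f (n + i - i) else 0)) + (\<Sum>n<i. if i \<le> n then f (n - i) else 0)"
    by (rule suminf_offset) simp
  then show ?thesis by simp
qed

lemma ennreal_Cauchy_product:
  fixes a b :: "nat \<Rightarrow> ennreal"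
  shows "(\<Sum>n. \<Sum>i\<le>n. a i * b (n - i)) = (\<Sum>n. a n) * (\<Sum>n. b n)"
proof -
  have "(\<Sum>i\<le>n. a i * b (n - i)) = (\<Sum>i. if i \<le> n then a i * b (n - i) else 0)" for n
    by (subst suminf_finite[of "{..n}"]) (auto intro!: sum.cong)
  then have "(\<Sum>n. \<Sum>i\<le>n. a i * b (n - i)) = (\<Sum>n. \<Sum>i. if i \<le> n then a i * b (n - i) else 0)"
    by simp
  also have "\<dots> = (\<Sum>i. \<Sum>n. if i \<le> n then a i * b (n - i) else 0)"
    by (rule ennreal_suminf_swap)
  also have "\<dots> = (\<Sum>i. a i * (\<Sum>n. b n))"
    by (subst ennreal_suminf_offset[of _ "\<lambda>n. a _ * b n"]) simp
  also have "\<dots> = (\<Sum>i. a i) * (\<Sum>n. b n)"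
    by simp
  finally show ?thesis .
qed

text \<open>Partial sums are continuous in the parameter, so a bound valid strictly below
  \<open>r\<close> persists at \<open>r\<close>. It carries estimates from the range where the
  series converge geometrically to the endpoint, which may be the radius of convergence.\<close>

lemma ennreal_power_series_le:
  fixes a :: "nat \<Rightarrow> real"
  assumes a: "\<And>n. 0 \<le> a n" and r: "0 < r"
    and le: "\<And>s. 0 < s \<Longrightarrow> s < r \<Longrightarrow> (\<Sum>n. ennreal (s ^ n * a n)) \<le> c"
  shows "(\<Sum>n. ennreal (r ^ n * a n)) \<le> c"
proof (rule suminf_le_const[OF summableI])
  fix N
  have lim: "((\<lambda>s. \<Sum>n<N. ennreal (s ^ n * a n)) \<longlongrightarrow> (\<Sum>n<N. ennreal (r ^ n * a n))) (at_left r)"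
    by (intro tendsto_sum tendsto_ennrealI tendsto_intros)
  have "eventually (\<lambda>s. s \<in> {0<..<r}) (at_left r)"
    by (rule eventually_at_left_real) (use r in auto)
  then have "eventually (\<lambda>s. (\<Sum>n<N. ennreal (s ^ n * a n)) \<le> c) (at_left r)"
  proof eventually_elim
    case (elim s)
    have "(\<Sum>n<N. ennreal (s ^ n * a n)) \<le> (\<Sum>n. ennreal (s ^ n * a n))"
      by (rule sum_le_suminf) auto
    also have "\<dots> \<le> c"
      using le elim by auto
    finally show ?case .
  qed
  then show "(\<Sum>n<N. ennreal (r ^ n * a n)) \<le> c"
    by (rule tendsto_upperbound[OF lim]) simp
qed

lemma walk_0: "walk \<mu> 0 = return_pmf 1"
  by (simp add: walk_def)

lemma walk_add: "walk \<mu> (m + n) = do {x \<leftarrow> walk \<mu> m; y \<leftarrow> walk \<mu> n; return_pmf (x * y)}"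
  by (simp add: walk_def replicate_pmf_distrib map_pmf_def bind_assoc_pmf bind_return_pmf)

lemma walk_1: "walk \<mu> (Suc 0) = \<mu>"
  by (simp add: walk_def replicate_pmf_1[simplified] pmf.map_comp o_def)

lemma pmf_bind_mult:
  fixes A B :: "'g free_group pmf"
  assumes "finite S" "set_pmf A \<subseteq> S"
  shows "pmf (do {x \<leftarrow> A; y \<leftarrow> B; return_pmf (x * y)}) z = (\<Sum>x\<in>S. pmf A x * pmf B (inverse x * z))"
proof -
  have "pmf (B \<bind> (\<lambda>y. return_pmf (x * y))) z = pmf B (inverse x * z)" for x
  proof -
    have "B \<bind> (\<lambda>y. return_pmf (x * y)) = map_pmf (\<lambda>y. x * y) B"
      by (simp add: map_pmf_def)
    also have "pmf \<dots> z = pmf B (inverse x * z)"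
      using pmf_map_inj'[of "\<lambda>y. x * y" B "inverse x * z"] by (simp add: inj_def)
    finally show ?thesis .
  qed
  then have "pmf (do {x \<leftarrow> A; y \<leftarrow> B; return_pmf (x * y)}) z = (\<integral>x. pmf B (inverse x * z) \<partial>measure_pmf A)"
    by (simp add: pmf_bind)
  also have "\<dots> = (\<Sum>x\<in>S. pmf A x * pmf B (inverse x * z))"
    using assms by (subst integral_measure_pmf[of S]) (auto simp: mult.commute)
  finally show ?thesis .
qed

text \<open>Two generators fixed for good; that \<open>i1\<close> differs from \<open>i0\<close> is
  the content of \<open>i1_neq\<close>, where the rank enters.\<close>

definition i0 :: 'g where "i0 = undefined"
definition i1 :: 'g where "i1 = (SOME i. i \<noteq> i0)"
definition l0 :: "'g letter" where "l0 = (i0, True)"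
definition l1 :: "'g letter" where "l1 = (i1, True)"

text \<open>Good words can be concatenated without cancellation.\<close>

definition good_words :: "nat \<Rightarrow> 'g free_group set" where
  "good_words m = {x. word_length x = m \<and> x \<noteq> 1 \<and> hd (word x) = l0 \<and> last (word x) \<noteq> flip l0}"

lemma finite_good_words [simp]: "finite (good_words m :: 'g::finite free_group set)"
  by (rule finite_subset[OF _ finite_word_length_eq[of m]]) (auto simp: good_words_def)

lemma good_words_red_concat: "x \<in> good_words m \<Longrightarrow> y \<in> good_words n \<Longrightarrow> red_concat x y"
  by (simp add: good_words_def red_concat_iff) (metis flip_flip)

lemma good_words_mult: "x \<in> good_words m \<Longrightarrow> y \<in> good_words n \<Longrightarrow> x * y \<in> good_words (m + n)"
  using good_words_red_concat[of x m y n] word_mult_red[of x y] word_length_mult_red[of x y]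
  by (auto simp: good_words_def simp flip: word_eq_Nil_iff)

lemma good_words_mult_inj:
  assumes "x \<in> good_words m" "x' \<in> good_words m" "y \<in> good_words n" "y' \<in> good_words n" "x * y = x' * y'"
  shows "x = x' \<and> y = y'"
proof -
  have "word x @ word y = word x' @ word y'"
    using assms good_words_red_concat by (metis word_mult_red)
  then have "word x = word x'" "word y = word y'"
    using assms by (auto simp: good_words_def word_length_def)
  then show ?thesis by (simp add: word_inject)
qed

lemma good_words_l0: "of_letter l0 \<in> good_words 1"
  by (auto simp: good_words_def simp flip: word_eq_Nil_iff)

text \<open>The letter is \<open>l1\<close> exactly when \<open>l0\<close> would cancel. In both
  cases it is different from \<open>flip l0\<close>, so a further \<open>l0\<close> can be put in
  front of it; in the same way \<open>pad_right\<close> gives an admissible last letter.\<close>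

definition pad_left :: "'g free_group \<Rightarrow> 'g letter" where
  "pad_left x = (if x \<noteq> 1 \<and> hd (word x) = flip l0 then l1 else l0)"

definition pad_right :: "'g free_group \<Rightarrow> 'g letter" where
  "pad_right x = (if x \<noteq> 1 \<and> last (word x) = flip l0 then l1 else l0)"

definition pad :: "'g free_group \<Rightarrow> 'g free_group" where
  "pad x = of_letter l0 * (of_letter (pad_left x) * (x * of_letter (pad_right x)))"

locale symmetric_walk =
  fixes \<mu> :: "'g::finite free_group pmf"
  assumes rank: "CARD('g) \<ge> 2"
    and supp: "set_pmf \<mu> \<subseteq> insert 1 generators"
    and sym: "\<forall>a\<in>generators. pmf \<mu> a = pmf \<mu> (inverse a) \<and> pmf \<mu> a > 0"
begin

lemma i1_neq: "(i1 :: 'g) \<noteq> i0"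
proof -
  have "\<exists>i :: 'g. i \<noteq> i0"
  proof (rule ccontr)
    assume "\<not> ?thesis"
    then have "(UNIV :: 'g set) = {i0}" by auto
    then have "CARD('g) = card {i0 :: 'g}" by simp
    then show False using rank by simp
  qed
  then show ?thesis unfolding i1_def by (rule someI_ex)
qed

lemma l1_neq [simp]: "(l1 :: 'g letter) \<noteq> l0" "(l0 :: 'g letter) \<noteq> l1"
  "(l1 :: 'g letter) \<noteq> flip l0" "flip l1 \<noteq> (l0 :: 'g letter)" "flip l0 \<noteq> (l1 :: 'g letter)"
  using i1_neq by (auto simp: l0_def l1_def flip_def)

abbreviation S :: "'g free_group set" where "S \<equiv> insert 1 generators"

lemma finite_S: "finite S" by simp

lemma inverse_S: "inverse ` S = S"
proof -
  have "inverse ` S \<subseteq> S"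
    by (auto simp: generators_eq inverse_of_letter)
  then show ?thesis
    by (metis (no_types, lifting) image_subset_iff inverse_inverse_free subsetI imageI subset_antisym)
qed

lemma mu_letter_pos: "pmf \<mu> (of_letter x) > 0"
  using sym by (metis generators_eq rangeI)

lemma mu_inverse: "pmf \<mu> (inverse x) = pmf \<mu> x"
proof (cases "x \<in> S")
  case True
  then show ?thesis using sym by auto
next
  case False
  then have "inverse x \<notin> S"
    using inverse_S by (metis imageI inverse_inverse_free)
  with False show ?thesis
    using supp by (metis subset_iff set_pmf_iff)
qed

lemma sum_mu_S: "(\<Sum>y\<in>S. pmf \<mu> y) = 1"
  by (rule sum_pmf_eq_1[OF finite_S supp])

definition P :: "nat \<Rightarrow> 'g free_group \<Rightarrow> real" where
  "P n x = pmf (walk \<mu> n) x"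

lemma P_nonneg [simp]: "0 \<le> P n x"
  by (simp add: P_def)

lemma P_0: "P 0 x = (if x = 1 then 1 else 0)"
  by (simp add: P_def walk_0 indicator_def)

lemma P_Suc: "P (Suc n) x = (\<Sum>y\<in>S. pmf \<mu> y * P n (inverse y * x))"
  unfolding P_def
  using walk_add[of \<mu> 1 n] pmf_bind_mult[OF finite_S supp] by (simp add: walk_1)

lemma set_walk: "x \<in> set_pmf (walk \<mu> n) \<Longrightarrow> word_length x \<le> n"
proof (induction n arbitrary: x)
  case 0
  then show ?case by (simp add: walk_0)
next
  case (Suc n)
  then obtain y z where "y \<in> set_pmf \<mu>" "z \<in> set_pmf (walk \<mu> n)" "x = y * z"
    using walk_add[of \<mu> 1 n] by (auto simp: walk_1)
  moreover from this have "word_length y \<le> 1"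
    using supp by (auto simp: generators_eq)
  ultimately show ?case
    using Suc.IH[of z] word_length_mult_le[of y z] by simp
qed

lemma P_eq_0: "word_length x > n \<Longrightarrow> P n x = 0"
  using set_walk[of x n] by (auto simp: P_def set_pmf_iff)

lemma finite_set_walk: "finite (set_pmf (walk \<mu> n))"
proof -
  have "set_pmf (walk \<mu> n) \<subseteq> (\<Union>m\<le>n. {x. word_length x = m})"
    using set_walk by blast
  then show ?thesis
    by (rule finite_subset) simp
qed

lemma P_add:
  assumes "finite T" "set_pmf (walk \<mu> m) \<subseteq> T"
  shows "P (m + n) x = (\<Sum>y\<in>T. P m y * P n (inverse y * x))"
  unfolding P_def walk_add by (rule pmf_bind_mult[OF assms])

lemma P_mult_le: "P m x * P n y \<le> P (m + n) (x * y)"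
proof -
  have "P m x * P n y = (\<Sum>z\<in>{x}. P m z * P n (inverse z * (x * y)))"
    by simp
  also have "\<dots> \<le> (\<Sum>z\<in>insert x (set_pmf (walk \<mu> m)). P m z * P n (inverse z * (x * y)))"
    using finite_set_walk by (intro sum_mono2) auto
  also have "\<dots> = P (m + n) (x * y)"
    by (subst P_add) (auto simp: finite_set_walk)
  finally show ?thesis .
qed

lemma P_Suc_right: "P (Suc n) x = (\<Sum>y\<in>S. P n (x * y) * pmf \<mu> y)"
proof -
  let ?T = "set_pmf (walk \<mu> n) \<union> (\<lambda>y. x * y) ` S"
  have "P (Suc n) x = P (n + Suc 0) x" by simp
  also have "\<dots> = (\<Sum>z\<in>?T. P n z * P (Suc 0) (inverse z * x))"
    by (rule P_add) (auto simp: finite_set_walk)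
  also have "\<dots> = (\<Sum>z\<in>(\<lambda>y. x * y) ` S. P n z * P (Suc 0) (inverse z * x))"
  proof (rule sum.mono_neutral_right)
    show "\<forall>z\<in>?T - (\<lambda>y. x * y) ` S. P n z * P (Suc 0) (inverse z * x) = 0"
    proof
      fix z assume "z \<in> ?T - (\<lambda>y. x * y) ` S"
      then have "inverse x * z \<notin> S"
        by (metis DiffD2 imageI inverse_mult_cancel(2))
      then have "pmf \<mu> (inverse x * z) = 0"
        using supp by (metis subset_iff set_pmf_iff)
      then have "pmf \<mu> (inverse z * x) = 0"
        using mu_inverse[of "inverse x * z"] by (simp add: inverse_mult_free)
      then show "P n z * P (Suc 0) (inverse z * x) = 0"
        by (simp add: P_def walk_1)
    qed
  qed (auto simp: finite_set_walk)
  also have "\<dots> = (\<Sum>y\<in>S. P n (x * y) * pmf \<mu> y)"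
    by (subst sum.reindex)
      (auto simp: inj_on_def P_def walk_1 inverse_mult_free mult.assoc mu_inverse)
  finally show ?thesis .
qed

text \<open>The first-step and the last-step recursion of the walk are exchanged by inversion,
  because \<open>\<mu>\<close> is symmetric.\<close>

lemma P_inverse: "P n (inverse x) = P n x"
proof (induction n arbitrary: x)
  case 0
  have "inverse x = 1 \<longleftrightarrow> x = 1"
    by (metis inverse_inverse_free inverse_one_free)
  then show ?case by (simp add: P_0)
next
  case (Suc n)
  have "P (Suc n) (inverse x) = (\<Sum>y\<in>S. P n (inverse x * y) * pmf \<mu> y)"
    by (rule P_Suc_right)
  also have "\<dots> = (\<Sum>y\<in>S. pmf \<mu> y * P n (inverse y * x))"
    by (intro sum.cong refl) (subst Suc.IH[symmetric], simp add: inverse_mult_free)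
  finally show ?case by (simp only: P_Suc)
qed

lemma P_Suc0: "P (Suc 0) x = pmf \<mu> x"
  by (simp add: P_def walk_1)

definition mu_min :: real where "mu_min = Min (range (\<lambda>x. pmf \<mu> (of_letter x)))"

lemma mu_min: "0 < mu_min" "mu_min \<le> pmf \<mu> (of_letter x)"
  unfolding mu_min_def using mu_letter_pos by (auto simp: Min_gr_iff)

lemma pad_left_red: "red_concat (of_letter (pad_left x)) (x :: 'g free_group)"
  using l1_neq by (auto simp: red_concat_iff pad_left_def)

lemma pad_right_red: "red_concat x (of_letter (pad_right (x :: 'g free_group)))"
  using l1_neq by (simp add: red_concat_iff pad_right_def) (metis flip_flip)

lemma word_pad: "word (pad (x :: 'g free_group)) = l0 # pad_left x # word x @ [pad_right x]"
proof -
  have 1: "word (x * of_letter (pad_right x)) = word x @ [pad_right x]"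
    using word_mult_red[OF pad_right_red] by simp
  have "red_concat (of_letter (pad_left x)) (x * of_letter (pad_right x))"
  proof (cases "x = 1")
    case True
    then show ?thesis by (auto simp: red_concat_iff pad_left_def pad_right_def)
  next
    case False
    then show ?thesis
      using pad_left_red[of x] by (auto simp: red_concat_iff 1)
  qed
  then have 2: "word (of_letter (pad_left x) * (x * of_letter (pad_right x))) = pad_left x # word x @ [pad_right x]"
    by (simp add: word_mult_red 1)
  have "red_concat (of_letter l0) (of_letter (pad_left x) * (x * of_letter (pad_right x)))"
    unfolding red_concat_iff 2 by (simp add: pad_left_def)
  then show ?thesis
    by (simp add: pad_def word_mult_red 2)
qed

lemma pad_good: "pad (x :: 'g free_group) \<in> good_words (word_length x + 3)"
proof -
  have "pad x \<noteq> 1"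
    using word_pad[of x] by (metis list.distinct(1) word_one)
  moreover have "pad_right x \<noteq> flip l0"
    by (simp add: pad_right_def)
  ultimately show ?thesis
    by (simp add: good_words_def word_pad word_length_def)
qed

lemma inj_pad: "inj (pad :: 'g free_group \<Rightarrow> _)"
proof (rule injI)
  fix x y :: "'g free_group" assume "pad x = pad y"
  then have "word x @ [pad_right x] = word y @ [pad_right y]"
    using word_pad by (metis list.inject)
  then show "x = y" by (simp add: word_inject)
qed

lemma P_pad: "mu_min ^ 3 * P n x \<le> P (n + 3) (pad x)"
proof -
  let ?a = "of_letter l0" and ?b = "of_letter (pad_left x)" and ?c = "of_letter (pad_right x)"
  have "mu_min ^ 3 * P n x = mu_min * (mu_min * (P n x * mu_min))"
    by (simp add: power3_eq_cube ac_simps)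
  also have "\<dots> \<le> P 1 ?a * (P 1 ?b * (P n x * P 1 ?c))"
    using mu_min by (intro mult_mono mult_nonneg_nonneg) (auto simp: P_Suc0 less_imp_le)
  also have "\<dots> \<le> P 1 ?a * (P 1 ?b * P (n + 1) (x * ?c))"
    by (intro mult_left_mono P_mult_le P_nonneg)
  also have "\<dots> \<le> P 1 ?a * P (1 + (n + 1)) (?b * (x * ?c))"
    by (intro mult_left_mono P_mult_le P_nonneg)
  also have "\<dots> \<le> P (1 + (1 + (n + 1))) (pad x)"
    unfolding pad_def by (rule P_mult_le)
  finally show ?thesis by (simp add: numeral_3_eq_3)
qed

text \<open>\<open>E\<close> is the law of the length of the walk, and \<open>A\<close> its part on
  good words, singled out because it is supermultiplicative. The two are comparable up to a constant
  factor and a shift of both arguments by three (\<open>A_le_E\<close>,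
  \<open>E_le_A\<close>).\<close>

definition A :: "nat \<Rightarrow> nat \<Rightarrow> real" where
  "A n m = (\<Sum>x\<in>good_words m. P n x)"

definition E :: "nat \<Rightarrow> nat \<Rightarrow> real" where
  "E n m = (\<Sum>x\<in>{x. word_length x = m}. P n x)"

lemma A_nonneg [simp]: "0 \<le> A n m" and E_nonneg [simp]: "0 \<le> E n m"
  by (simp_all add: A_def E_def sum_nonneg)

lemma A_le_E: "A n m \<le> E n m"
  unfolding A_def E_def by (rule sum_mono2) (auto simp: good_words_def)

lemma E_eq_prob: "E n m = measure_pmf.prob (walk \<mu> n) {x. word_length x = m}"
  by (simp add: E_def P_def measure_measure_pmf_finite)

lemma E_eq_0: "n < m \<Longrightarrow> E n m = 0"
  unfolding E_def by (intro sum.neutral) (auto simp: P_eq_0)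

lemma E_le_A: "mu_min ^ 3 * E n m \<le> A (n + 3) (m + 3)"
proof -
  have "mu_min ^ 3 * E n m = (\<Sum>x\<in>{x. word_length x = m}. mu_min ^ 3 * P n x)"
    by (simp add: E_def sum_distrib_left)
  also have "\<dots> \<le> (\<Sum>x\<in>{x. word_length x = m}. P (n + 3) (pad x))"
    by (intro sum_mono P_pad)
  also have "\<dots> = (\<Sum>y\<in>pad ` {x. word_length x = m}. P (n + 3) y)"
    using inj_pad by (subst sum.reindex) (auto simp: inj_on_def)
  also have "\<dots> \<le> A (n + 3) (m + 3)"
    unfolding A_def using pad_good by (intro sum_mono2) auto
  finally show ?thesis .
qed

text \<open>For fixed lengths a product of good words determines its factors, so different pairs
  contribute to different words.\<close>

lemma A_supermult: "A n m * A n' m' \<le> A (n + n') (m + m')"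
proof -
  have "A n m * A n' m' = (\<Sum>(x, y)\<in>good_words m \<times> good_words m'. P n x * P n' y)"
    by (simp add: A_def sum_product sum.cartesian_product)
  also have "\<dots> \<le> (\<Sum>(x, y)\<in>good_words m \<times> good_words m'. P (n + n') (x * y))"
    by (intro sum_mono) (auto simp: P_mult_le)
  also have "\<dots> = (\<Sum>z\<in>(\<lambda>(x, y). x * y) ` (good_words m \<times> good_words m'). P (n + n') z)"
  proof (subst sum.reindex)
    show "inj_on (\<lambda>(x, y). x * y) (good_words m \<times> good_words m' :: ('g free_group \<times> 'g free_group) set)"
      by (rule inj_onI) (auto dest: good_words_mult_inj)
  qed (simp add: case_prod_unfold)
  also have "\<dots> \<le> A (n + n') (m + m')"
    unfolding A_def by (intro sum_mono2) (auto simp: good_words_mult)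
  finally show ?thesis .
qed

lemma A_power: "A n m ^ Suc j \<le> A (Suc j * n) (Suc j * m)"
proof (induction j)
  case (Suc j)
  have "A n m ^ Suc (Suc j) \<le> A n m * A (Suc j * n) (Suc j * m)"
    using Suc by (simp add: mult_left_mono)
  also have "\<dots> \<le> A (n + Suc j * n) (m + Suc j * m)"
    by (rule A_supermult)
  finally show ?case by simp
qed simp

end

subsection \<open>Generating functions\<close>

context symmetric_walk
begin

text \<open>The probability that the walk visits \<open>x\<close> for the first time at time
  \<open>n\<close>. The recursion splits off the first step \<open>y\<close>, after which the target
  seen from the walker is \<open>inverse y * x\<close>.\<close>

primrec fp :: "nat \<Rightarrow> 'g free_group \<Rightarrow> real" where
  "fp 0 x = (if x = 1 then 1 else 0)"
| "fp (Suc n) x = (if x = 1 then 0 else (\<Sum>y\<in>S. pmf \<mu> y * fp n (inverse y * x)))"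

lemma fp_nonneg [simp]: "0 \<le> fp n x"
  by (induction n arbitrary: x) (auto intro!: sum_nonneg add_nonneg_nonneg)

lemma fp_one: "fp n 1 = (if n = 0 then 1 else 0)"
  by (cases n) auto

text \<open>Decomposition at the first visit to \<open>x\<close>; what follows is a loop, whose
  probability is the same at every site.\<close>

lemma P_eq_fp: "P n x = (\<Sum>i\<le>n. fp i x * P (n - i) 1)"
proof (induction n arbitrary: x)
  case 0
  then show ?case by (simp add: P_0)
next
  case (Suc n)
  show ?case
  proof (cases "x = 1")
    case True
    have "(\<Sum>i\<le>Suc n. fp i x * P (Suc n - i) 1) = (\<Sum>i\<le>Suc n. if i = 0 then P (Suc n) 1 else 0)"
      using True by (intro sum.cong) (auto simp: fp_one)
    then show ?thesis using True by simp
  next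
    case False
    have "P (Suc n) x = (\<Sum>y\<in>S. pmf \<mu> y * (\<Sum>i\<le>n. fp i (inverse y * x) * P (n - i) 1))"
      unfolding P_Suc by (simp add: Suc.IH)
    also have "\<dots> = (\<Sum>y\<in>S. \<Sum>i\<le>n. pmf \<mu> y * fp i (inverse y * x) * P (n - i) 1)"
      by (simp add: sum_distrib_left mult.assoc)
    also have "\<dots> = (\<Sum>i\<le>n. \<Sum>y\<in>S. pmf \<mu> y * fp i (inverse y * x) * P (n - i) 1)"
      by (rule sum.swap)
    also have "\<dots> = (\<Sum>i\<le>n. fp (Suc i) x * P (n - i) 1)"
      using False by (simp add: sum_distrib_right)
    also have "\<dots> = (\<Sum>i\<le>Suc n. fp i x * P (Suc n - i) 1)"
      using False by (subst sum.atMost_Suc_shift) simp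
    finally show ?thesis .
  qed
qed

lemma fp_le_P: "fp n x \<le> P n x"
proof -
  have "fp n x = fp n x * P (n - n) 1" by (simp add: P_0)
  also have "\<dots> \<le> P n x"
    unfolding P_eq_fp[of n x]
    by (rule member_le_sum[of n "{..n}" "\<lambda>i. fp i x * P (n - i) 1"]) auto
  finally show ?thesis .
qed

text \<open>A first visit is not visibly invariant under reversal of the path, but
  \<open>P_eq_fp\<close> determines \<open>fp\<close> recursively from \<open>P\<close>, which is
  invariant.\<close>

lemma fp_inverse: "fp n (inverse x) = fp n x"
proof (induction n rule: less_induct)
  case (less n)
  have *: "P n y = (\<Sum>i<n. fp i y * P (n - i) 1) + fp n y" for y
    unfolding P_eq_fp[of n y] by (simp add: lessThan_Suc_atMost[symmetric] P_0)
  have "(\<Sum>i<n. fp i (inverse x) * P (n - i) 1) = (\<Sum>i<n. fp i x * P (n - i) 1)"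
    using less by (intro sum.cong) auto
  then show ?case
    using *[of x] *[of "inverse x"] P_inverse[of n x] by simp
qed

lemma last_cons_reduce: "cons_reduce l v \<noteq> [] \<Longrightarrow> v \<noteq> [] \<Longrightarrow> last (cons_reduce l v) = last v"
  by (cases v) (auto split: if_splits)

text \<open>A letter multiplied from the left leaves the last letter of \<open>x\<close> unchanged
  unless it exhausts \<open>x\<close>. This keeps the hypothesis of \<open>fp_mult\<close> intact
  along its induction.\<close>

lemma red_concat_letter_mult:
  assumes "red_concat x y" "x \<noteq> 1" "z \<in> S"
  shows "red_concat (inverse z * x) y"
proof (cases "z = 1")
  case True
  then show ?thesis using assms by simp
next
  case False
  then obtain l where l: "inverse z = of_letter l"
    using assms False by (metis generators_eq imageE insertE inverse_of_letter)
  have "inverse z * x \<noteq> 1 \<Longrightarrow> last (word (inverse z * x)) = last (word x)"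
    using last_cons_reduce[of l "word x"] assms(2) by (simp add: l word_letter_mult flip: word_eq_Nil_iff)
  then show ?thesis
    using assms by (auto simp: red_concat_iff)
qed

text \<open>The Cayley graph is a tree: when nothing cancels, a path from the identity to
  \<open>x * y\<close> passes through \<open>x\<close>, and the first passage splits there. The
  recursion of \<open>fp\<close> turns this into an induction on the time with a moving
  \<open>x\<close>.\<close>

lemma fp_mult: "red_concat x y \<Longrightarrow> fp n (x * y) = (\<Sum>i\<le>n. fp i x * fp (n - i) y)"
proof (induction n arbitrary: x)
  case 0
  have "x * y = 1 \<longleftrightarrow> x = 1 \<and> y = 1"
    using word_mult_red[OF 0] by (metis append_is_Nil_conv word_eq_Nil_iff)
  then show ?case by simp
next
  case (Suc n)
  show ?case
  proof (cases "x = 1")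
    case True
    have "(\<Sum>i\<le>Suc n. fp i x * fp (Suc n - i) y) = (\<Sum>i\<le>Suc n. if i = 0 then fp (Suc n) y else 0)"
      using True by (intro sum.cong) (auto simp: fp_one simp del: fp.simps)
    then show ?thesis using True by (simp del: fp.simps)
  next
    case False
    then have "x * y \<noteq> 1"
      using word_mult_red[OF Suc.prems] by (metis append_is_Nil_conv word_eq_Nil_iff)
    then have "fp (Suc n) (x * y) = (\<Sum>z\<in>S. pmf \<mu> z * fp n ((inverse z * x) * y))"
      by (simp add: mult.assoc)
    also have "\<dots> = (\<Sum>z\<in>S. \<Sum>i\<le>n. pmf \<mu> z * fp i (inverse z * x) * fp (n - i) y)"
      using Suc.IH[OF red_concat_letter_mult[OF Suc.prems False]]
      by (intro sum.cong refl) (simp add: sum_distrib_left mult.assoc)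
    also have "\<dots> = (\<Sum>i\<le>n. \<Sum>z\<in>S. pmf \<mu> z * fp i (inverse z * x) * fp (n - i) y)"
      by (rule sum.swap)
    also have "\<dots> = (\<Sum>i\<le>n. fp (Suc i) x * fp (n - i) y)"
      using False by (simp add: sum_distrib_right)
    also have "\<dots> = (\<Sum>i\<le>Suc n. fp i x * fp (Suc n - i) y)"
      using False by (subst sum.atMost_Suc_shift) simp
    finally show ?thesis .
  qed
qed

definition G :: "real \<Rightarrow> 'g free_group \<Rightarrow> ennreal" where
  "G s x = (\<Sum>n. ennreal (s ^ n * P n x))"

definition F :: "real \<Rightarrow> 'g free_group \<Rightarrow> ennreal" where
  "F s x = (\<Sum>n. ennreal (s ^ n * fp n x))"

lemma F_one: "F s 1 = 1"
proof -
  have "F s 1 = (\<Sum>n. if n = 0 then 1 else 0)"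
    unfolding F_def by (intro suminf_cong) (auto simp: fp_one)
  also have "\<dots> = (1 :: ennreal)"
    by (subst suminf_finite[of "{0}"]) auto
  finally show ?thesis .
qed

lemma F_mono: "0 \<le> s \<Longrightarrow> s \<le> t \<Longrightarrow> F s x \<le> F t x"
  unfolding F_def by (intro suminf_le ennreal_leI mult_right_mono power_mono) auto

lemma F_inverse: "F s (inverse x) = F s x"
  by (simp add: F_def fp_inverse)

lemma power_series_Cauchy_product:
  fixes a b c :: "nat \<Rightarrow> real"
  assumes "0 \<le> s" "\<And>n. 0 \<le> a n" "\<And>n. 0 \<le> b n" and c: "\<And>n. c n = (\<Sum>i\<le>n. a i * b (n - i))"
  shows "(\<Sum>n. ennreal (s ^ n * c n)) = (\<Sum>n. ennreal (s ^ n * a n)) * (\<Sum>n. ennreal (s ^ n * b n))"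
proof -
  have "ennreal (s ^ n * c n) = (\<Sum>i\<le>n. ennreal (s ^ i * a i) * ennreal (s ^ (n - i) * b (n - i)))" for n
  proof -
    have "s ^ n * c n = (\<Sum>i\<le>n. (s ^ i * a i) * (s ^ (n - i) * b (n - i)))"
      unfolding c sum_distrib_left
    proof (rule sum.cong)
      fix i assume "i \<in> {..n}"
      then have "s ^ n = s ^ i * s ^ (n - i)"
        by (simp flip: power_add)
      then show "s ^ n * (a i * b (n - i)) = (s ^ i * a i) * (s ^ (n - i) * b (n - i))"
        by (simp only: mult_ac)
    qed simp
    also have "ennreal \<dots> = (\<Sum>i\<le>n. ennreal ((s ^ i * a i) * (s ^ (n - i) * b (n - i))))"
      using assms by (intro sum_ennreal[symmetric] mult_nonneg_nonneg) auto
    also have "\<dots> = (\<Sum>i\<le>n. ennreal (s ^ i * a i) * ennreal (s ^ (n - i) * b (n - i)))"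
      using assms by (intro sum.cong refl ennreal_mult mult_nonneg_nonneg) auto
    finally show ?thesis .
  qed
  then show ?thesis
    by (subst ennreal_Cauchy_product[symmetric]) (simp only:)
qed

lemma G_eq: "0 \<le> s \<Longrightarrow> G s x = F s x * G s 1"
  unfolding F_def G_def by (rule power_series_Cauchy_product) (auto intro: P_eq_fp)

lemma F_mult: "0 \<le> s \<Longrightarrow> red_concat x y \<Longrightarrow> F s (x * y) = F s x * F s y"
  unfolding F_def by (rule power_series_Cauchy_product) (auto intro: fp_mult)

lemma suminf_sum_ennreal:
  fixes f :: "nat \<Rightarrow> 'b \<Rightarrow> ennreal"
  shows "finite I \<Longrightarrow> (\<Sum>n. \<Sum>i\<in>I. f n i) = (\<Sum>i\<in>I. \<Sum>n. f n i)"
  by (rule suminf_sum) auto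

lemma power_Suc_sum_ennreal:
  assumes "0 \<le> s" "\<And>y. 0 \<le> a y" and c: "c = (\<Sum>y\<in>S. pmf \<mu> y * a y)"
  shows "ennreal (s ^ Suc n * c) = (\<Sum>y\<in>S. ennreal (s * pmf \<mu> y) * ennreal (s ^ n * a y))"
proof -
  have "s ^ Suc n * c = (\<Sum>y\<in>S. (s * pmf \<mu> y) * (s ^ n * a y))"
    unfolding c sum_distrib_left by (intro sum.cong refl) (simp only: power_Suc mult_ac)
  also have "ennreal \<dots> = (\<Sum>y\<in>S. ennreal ((s * pmf \<mu> y) * (s ^ n * a y)))"
    using assms by (intro sum_ennreal[symmetric] mult_nonneg_nonneg) auto
  also have "\<dots> = (\<Sum>y\<in>S. ennreal (s * pmf \<mu> y) * ennreal (s ^ n * a y))"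
    using assms by (intro sum.cong refl ennreal_mult mult_nonneg_nonneg) auto
  finally show ?thesis .
qed

lemma F_rec:
  assumes "0 \<le> s" "x \<noteq> 1"
  shows "F s x = (\<Sum>y\<in>S. ennreal (s * pmf \<mu> y) * F s (inverse y * x))"
proof -
  have "F s x = (\<Sum>n. ennreal (s ^ Suc n * fp (Suc n) x)) + (\<Sum>n<Suc 0. ennreal (s ^ n * fp n x))"
    unfolding F_def using suminf_offset[of "\<lambda>n. ennreal (s ^ n * fp n x)" "Suc 0"] by simp
  also have "\<dots> = (\<Sum>n. ennreal (s ^ Suc n * fp (Suc n) x))"
    using assms by simp
  also have "\<dots> = (\<Sum>n. \<Sum>y\<in>S. ennreal (s * pmf \<mu> y) * ennreal (s ^ n * fp n (inverse y * x)))"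
    using assms by (intro suminf_cong power_Suc_sum_ennreal) auto
  also have "\<dots> = (\<Sum>y\<in>S. \<Sum>n. ennreal (s * pmf \<mu> y) * ennreal (s ^ n * fp n (inverse y * x)))"
    by (rule suminf_sum_ennreal) simp
  finally show ?thesis
    unfolding F_def by (simp del: sum.insert)
qed

text \<open>The generating function of the first return to the identity: one step \<open>y\<close>,
  then a first passage back, whose target seen from \<open>y\<close> is
  \<open>inverse y\<close>.\<close>

definition U :: "real \<Rightarrow> ennreal" where
  "U s = (\<Sum>y\<in>S. ennreal (s * pmf \<mu> y) * F s (inverse y))"

lemma G_one_eq:
  assumes "0 \<le> s"
  shows "G s 1 = 1 + U s * G s 1"
proof -
  have "G s 1 = (\<Sum>n. ennreal (s ^ Suc n * P (Suc n) 1)) + (\<Sum>n<Suc 0. ennreal (s ^ n * P n 1))"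
    unfolding G_def using suminf_offset[of "\<lambda>n. ennreal (s ^ n * P n 1)" "Suc 0"] by simp
  also have "(\<Sum>n<Suc 0. ennreal (s ^ n * P n 1)) = 1"
    by (simp add: P_0)
  also have "(\<Sum>n. ennreal (s ^ Suc n * P (Suc n) 1))
      = (\<Sum>n. \<Sum>y\<in>S. ennreal (s * pmf \<mu> y) * ennreal (s ^ n * P n (inverse y)))"
    using assms by (intro suminf_cong power_Suc_sum_ennreal) (auto simp: P_Suc simp del: sum.insert)
  also have "\<dots> = (\<Sum>y\<in>S. \<Sum>n. ennreal (s * pmf \<mu> y) * ennreal (s ^ n * P n (inverse y)))"
    by (rule suminf_sum_ennreal) simp
  also have "\<dots> = (\<Sum>y\<in>S. ennreal (s * pmf \<mu> y) * G s (inverse y))"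
    unfolding G_def by (simp del: sum.insert)
  also have "\<dots> = U s * G s 1"
    using assms by (simp add: U_def G_eq[of s "inverse _"] sum_distrib_right mult.assoc del: sum.insert)
  finally show ?thesis by (simp add: add.commute)
qed

lemma U_mono: "0 \<le> s \<Longrightarrow> s \<le> t \<Longrightarrow> U s \<le> U t"
  unfolding U_def by (intro sum_mono mult_mono ennreal_leI mult_right_mono F_mono) auto

text \<open>Splitting a first passage from the identity to the neighbour \<open>a\<close> at its first step.\<close>

lemma F_letter:
  assumes "0 \<le> s"
  shows "F s (of_letter a) + ennreal (s * pmf \<mu> (of_letter a)) * (F s (of_letter a))\<^sup>2
    = ennreal (s * pmf \<mu> (of_letter a)) + U s * F s (of_letter a)"
proof -
  let ?a = "of_letter a" and ?w = "\<lambda>y. ennreal (s * pmf \<mu> y)"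
  have a: "?a \<in> S" by (simp add: generators_eq)
  have F: "F s (inverse y * ?a) = F s (inverse y) * F s ?a" if "y \<in> S - {?a}" for y
  proof (rule F_mult[OF assms])
    show "red_concat (inverse y) ?a"
      using that by (auto simp: generators_eq inverse_of_letter red_concat_iff)
  qed
  have "F s ?a = ?w ?a * F s (inverse ?a * ?a) + (\<Sum>y\<in>S - {?a}. ?w y * F s (inverse y * ?a))"
    unfolding F_rec[OF assms of_letter_neq_one(1)] by (rule sum.remove[OF finite_S a])
  also have "\<dots> = ?w ?a + (\<Sum>y\<in>S - {?a}. ?w y * F s (inverse y)) * F s ?a"
    by (simp add: F F_one sum_distrib_right mult.assoc del: sum.insert)
  finally have 1: "F s ?a = ?w ?a + (\<Sum>y\<in>S - {?a}. ?w y * F s (inverse y)) * F s ?a" .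
  have "U s = ?w ?a * F s ?a + (\<Sum>y\<in>S - {?a}. ?w y * F s (inverse y))"
    unfolding U_def by (subst sum.remove[OF finite_S a]) (simp add: F_inverse)
  then have "?w ?a + U s * F s ?a
      = (?w ?a + (\<Sum>y\<in>S - {?a}. ?w y * F s (inverse y)) * F s ?a) + ?w ?a * (F s ?a)\<^sup>2"
    by (simp add: algebra_simps power2_eq_square)
  then show ?thesis
    using 1 by simp
qed

end

section \<open>The Green function at the parameter \<open>r\<close>, the critical one
  included\<close>

locale critical_walk = symmetric_walk \<mu> for \<mu> :: "'g::finite free_group pmf" +
  fixes r :: real
  assumes r_gt_1: "1 < r"
    and r_le: "ereal r \<le> inverse (spectral_radius \<mu>)"
begin

lemma P_le_power:
  assumes "0 < s" "s < r"
  shows "eventually (\<lambda>n. P n 1 \<le> (1 / s) ^ n) sequentially"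
proof -
  have r0: "0 < ereal r" using r_gt_1 by simp
  have "spectral_radius \<mu> < ereal (1 / s)"
  proof (cases "spectral_radius \<mu>")
    case (real l)
    then have *: "l \<noteq> 0 \<Longrightarrow> r \<le> 1 / l"
      using r_le by (simp add: divide_inverse)
    have "l < 1 / s"
    proof (cases "l > 0")
      case True
      then have "l \<le> 1 / r" using * r_gt_1 by (simp add: field_simps)
      also have "\<dots> < 1 / s" using assms by (simp add: field_simps)
      finally show ?thesis .
    next
      case False
      moreover have "0 < 1 / s" using assms by simp
      ultimately show ?thesis by linarith
    qed
    then show ?thesis
      using real by simp
  next
    case PInf
    then show ?thesis using r_le r_gt_1 by simp
  qed auto
  then have "eventually (\<lambda>n. ereal (root n (pmf (walk \<mu> n) 1)) < ereal (1 / s)) sequentially"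
    unfolding spectral_radius_def by (rule Limsup_lessD)
  then show ?thesis
    using eventually_gt_at_top[of 0]
  proof eventually_elim
    case (elim n)
    then have "root n (P n 1) < 1 / s" by (simp add: P_def)
    then have "root n (P n 1) ^ n \<le> (1 / s) ^ n"
      using elim by (intro power_mono) (auto simp: real_root_ge_zero)
    then show ?case
      using elim by (simp add: real_root_pow_pos2)
  qed
qed

lemma G_finite_less:
  assumes "0 < s" "s < r"
  shows "G s 1 < \<top>"
proof -
  define t where "t = (s + r) / 2"
  have t: "s < t" "t < r" "0 < t" using assms by (auto simp: t_def)
  have "summable (\<lambda>n. s ^ n * P n 1)"
  proof (rule summable_comparison_test_ev)
    show "eventually (\<lambda>n. norm (s ^ n * P n 1) \<le> (s / t) ^ n) sequentially"
      using P_le_power[OF t(3,2)]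
    proof eventually_elim
      case (elim n)
      have "s ^ n * P n 1 \<le> s ^ n * (1 / t) ^ n"
        using elim assms by (intro mult_left_mono) auto
      also have "\<dots> = (s / t) ^ n" by (simp add: power_divide)
      finally show ?case using assms by simp
    qed
    show "summable (\<lambda>n. (s / t) ^ n)"
      using t assms by (intro summable_geometric) auto
  qed
  then have "(\<Sum>n. ennreal (s ^ n * P n 1)) = ennreal (\<Sum>n. s ^ n * P n 1)"
    using assms by (intro suminf_ennreal2) auto
  then show ?thesis by (simp add: G_def)
qed

lemma G_ge_1: "0 \<le> s \<Longrightarrow> 1 \<le> G s 1"
  using G_one_eq[of s] by (metis le_iff_add)

text \<open>By the renewal equation \<open>G_one_eq\<close>, a value above one would give
  \<open>1 + G s 1 <= G s 1\<close>, which is impossible because \<open>G s 1\<close> is finite for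
  \<open>s < r\<close>.\<close>

lemma U_less_1:
  assumes "0 < s" "s < r"
  shows "U s \<le> 1"
proof (rule ccontr)
  assume "\<not> U s \<le> 1"
  then have "1 * G s 1 \<le> U s * G s 1"
    by (intro mult_right_mono) auto
  then have "1 + G s 1 \<le> G s 1"
    using G_one_eq[of s] assms by (metis add_left_mono less_imp_le mult_1)
  moreover have "G s 1 < 1 + G s 1"
    using G_finite_less[OF assms]
    by (cases "G s 1") (auto simp flip: ennreal_1 ennreal_plus intro!: ennreal_lessI)
  ultimately show False by simp
qed

text \<open>Written as one power series, with the index shifted by the first step, \<open>U\<close>
  inherits at \<open>r\<close> the bound known below \<open>r\<close>.\<close>

lemma U_le_1: "U r \<le> 1"
proof -
  define u where "u n = (\<Sum>y\<in>S. pmf \<mu> y * fp n (inverse y))" for n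
  define b where "b n = (case n of 0 \<Rightarrow> 0 | Suc m \<Rightarrow> u m)" for n
  have u: "0 \<le> u n" for n
    unfolding u_def by (intro sum_nonneg mult_nonneg_nonneg) auto
  have U_eq: "U s = (\<Sum>n. ennreal (s ^ n * b n))" if "0 \<le> s" for s
  proof -
    have "(\<Sum>n. ennreal (s ^ n * b n)) = (\<Sum>n. ennreal (s ^ Suc n * u n)) + (\<Sum>n<Suc 0. ennreal (s ^ n * b n))"
      using suminf_offset[of "\<lambda>n. ennreal (s ^ n * b n)" "Suc 0"] by (simp add: b_def)
    also have "\<dots> = (\<Sum>n. \<Sum>y\<in>S. ennreal (s * pmf \<mu> y) * ennreal (s ^ n * fp n (inverse y)))"
      using that by (simp add: b_def power_Suc_sum_ennreal[OF that _ u_def] del: sum.insert power_Suc)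
    also have "\<dots> = (\<Sum>y\<in>S. \<Sum>n. ennreal (s * pmf \<mu> y) * ennreal (s ^ n * fp n (inverse y)))"
      by (rule suminf_sum_ennreal) simp
    finally show ?thesis
      unfolding U_def F_def by (simp del: sum.insert)
  qed
  have "(\<Sum>n. ennreal (r ^ n * b n)) \<le> 1"
  proof (rule ennreal_power_series_le)
    show "0 \<le> b n" for n using u by (auto simp: b_def split: nat.split)
    show "(\<Sum>n. ennreal (s ^ n * b n)) \<le> 1" if "0 < s" "s < r" for s
      using U_less_1[OF that] U_eq[of s] that by simp
  qed (use r_gt_1 in auto)
  then show ?thesis using U_eq[of r] r_gt_1 by simp
qed

definition \<phi> :: "'g letter \<Rightarrow> real" where
  "\<phi> a = enn2real (F r (of_letter a))"

definition u :: real where "u = enn2real (U r)"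

lemma U_eq_u: "U r = ennreal u" and u_nonneg: "0 \<le> u" and u_le_1: "u \<le> 1"
proof -
  show "U r = ennreal u"
    unfolding u_def using U_le_1 by (cases "U r") (auto simp: top_unique)
  show "0 \<le> u" "u \<le> 1"
    using U_le_1 by (auto simp: u_def enn2real_leI)
qed

lemma F_letter_finite: "F r (of_letter a) = ennreal (\<phi> a)"
proof -
  let ?w = "ennreal (r * pmf \<mu> (of_letter (flip a)))"
  have "?w * F r (inverse (of_letter (flip a))) \<le> U r"
    unfolding U_def by (rule member_le_sum) (auto simp: generators_eq)
  then have "?w * F r (of_letter a) \<le> 1"
    using U_le_1 by (simp add: inverse_of_letter)
  moreover have "?w \<noteq> 0"
    using mu_letter_pos[of "flip a"] r_gt_1 by simp
  ultimately have "F r (of_letter a) \<noteq> \<top>"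
    by (auto simp: ennreal_mult_top top_unique)
  then show ?thesis
    by (simp add: \<phi>_def less_top)
qed

lemma \<phi>_nonneg: "0 \<le> \<phi> a"
  by (simp add: \<phi>_def)

lemma \<phi>_eq: "\<phi> a + r * pmf \<mu> (of_letter a) * (\<phi> a)\<^sup>2 = r * pmf \<mu> (of_letter a) + u * \<phi> a"
proof -
  have "ennreal (\<phi> a + r * pmf \<mu> (of_letter a) * (\<phi> a)\<^sup>2) = ennreal (r * pmf \<mu> (of_letter a) + u * \<phi> a)"
    using F_letter[of r a] r_gt_1 \<phi>_nonneg[of a] u_nonneg
    by (simp add: F_letter_finite U_eq_u ennreal_mult ennreal_power)
  then show ?thesis
    using r_gt_1 \<phi>_nonneg[of a] u_nonneg
    by (subst (asm) ennreal_inj) (auto intro!: add_nonneg_nonneg mult_nonneg_nonneg)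
qed

text \<open>If the total return weight were one, the quadratic equation \<open>\<phi>_eq\<close>
  would force every \<open>\<phi> a\<close> to be one, and the definition of \<open>U\<close> would
  then give \<open>U r = r\<close>, which exceeds one. The strict inequality is what makes the Green
  function finite at the endpoint.\<close>

lemma u_less_1: "u < 1"
proof (rule ccontr)
  assume "\<not> u < 1"
  then have u: "u = 1" using u_le_1 by simp
  have "\<phi> = (\<lambda>_. 1)"
  proof
    fix a
    have "(\<phi> a)\<^sup>2 = 1"
      using \<phi>_eq[of a] u mu_letter_pos[of a] r_gt_1 by simp
    then show "\<phi> a = 1" using \<phi>_nonneg[of a] by (simp add: power2_eq_1_iff)
  qed
  then have F: "F r (inverse y) = 1" if "y \<in> S" for y
    using that by (auto simp: generators_eq inverse_of_letter F_one F_letter_finite)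
  have "U r = (\<Sum>y\<in>S. ennreal (r * pmf \<mu> y))"
    unfolding U_def by (intro sum.cong refl) (simp add: F del: insert_iff)
  also have "\<dots> = ennreal (\<Sum>y\<in>S. r * pmf \<mu> y)"
    using r_gt_1 by (intro sum_ennreal) auto
  also have "(\<Sum>y\<in>S. r * pmf \<mu> y) = r"
    using sum_mu_S by (simp add: sum_distrib_left[symmetric] del: sum.insert)
  finally have "ennreal u = ennreal r" by (simp add: U_eq_u)
  then show False using u r_gt_1 by simp
qed

lemma \<phi>_pos: "0 < \<phi> a"
  using \<phi>_eq[of a] \<phi>_nonneg[of a] mu_letter_pos[of a] r_gt_1
  by (cases "\<phi> a = 0") auto

text \<open>The quadratic equation reads \<open>(1 - u) * \<phi> a = r * pmf \<mu> (of_letter a) *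
  (1 - (\<phi> a)\<^sup>2)\<close>, and its left side is positive.\<close>

lemma \<phi>_less_1: "\<phi> a < 1"
proof -
  have w: "0 < r * pmf \<mu> (of_letter a)"
    using mu_letter_pos[of a] r_gt_1 by simp
  have "0 < (1 - u) * \<phi> a"
    using u_less_1 \<phi>_pos by simp
  then have "r * pmf \<mu> (of_letter a) * (\<phi> a)\<^sup>2 < r * pmf \<mu> (of_letter a) * 1"
    using \<phi>_eq[of a] by (simp add: algebra_simps)
  then have "(\<phi> a)\<^sup>2 < 1"
    using w by (simp only: mult_less_cancel_left_pos)
  then show ?thesis
    by (simp add: power2_less_1_iff)
qed

text \<open>The bound is uniform in \<open>s < r\<close> and therefore survives at \<open>r\<close>,
  where \<open>G_one_eq\<close> alone might be an identity between infinities.\<close>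

lemma G_bound:
  assumes "0 < s" "s < r"
  shows "G s 1 \<le> ennreal (1 / (1 - u))"
proof -
  obtain g where g: "G s 1 = ennreal g" "0 \<le> g"
    using G_finite_less[OF assms] by (cases "G s 1") auto
  obtain v where v: "U s = ennreal v" "0 \<le> v" "v \<le> u"
    using U_mono[of s r] assms U_eq_u u_nonneg
    by (cases "U s") (auto simp: top_unique ennreal_le_iff)
  have "ennreal g = ennreal (1 + v * g)"
    using G_one_eq[of s] assms g v by (simp add: ennreal_mult)
  then have "g = 1 + v * g"
    using g v by (subst (asm) ennreal_inj) auto
  also have "\<dots> \<le> 1 + u * g"
    using g v by (intro add_left_mono mult_right_mono) auto
  finally have "g \<le> 1 / (1 - u)"
    using u_less_1 by (simp add: field_simps)
  then show ?thesis using g by (simp add: ennreal_leI)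
qed

definition Gc :: real where "Gc = enn2real (G r 1)"

lemma G_eq_Gc: "G r 1 = ennreal Gc" and Gc_ge_1: "1 \<le> Gc"
proof -
  have "G r 1 \<le> ennreal (1 / (1 - u))"
    unfolding G_def
    by (rule ennreal_power_series_le) (use r_gt_1 G_bound in \<open>auto simp: G_def\<close>)
  then show 1: "G r 1 = ennreal Gc"
    unfolding Gc_def by (cases "G r 1") (auto simp: top_unique)
  then show "1 \<le> Gc"
    using G_ge_1[of r] r_gt_1 by (simp flip: ennreal_1 add: ennreal_le_iff2)
qed

lemma F_word: "F r x = ennreal (prod_list (map \<phi> (word x)))"
proof (induction "word x" arbitrary: x)
  case Nil
  then show ?case by (metis F_one ennreal_1 list.map(1) prod_list.Nil word_eq_Nil_iff)
next
  case (Cons l w)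
  then obtain y z where yz: "x = y * z" "red_concat y z" "word y = [l]" "word z = w"
    using factor_word[of x "[l]" w] by auto
  then have "y = of_letter l" by (metis word_inject word_of_letter)
  then have "F r x = ennreal (\<phi> l) * F r z"
    using yz F_mult[of r y z] r_gt_1 by (simp add: F_letter_finite)
  then show ?case
    using yz(4) Cons(1)[of z] \<phi>_nonneg[of l]
    by (simp only: ennreal_mult'[symmetric] Cons(2)[symmetric] list.map prod_list.Cons)
qed

lemma F_le_1: "F r x \<le> 1"
proof -
  have "prod_list (map \<phi> w) \<le> 1 \<and> 0 \<le> prod_list (map \<phi> w)" for w
    by (induction w) (auto intro!: mult_le_one mult_nonneg_nonneg \<phi>_nonneg less_imp_le[OF \<phi>_less_1])
  then show ?thesis
    unfolding F_word by (simp flip: ennreal_1 add: ennreal_leI)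
qed

text \<open>\<open>r ^ n * P n x\<close> is the mean number of particles at \<open>x\<close> in
  generation \<open>n\<close>. It is a single term of the Green series, which converges at
  \<open>r\<close>.\<close>

lemma P_le_Gc: "r ^ n * P n x \<le> Gc"
proof -
  have "ennreal (r ^ n * P n x) \<le> G r x"
    unfolding G_def using sum_le_suminf[of "\<lambda>n. ennreal (r ^ n * P n x)" "{n}"] by simp
  also have "\<dots> \<le> 1 * G r 1"
    unfolding G_eq[OF less_imp_le[OF less_trans[OF zero_less_one r_gt_1]], of x] by (intro mult_right_mono F_le_1) auto
  finally show ?thesis
    using Gc_ge_1 by (simp add: G_eq_Gc)
qed

end

subsection \<open>The rate function\<close>

locale rate_walk = critical_walk \<mu> r for \<mu> :: "'g::finite free_group pmf" and r :: real +
  fixes L :: "real \<Rightarrow> ereal"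
  assumes rate: "is_rate_function \<mu> L"
begin

lemma L_nonneg: "0 \<le> L q"
  using rate by (auto simp: is_rate_function_def)

lemma L_lsc:
  assumes "y < L q"
  obtains \<delta> where "\<delta> > 0" "\<And>q'. \<bar>q' - q\<bar> \<le> \<delta> \<Longrightarrow> y < L q'"
proof -
  have "open (- {q. L q \<le> y})"
    using rate by (auto simp: is_rate_function_def)
  moreover have "q \<in> - {q. L q \<le> y}" using assms by simp
  ultimately obtain e where e: "e > 0" "cball q e \<subseteq> - {q. L q \<le> y}"
    using open_contains_cball by blast
  show thesis
  proof (rule that[OF e(1)])
    fix q' assume "\<bar>q' - q\<bar> \<le> e"
    then have "q' \<in> cball q e" by (simp add: dist_real_def abs_minus_commute)
    then show "y < L q'" using e(2) by auto
  qed
qed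

lemma rate_bounds:
  assumes "B \<in> sets borel"
  shows "- (INF q\<in>interior B. L q) \<le> liminf (speed_rate \<mu> B)"
    and "limsup (speed_rate \<mu> B) \<le> - (INF q\<in>closure B. L q)"
  using rate assms unfolding is_rate_function_def by blast+

definition speed_prob :: "nat \<Rightarrow> real set \<Rightarrow> real" where
  "speed_prob n B = measure_pmf.prob (walk \<mu> n) {x. real (word_length x) / real n \<in> B}"

lemma speed_prob_le_1: "speed_prob n B \<le> 1" and speed_prob_nonneg [simp]: "0 \<le> speed_prob n B"
  by (simp_all add: speed_prob_def)

lemma speed_rate_eq: "speed_rate \<mu> B n = eln (speed_prob n B) / ereal (real n)"
  by (simp add: speed_rate_def speed_prob_def)

lemma speed_prob_upper:
  assumes "\<And>q. q \<in> {c..d} \<Longrightarrow> ereal y \<le> L q" and "\<delta> > 0"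
  shows "eventually (\<lambda>n. speed_prob n {c..d} \<le> exp (- real n * (y - \<delta>))) sequentially"
proof -
  have "limsup (speed_rate \<mu> {c..d}) \<le> - (INF q\<in>closure {c..d}. L q)"
    by (rule rate_bounds) simp
  also have "\<dots> \<le> - ereal y"
    using assms by (auto simp del: uminus_ereal.simps intro!: INF_greatest)
  also have "\<dots> < ereal (- (y - \<delta>))"
    using assms by simp
  finally have "eventually (\<lambda>n. speed_rate \<mu> {c..d} n < ereal (- (y - \<delta>))) sequentially"
    by (rule Limsup_lessD)
  then show ?thesis
    using eventually_gt_at_top[of 0]
  proof eventually_elim
    case (elim n)
    show ?case
    proof (cases "speed_prob n {c..d} = 0")
      case False
      then have pos: "0 < speed_prob n {c..d}"
        using speed_prob_nonneg[of n "{c..d}"] by linarith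
      have "ln (speed_prob n {c..d}) / real n < - (y - \<delta>)"
        using elim False by (simp add: speed_rate_eq eln_def)
      then have "ln (speed_prob n {c..d}) < - real n * (y - \<delta>)"
        using elim by (simp add: field_simps)
      then show ?thesis
        using pos by (metis exp_ln exp_less_cancel_iff less_imp_le)
    qed simp
  qed
qed

lemma speed_prob_lower:
  assumes "L q \<le> ereal y" and "\<delta> > 0" "\<epsilon> > 0"
  shows "eventually (\<lambda>n. exp (- real n * (y + \<epsilon>)) \<le> speed_prob n {q - \<delta><..<q + \<delta>}) sequentially"
proof -
  let ?B = "{q - \<delta><..<q + \<delta>}"
  have "ereal (- (y + \<epsilon>)) < - ereal y"
    using assms by simp
  also have "- ereal y \<le> - L q"
    using assms by (simp del: uminus_ereal.simps)
  also have "\<dots> \<le> - (INF q\<in>interior ?B. L q)"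
    using assms by (auto simp del: uminus_ereal.simps intro!: INF_lower simp: interior_open)
  also have "\<dots> \<le> liminf (speed_rate \<mu> ?B)"
    by (rule rate_bounds) simp
  finally have "eventually (\<lambda>n. ereal (- (y + \<epsilon>)) < speed_rate \<mu> ?B n) sequentially"
    by (rule less_LiminfD)
  then show ?thesis
    using eventually_gt_at_top[of 0]
  proof eventually_elim
    case (elim n)
    have nz: "speed_prob n ?B \<noteq> 0"
      using elim by (auto simp: speed_rate_eq eln_def)
    then have pos: "0 < speed_prob n ?B"
      using speed_prob_nonneg[of n ?B] by linarith
    have "- (y + \<epsilon>) < ln (speed_prob n ?B) / real n"
      using elim nz by (simp add: speed_rate_eq eln_def)
    then have "- real n * (y + \<epsilon>) < ln (speed_prob n ?B)"
      using elim by (simp add: field_simps)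
    then show ?case
      using pos by (metis exp_ln exp_less_cancel_iff less_imp_le)
  qed
qed

lemma speed_prob_eq_sum: "speed_prob n B = (\<Sum>m | m \<le> n \<and> real m / real n \<in> B. E n m)"
proof -
  let ?M = "{m. m \<le> n \<and> real m / real n \<in> B}"
  have "speed_prob n B = measure_pmf.prob (walk \<mu> n) (\<Union>m\<in>?M. {x. word_length x = m})"
    unfolding speed_prob_def by (rule measure_pmf.finite_measure_eq_AE)
      (auto simp: AE_measure_pmf_iff dest: set_walk)
  also have "\<dots> = (\<Sum>m\<in>?M. measure_pmf.prob (walk \<mu> n) {x. word_length x = m})"
    by (rule measure_pmf.finite_measure_finite_Union) (auto simp: disjoint_family_on_def)
  finally show ?thesis by (simp add: E_eq_prob)
qed

lemma E_le_speed_prob: "m \<le> n \<Longrightarrow> real m / real n \<in> B \<Longrightarrow> E n m \<le> speed_prob n B"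
  unfolding speed_prob_eq_sum by (rule member_le_sum) auto

text \<open>Repeating good words gives, at all multiples of \<open>n\<close>, the exact speed
  \<open>m / n\<close> with probability at least a power of \<open>A n m\<close>. If
  \<open>L\<close> were larger at \<open>m / n\<close>, it would be larger on a whole interval by
  semicontinuity, and the upper large deviation bound there would be violated.\<close>

lemma L_le_A:
  assumes "0 < n" "A n m > 0"
  shows "L (real m / real n) \<le> ereal (- ln (A n m) / real n)"
proof (rule ccontr)
  define y where "y = - ln (A n m) / real n"
  assume "\<not> ?thesis"
  then have "ereal y < L (real m / real n)" by (simp add: y_def)
  then obtain y' where y': "ereal y < ereal y'" "ereal y' < L (real m / real n)"
    using ereal_dense2 by blast
  obtain \<delta> where \<delta>: "\<delta> > 0" "\<And>q. \<bar>q - real m / real n\<bar> \<le> \<delta> \<Longrightarrow> ereal y' < L q"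
    using L_lsc[OF y'(2)] by blast
  let ?c = "real m / real n - \<delta>" and ?d = "real m / real n + \<delta>"
  define \<epsilon> where "\<epsilon> = (y' - y) / 2"
  have e: "\<epsilon> > 0" using y' by (simp add: \<epsilon>_def)
  have "ereal y' \<le> L q" if "q \<in> {?c..?d}" for q
    by (rule less_imp_le[OF \<delta>(2)]) (use that in \<open>auto simp: abs_le_iff\<close>)
  then have "eventually (\<lambda>N. speed_prob N {?c..?d} \<le> exp (- real N * (y' - \<epsilon>))) sequentially"
    using e by (rule speed_prob_upper)
  then obtain N0 where N0: "\<And>N. N \<ge> N0 \<Longrightarrow> speed_prob N {?c..?d} \<le> exp (- real N * (y' - \<epsilon>))"
    by (auto simp: eventually_sequentially)
  define N where "N = Suc N0 * n"
  have NN: "N \<ge> N0"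
  proof -
    have "N0 * 1 \<le> Suc N0 * n" using assms by (intro mult_le_mono) auto
    then show ?thesis by (simp add: N_def)
  qed
  have mn: "m \<le> n"
    using assms E_eq_0[of n m] A_le_E[of n m] by (cases "m \<le> n") auto
  have "exp (- real N * y) = A n m ^ Suc N0"
  proof -
    have "- real N * y = real (Suc N0) * ln (A n m)"
      using assms unfolding N_def y_def of_nat_mult by simp
    then have "exp (- real N * y) = exp (ln (A n m)) ^ Suc N0"
      by (simp only: exp_of_nat_mult)
    then show ?thesis using assms by simp
  qed
  also have "\<dots> \<le> A N (Suc N0 * m)"
    unfolding N_def by (rule A_power)
  also have "\<dots> \<le> E N (Suc N0 * m)" by (rule A_le_E)
  also have "\<dots> \<le> speed_prob N {?c..?d}"
    using mn assms \<delta>(1) by (intro E_le_speed_prob) (auto simp: N_def simp del: mult_Suc of_nat_Suc intro: mult_le_mono)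
  also have "\<dots> \<le> exp (- real N * (y' - \<epsilon>))" using N0 NN by blast
  finally have "real N * (y' - \<epsilon>) \<le> real N * y" by simp
  moreover have "0 < real N" using assms by (simp add: N_def add_pos_nonneg)
  ultimately have "y' - \<epsilon> \<le> y" by (simp only: mult_le_cancel_left_pos)
  then show False using e unfolding \<epsilon>_def by argo
qed

lemma A_le_exp:
  assumes "0 < n" "ereal y \<le> L (real m / real n)"
  shows "A n m \<le> exp (- real n * y)"
proof (cases "A n m > 0")
  case True
  then have "y \<le> - ln (A n m) / real n"
    using L_le_A[OF assms(1) True] assms(2) by (metis ereal_less_eq(3) order_trans)
  then have "ln (A n m) \<le> - real n * y"
    using assms by (simp add: field_simps)
  then show ?thesis
    using True by (metis exp_ln exp_le_cancel_iff)
next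
  case False
  then have "A n m \<le> 0" by simp
  also have "0 \<le> exp (- real n * y)" by simp
  finally show ?thesis .
qed

text \<open>The approximate converse of \<open>L_le_A\<close>. The probability of an interval of
  speeds is a sum of at most \<open>n + 1\<close> terms \<open>E n m\<close>, so one of them has the
  right exponential order, and padding turns it into a term of \<open>A\<close>.\<close>

lemma A_lower:
  assumes L: "L q \<le> ereal y" and d: "\<delta> > 0" "\<epsilon> > 0"
  shows "\<exists>n m. n0 \<le> n \<and> 0 < n \<and> 0 < m \<and> \<bar>real m / real n - q\<bar> < \<delta> \<and> exp (- real n * (y + \<epsilon>)) \<le> A n m"
proof -
  have y0: "0 \<le> y" using L L_nonneg[of q] by (metis ereal_less_eq(5) order_trans)
  have "eventually (\<lambda>n::nat. real (n + 1) * exp (- (\<epsilon> / 2) * real n) \<le> mu_min ^ 3) sequentially"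
  proof -
    have "(\<lambda>n::nat. real (n + 1) * exp (- (\<epsilon> / 2) * real n)) \<longlonglongrightarrow> 0"
      using d by real_asymp
    moreover have "0 < mu_min ^ 3" using mu_min by simp
    ultimately have "eventually (\<lambda>n::nat. real (n + 1) * exp (- (\<epsilon> / 2) * real n) < mu_min ^ 3) sequentially"
      by (rule order_tendstoD)
    then show ?thesis
      by (rule eventually_mono) simp
  qed
  moreover have "eventually (\<lambda>n. exp (- real n * (y + \<epsilon> / 2)) \<le> speed_prob n {q - \<delta> / 2<..<q + \<delta> / 2}) sequentially"
    using d by (intro speed_prob_lower L) auto
  moreover have "eventually (\<lambda>n::nat. 3 / real n < \<delta> / 2) sequentially"
    using d by real_asymp
  ultimately have "eventually (\<lambda>n. real (n + 1) * exp (- (\<epsilon> / 2) * real n) \<le> mu_min ^ 3 \<and>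
      exp (- real n * (y + \<epsilon> / 2)) \<le> speed_prob n {q - \<delta> / 2<..<q + \<delta> / 2} \<and> 3 / real n < \<delta> / 2
      \<and> n \<ge> n0 \<and> n > 0) sequentially"
    using eventually_ge_at_top[of n0] eventually_gt_at_top[of 0] by eventually_elim auto
  then obtain n where n: "real (n + 1) * exp (- (\<epsilon> / 2) * real n) \<le> mu_min ^ 3"
      "exp (- real n * (y + \<epsilon> / 2)) \<le> speed_prob n {q - \<delta> / 2<..<q + \<delta> / 2}" "3 / real n < \<delta> / 2"
      "n \<ge> n0" "n > 0"
    using eventually_happens'[OF trivial_limit_sequentially] by blast
  let ?M = "{m. m \<le> n \<and> real m / real n \<in> {q - \<delta> / 2<..<q + \<delta> / 2}}"
  have "\<exists>m\<in>?M. speed_prob n {q - \<delta> / 2<..<q + \<delta> / 2} / real (n + 1) \<le> E n m"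
  proof (rule ccontr)
    assume "\<not> ?thesis"
    then have lt: "E n m < speed_prob n {q - \<delta> / 2<..<q + \<delta> / 2} / real (n + 1)" if "m \<in> ?M" for m
      using that by (auto simp: not_le)
    have "?M \<noteq> {}"
    proof
      assume M: "?M = {}"
      have "speed_prob n {q - \<delta> / 2<..<q + \<delta> / 2} = 0"
        unfolding speed_prob_eq_sum M by simp
      then show False using n(2) by (smt (verit) exp_gt_zero)
    qed
    have "speed_prob n {q - \<delta> / 2<..<q + \<delta> / 2} = (\<Sum>m\<in>?M. E n m)"
      by (rule speed_prob_eq_sum)
    also have "\<dots> < (\<Sum>m\<in>?M. speed_prob n {q - \<delta> / 2<..<q + \<delta> / 2} / real (n + 1))"
      using \<open>?M \<noteq> {}\<close> lt by (intro sum_strict_mono) auto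
    also have "\<dots> = real (card ?M) * (speed_prob n {q - \<delta> / 2<..<q + \<delta> / 2} / real (n + 1))"
      by simp
    also have "\<dots> \<le> real (n + 1) * (speed_prob n {q - \<delta> / 2<..<q + \<delta> / 2} / real (n + 1))"
    proof (intro mult_right_mono)
      have "card ?M \<le> card {..n}" by (intro card_mono) auto
      then show "real (card ?M) \<le> real (n + 1)" by simp
    qed simp
    finally show False by simp
  qed
  then obtain m where m: "m \<le> n" "real m / real n \<in> {q - \<delta> / 2<..<q + \<delta> / 2}"
      "speed_prob n {q - \<delta> / 2<..<q + \<delta> / 2} / real (n + 1) \<le> E n m"
    by auto
  show ?thesis
  proof (intro exI conjI)
    show "n0 \<le> n + 3" "0 < n + 3" "0 < m + 3" using n by auto
    have "exp (- real (n + 3) * (y + \<epsilon>)) \<le> exp (- real n * (y + \<epsilon>))"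
      unfolding exp_le_cancel_iff using y0 d by (intro mult_right_mono) auto
    also have "\<dots> = exp (- real n * (y + \<epsilon> / 2)) * exp (- (\<epsilon> / 2) * real n)"
      by (simp add: exp_add[symmetric] algebra_simps)
    also have "\<dots> \<le> (real (n + 1) * E n m) * exp (- (\<epsilon> / 2) * real n)"
      using m(3) n(2) by (intro mult_right_mono) (auto simp: field_simps)
    also have "\<dots> = E n m * (real (n + 1) * exp (- (\<epsilon> / 2) * real n))"
      by simp
    also have "\<dots> \<le> E n m * mu_min ^ 3"
      by (intro mult_left_mono n(1)) simp
    also have "\<dots> \<le> A (n + 3) (m + 3)"
      using E_le_A[of n m] by (simp add: mult.commute)
    finally show "exp (- real (n + 3) * (y + \<epsilon>)) \<le> A (n + 3) (m + 3)" .
    \<comment> \<open>Padding raises the ratio by at most \<open>3 / n\<close>.\<close>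
    have "real (m + 3) / real (n + 3) - real m / real n = 3 * (real n - real m) / (real n * real (n + 3))"
      using n(5) by (simp add: field_simps)
    moreover have "0 \<le> 3 * (real n - real m) / (real n * real (n + 3))"
      using m(1) by (intro divide_nonneg_nonneg) auto
    ultimately have "\<bar>real (m + 3) / real (n + 3) - real m / real n\<bar> = 3 * (real n - real m) / (real n * real (n + 3))"
      by (simp only: abs_of_nonneg)
    also have "\<dots> \<le> 3 * real n / (real n * real (n + 3))"
      by (intro divide_right_mono mult_left_mono) auto
    also have "\<dots> \<le> 3 / real n"
      using n(5) by (simp add: divide_simps)
    finally show "\<bar>real (m + 3) / real (n + 3) - q\<bar> < \<delta>"
      using m(2) n(3) by (auto simp: abs_if split: if_splits)
  qed
qed

text \<open>Bookkeeping for a concatenation of blocks of lengths \<open>N1\<close> and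
  \<open>N2\<close>. The numbers of blocks are \<open>N2 * \<alpha>\<close> and
  \<open>N1 * \<beta>\<close>, multiplied crosswise, so that the times spent in the two kinds are in
  the ratio \<open>\<alpha>\<close> to \<open>\<beta>\<close>.\<close>

lemma convex_mix:
  fixes N1 N2 \<alpha> \<beta> w n M1 M2 m :: real
  assumes "0 < N1" "0 < N2" "0 < \<alpha>" "0 < \<beta>" "w = \<alpha> / (\<alpha> + \<beta>)"
    and n: "n = N2 * \<alpha> * N1 + N1 * \<beta> * N2" and m: "m = N2 * \<alpha> * M1 + N1 * \<beta> * M2"
  shows "m / n = w * (M1 / N1) + (1 - w) * (M2 / N2)" "n * w = N2 * \<alpha> * N1" "n * (1 - w) = N1 * \<beta> * N2"
proof -
  have ab: "0 < \<alpha> + \<beta>" using assms by simp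
  have n': "n = N1 * N2 * (\<alpha> + \<beta>)" by (simp add: n algebra_simps)
  have w: "1 - w = \<beta> / (\<alpha> + \<beta>)" using assms ab by (simp add: field_simps)
  show "n * w = N2 * \<alpha> * N1" "n * (1 - w) = N1 * \<beta> * N2"
    unfolding w n' using ab assms(5) by auto
  have "m = N1 * N2 * (\<alpha> * (M1 / N1) + \<beta> * (M2 / N2))"
    using assms by (simp add: field_simps)
  then have "m / n = (\<alpha> * (M1 / N1) + \<beta> * (M2 / N2)) / (\<alpha> + \<beta>)"
    unfolding n' using assms by simp
  then show "m / n = w * (M1 / N1) + (1 - w) * (M2 / N2)"
    unfolding w using assms(5) by (simp add: add_divide_distrib mult.commute)
qed

text \<open>Good words with speeds near \<open>q1\<close> and \<open>q2\<close> are concatenated in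
  proportions tending to \<open>t\<close>. By supermultiplicativity the mixture has the mixed
  exponential cost, and \<open>A_le_exp\<close> turns this cost into a bound on \<open>L\<close>,
  against the semicontinuity at the mixed speed.\<close>

lemma L_convex:
  assumes L: "L q1 \<le> ereal y1" "L q2 \<le> ereal y2" and t: "0 \<le> t" "t \<le> 1"
  shows "L (t * q1 + (1 - t) * q2) \<le> ereal (t * y1 + (1 - t) * y2)"
proof (rule ccontr)
  let ?q = "t * q1 + (1 - t) * q2" and ?y = "t * y1 + (1 - t) * y2"
  assume "\<not> ?thesis"
  then have "ereal ?y < L ?q" by simp
  then obtain y' where y': "ereal ?y < ereal y'" "ereal y' < L ?q"
    using ereal_dense2 by blast
  obtain \<delta> where \<delta>: "\<delta> > 0" "\<And>q. \<bar>q - ?q\<bar> \<le> \<delta> \<Longrightarrow> ereal y' < L q"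
    using L_lsc[OF y'(2)] by blast
  define \<epsilon> where "\<epsilon> = (y' - ?y) / 3"
  have e: "\<epsilon> > 0" using y' by (simp add: \<epsilon>_def)
  obtain n1 m1 where 1: "0 < n1" "\<bar>real m1 / real n1 - q1\<bar> < \<delta> / 2" "exp (- real n1 * (y1 + \<epsilon>)) \<le> A n1 m1"
    using A_lower[OF L(1), of "\<delta> / 2" \<epsilon> 0] \<delta>(1) e by auto
  obtain n2 m2 where 2: "0 < n2" "\<bar>real m2 / real n2 - q2\<bar> < \<delta> / 2" "exp (- real n2 * (y2 + \<epsilon>)) \<le> A n2 m2"
    using A_lower[OF L(2), of "\<delta> / 2" \<epsilon> 0] \<delta>(1) e by auto
  \<comment> \<open>With \<open>a\<close> the integer part of \<open>t * K\<close>, the two kinds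
    occur in proportion \<open>Suc a\<close> to \<open>Suc b\<close> with \<open>a + b = K\<close>.
    The added ones keep both numbers positive even for \<open>t = 0\<close> and
    \<open>t = 1\<close>.\<close>
  define w where "w K = real (Suc (nat \<lfloor>t * real K\<rfloor>)) / (real K + 2)" for K
  have wlim: "w \<longlonglongrightarrow> t"
  proof -
    have "(\<lambda>K::nat. (t * real K) / (real K + 2)) \<longlonglongrightarrow> t"
      by real_asymp
    moreover have "(\<lambda>K::nat. (t * real K + 1) / (real K + 2)) \<longlonglongrightarrow> t"
      by real_asymp
    moreover have "(t * real K) / (real K + 2) \<le> w K \<and> w K \<le> (t * real K + 1) / (real K + 2)" for K
    proof -
      have "t * real K \<le> real (Suc (nat \<lfloor>t * real K\<rfloor>))" "real (Suc (nat \<lfloor>t * real K\<rfloor>)) \<le> t * real K + 1"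
        using mult_nonneg_nonneg[OF t(1), of "real K"] by linarith+
      then show ?thesis by (auto simp: w_def divide_right_mono)
    qed
    ultimately show ?thesis
      by (intro tendsto_sandwich[of "\<lambda>K. (t * real K) / (real K + 2)" w sequentially "\<lambda>K. (t * real K + 1) / (real K + 2)"])
        auto
  qed
  let ?s = "\<lambda>x. x * (real m1 / real n1) + (1 - x) * (real m2 / real n2)"
  have lim1: "(\<lambda>K. ?s (w K)) \<longlonglongrightarrow> ?s t"
    by (intro tendsto_intros wlim)
  have lim2: "(\<lambda>K. w K * y1 + (1 - w K) * y2) \<longlonglongrightarrow> ?y"
    by (intro tendsto_intros wlim)
  have "\<bar>?s t - ?q\<bar> < \<delta>"
  proof -
    have "?s t - ?q = t * (real m1 / real n1 - q1) + (1 - t) * (real m2 / real n2 - q2)"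
      by (simp add: algebra_simps)
    also have "\<bar>\<dots>\<bar> \<le> t * \<bar>real m1 / real n1 - q1\<bar> + (1 - t) * \<bar>real m2 / real n2 - q2\<bar>"
      using t by (intro order_trans[OF abs_triangle_ineq]) (simp add: abs_mult)
    also have "\<dots> \<le> t * (\<delta> / 2) + (1 - t) * (\<delta> / 2)"
      using 1 2 t by (intro add_mono mult_left_mono) auto
    also have "\<dots> = \<delta> / 2" by argo
    also have "\<dots> < \<delta>" using \<delta>(1) by simp
    finally show ?thesis .
  qed
  then have "eventually (\<lambda>K. \<bar>?s (w K) - ?q\<bar> < \<delta>) sequentially"
    by (intro order_tendstoD(2)[OF tendsto_rabs[OF tendsto_diff[OF lim1 tendsto_const]]])
  moreover have "eventually (\<lambda>K. w K * y1 + (1 - w K) * y2 < ?y + \<epsilon>) sequentially"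
    using e by (intro order_tendstoD(2)[OF lim2]) auto
  ultimately have "eventually (\<lambda>K. \<bar>?s (w K) - ?q\<bar> < \<delta> \<and> w K * y1 + (1 - w K) * y2 < ?y + \<epsilon>) sequentially"
    by (rule eventually_conj)
  then obtain K where K: "\<bar>?s (w K) - ?q\<bar> < \<delta>" "w K * y1 + (1 - w K) * y2 < ?y + \<epsilon>"
    using eventually_happens'[OF trivial_limit_sequentially] by blast
  define a where "a = nat \<lfloor>t * real K\<rfloor>"
  have aK: "a \<le> K"
  proof -
    have "t * real K \<le> real K" using t by (simp add: mult_left_le_one_le)
    then show ?thesis unfolding a_def by linarith
  qed
  define b where "b = K - a"
  have wK: "w K = real (Suc a) / (real (Suc a) + real (Suc b))"
    using aK by (simp add: w_def a_def[symmetric] b_def of_nat_diff)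
  let ?i = "n2 * Suc a" and ?j = "n1 * Suc b"
  define n m where "n = ?i * n1 + ?j * n2" and "m = ?i * m1 + ?j * m2"
  have n0: "0 < n" using 1 2 by (simp add: n_def)
  have nr: "real n = real n2 * real (Suc a) * real n1 + real n1 * real (Suc b) * real n2"
    and mr: "real m = real n2 * real (Suc a) * real m1 + real n1 * real (Suc b) * real m2"
    by (simp_all only: n_def m_def of_nat_add of_nat_mult)
  have pos: "0 < real n1" "0 < real n2" "0 < real (Suc a)" "0 < real (Suc b)"
    using 1(1) 2(1) by auto
  note mix = convex_mix[OF pos wK nr mr]
  have ratio: "real m / real n = ?s (w K)"
    by (rule mix(1))
  have nw: "real n * w K = real ?i * real n1" "real n * (1 - w K) = real ?j * real n2"
    by (simp_all only: mix(2,3) of_nat_mult)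
  have p: "A n1 m1 ^ k \<le> A (k * n1) (k * m1)" "A n2 m2 ^ k \<le> A (k * n2) (k * m2)" if "k > 0" for k
    using that A_power[of _ _ "k - 1"] by simp_all
  have "exp (- real n * (w K * y1 + (1 - w K) * y2 + \<epsilon>)) =
      exp (- real n1 * (y1 + \<epsilon>)) ^ ?i * exp (- real n2 * (y2 + \<epsilon>)) ^ ?j"
  proof -
    have "- real n * (w K * y1 + (1 - w K) * y2 + \<epsilon>) = - (real n * w K) * (y1 + \<epsilon>) - (real n * (1 - w K)) * (y2 + \<epsilon>)"
      by (simp add: algebra_simps)
    also have "\<dots> = real ?i * (- real n1 * (y1 + \<epsilon>)) + real ?j * (- real n2 * (y2 + \<epsilon>))"
      unfolding nw by (simp add: algebra_simps)
    finally show ?thesis by (simp only: exp_add exp_of_nat_mult)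
  qed
  also have "\<dots> \<le> A n1 m1 ^ ?i * A n2 m2 ^ ?j"
    using 1 2 by (intro mult_mono power_mono) auto
  also have "\<dots> \<le> A (?i * n1) (?i * m1) * A (?j * n2) (?j * m2)"
    using 1 2 by (intro mult_mono p) auto
  also have "\<dots> \<le> A n m"
    unfolding n_def m_def by (rule A_supermult)
  finally have low: "exp (- real n * (w K * y1 + (1 - w K) * y2 + \<epsilon>)) \<le> A n m" .
  have "A n m \<le> exp (- real n * y')"
    using \<delta>(2)[of "real m / real n"] K(1) by (intro A_le_exp n0) (auto simp: ratio)
  with low have "exp (- real n * (w K * y1 + (1 - w K) * y2 + \<epsilon>)) \<le> exp (- real n * y')"
    by (rule order_trans)
  then have "real n * y' \<le> real n * (w K * y1 + (1 - w K) * y2 + \<epsilon>)" by simp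
  then have "y' \<le> w K * y1 + (1 - w K) * y2 + \<epsilon>"
    using n0 by (simp only: mult_le_cancel_left_pos of_nat_0_less_iff)
  with K(2) show False
    using e unfolding \<epsilon>_def by argo
qed

text \<open>The speed always lies in the unit interval; if \<open>L\<close> were at least
  \<open>ln r\<close> everywhere there, the total probability would decay exponentially.\<close>

lemma L_less_ln_r: "\<exists>q\<in>{0..1}. L q < ereal (ln r)"
proof (rule ccontr)
  assume "\<not> ?thesis"
  then have "eventually (\<lambda>n. speed_prob n {0..1} \<le> exp (- real n * (ln r - ln r / 2))) sequentially"
    using r_gt_1 by (intro speed_prob_upper) (auto simp: not_less)
  moreover have "speed_prob n {0..1} = 1" for n
    unfolding speed_prob_def
    by (subst measure_pmf.prob_eq_1) (auto simp: AE_measure_pmf_iff divide_simps dest: set_walk)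
  ultimately have "eventually (\<lambda>n. 1 \<le> exp (- real n * (ln r / 2))) sequentially"
    by (elim eventually_mono) simp
  then have "eventually (\<lambda>n::nat. False) sequentially"
    using eventually_gt_at_top[of 0]
  proof eventually_elim
    case (elim n)
    then have "0 \<le> - real n * (ln r / 2)" by simp
    moreover have "0 < real n * (ln r / 2)" using elim r_gt_1 by simp
    ultimately show ?case by simp
  qed
  then show False by simp
qed

lemma E_le: "E n m \<le> (2 * real CARD('g)) ^ m * (Gc / r ^ n)"
proof -
  have P: "P n x \<le> Gc / r ^ n" for x
    using P_le_Gc[of n x] r_gt_1 by (simp add: field_simps)
  have "E n m \<le> real (card {x :: 'g free_group. word_length x = m}) * (Gc / r ^ n)"
    unfolding E_def using sum_bounded_above[of "{x :: 'g free_group. word_length x = m}" "P n" "Gc / r ^ n"] P by simp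
  also have "\<dots> \<le> (2 * real CARD('g)) ^ m * (Gc / r ^ n)"
  proof (rule mult_right_mono)
    have "real (card {x :: 'g free_group. word_length x = m}) \<le> real ((2 * CARD('g)) ^ m)"
      using card_word_length_le[where 'g = 'g, of m] by (simp only: of_nat_le_iff)
    then show "real (card {x :: 'g free_group. word_length x = m}) \<le> (2 * real CARD('g)) ^ m" by simp
    show "0 \<le> Gc / r ^ n" using Gc_ge_1 r_gt_1 by simp
  qed
  finally show ?thesis .
qed

text \<open>At speeds close to 0 there are only subexponentially many words, and
  \<open>P_le_Gc\<close> bounds the probability of each by \<open>Gc / r ^ n\<close>. Hence no rate
  below \<open>ln r\<close> is possible.\<close>

lemma L_0_ge: "ereal (ln r) \<le> L 0"
proof (rule ccontr)
  assume "\<not> ?thesis"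
  then have "L 0 < ereal (ln r)" by simp
  then obtain y where y: "L 0 < ereal y" "ereal y < ereal (ln r)"
    using ereal_dense2 by blast
  define g where "g = ln (2 * real CARD('g))"
  have g: "0 < g" using rank by (simp add: g_def)
  define \<epsilon> where "\<epsilon> = (ln r - y) / 4"
  have e: "0 < \<epsilon>" using y by (simp add: \<epsilon>_def)
  obtain n0 :: nat where n0: "real n0 > ln Gc / \<epsilon>"
    using reals_Archimedean2 by blast
  obtain n m where nm: "n0 \<le> n" "0 < n" "\<bar>real m / real n - 0\<bar> < \<epsilon> / g" "exp (- real n * (y + \<epsilon>)) \<le> A n m"
    using A_lower[OF less_imp_le[OF y(1)], of "\<epsilon> / g" \<epsilon> n0] e g by auto
  have mn: "real m * g < real n * \<epsilon>"
    using nm g by (simp add: field_simps)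
  have G0: "0 < Gc" using Gc_ge_1 by simp
  have "exp (- real n * (y + \<epsilon>)) \<le> (2 * real CARD('g)) ^ m * (Gc / r ^ n)"
    using nm(4) A_le_E[of n m] E_le[of n m] by linarith
  also have "\<dots> = exp (real m * g + ln Gc - real n * ln r)"
    using G0 r_gt_1 by (simp add: g_def exp_diff exp_add exp_of_nat_mult)
  finally have "- real n * (y + \<epsilon>) \<le> real m * g + ln Gc - real n * ln r" by simp
  then have "real n * (ln r - y - \<epsilon>) \<le> real m * g + ln Gc" by (simp add: algebra_simps)
  moreover have "ln r - y - \<epsilon> = 3 * \<epsilon>" unfolding \<epsilon>_def by argo
  ultimately have "real n * (3 * \<epsilon>) \<le> real n * \<epsilon> + ln Gc" using mn by (metis add_le_cancel_right less_imp_le order_trans)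
  then have "real n * \<epsilon> * 2 \<le> ln Gc" by (simp add: algebra_simps)
  moreover have "ln Gc < real n * \<epsilon>"
  proof -
    have "ln Gc < real n0 * \<epsilon>" using n0 e by (simp add: field_simps)
    also have "\<dots> \<le> real n * \<epsilon>" using nm(1) e by (intro mult_right_mono) auto
    finally show ?thesis .
  qed
  moreover have "0 \<le> ln Gc" using Gc_ge_1 by simp
  ultimately show False by linarith
qed

lemma I_set_0: "0 \<in> I_set L r \<longleftrightarrow> L 0 = ereal (ln r)"
  using L_0_ge by (auto simp: I_set_def)

lemma L_cases: obtains y where "L q = ereal y" "0 \<le> y" | "L q = \<infinity>"
  using L_nonneg[of q] by (cases "L q") auto

context
  assumes L0: "L 0 = ereal (ln r)"
begin

abbreviation slope0 :: "real \<Rightarrow> ereal" where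
  "slope0 q \<equiv> (L 0 - L q) / ereal q"

lemma slope0_antimono:
  assumes "0 < q" "q \<le> q'"
  shows "slope0 q' \<le> slope0 q"
proof (cases rule: L_cases[of q'])
  case (1 y')
  have "L ((q / q') * q' + (1 - q / q') * 0) \<le> ereal ((q / q') * y' + (1 - q / q') * ln r)"
    using assms 1 L0 by (intro L_convex) auto
  then have Lq: "L q \<le> ereal ((q / q') * y' + (1 - q / q') * ln r)"
    using assms by simp
  then obtain y where y: "L q = ereal y"
    by (cases rule: L_cases[of q]) auto
  have "y \<le> (q / q') * y' + (1 - q / q') * ln r"
    using Lq y by simp
  then have "q / q' * (ln r - y') \<le> ln r - y"
    by (simp add: algebra_simps)
  then have "(ln r - y') / q' \<le> (ln r - y) / q"
    using assms by (simp add: field_simps)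
  then show ?thesis
    using assms 1 y L0 by simp
next
  case 2
  then show ?thesis using assms L0 by simp
qed

text \<open>Convexity makes the difference quotients monotone, so the one-sided limit in
  \<open>dim_bound\<close> exists and is a supremum. In this form it can be approximated from below
  by a single positive speed.\<close>

lemma dim_bound_0_eq: "dim_bound L r 0 = (SUP q\<in>{0<..}. slope0 q)"
proof -
  have "((\<lambda>q. slope0 q) \<longlongrightarrow> (SUP q\<in>{0<..}. slope0 q)) (at_right 0)"
  proof (rule order_tendstoI)
    fix a assume "a < (SUP q\<in>{0<..}. slope0 q)"
    then obtain q1 where q1: "q1 > 0" "a < slope0 q1"
      by (auto simp: less_SUP_iff)
    have "eventually (\<lambda>q. q \<in> {0<..<q1}) (at_right 0)"
      by (rule eventually_at_right_real) (use q1 in auto)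
    then show "eventually (\<lambda>q. a < slope0 q) (at_right 0)"
    proof eventually_elim
      case (elim q)
      then show ?case using slope0_antimono[of q q1] q1(2) by (simp add: less_le_trans)
    qed
  next
    fix a assume a: "(SUP q\<in>{0<..}. slope0 q) < a"
    have "eventually (\<lambda>q. q > 0) (at_right (0::real))"
      by (simp add: eventually_at_right_less)
    then show "eventually (\<lambda>q. slope0 q < a) (at_right 0)"
    proof eventually_elim
      case (elim q)
      then have "slope0 q \<le> (SUP q\<in>{0<..}. slope0 q)" by (intro SUP_upper) auto
      then show ?case using a by (rule le_less_trans)
    qed
  qed
  then have "Lim (at_right 0) (\<lambda>q. slope0 q) = (SUP q\<in>{0<..}. slope0 q)"
    by (intro tendsto_Lim) auto
  then show ?thesis by (simp add: dim_bound_def)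
qed

lemma slope0_le_dim_bound: "0 < q \<Longrightarrow> slope0 q \<le> dim_bound L r 0"
  unfolding dim_bound_0_eq by (intro SUP_upper) auto

lemma less_dim_bound_0:
  assumes "ereal h < dim_bound L r 0" "\<delta> > 0"
  obtains q where "0 < q" "q < \<delta>" "ereal h < slope0 q"
proof -
  obtain q1 where q1: "q1 > 0" "ereal h < slope0 q1"
    using assms(1) unfolding dim_bound_0_eq by (auto simp: less_SUP_iff)
  define q where "q = min q1 (\<delta> / 2)"
  have "0 < q" "q < \<delta>" "q \<le> q1" using q1 assms(2) by (auto simp: q_def)
  moreover have "ereal h < slope0 q"
    using slope0_antimono[OF \<open>0 < q\<close> \<open>q \<le> q1\<close>] q1(2) by (rule less_le_trans[rotated])
  ultimately show thesis using that by blast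
qed

end

text \<open>Blocks exist only for speeds with rate strictly below \<open>ln r\<close>, and their
  entropy is measured per letter, so the speed has to be positive. For \<open>h = 0\<close>
  convexity allows a small move towards a speed of rate below \<open>ln r\<close>; for
  \<open>h > 0\<close> and \<open>q > 0\<close> the strict bound makes \<open>q\<close> itself
  suitable; at \<open>q = 0\<close> a difference quotient near the limit provides
  \<open>q'\<close>.\<close>

lemma approx_speed:
  assumes q: "q \<in> I_set L r" and h: "0 \<le> h" "h = 0 \<or> ereal h < dim_bound L r q" and e: "\<epsilon> > 0"
  obtains q' y where "0 < q'" "\<bar>q' - q\<bar> < \<epsilon>" "L q' \<le> ereal y" "0 \<le> y" "y < ln r" "h * q' < ln r - y"
proof -
  have q01: "0 \<le> q" "q \<le> 1" and Lq: "L q \<le> ereal (ln r)"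
    using q by (auto simp: I_set_def)
  obtain yq where yq: "L q = ereal yq" "0 \<le> yq"
    using Lq by (cases rule: L_cases[of q]) auto
  consider "h = 0" | "h \<noteq> 0" "q > 0" | "h \<noteq> 0" "q = 0"
    using q01 by linarith
  then show thesis
  proof cases
    case 1
    obtain q0 where q0: "0 \<le> q0" "q0 \<le> 1" "L q0 < ereal (ln r)"
      using L_less_ln_r by auto
    then have "q0 \<noteq> 0" using L_0_ge by auto
    obtain y0 where y0: "L q0 = ereal y0" "0 \<le> y0"
      using q0 by (cases rule: L_cases[of q0]) auto
    define t where "t = min (1 / 2) (\<epsilon> / 4)"
    have t: "0 < t" "t < 1" "t < \<epsilon>" using e by (auto simp: t_def)
    show ?thesis
    proof (rule that)
      have "0 < t * q0" using t q0 \<open>q0 \<noteq> 0\<close> by simp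
      moreover have "0 \<le> (1 - t) * q" using t q01 by simp
      ultimately show "0 < t * q0 + (1 - t) * q" by linarith
      have "\<bar>t * q0 + (1 - t) * q - q\<bar> = t * \<bar>q0 - q\<bar>"
      proof -
        have "t * q0 + (1 - t) * q - q = t * (q0 - q)" by (simp add: algebra_simps)
        then show ?thesis using t by (simp add: abs_mult)
      qed
      also have "\<dots> \<le> t * 1" using t q0 q01 by (intro mult_left_mono) auto
      finally show "\<bar>t * q0 + (1 - t) * q - q\<bar> < \<epsilon>" using t by simp
      show "L (t * q0 + (1 - t) * q) \<le> ereal (t * y0 + (1 - t) * yq)"
        using y0 yq t by (intro L_convex) auto
      show "0 \<le> t * y0 + (1 - t) * yq" using t y0 yq by simp
      have "t * y0 < t * ln r" using q0 y0 t by (intro mult_strict_left_mono) auto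
      moreover have "(1 - t) * yq \<le> (1 - t) * ln r" using Lq yq t by (intro mult_left_mono) auto
      ultimately show *: "t * y0 + (1 - t) * yq < ln r" by (simp add: algebra_simps)
      show "h * (t * q0 + (1 - t) * q) < ln r - (t * y0 + (1 - t) * yq)"
        using * 1 by simp
    qed
  next
    case 2
    then have "ereal h < (ereal (ln r) - L q) / ereal q"
      using h by (simp add: dim_bound_def)
    then have "h < (ln r - yq) / q" using 2 yq by simp
    then have *: "h * q < ln r - yq" using 2 by (simp add: field_simps)
    moreover have "0 \<le> h * q" using 2 h by simp
    ultimately have "yq < ln r" by linarith
    then show ?thesis
      using * 2 yq e by (intro that[of q yq]) auto
  next
    case 3
    then have L0: "L 0 = ereal (ln r)" using q I_set_0 by simp
    obtain q' where q': "0 < q'" "q' < \<epsilon>" "ereal h < slope0 q'"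
      using less_dim_bound_0[OF L0, of h \<epsilon>] 3 h e by auto
    then obtain y where y: "L q' = ereal y" "0 \<le> y"
      using L0 by (cases rule: L_cases[of q']) auto
    then have "h < (ln r - y) / q'" using q' L0 by simp
    then have *: "h * q' < ln r - y" using q' by (simp add: field_simps)
    moreover have "0 \<le> h * q'" using q' h by simp
    ultimately have "y < ln r" by linarith
    then show ?thesis
      using * q' y 3 by (intro that[of q' y]) auto
  qed
qed

end

subsection \<open>The environment and its resampling\<close>

definition env :: "'b pmf \<Rightarrow> (nat list \<Rightarrow> 'b) measure" where
  "env D = PiM UNIV (\<lambda>_. measure_pmf D)"

definition sh :: "nat list \<Rightarrow> (nat list \<Rightarrow> 'b) \<Rightarrow> nat list \<Rightarrow> 'b" where
  "sh v \<omega> = (\<lambda>w. \<omega> (v @ w))"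

text \<open>Depths below \<open>k\<close> are kept and everything from depth \<open>k\<close> on is
  replaced. Since the result has the law of the environment again, integrating over the two
  arguments separately plays the part of conditioning on the kept generations.\<close>

definition resample :: "nat \<Rightarrow> (nat list \<Rightarrow> 'b) \<Rightarrow> (nat list \<Rightarrow> 'b) \<Rightarrow> nat list \<Rightarrow> 'b" where
  "resample k \<omega> \<omega>' = (\<lambda>w. if length w < k then \<omega> w else \<omega>' w)"

lemma sh_apply: "sh v \<omega> w = \<omega> (v @ w)"
  by (simp add: sh_def)

lemma sh_apply_Nil [simp]: "sh v \<omega> [] = \<omega> v"
  by (simp add: sh_def)

lemma sh_sh [simp]: "sh v (sh u \<omega>) = sh (u @ v) \<omega>"
  by (simp add: sh_def)

lemma sh_Nil [simp]: "sh [] \<omega> = \<omega>"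
  by (simp add: sh_def)

lemma sh_resample: "k \<le> length v \<Longrightarrow> sh v (resample k \<omega> \<omega>') = sh v \<omega>'"
  by (auto simp: sh_def resample_def)

lemma space_env [simp]: "space (env D) = UNIV"
  by (simp add: env_def space_PiM PiE_UNIV_domain)

lemma prob_space_env: "prob_space (env D)"
  unfolding env_def by (intro prob_space_PiM prob_space_measure_pmf)

lemma measurable_env_component [measurable]: "(\<lambda>\<omega>. \<omega> u) \<in> env D \<rightarrow>\<^sub>M count_space UNIV"
  using measurable_component_singleton[of u UNIV "\<lambda>_. measure_pmf D"] by (simp add: env_def)

lemma measurable_into_env:
  assumes "\<And>u. (\<lambda>x. f x u) \<in> M \<rightarrow>\<^sub>M count_space UNIV"
  shows "f \<in> M \<rightarrow>\<^sub>M env D"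
  unfolding env_def by (rule measurable_PiM_single') (use assms in \<open>auto simp: PiE_UNIV_domain\<close>)

lemma measurable_sh [measurable]: "sh v \<in> env D \<rightarrow>\<^sub>M env D"
  by (rule measurable_into_env) (simp add: measurable_env_component sh_apply)

lemma measurable_resample [measurable]:
  "(\<lambda>(\<omega>, \<omega>'). resample k \<omega> \<omega>') \<in> env D \<Otimes>\<^sub>M env D \<rightarrow>\<^sub>M env D"
  by (rule measurable_into_env)
    (auto simp: resample_def case_prod_unfold if_distrib[where f = "\<lambda>f. f _"] split: if_splits
      intro!: measurable_compose[OF measurable_fst measurable_env_component] measurable_compose[OF measurable_snd measurable_env_component])

lemma sets_env_component: "{\<omega>. \<omega> u = b} \<in> sets (env D)"
proof -
  have "(\<lambda>\<omega>. \<omega> u) -` {b} \<inter> space (env D) \<in> sets (env D)"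
    by (rule measurable_sets[OF measurable_env_component]) simp
  then show ?thesis by (simp add: vimage_def)
qed

text \<open>The labels are countably many, so an event that depends on finitely many coordinates is
  a countable union of cylinders.\<close>

lemma sets_env_finite:
  fixes D :: "'b :: countable pmf"
  assumes U: "finite U" and Q: "\<And>\<omega> \<omega>'. (\<And>u. u \<in> U \<Longrightarrow> \<omega> u = \<omega>' u) \<Longrightarrow> Q \<omega> \<Longrightarrow> Q \<omega>'"
  shows "{\<omega>. Q \<omega>} \<in> sets (env D)"
proof -
  obtain us where us: "set us = U" using finite_list[OF U] by blast
  have eq: "{\<omega>. map \<omega> us = l} \<in> sets (env D)" for l
  proof -
    have "{\<omega>. map \<omega> us = l} = (if length l = length us then {\<omega> \<in> space (env D). \<forall>i\<in>{..<length us}. \<omega> (us ! i) = l ! i} else {})"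
      by (auto simp: list_eq_iff_nth_eq)
    also have "\<dots> \<in> sets (env D)"
    proof -
      have "{\<omega> \<in> space (env D). \<forall>i\<in>{..<length us}. \<omega> (us ! i) = l ! i} \<in> sets (env D)"
        by (rule sets.sets_Collect_finite_All) (use sets_env_component in auto)
      then show ?thesis by simp
    qed
    finally show ?thesis .
  qed
  have "{\<omega>. Q \<omega>} = (\<Union>l\<in>(\<lambda>\<omega>. map \<omega> us) ` {\<omega>. Q \<omega>}. {\<omega>. map \<omega> us = l})"
    using Q us by (auto simp: map_eq_conv)
  also have "\<dots> \<in> sets (env D)"
    by (rule sets.countable_UN'[OF countableI_type]) (use eq in blast)
  finally show ?thesis .
qed

lemma emeasure_env_cylinder:
  assumes "finite J"
  shows "emeasure (env D) (prod_emb UNIV (\<lambda>_. measure_pmf D) J (Pi\<^sub>E J A)) = (\<Prod>j\<in>J. emeasure (measure_pmf D) (A j))"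
  unfolding env_def using assms by (intro emeasure_PiM_emb) (auto intro: prob_space_measure_pmf)

lemma prod_emb_UNIV: "prod_emb UNIV (\<lambda>_. measure_pmf D) J (Pi\<^sub>E J A) = {\<omega>. \<forall>j\<in>J. \<omega> j \<in> A j}"
  by (auto simp: prod_emb_def PiE_UNIV_domain PiE_iff restrict_def extensional_def)

lemma distr_sh: "distr (env D) (env D) (sh v) = env D"
  using distr_PiM_reindex[of UNIV "\<lambda>_. measure_pmf D" "\<lambda>w. v @ w" UNIV]
  by (simp add: env_def sh_def[abs_def] prob_space_measure_pmf inj_on_def restrict_UNIV)

lemma env_eqI:
  assumes "finite_measure M" "sets M = sets (env D)"
    and "\<And>J A. finite J \<Longrightarrow> emeasure M {\<omega>. \<forall>j\<in>J. \<omega> j \<in> A j} = (\<Prod>j\<in>J. emeasure (measure_pmf D) (A j))"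
  shows "M = env D"
proof (rule measure_eqI_PiM_infinite)
  show "sets M = sets (PiM UNIV (\<lambda>_. measure_pmf D))" "sets (env D) = sets (PiM UNIV (\<lambda>_. measure_pmf D))"
    using assms(2) by (auto simp: env_def)
  fix A and J :: "nat list set" assume "finite J"
  then show "emeasure M (prod_emb UNIV (\<lambda>_. measure_pmf D) J (Pi\<^sub>E J A))
      = emeasure (env D) (prod_emb UNIV (\<lambda>_. measure_pmf D) J (Pi\<^sub>E J A))"
    using assms(3) by (simp add: emeasure_env_cylinder) (simp add: prod_emb_UNIV)
qed fact

lemma emeasure_env_cylinder':
  "finite J \<Longrightarrow> emeasure (env D) {\<omega>. \<forall>j\<in>J. \<omega> j \<in> A j} = (\<Prod>j\<in>J. emeasure (measure_pmf D) (A j))"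
  using emeasure_env_cylinder[of J D A] by (simp only: prod_emb_UNIV)

lemma sets_env_cylinder: "finite J \<Longrightarrow> {\<omega>. \<forall>j\<in>J. \<omega> j \<in> A j} \<in> sets (env D)"
proof -
  assume J: "finite J"
  have "{\<omega>. \<forall>j\<in>J. \<omega> j \<in> A j} = {\<omega> \<in> space (env D). \<forall>j\<in>J. \<omega> j \<in> A j}" by simp
  also have "\<dots> \<in> sets (env D)"
  proof (rule sets.sets_Collect_finite_All[OF _ J])
    fix j
    have "(\<lambda>\<omega>. \<omega> j) -` A j \<inter> space (env D) \<in> sets (env D)"
      by (rule measurable_sets[OF measurable_env_component]) simp
    then show "{\<omega> \<in> space (env D). \<omega> j \<in> A j} \<in> sets (env D)" by (simp add: vimage_def)
  qed
  finally show ?thesis .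
qed

lemma distr_resample:
  fixes D :: "'a pmf"
  shows "distr (env D \<Otimes>\<^sub>M env D) (env D) (\<lambda>(\<omega>, \<omega>'). resample k \<omega> \<omega>') = env D" (is "?M = _")
proof (rule env_eqI)
  interpret E: prob_space "env D" by (rule prob_space_env)
  interpret EE: pair_prob_space "env D" "env D" ..
  show "finite_measure ?M"
    by (intro prob_space.finite_measure EE.prob_space_distr measurable_resample)
  fix J :: "nat list set" and A :: "nat list \<Rightarrow> 'a set" assume J: "finite J"
  let ?J1 = "{j \<in> J. length j < k}" and ?J2 = "{j \<in> J. \<not> length j < k}"
  let ?C = "\<lambda>J. {\<omega>. \<forall>j\<in>J. \<omega> j \<in> A j}"
  have "emeasure ?M (?C J) = emeasure (env D \<Otimes>\<^sub>M env D) ((\<lambda>(\<omega>, \<omega>'). resample k \<omega> \<omega>') -` ?C J \<inter> space (env D \<Otimes>\<^sub>M env D))"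
    using J by (intro emeasure_distr measurable_resample sets_env_cylinder)
  also have "(\<lambda>(\<omega>, \<omega>'). resample k \<omega> \<omega>') -` ?C J \<inter> space (env D \<Otimes>\<^sub>M env D) = ?C ?J1 \<times> ?C ?J2"
    by (auto simp: space_pair_measure resample_def split: if_splits)
  also have "emeasure (env D \<Otimes>\<^sub>M env D) \<dots> = emeasure (env D) (?C ?J1) * emeasure (env D) (?C ?J2)"
    using J by (intro E.emeasure_pair_measure_Times sets_env_cylinder) auto
  also have "\<dots> = (\<Prod>j\<in>?J1. emeasure (measure_pmf D) (A j)) * (\<Prod>j\<in>?J2. emeasure (measure_pmf D) (A j))"
    using J by (subst (1 2) emeasure_env_cylinder') auto
  also have "\<dots> = (\<Prod>j\<in>J. emeasure (measure_pmf D) (A j))"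
    using J by (subst prod.union_disjoint[symmetric]) (auto intro!: prod.cong)
  finally show "emeasure ?M (?C J) = (\<Prod>j\<in>J. emeasure (measure_pmf D) (A j))" .
qed simp

lemma emeasure_env_resample:
  assumes "A \<in> sets (env D)"
  shows "emeasure (env D) A = (\<integral>\<^sup>+\<omega>. emeasure (env D) {\<omega>'. resample k \<omega> \<omega>' \<in> A} \<partial>env D)"
proof -
  interpret E: prob_space "env D" by (rule prob_space_env)
  let ?R = "\<lambda>(\<omega>, \<omega>'). resample k \<omega> \<omega>'"
  have m: "?R -` A \<inter> space (env D \<Otimes>\<^sub>M env D) \<in> sets (env D \<Otimes>\<^sub>M env D)"
    by (rule measurable_sets[OF measurable_resample assms])
  have "emeasure (env D) A = emeasure (distr (env D \<Otimes>\<^sub>M env D) (env D) ?R) A"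
    by (simp add: distr_resample)
  also have "\<dots> = emeasure (env D \<Otimes>\<^sub>M env D) (?R -` A \<inter> space (env D \<Otimes>\<^sub>M env D))"
    by (intro emeasure_distr measurable_resample assms)
  also have "\<dots> = (\<integral>\<^sup>+\<omega>. emeasure (env D) (Pair \<omega> -` (?R -` A \<inter> space (env D \<Otimes>\<^sub>M env D))) \<partial>env D)"
    by (rule E.emeasure_pair_measure_alt[OF m])
  finally show ?thesis
    by (simp add: space_pair_measure vimage_def)
qed

lemma measurable_env_section:
  assumes "A \<in> sets (env D)"
  shows "{\<omega>'. resample k \<omega> \<omega>' \<in> A} \<in> sets (env D)"
proof -
  have "(\<lambda>\<omega>'. resample k \<omega> \<omega>') \<in> env D \<rightarrow>\<^sub>M env D"
    using measurable_Pair2[OF measurable_resample, of \<omega>] by simp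
  from measurable_sets[OF this assms] show ?thesis by (simp add: vimage_def)
qed

lemma sets_env_sh:
  assumes "A \<in> sets (env D)"
  shows "{\<omega>. sh v \<omega> \<in> A} \<in> sets (env D)"
  using measurable_sets[OF measurable_sh assms, of v] by (simp add: vimage_def)

lemma emeasure_env_sh:
  assumes "A \<in> sets (env D)"
  shows "emeasure (env D) {\<omega>. sh v \<omega> \<in> A} = emeasure (env D) A"
  using emeasure_distr[OF measurable_sh assms, of v] by (simp add: distr_sh vimage_def)

lemma measure_env_sh:
  assumes "A \<in> sets (env D)"
  shows "measure (env D) {\<omega>. sh v \<omega> \<in> A} = measure (env D) A"
  using emeasure_env_sh[OF assms] by (simp add: measure_def)

text \<open>Different vertices of equal length are incomparable, so their subtrees use disjoint sets
  of coordinates.\<close>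

lemma indep_vars_sh:
  assumes V: "\<And>v. v \<in> V \<Longrightarrow> length v = k"
  shows "prob_space.indep_vars (env D) (\<lambda>_. env D) sh V"
proof -
  interpret E: prob_space "env D" by (rule prob_space_env)
  let ?K = "\<lambda>v. range (\<lambda>w. v @ w)"
  have dist: "distr (env D) (measure_pmf D) (\<lambda>\<omega>. \<omega> u) = measure_pmf D" for u
    unfolding env_def by (rule distr_PiM_component) (auto intro: prob_space_measure_pmf)
  have "E.indep_vars (\<lambda>_. measure_pmf D) (\<lambda>u \<omega>. \<omega> u) (UNIV :: nat list set)"
    by (subst E.indep_vars_iff_distr_eq_PiM)
      (auto simp: dist measurable_env_component env_def[symmetric] restrict_UNIV distr_id2)
  then have "E.indep_vars (\<lambda>v. PiM (?K v) (\<lambda>_. measure_pmf D)) (\<lambda>v \<omega>. restrict (\<lambda>i. \<omega> i) (?K v)) V"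
  proof (rule E.indep_vars_restrict)
    show "disjoint_family_on ?K V"
      unfolding disjoint_family_on_def using V by (metis (no_types, lifting) append_eq_append_conv disjoint_iff imageE)
  qed auto
  then have "E.indep_vars (\<lambda>_. env D) (\<lambda>v \<omega>. (\<lambda>x w. x (v @ w)) (restrict (\<lambda>i. \<omega> i) (?K v))) V"
  proof (rule E.indep_vars_compose2)
    fix v assume "v \<in> V"
    show "(\<lambda>x w. x (v @ w)) \<in> PiM (?K v) (\<lambda>_. measure_pmf D) \<rightarrow>\<^sub>M env D"
      proof (rule measurable_into_env)
      fix u
      show "(\<lambda>x. x (v @ u)) \<in> PiM (?K v) (\<lambda>_. measure_pmf D) \<rightarrow>\<^sub>M count_space UNIV"
        using measurable_component_singleton[of "v @ u" "?K v" "\<lambda>_. measure_pmf D"] by simp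
    qed
  qed
  then show ?thesis
    by (simp add: sh_def[abs_def])
qed

lemma indep_events_sh:
  assumes V: "\<And>v. v \<in> V \<Longrightarrow> length v = k" "finite V" and A: "\<And>v. v \<in> V \<Longrightarrow> A v \<in> sets (env D)"
  shows "measure (env D) {\<omega>. \<forall>v\<in>V. sh v \<omega> \<in> A v} = (\<Prod>v\<in>V. measure (env D) (A v))"
proof -
  interpret E: prob_space "env D" by (rule prob_space_env)
  show ?thesis
  proof (cases "V = {}")
    case True
    then show ?thesis using E.prob_space by simp
  next
    case False
    have "E.prob (\<Inter>v\<in>V. sh v -` A v \<inter> space (env D)) = (\<Prod>v\<in>V. E.prob (sh v -` A v \<inter> space (env D)))"
      by (rule E.indep_varsD[OF indep_vars_sh[OF V(1)]]) (use V A False in auto)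
    also have "(\<Inter>v\<in>V. sh v -` A v \<inter> space (env D)) = {\<omega>. \<forall>v\<in>V. sh v \<omega> \<in> A v}"
      using False by auto
    also have "(\<Prod>v\<in>V. E.prob (sh v -` A v \<inter> space (env D))) = (\<Prod>v\<in>V. measure (env D) (A v))"
      using measure_env_sh A by (intro prod.cong) (auto simp: vimage_def)
    finally show ?thesis .
  qed
qed

text \<open>Chebyshev's inequality for the number of subtrees lying in \<open>G\<close>: the
  indicators are pairwise independent, so the variance is at most the mean, and falling below half
  of the mean \<open>n * t\<close> has probability at most \<open>4 / (n * t)\<close>.\<close>

lemma measure_env_count_ge:
  assumes S: "\<And>v. v \<in> S \<Longrightarrow> length v = k" "finite S" "B \<le> card S" "0 < B"
    and G: "G \<in> sets (env D)" "\<tau> \<le> measure (env D) G" "0 < \<tau>" and b: "b \<le> \<tau> * real B / 2"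
  shows "1 - 4 / (\<tau> * real B) \<le> measure (env D) {\<omega>. b \<le> real (card {v \<in> S. sh v \<omega> \<in> G})}"
proof -
  interpret E: prob_space "env D" by (rule prob_space_env)
  define t where "t = measure (env D) G"
  define n where "n = real (card S)"
  have t: "0 < t" "\<tau> \<le> t" "t \<le> 1" using G by (auto simp: t_def)
  have n: "0 < n" "real B \<le> n" using S by (auto simp: n_def)
  let ?I = "\<lambda>v \<omega>. indicator {\<omega>. sh v \<omega> \<in> G} \<omega> :: real"
  define X where "X \<omega> = (\<Sum>v\<in>S. ?I v \<omega>)" for \<omega>
  have X: "X \<omega> = real (card {v \<in> S. sh v \<omega> \<in> G})" for \<omega>
    unfolding X_def using S(2) by (simp add: indicator_def of_bool_def sum.If_cases Int_def)
  have sets: "{\<omega>. sh v \<omega> \<in> G} \<in> E.events" for v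
    by (rule sets_env_sh[OF G(1)])
  have int: "integrable (env D) (?I v)" for v
    using sets[of v] by (simp add: E.emeasure_eq_measure integrable_real_indicator)
  have int2: "integrable (env D) (\<lambda>\<omega>. ?I v \<omega> * ?I w \<omega>)" for v w
    using sets[of v] sets[of w]
    by (simp add: indicator_inter_arith[symmetric] E.emeasure_eq_measure integrable_real_indicator sets.Int)
  have EX: "E.expectation X = n * t"
    unfolding X_def n_def t_def using int sets measure_env_sh[OF G(1)] by (simp add: Bochner_Integration.integral_sum)
  have Iw: "E.expectation (\<lambda>\<omega>. ?I v \<omega> * ?I w \<omega>) = (if v = w then t else t * t)" if vw: "v \<in> S" "w \<in> S" for v w
  proof -
    have "E.expectation (\<lambda>\<omega>. ?I v \<omega> * ?I w \<omega>) = measure (env D) {\<omega>. \<forall>u\<in>{v, w}. sh u \<omega> \<in> G}"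
      using sets[of v] sets[of w] by (simp add: indicator_inter_arith[symmetric] sets.Int Int_def)
    also have "\<dots> = (\<Prod>u\<in>{v, w}. measure (env D) G)"
      using S vw G by (intro indep_events_sh[of _ k]) auto
    finally show ?thesis by (auto simp: t_def)
  qed
  have sq: "(X \<omega>)\<^sup>2 = (\<Sum>v\<in>S. \<Sum>w\<in>S. ?I v \<omega> * ?I w \<omega>)" for \<omega>
    by (simp add: X_def power2_eq_square sum_product)
  have "E.expectation (\<lambda>\<omega>. (X \<omega>)\<^sup>2) = (\<Sum>v\<in>S. \<Sum>w\<in>S. E.expectation (\<lambda>\<omega>. ?I v \<omega> * ?I w \<omega>))"
    unfolding sq using int2 by (subst Bochner_Integration.integral_sum; (intro Bochner_Integration.integrable_sum)?; auto)+
  also have "\<dots> = (\<Sum>v\<in>S. \<Sum>w\<in>S. if v = w then t else t * t)"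
    by (intro sum.cong refl Iw)
  also have "\<dots> = (\<Sum>v\<in>S. t + (n - 1) * (t * t))"
  proof (rule sum.cong[OF refl])
    fix v assume v: "v \<in> S"
    then have "(\<Sum>w\<in>S. if v = w then t else t * t) = t + (\<Sum>w\<in>S - {v}. t * t)"
    proof -
      have "(\<Sum>w\<in>S - {v}. if v = w then t else t * t) = (\<Sum>w\<in>S - {v}. t * t)"
        by (rule sum.cong) auto
      then show ?thesis using S(2) v by (simp only: sum.remove if_True simp_thms)
    qed
    also have "\<dots> = t + (n - 1) * (t * t)"
      using v S(2) n by (simp add: card_Diff_singleton n_def of_nat_diff card_gt_0_iff Suc_leI)
    finally show "(\<Sum>w\<in>S. if v = w then t else t * t) = t + (n - 1) * (t * t)" .
  qed
  finally have EX2: "E.expectation (\<lambda>\<omega>. (X \<omega>)\<^sup>2) = n * (t + (n - 1) * (t * t))"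
    by (simp add: n_def)
  have intX: "integrable (env D) X" unfolding X_def using int by auto
  have intX2: "integrable (env D) (\<lambda>\<omega>. (X \<omega>)\<^sup>2)"
    unfolding sq using int2 by auto
  have var: "E.variance X = n * t * (1 - t)"
    using E.variance_eq[OF intX intX2] EX EX2 by (simp add: algebra_simps power2_eq_square)
  have \<tau>Bnt: "\<tau> * real B \<le> n * t"
    using mult_mono[of \<tau> t "real B" n] n t G by (simp add: mult.commute)
  have "E.prob {\<omega> \<in> space (env D). n * t / 2 \<le> \<bar>X \<omega> - E.expectation X\<bar>} \<le> E.variance X / (n * t / 2)\<^sup>2"
    using intX intX2 n t by (intro E.Chebyshev_inequality) auto
  also have "\<dots> = 4 * (1 - t) / (n * t)"
    unfolding var using n t by (simp add: power2_eq_square field_simps)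
  also have "\<dots> \<le> 4 / (n * t)"
    using n t by (intro divide_right_mono) auto
  also have "\<dots> \<le> 4 / (\<tau> * real B)"
  proof (rule divide_left_mono)
    show "\<tau> * real B \<le> n * t" by (rule \<tau>Bnt)
    show "0 < n * t * (\<tau> * real B)" using n t G S by simp
  qed simp
  finally have le: "E.prob {\<omega>. n * t / 2 \<le> \<bar>X \<omega> - n * t\<bar>} \<le> 4 / (\<tau> * real B)"
    by (simp add: EX)
  have Xm [measurable]: "X \<in> borel_measurable (env D)" using intX by auto
  have bt: "b \<le> n * t / 2"
    using \<tau>Bnt b by linarith
  have e1: "{\<omega>. n * t / 2 \<le> \<bar>X \<omega> - n * t\<bar>} \<in> E.events" "{\<omega>. b \<le> X \<omega>} \<in> E.events"
    using measurable_sets[of "\<lambda>\<omega>. \<bar>X \<omega> - n * t\<bar>" "env D" borel "{n * t / 2..}"]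
      measurable_sets[of X "env D" borel "{b..}"] by (auto simp: vimage_def)
  have "1 - E.prob {\<omega>. b \<le> X \<omega>} = E.prob (space (env D) - {\<omega>. b \<le> X \<omega>})"
    by (rule E.prob_compl[OF e1(2), symmetric])
  also have "\<dots> \<le> E.prob {\<omega>. n * t / 2 \<le> \<bar>X \<omega> - n * t\<bar>}"
  proof (rule E.finite_measure_mono[OF _ e1(1)])
    show "space (env D) - {\<omega>. b \<le> X \<omega>} \<subseteq> {\<omega>. n * t / 2 \<le> \<bar>X \<omega> - n * t\<bar>}"
    proof
      fix \<omega> assume "\<omega> \<in> space (env D) - {\<omega>. b \<le> X \<omega>}"
      then have "X \<omega> < n * t / 2" using bt by simp
      then have "n * t / 2 \<le> \<bar>X \<omega> - n * t\<bar>" by (simp add: abs_if)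
      then show "\<omega> \<in> {\<omega>. n * t / 2 \<le> \<bar>X \<omega> - n * t\<bar>}" by simp
    qed
  qed
  finally show ?thesis using le by (simp add: X)
qed

type_synonym 'g environment = "nat list \<Rightarrow> nat \<times> 'g free_group"

definition tree :: "'g environment \<Rightarrow> nat list set" where
  "tree \<omega> = gw_tree (\<lambda>u. fst (\<omega> u))"

definition pos :: "'g environment \<Rightarrow> nat list \<Rightarrow> 'g free_group" where
  "pos \<omega> u = position (\<lambda>u. snd (\<omega> u)) u"

lemma Nil_in_tree [simp]: "[] \<in> tree \<omega>"
  by (simp add: tree_def gw_tree_def)

lemma pos_Nil [simp]: "pos \<omega> [] = 1"
  by (simp add: pos_def position_def)

lemma tree_append: "u @ w \<in> tree \<omega> \<longleftrightarrow> u \<in> tree \<omega> \<and> w \<in> tree (sh u \<omega>)"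
proof -
  have "(\<forall>k<length (u @ w). (u @ w) ! k < fst (\<omega> (take k (u @ w)))) \<longleftrightarrow>
      (\<forall>k<length u. u ! k < fst (\<omega> (take k u))) \<and> (\<forall>k<length w. w ! k < fst (\<omega> (u @ take k w)))"
    (is "?L \<longleftrightarrow> ?R1 \<and> ?R2")
  proof (intro iffI conjI allI impI)
    fix k assume ?L "k < length u"
    then show "u ! k < fst (\<omega> (take k u))"
      by (elim allE[of _ k]) (auto simp: nth_append)
  next
    fix k assume ?L "k < length w"
    then show "w ! k < fst (\<omega> (u @ take k w))"
      by (elim allE[of _ "length u + k"]) (auto simp: nth_append)
  next
    fix k assume a: "?R1 \<and> ?R2" and k: "k < length (u @ w)"
    show "(u @ w) ! k < fst (\<omega> (take k (u @ w)))"
    proof (cases "k < length u")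
      case True
      then show ?thesis using a by (auto simp: nth_append)
    next
      case False
      then have "k - length u < length w" using k by auto
      then show ?thesis using a False by (auto simp: nth_append)
    qed
  qed
  then show ?thesis by (simp add: tree_def gw_tree_def sh_apply)
qed

lemma singleton_in_tree [simp]: "[k] \<in> tree \<omega> \<longleftrightarrow> k < fst (\<omega> [])"
  by (simp add: tree_def gw_tree_def)

lemma pos_snoc: "pos \<omega> (u @ [k]) = pos \<omega> u * snd (\<omega> (u @ [k]))"
proof -
  have "map (\<lambda>j. snd (\<omega> (take j (u @ [k])))) [1..<Suc (length u)] = map (\<lambda>j. snd (\<omega> (take j u))) [1..<Suc (length u)]"
    by (intro map_cong) auto
  moreover have "[1..<Suc (length (u @ [k]))] = [1..<Suc (length u)] @ [Suc (length u)]"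
    by simp
  ultimately show ?thesis
    by (simp only: pos_def position_def map_append prod_list.append) simp
qed

lemma pos_append: "pos \<omega> (u @ w) = pos \<omega> u * pos (sh u \<omega>) w"
proof (induction w rule: rev_induct)
  case (snoc k w)
  have "pos \<omega> (u @ (w @ [k])) = pos \<omega> ((u @ w) @ [k])" by simp
  also have "\<dots> = pos \<omega> u * pos (sh u \<omega>) w * snd (\<omega> (u @ w @ [k]))"
    by (subst pos_snoc) (simp only: snoc append_assoc)
  finally show ?case by (simp add: pos_snoc mult.assoc sh_def)
qed simp

lemma pos_singleton [simp]: "pos \<omega> [k] = snd (\<omega> [k])"
  by (simp add: pos_def position_def)

lemma tree_cong:
  assumes "\<And>w. length w < length u \<Longrightarrow> \<omega> w = \<omega>' w"
  shows "u \<in> tree \<omega> \<longleftrightarrow> u \<in> tree \<omega>'"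
  using assms by (auto simp: tree_def gw_tree_def)

lemma pos_cong:
  assumes "\<And>w. length w \<le> length u \<Longrightarrow> \<omega> w = \<omega>' w"
  shows "pos \<omega> u = pos \<omega>' u"
  unfolding pos_def position_def using assms by (intro arg_cong[of _ _ prod_list] map_cong) auto

lemma tree_take: "u \<in> tree \<omega> \<Longrightarrow> take k u \<in> tree \<omega>"
  using tree_append[of "take k u" "drop k u" \<omega>] by simp

lemma finite_tree_level: "finite {u \<in> tree \<omega>. length u = n}"
proof (induction n)
  case (Suc n)
  have "{u \<in> tree \<omega>. length u = Suc n} \<subseteq> (\<Union>u\<in>{u \<in> tree \<omega>. length u = n}. (\<lambda>k. u @ [k]) ` {..<fst (\<omega> u)})"
  proof
    fix u assume u: "u \<in> {u \<in> tree \<omega>. length u = Suc n}"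
    then obtain v k where v: "u = v @ [k]"
      by (cases u rule: rev_cases) auto
    then show "u \<in> (\<Union>u\<in>{u \<in> tree \<omega>. length u = n}. (\<lambda>k. u @ [k]) ` {..<fst (\<omega> u)})"
      using u by (auto simp: tree_append)
  qed
  then show ?case by (rule finite_subset) (use Suc in auto)
qed simp

lemma sets_tree_event:
  fixes D :: "(nat \<times> 'g::countable free_group) pmf"
  assumes "\<And>\<omega> \<omega>'. (\<And>k. k \<le> length u \<Longrightarrow> \<omega> (take k u) = \<omega>' (take k u)) \<Longrightarrow> Q \<omega> \<Longrightarrow> Q \<omega>'"
  shows "{\<omega>. Q \<omega>} \<in> sets (env D)"
proof (rule sets_env_finite)
  show "finite ((\<lambda>k. take k u) ` {..length u})" by simp
  fix \<omega> \<omega>' assume "\<And>v. v \<in> (\<lambda>k. take k u) ` {..length u} \<Longrightarrow> \<omega> v = \<omega>' v" "Q \<omega>"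
  then show "Q \<omega>'" by (intro assms[of \<omega> \<omega>']) auto
qed

lemma tree_pos_prefix_cong:
  assumes "\<And>k. k \<le> length u \<Longrightarrow> \<omega> (take k u) = \<omega>' (take k u)"
  shows "u \<in> tree \<omega> \<longleftrightarrow> u \<in> tree \<omega>'" "pos \<omega> u = pos \<omega>' u"
proof -
  show "u \<in> tree \<omega> \<longleftrightarrow> u \<in> tree \<omega>'"
    using assms by (simp add: tree_def gw_tree_def)
  show "pos \<omega> u = pos \<omega>' u"
    unfolding pos_def position_def using assms assms[of "length u"] by (intro arg_cong[of _ _ prod_list] map_cong) auto
qed

lemma sets_tree_pos:
  fixes D :: "(nat \<times> 'g::countable free_group) pmf"
  shows "{\<omega>. u \<in> tree \<omega> \<and> Q (pos \<omega> u)} \<in> sets (env D)"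
  by (rule sets_tree_event[of u]) (metis tree_pos_prefix_cong)

definition occ :: "nat \<Rightarrow> 'g free_group set \<Rightarrow> 'g environment \<Rightarrow> 'g free_group set" where
  "occ n X \<omega> = {x \<in> X. \<exists>u\<in>tree \<omega>. length u = n \<and> pos \<omega> u = x}"

text \<open>The condition is put on the child \<open>u @ [0]\<close> because the label of
  \<open>u\<close> already determines its position; only from the next generation on is the
  environment independent of the occupied sites.\<close>

definition kids :: "nat \<Rightarrow> 'g free_group set \<Rightarrow> 'g environment set \<Rightarrow> 'g environment \<Rightarrow> 'g free_group set" where
  "kids n X G \<omega> = {x \<in> X. \<exists>u\<in>tree \<omega>. length u = n \<and> pos \<omega> u = x \<and> sh (u @ [0]) \<omega> \<in> G}"

lemma sets_kids_mem:
  fixes D :: "(nat \<times> 'g::countable free_group) pmf"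
  assumes "G \<in> sets (env D)"
  shows "{\<omega>. x \<in> kids n X G \<omega>} \<in> sets (env D)"
proof (cases "x \<in> X")
  case True
  have "{\<omega>. x \<in> kids n X G \<omega>} = (\<Union>u\<in>{u. length u = n}. {\<omega>. u \<in> tree \<omega> \<and> pos \<omega> u = x} \<inter> {\<omega>. sh (u @ [0]) \<omega> \<in> G})"
    using True by (auto simp: kids_def)
  also have "\<dots> \<in> sets (env D)"
    by (rule sets.countable_UN'[OF countableI_type])
      (intro image_subsetI sets.Int sets_env_sh[OF assms] sets_tree_pos[of _ "\<lambda>y. y = x"])
  finally show ?thesis .
next
  case False
  then show ?thesis by (simp add: kids_def)
qed

lemma sets_card_ge:
  assumes X: "finite X" "\<And>\<omega>. K \<omega> \<subseteq> X" and M: "\<And>x. {\<omega>. x \<in> K \<omega>} \<in> sets (env D)"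
  shows "{\<omega>. (b :: real) \<le> real (card (K \<omega>))} \<in> sets (env D)"
proof -
  have "{\<omega>. b \<le> real (card (K \<omega>))} = (\<Union>Z\<in>{Z \<in> Pow X. b \<le> real (card Z)}. {\<omega> \<in> space (env D). \<forall>x\<in>Z. x \<in> K \<omega>})"
  proof (intro equalityI subsetI)
    fix \<omega> assume "\<omega> \<in> {\<omega>. b \<le> real (card (K \<omega>))}"
    then show "\<omega> \<in> (\<Union>Z\<in>{Z \<in> Pow X. b \<le> real (card Z)}. {\<omega> \<in> space (env D). \<forall>x\<in>Z. x \<in> K \<omega>})"
      using X(2)[of \<omega>] by (intro UN_I[of "K \<omega>"]) auto
  next
    fix \<omega> assume "\<omega> \<in> (\<Union>Z\<in>{Z \<in> Pow X. b \<le> real (card Z)}. {\<omega> \<in> space (env D). \<forall>x\<in>Z. x \<in> K \<omega>})"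
    then obtain Z where Z: "b \<le> real (card Z)" "Z \<subseteq> K \<omega>" by auto
    have "card Z \<le> card (K \<omega>)"
      by (rule card_mono[OF finite_subset[OF X(2) X(1)] Z(2)])
    then show "\<omega> \<in> {\<omega>. b \<le> real (card (K \<omega>))}" using Z(1) by simp
  qed
  also have "\<dots> \<in> sets (env D)"
    using X(1) M by (intro sets.finite_UN sets.sets_Collect_finite_All) (auto dest: finite_subset)
  finally show ?thesis .
qed

lemma kids_subset: "kids n X G \<omega> \<subseteq> X"
  by (auto simp: kids_def)

lemma occ_eq_kids: "occ n X \<omega> = kids n X UNIV \<omega>"
  by (simp add: occ_def kids_def)

lemma occ_subset: "occ n X \<omega> \<subseteq> X"
  by (auto simp: occ_def)

lemma sets_card_kids:
  fixes D :: "(nat \<times> 'g::countable free_group) pmf"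
  assumes "finite X" "G \<in> sets (env D)"
  shows "{\<omega>. (b :: real) \<le> real (card (kids n X G \<omega>))} \<in> sets (env D)"
  by (rule sets_card_ge[OF assms(1) kids_subset sets_kids_mem[OF assms(2)]])

lemma sets_card_occ:
  fixes D :: "(nat \<times> 'g::countable free_group) pmf"
  assumes "finite X"
  shows "{\<omega>. (b :: real) \<le> real (card (occ n X \<omega>))} \<in> sets (env D)"
  unfolding occ_eq_kids using sets.top[of "env D"] by (intro sets_card_kids assms) simp

text \<open>One vertex is selected above each occupied site before the environment at depth \<open>n + 1\<close>
  and beyond is resampled; the selected subtrees are independent copies of the environment.\<close>

lemma measure_env_kids_ge:
  fixes D :: "(nat \<times> 'g::countable free_group) pmf"
  assumes X: "finite X"
    and A: "A \<in> sets (env D)" "\<And>\<omega> \<omega>'. \<omega> \<in> A \<Longrightarrow> (\<And>w. length w \<le> n \<Longrightarrow> \<omega> w = \<omega>' w) \<Longrightarrow> \<omega>' \<in> A"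
    and B: "\<And>\<omega>. \<omega> \<in> A \<Longrightarrow> B \<le> card (occ n X \<omega>)" "0 < B"
    and G: "G \<in> sets (env D)" "\<tau> \<le> measure (env D) G" "0 < \<tau>" and b: "b \<le> \<tau> * real B / 2"
  shows "measure (env D) A * (1 - 4 / (\<tau> * real B)) \<le> measure (env D) (A \<inter> {\<omega>. b \<le> real (card (kids n X G \<omega>))})"
proof -
  interpret E: prob_space "env D" by (rule prob_space_env)
  let ?C = "A \<inter> {\<omega>. b \<le> real (card (kids n X G \<omega>))}"
  define c where "c = 1 - 4 / (\<tau> * real B)"
  have C: "?C \<in> sets (env D)"
    using A sets_card_kids[OF X G(1)] by auto
  \<comment> \<open>The generations up to \<open>n\<close> are frozen here; the integral over them
    is taken afterwards.\<close>
  have sec: "ennreal c * indicator A \<omega> \<le> emeasure (env D) {\<omega>'. resample (Suc n) \<omega> \<omega>' \<in> ?C}" for \<omega>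
  proof (cases "\<omega> \<in> A")
    case True
    let ?R = "resample (Suc n) \<omega>"
    have agree: "\<omega> w = ?R \<omega>' w" if "length w \<le> n" for w \<omega>'
      using that by (simp add: resample_def)
    define pick where "pick x = (SOME u. u \<in> tree \<omega> \<and> length u = n \<and> pos \<omega> u = x)" for x
    have pick: "pick x \<in> tree \<omega>" "length (pick x) = n" "pos \<omega> (pick x) = x" if "x \<in> occ n X \<omega>" for x
    proof -
      have "\<exists>u. u \<in> tree \<omega> \<and> length u = n \<and> pos \<omega> u = x"
        using that by (auto simp: occ_def)
      then have "pick x \<in> tree \<omega> \<and> length (pick x) = n \<and> pos \<omega> (pick x) = x"
        unfolding pick_def by (rule someI_ex)
      then show "pick x \<in> tree \<omega>" "length (pick x) = n" "pos \<omega> (pick x) = x" by auto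
    qed
    let ?S = "(\<lambda>x. pick x @ [0]) ` occ n X \<omega>"
    have inj: "inj_on (\<lambda>x. pick x @ [0]) (occ n X \<omega>)"
    proof (rule inj_onI)
      fix x y assume xy: "x \<in> occ n X \<omega>" "y \<in> occ n X \<omega>" and "pick x @ [0] = pick y @ [0]"
      then have eq: "pick x = pick y" by simp
      have "x = pos \<omega> (pick x)" using pick(3)[OF xy(1)] by (rule sym)
      also have "\<dots> = y" unfolding eq by (rule pick(3)[OF xy(2)])
      finally show "x = y" .
    qed
    have fin: "finite (occ n X \<omega>)" by (rule finite_subset[OF occ_subset X])
    have "1 - 4 / (\<tau> * real B) \<le> measure (env D) {\<omega>'. b \<le> real (card {v \<in> ?S. sh v \<omega>' \<in> G})}"
    proof (rule measure_env_count_ge[where k = "Suc n"])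
      show "B \<le> card ?S" using B(1)[OF True] by (simp add: card_image[OF inj])
    qed (use pick fin G B b in auto)
    also have "\<dots> \<le> measure (env D) {\<omega>'. ?R \<omega>' \<in> ?C}"
    proof (rule E.finite_measure_mono)
      show "{\<omega>'. b \<le> real (card {v \<in> ?S. sh v \<omega>' \<in> G})} \<subseteq> {\<omega>'. ?R \<omega>' \<in> ?C}"
      proof safe
        fix \<omega>' assume b: "b \<le> real (card {v \<in> ?S. sh v \<omega>' \<in> G})"
        show "?R \<omega>' \<in> A" by (rule A(2)[OF True agree])
        have "{v \<in> ?S. sh v \<omega>' \<in> G} \<subseteq> (\<lambda>x. pick x @ [0]) ` kids n X G (?R \<omega>')"
        proof safe
          fix x assume x: "x \<in> occ n X \<omega>" and s: "sh (pick x @ [0]) \<omega>' \<in> G"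
          have "x \<in> kids n X G (?R \<omega>')"
            unfolding kids_def
          proof (intro CollectI conjI bexI[of _ "pick x"])
            show "x \<in> X" using x occ_subset by blast
            show "length (pick x) = n" by (rule pick(2)[OF x])
            show "pick x \<in> tree (?R \<omega>')"
              by (rule tree_cong[THEN iffD1, OF agree pick(1)[OF x]]) (simp add: pick(2)[OF x])
            show "pos (?R \<omega>') (pick x) = x"
              by (rule trans[OF pos_cong[OF agree, symmetric] pick(3)[OF x]]) (simp add: pick(2)[OF x])
            show "sh (pick x @ [0]) (?R \<omega>') \<in> G"
              using s pick(2)[OF x] by (subst sh_resample) auto
          qed
          then show "pick x @ [0] \<in> (\<lambda>x. pick x @ [0]) ` kids n X G (?R \<omega>')" by auto
        qed
        then have "card {v \<in> ?S. sh v \<omega>' \<in> G} \<le> card ((\<lambda>x. pick x @ [0]) ` kids n X G (?R \<omega>'))"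
          by (intro card_mono finite_imageI finite_subset[OF kids_subset X])
        also have "\<dots> \<le> card (kids n X G (?R \<omega>'))"
          by (intro card_image_le finite_subset[OF kids_subset X])
        finally show "b \<le> real (card (kids n X G (?R \<omega>')))" using b by simp
      qed
    qed (rule measurable_env_section[OF C])
    finally show ?thesis
      using True by (simp add: c_def E.emeasure_eq_measure ennreal_leI)
  qed simp
  have "ennreal c * emeasure (env D) A = (\<integral>\<^sup>+\<omega>. ennreal c * indicator A \<omega> \<partial>env D)"
    using A(1) by (simp add: nn_integral_cmult_indicator)
  also have "\<dots> \<le> (\<integral>\<^sup>+\<omega>. emeasure (env D) {\<omega>'. resample (Suc n) \<omega> \<omega>' \<in> ?C} \<partial>env D)"
    by (intro nn_integral_mono sec)
  also have "\<dots> = emeasure (env D) ?C"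
    by (rule emeasure_env_resample[OF C, symmetric])
  finally have le: "ennreal c * ennreal (measure (env D) A) \<le> ennreal (measure (env D) ?C)"
    by (simp add: E.emeasure_eq_measure)
  show ?thesis
  \<comment> \<open>For negative \<open>c\<close> the value \<open>ennreal c\<close> is 0 and the
    integrated inequality is empty, but then the claim has a nonpositive left side.\<close>
  proof (cases "0 \<le> c")
    case True
    then show ?thesis using le by (simp add: ennreal_mult[symmetric] c_def mult.commute)
  next
    case False
    then have "measure (env D) A * c \<le> 0" by (simp add: mult_nonneg_nonpos)
    also have "0 \<le> measure (env D) ?C" by simp
    finally show ?thesis by (simp add: c_def)
  qed
qed

subsection \<open>Occupied sites\<close>

text \<open>A Bonferroni bound for the probability that none of \<open>k\<close> independent events
  of probability \<open>g\<close> occurs; the crude factor \<open>k\<^sup>2\<close> leads directly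
  to the second moment of the offspring law.\<close>

lemma one_minus_power_le:
  assumes "0 \<le> g" "g \<le> (1 :: real)"
  shows "(1 - g) ^ k \<le> 1 - real k * g + (real k)\<^sup>2 * g\<^sup>2"
proof (induction k)
  case (Suc k)
  have "(1 - g) ^ Suc k \<le> (1 - g) * (1 - real k * g + (real k)\<^sup>2 * g\<^sup>2)"
    using Suc assms by (simp add: mult_left_mono)
  also have "\<dots> = 1 - real (Suc k) * g + ((real k)\<^sup>2 + real k) * g\<^sup>2 - (real k)\<^sup>2 * g ^ 3"
    by (simp add: algebra_simps power2_eq_square power3_eq_cube)
  also have "\<dots> \<le> 1 - real (Suc k) * g + ((real k)\<^sup>2 + real k) * g\<^sup>2"
    using assms by simp
  also have "\<dots> \<le> 1 - real (Suc k) * g + (real (Suc k))\<^sup>2 * g\<^sup>2"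
    by (intro add_left_mono mult_right_mono) (auto simp: power2_eq_square algebra_simps)
  finally show ?case .
qed simp

text \<open>Resampling from depth one on separates the root label from the subtrees of the children,
  and these are independent of each other.\<close>

lemma emeasure_env_root_in:
  assumes A: "\<And>k. k \<in> K \<Longrightarrow> A k \<in> sets (env D)" and K: "finite K"
  shows "emeasure (env D) {\<omega>. \<omega> [] \<in> R \<and> (\<forall>k\<in>K. sh [k] \<omega> \<in> A k)} = ennreal (measure (measure_pmf D) R * (\<Prod>k\<in>K. measure (env D) (A k)))"
    and "{\<omega>. \<omega> [] \<in> R \<and> (\<forall>k\<in>K. sh [k] \<omega> \<in> A k)} \<in> sets (env D)"
proof -
  interpret E: prob_space "env D" by (rule prob_space_env)
  let ?S = "{\<omega>. \<omega> [] \<in> R}" and ?T = "{\<omega>. \<forall>k\<in>K. sh [k] \<omega> \<in> A k}"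
  have S: "?S \<in> sets (env D)" using sets_env_cylinder[of "{[]}" "\<lambda>_. R"] by simp
  have T: "?T \<in> sets (env D)"
    using sets.sets_Collect_finite_All[OF _ K, of "env D" "\<lambda>k \<omega>. sh [k] \<omega> \<in> A k"] sets_env_sh[OF A] by simp
  have eq: "{\<omega>. \<omega> [] \<in> R \<and> (\<forall>k\<in>K. sh [k] \<omega> \<in> A k)} = ?S \<inter> ?T" by auto
  show *: "{\<omega>. \<omega> [] \<in> R \<and> (\<forall>k\<in>K. sh [k] \<omega> \<in> A k)} \<in> sets (env D)"
    unfolding eq using S T by (rule sets.Int)
  have mT: "measure (env D) ?T = (\<Prod>k\<in>K. measure (env D) (A k))"
  proof -
    have "measure (env D) {\<omega>. \<forall>v\<in>(\<lambda>k. [k]) ` K. sh v \<omega> \<in> A (hd v)} = (\<Prod>v\<in>(\<lambda>k. [k]) ` K. measure (env D) (A (hd v)))"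
      using K A by (intro indep_events_sh[of _ 1]) auto
    then show ?thesis by (simp add: prod.reindex inj_on_def)
  qed
  have mS: "emeasure (env D) ?S = ennreal (measure (measure_pmf D) R)"
    using emeasure_env_cylinder'[of "{[]}" D "\<lambda>_. R"] by (simp add: measure_pmf.emeasure_eq_measure)
  have "emeasure (env D) (?S \<inter> ?T) = (\<integral>\<^sup>+\<omega>. emeasure (env D) {\<omega>'. resample 1 \<omega> \<omega>' \<in> ?S \<inter> ?T} \<partial>env D)"
    using S T by (intro emeasure_env_resample sets.Int)
  also have "\<dots> = (\<integral>\<^sup>+\<omega>. emeasure (env D) ?T * indicator ?S \<omega> \<partial>env D)"
  proof (rule nn_integral_cong)
    fix \<omega> :: "nat list \<Rightarrow> 'a"
    have "{\<omega>'. resample 1 \<omega> \<omega>' \<in> ?S \<inter> ?T} = (if \<omega> \<in> ?S then ?T else {})"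
      by (auto simp: sh_resample) (auto simp: resample_def)
    then show "emeasure (env D) {\<omega>'. resample 1 \<omega> \<omega>' \<in> ?S \<inter> ?T} = emeasure (env D) ?T * indicator ?S \<omega>"
      by (simp add: indicator_def)
  qed
  also have "\<dots> = emeasure (env D) ?T * emeasure (env D) ?S"
    using S by (rule nn_integral_cmult_indicator)
  finally show "emeasure (env D) {\<omega>. \<omega> [] \<in> R \<and> (\<forall>k\<in>K. sh [k] \<omega> \<in> A k)} = ennreal (measure (measure_pmf D) R * (\<Prod>k\<in>K. measure (env D) (A k)))"
    unfolding eq mS E.emeasure_eq_measure[of ?T] mT
    by (simp add: ennreal_mult[symmetric] prod_nonneg mult.commute)
qed

lemma emeasure_env_root:
  assumes "\<And>k. k \<in> K \<Longrightarrow> A k \<in> sets (env D)" "finite K"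
  shows "emeasure (env D) {\<omega>. \<omega> [] = b \<and> (\<forall>k\<in>K. sh [k] \<omega> \<in> A k)} = ennreal (pmf D b * (\<Prod>k\<in>K. measure (env D) (A k)))"
    and "{\<omega>. \<omega> [] = b \<and> (\<forall>k\<in>K. sh [k] \<omega> \<in> A k)} \<in> sets (env D)"
  using emeasure_env_root_in[where R = "{b}", OF assms] by (simp_all add: measure_pmf_single)

locale branching = rate_walk \<mu> r L for \<mu> :: "'g::finite free_group pmf" and r L +
  fixes p :: "nat pmf"
  assumes p0: "pmf p 0 = 0"
    and exp_moment: "\<exists>s>0. summable (\<lambda>k. exp (s * real k) * pmf p k)"
    and mean: "(\<lambda>k. real k * pmf p k) sums r"
begin

abbreviation D :: "(nat \<times> 'g free_group) pmf" where "D \<equiv> pair_pmf p \<mu>"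
abbreviation \<E> :: "'g environment measure" where "\<E> \<equiv> env D"

sublocale Env: prob_space \<E> by (rule prob_space_env)

lemma summable_p2: "summable (\<lambda>k. (real k)\<^sup>2 * pmf p k)"
proof -
  obtain s where s: "s > 0" "summable (\<lambda>k. exp (s * real k) * pmf p k)"
    using exp_moment by blast
  have "eventually (\<lambda>k::nat. (real k)\<^sup>2 \<le> exp (s * real k)) sequentially"
    using s(1) by real_asymp
  then have "eventually (\<lambda>k. norm ((real k)\<^sup>2 * pmf p k) \<le> exp (s * real k) * pmf p k) sequentially"
    by eventually_elim (auto intro: mult_right_mono)
  then show ?thesis
    using s(2) by (rule summable_comparison_test_ev)
qed

definition p2 :: real where "p2 = (\<Sum>k. (real k)\<^sup>2 * pmf p k)"

lemma p2_nonneg: "0 \<le> p2"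
  unfolding p2_def by (intro suminf_nonneg summable_p2) auto

lemma p_sums: "pmf p sums 1"
proof -
  have "(\<integral>\<^sup>+k. ennreal (pmf p k) \<partial>count_space UNIV) = 1"
    by (simp add: nn_integral_pmf)
  then have "(\<Sum>k. ennreal (pmf p k)) = ennreal 1"
    by (simp add: nn_integral_count_space_nat)
  then have "(\<lambda>k. ennreal (pmf p k)) sums ennreal 1"
    using summable_sums[OF summableI, of "\<lambda>k. ennreal (pmf p k)"] by simp
  then show ?thesis
    by (subst (asm) sums_ennreal) auto
qed

lemma offspring_lower:
  assumes "0 \<le> g" "g \<le> 1"
  shows "ennreal (r * g - p2 * g\<^sup>2) \<le> (\<Sum>k. ennreal (pmf p k * (1 - (1 - g) ^ k)))"
proof -
  have le1: "(1 - g) ^ k \<le> 1" for k using assms by (simp add: power_le_one)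
  have 1: "(\<lambda>k. (real k * pmf p k) * g - (real k)\<^sup>2 * pmf p k * g\<^sup>2) sums (r * g - p2 * g\<^sup>2)"
    using sums_mult2[OF mean, of g] sums_mult2[OF summable_sums[OF summable_p2], of "g\<^sup>2"]
    unfolding p2_def by (rule sums_diff)
  have s2: "summable (\<lambda>k. pmf p k * (1 - (1 - g) ^ k))"
  proof (rule summable_comparison_test'[of "pmf p" 0])
    fix k :: nat
    have "pmf p k * (1 - (1 - g) ^ k) \<le> pmf p k * 1"
      using assms by (intro mult_left_mono) auto
    then show "norm (pmf p k * (1 - (1 - g) ^ k)) \<le> pmf p k"
      using le1[of k] by simp
  qed (use p_sums in \<open>simp add: sums_iff\<close>)
  have "r * g - p2 * g\<^sup>2 \<le> (\<Sum>k. pmf p k * (1 - (1 - g) ^ k))"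
  proof -
    have "(\<Sum>k. (real k * pmf p k) * g - (real k)\<^sup>2 * pmf p k * g\<^sup>2) \<le> (\<Sum>k. pmf p k * (1 - (1 - g) ^ k))"
    proof (rule suminf_le[OF _ sums_summable[OF 1] s2])
      fix k
      have "pmf p k * (real k * g - (real k)\<^sup>2 * g\<^sup>2) \<le> pmf p k * (1 - (1 - g) ^ k)"
        using one_minus_power_le[OF assms, of k] by (intro mult_left_mono) auto
      then show "(real k * pmf p k) * g - (real k)\<^sup>2 * pmf p k * g\<^sup>2 \<le> pmf p k * (1 - (1 - g) ^ k)"
        by (simp add: algebra_simps)
    qed
    then show ?thesis using 1 by (simp add: sums_iff)
  qed
  also have "ennreal (\<Sum>k. pmf p k * (1 - (1 - g) ^ k)) = (\<Sum>k. ennreal (pmf p k * (1 - (1 - g) ^ k)))"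
    using s2 le1 by (intro suminf_ennreal2[symmetric]) auto
  finally show ?thesis by (simp add: ennreal_leI)
qed

lemma emeasure_root_all:
  assumes "H \<in> sets \<E>"
  shows "emeasure \<E> {\<omega>. \<omega> [] = (k, y) \<and> (\<forall>i<k. sh [i] \<omega> \<in> H)} = ennreal (pmf p k * pmf \<mu> y * measure \<E> H ^ k)"
    and "{\<omega>. \<omega> [] = (k, y) \<and> (\<forall>i<k. sh [i] \<omega> \<in> H)} \<in> sets \<E>"
  using emeasure_env_root[of "{..<k}" "\<lambda>_. H" D "(k, y)"] assms by (simp_all add: pmf_pair Ball_def)

lemma sets_snd_root: "{\<omega>. snd (\<omega> []) = y} \<in> sets \<E>"
  by (rule sets_env_finite[of "{[]}"]) auto

text \<open>For each offspring number \<open>k\<close> the complement, failure of all the first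
  \<open>k\<close> subtrees, is a product event; the sum over \<open>k\<close> then averages with
  the offspring law.\<close>

lemma measure_root_Ex:
  assumes H: "H \<in> sets \<E>"
  shows "ennreal (pmf \<mu> y) * (\<Sum>k. ennreal (pmf p k * (1 - (1 - measure \<E> H) ^ k)))
    = emeasure \<E> {\<omega>. snd (\<omega> []) = y \<and> (\<exists>i<fst (\<omega> []). sh [i] \<omega> \<in> H)}"
proof -
  have mA: "measure \<E> (- H) = 1 - measure \<E> H" "- H \<in> sets \<E>"
    using Env.prob_compl[OF H] sets.compl_sets[OF H] by (auto simp: Compl_eq_Diff_UNIV)
  let ?B = "\<lambda>k. {\<omega>. \<omega> [] = (k, y) \<and> (\<forall>i<k. sh [i] \<omega> \<in> - H)}"
  let ?C = "\<lambda>k. {\<omega>. \<omega> [] = (k, y)}"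
  have C: "?C k \<in> sets \<E>" "emeasure \<E> (?C k) = ennreal (pmf p k * pmf \<mu> y)" for k
    using emeasure_env_root[of "{}" "\<lambda>_. H" D "(k, y)"] by (simp_all add: pmf_pair)
  note B = emeasure_root_all[OF mA(2), of _ y]
  have le: "0 \<le> 1 - (1 - measure \<E> H) ^ k" for k
    by (simp add: power_le_one)
  have "emeasure \<E> (?C k - ?B k) = ennreal (pmf \<mu> y) * ennreal (pmf p k * (1 - (1 - measure \<E> H) ^ k))" for k
  proof -
    have "emeasure \<E> (?C k - ?B k) = emeasure \<E> (?C k) - emeasure \<E> (?B k)"
      using B(2) by (intro emeasure_Diff C) auto
    also have "\<dots> = ennreal (pmf p k * pmf \<mu> y - pmf p k * pmf \<mu> y * (1 - measure \<E> H) ^ k)"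
      unfolding B(1) C(2) mA(1) by (rule ennreal_minus) simp
    also have "pmf p k * pmf \<mu> y - pmf p k * pmf \<mu> y * (1 - measure \<E> H) ^ k
        = pmf \<mu> y * (pmf p k * (1 - (1 - measure \<E> H) ^ k))"
      by (simp add: algebra_simps)
    finally show ?thesis using le[of k] by (simp add: ennreal_mult mult_nonneg_nonneg)
  qed
  then have "ennreal (pmf \<mu> y) * (\<Sum>k. ennreal (pmf p k * (1 - (1 - measure \<E> H) ^ k))) = (\<Sum>k. emeasure \<E> (?C k - ?B k))"
    by simp
  also have "\<dots> = emeasure \<E> (\<Union>k. ?C k - ?B k)"
    using B(2) C(1) by (intro suminf_emeasure) (auto simp: disjoint_family_on_def)
  also have "(\<Union>k. ?C k - ?B k) = {\<omega>. snd (\<omega> []) = y \<and> (\<exists>i<fst (\<omega> []). sh [i] \<omega> \<in> H)}"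
  proof (intro equalityI subsetI)
    fix \<omega> assume "\<omega> \<in> {\<omega>. snd (\<omega> []) = y \<and> (\<exists>i<fst (\<omega> []). sh [i] \<omega> \<in> H)}"
    then show "\<omega> \<in> (\<Union>k. ?C k - ?B k)"
      by (intro UN_I[of "fst (\<omega> [])"]) (auto simp: prod_eq_iff)
  qed auto
  finally show ?thesis .
qed

definition occ_event :: "nat \<Rightarrow> 'g free_group \<Rightarrow> 'g environment set" where
  "occ_event n x = {\<omega>. \<exists>u\<in>tree \<omega>. length u = n \<and> pos \<omega> u = x}"

lemma sets_occ_event: "occ_event n x \<in> sets \<E>"
proof -
  have "occ_event n x = (\<Union>u\<in>{u. length u = n}. {\<omega>. u \<in> tree \<omega> \<and> pos \<omega> u = x})"
    by (auto simp: occ_event_def)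
  also have "\<dots> \<in> sets \<E>"
    by (rule sets.countable_UN'[OF countableI_type]) (intro image_subsetI sets_tree_pos[of _ "\<lambda>y. y = x"])
  finally show ?thesis .
qed

text \<open>\<open>Kc\<close> is the second offspring moment times the bound on the mean number of
  particles at a site. The relations \<open>Dn (Suc n) = Dn n + 2 * Kc\<close> and
  \<open>2 * Kc <= Dn n\<close> are just what yields
  \<open>1 / Dn (Suc n) <= 1 / Dn n * (1 - Kc / Dn n)\<close>.\<close>

definition Kc :: real where "Kc = p2 * Gc"
definition Dn :: "nat \<Rightarrow> real" where "Dn n = 1 + 2 * Kc + 2 * Kc * real n"

lemma Kc_nonneg: "0 \<le> Kc"
  using p2_nonneg Gc_ge_1 by (simp add: Kc_def)

lemma Dn_ge: "1 \<le> Dn n" "2 * Kc \<le> Dn n"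
  using Kc_nonneg by (simp_all add: Dn_def add.assoc)

text \<open>The truncated second moment method, carried out one generation at a time: the mean number of
  particles at a site never exceeds the Green function, so the loss in \<open>1 / Dn n\<close> stays linear in \<open>n\<close>.\<close>

lemma occupancy_lower:
  "pmf \<mu> y * (r ^ n * P n x / Dn n) \<le> measure \<E> ({\<omega>. snd (\<omega> []) = y} \<inter> occ_event n x)"
proof (induction n arbitrary: x y)
  case 0
  show ?case
  proof (cases "x = 1")
    case True
    have "measure \<E> {\<omega>. snd (\<omega> []) = y} = pmf \<mu> y"
    proof -
      have "emeasure \<E> {\<omega>. snd (\<omega> []) = y} = emeasure (measure_pmf D) {b. snd b = y}"
        using emeasure_env_cylinder'[of "{[]}" D "\<lambda>_. {b. snd b = y}"] by simp
      also have "\<dots> = emeasure (measure_pmf (map_pmf snd D)) {y}"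
        by (simp add: vimage_def)
      also have "\<dots> = ennreal (pmf \<mu> y)"
        by (simp add: map_snd_pair_pmf emeasure_pmf_single)
      finally show ?thesis by (simp add: measure_def)
    qed
    moreover have "{\<omega>. snd (\<omega> []) = y} \<inter> occ_event 0 x = {\<omega>. snd (\<omega> []) = y}"
      using True by (auto simp: occ_event_def)
    moreover have "pmf \<mu> y * (1 / Dn 0) \<le> pmf \<mu> y"
      using Dn_ge[of 0] by (intro mult_left_le) auto
    ultimately show ?thesis using True by (simp add: P_0)
  qed (simp add: P_0)
next
  case (Suc n)
  \<comment> \<open>The event that a child of the root, through its own increment \<open>z\<close>
    and \<open>n\<close> further generations, leads to \<open>x\<close>. The increment at the root
    is part of the induction statement precisely in order to handle this first step.\<close>
  define H where "H = (\<Union>z\<in>S. {\<omega>. snd (\<omega> []) = z} \<inter> occ_event n (inverse z * x))"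
  have H: "H \<in> sets \<E>"
    unfolding H_def using sets_snd_root sets_occ_event by (intro sets.finite_UN sets.Int) auto
  \<comment> \<open>\<open>e\<close> is the mean number of particles at \<open>x\<close>, and
    \<open>g\<close> is the lower bound for the probability of \<open>H\<close> that the induction
    hypothesis provides.\<close>
  define e where "e = r ^ Suc n * P (Suc n) x"
  define g where "g = e / (r * Dn n)"
  have e: "0 \<le> e" "e \<le> Gc"
    using P_le_Gc[of "Suc n" x] r_gt_1 by (simp_all add: e_def del: power_Suc)
  have D1: "1 \<le> Dn n" and D2: "2 * Kc \<le> Dn n" by (rule Dn_ge)+
  have g0: "0 \<le> g" using e r_gt_1 D1 by (simp add: g_def)
  have gA: "g \<le> measure \<E> H"
  proof -
    have "g = r ^ n * P (Suc n) x / Dn n"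
      using r_gt_1 D1 by (simp add: g_def e_def)
    also have "\<dots> = (\<Sum>z\<in>S. pmf \<mu> z * (r ^ n * P n (inverse z * x) / Dn n))"
      unfolding P_Suc sum_distrib_left sum_divide_distrib by (intro sum.cong refl) (simp add: mult_ac)
    also have "\<dots> \<le> (\<Sum>z\<in>S. measure \<E> ({\<omega>. snd (\<omega> []) = z} \<inter> occ_event n (inverse z * x)))"
      by (intro sum_mono Suc)
    also have "\<dots> = measure \<E> H"
      unfolding H_def
      by (rule Env.finite_measure_finite_Union[symmetric])
        (auto simp: disjoint_family_on_def sets_snd_root sets_occ_event intro!: sets.Int)
    finally show ?thesis .
  qed
  have g1: "g \<le> 1"
    using gA Env.prob_le_1[of H] by linarith
  have 1: "pmf \<mu> y * (e / Dn (Suc n)) \<le> pmf \<mu> y * (r * g - p2 * g\<^sup>2)"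
  proof (rule mult_left_mono)
    have rg: "r * g = e / Dn n" using r_gt_1 D1 by (simp add: g_def)
    have "p2 * g\<^sup>2 \<le> p2 * (e / Dn n)\<^sup>2"
    proof (intro mult_left_mono power_mono g0 p2_nonneg)
      have "1 * g \<le> r * g" using g0 r_gt_1 by (intro mult_right_mono) auto
      then show "g \<le> e / Dn n" using rg by simp
    qed
    also have "\<dots> = (e / Dn n) * (p2 * e / Dn n)" by (simp add: power2_eq_square)
    also have "\<dots> \<le> (e / Dn n) * (Kc / Dn n)"
      using e D1 p2_nonneg by (intro mult_left_mono divide_right_mono) (auto simp: Kc_def intro: mult_left_mono)
    finally have "e / Dn n * (1 - Kc / Dn n) \<le> r * g - p2 * g\<^sup>2"
      unfolding rg by (simp add: algebra_simps)
    moreover have "e / Dn (Suc n) \<le> e / Dn n * (1 - Kc / Dn n)"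
    proof -
      have "Dn (Suc n) = Dn n + 2 * Kc" by (simp add: Dn_def algebra_simps)
      moreover have "1 / (Dn n + 2 * Kc) \<le> 1 / Dn n * (1 - Kc / Dn n)"
      proof -
        have "Dn n * Dn n \<le> (Dn n + 2 * Kc) * (Dn n - Kc)"
        proof -
          have "Kc * (2 * Kc) \<le> Kc * Dn n" using Kc_nonneg D2 by (rule mult_left_mono[rotated])
          then show ?thesis by (simp add: algebra_simps)
        qed
        then show ?thesis using D1 Kc_nonneg by (simp add: field_simps)
      qed
      ultimately show ?thesis
        using e mult_left_mono[of "1 / (Dn n + 2 * Kc)" "1 / Dn n * (1 - Kc / Dn n)" e] by simp
    qed
    ultimately show "e / Dn (Suc n) \<le> r * g - p2 * g\<^sup>2" by linarith
  qed simp
  have 2: "ennreal (pmf \<mu> y * (r * g - p2 * g\<^sup>2)) \<le> ennreal (measure \<E> ({\<omega>. snd (\<omega> []) = y} \<inter> occ_event (Suc n) x))"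
  proof -
    have "ennreal (pmf \<mu> y * (r * g - p2 * g\<^sup>2)) = ennreal (pmf \<mu> y) * ennreal (r * g - p2 * g\<^sup>2)"
      by (simp add: ennreal_mult')
    also have "\<dots> \<le> ennreal (pmf \<mu> y) * (\<Sum>k. ennreal (pmf p k * (1 - (1 - g) ^ k)))"
      using g0 g1 by (intro mult_left_mono offspring_lower) auto
    also have "\<dots> \<le> ennreal (pmf \<mu> y) * (\<Sum>k. ennreal (pmf p k * (1 - (1 - measure \<E> H) ^ k)))"
      using g0 g1 gA
      by (intro mult_left_mono suminf_le ennreal_leI diff_left_mono power_mono) auto
    also have "\<dots> = emeasure \<E> {\<omega>. snd (\<omega> []) = y \<and> (\<exists>i<fst (\<omega> []). sh [i] \<omega> \<in> H)}"
      by (rule measure_root_Ex[OF H])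
    also have "\<dots> \<le> emeasure \<E> ({\<omega>. snd (\<omega> []) = y} \<inter> occ_event (Suc n) x)"
    proof (rule emeasure_mono)
      show "{\<omega>. snd (\<omega> []) = y \<and> (\<exists>i<fst (\<omega> []). sh [i] \<omega> \<in> H)} \<subseteq> {\<omega>. snd (\<omega> []) = y} \<inter> occ_event (Suc n) x"
      proof safe
        fix \<omega> i assume i: "i < fst (\<omega> [])" "sh [i] \<omega> \<in> H"
        then obtain u where u: "u \<in> tree (sh [i] \<omega>)" "length u = n" "pos (sh [i] \<omega>) u = inverse (snd (\<omega> [i])) * x"
          by (auto simp: H_def occ_event_def)
        have "[i] @ u \<in> tree \<omega>" using i u by (simp only: tree_append singleton_in_tree simp_thms)
        moreover have "pos \<omega> ([i] @ u) = x" using u by (simp only: pos_append pos_singleton inverse_mult_cancel)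
        ultimately show "\<omega> \<in> occ_event (Suc n) x" using u(2) unfolding occ_event_def by force
      qed
    qed (intro sets.Int sets_snd_root sets_occ_event)
    finally show ?thesis by (simp add: Env.emeasure_eq_measure)
  qed
  then have "pmf \<mu> y * (r * g - p2 * g\<^sup>2) \<le> measure \<E> ({\<omega>. snd (\<omega> []) = y} \<inter> occ_event (Suc n) x)"
    by (subst (asm) ennreal_le_iff) auto
  with 1 show ?case unfolding e_def by (rule order_trans)
qed

end

subsection \<open>Blocks of bounded multiplication\<close>

lemma occ_cong:
  assumes "\<And>w. length w \<le> n \<Longrightarrow> \<omega> w = \<omega>' w"
  shows "occ n X \<omega> = occ n X \<omega>'"
proof -
  have "u \<in> tree \<omega> \<longleftrightarrow> u \<in> tree \<omega>'" "pos \<omega> u = pos \<omega>' u" if "length u = n" for u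
    using assms that by (auto intro!: tree_cong pos_cong cong: tree_cong)
  then show ?thesis unfolding occ_def by auto
qed

context branching
begin

abbreviation la :: "'g free_group" where "la \<equiv> of_letter l0"

text \<open>The increment at the root is the step that leads into it. Requiring the letter
  \<open>a\<close> here means that an environment grafted below a vertex is entered by this
  letter.\<close>

definition root_a :: "'g environment set" where "root_a = {\<omega>. snd (\<omega> []) = la}"

definition Qev :: "nat \<Rightarrow> nat \<Rightarrow> nat \<Rightarrow> 'g environment set" where
  "Qev n m B = root_a \<inter> {\<omega>. real B \<le> real (card (occ n (good_words m) \<omega>))}"

lemma sets_root_a: "root_a \<in> sets \<E>"
  unfolding root_a_def by (rule sets_snd_root)

lemma sets_Qev: "Qev n m B \<in> sets \<E>"
  unfolding Qev_def by (intro sets.Int sets_root_a sets_card_occ finite_good_words)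

lemma Qev_mono: "B \<le> B' \<Longrightarrow> Qev n m B' \<subseteq> Qev n m B"
  by (auto simp: Qev_def)

lemma Qev_cong:
  assumes "\<omega> \<in> Qev n m B" "\<And>w. length w \<le> n \<Longrightarrow> \<omega> w = \<omega>' w"
  shows "\<omega>' \<in> Qev n m B"
  using assms(1) occ_cong[of n \<omega> \<omega>' "good_words m"] assms(2) by (auto simp: Qev_def root_a_def)

lemma occ_mem_iff: "x \<in> occ n X \<omega> \<longleftrightarrow> x \<in> X \<and> \<omega> \<in> occ_event n x"
  by (auto simp: occ_def occ_event_def)

text \<open>The mean number of occupied good words, on the event \<open>root_a\<close>, is summed by
  layers on the right and by sites on the left, where \<open>occupancy_lower\<close>
  applies.\<close>

lemma sum_Qev:
  "pmf \<mu> la * (r ^ n * A n m / Dn n) \<le> (\<Sum>t\<in>{1..card (good_words m :: 'g free_group set)}. measure \<E> (Qev n m t))"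
proof -
  let ?X = "good_words m :: 'g free_group set"
  have pw: "(\<Sum>t\<in>{1..card ?X}. indicator (Qev n m t) \<omega>) = (\<Sum>x\<in>?X. indicator (root_a \<inter> occ_event n x) \<omega> :: real)" for \<omega>
  proof (cases "\<omega> \<in> root_a")
    case True
    have "(\<Sum>t\<in>{1..card ?X}. indicator (Qev n m t) \<omega>) = (\<Sum>t\<in>{1..card ?X}. if t \<le> card (occ n ?X \<omega>) then 1 else (0::real))"
      using True by (intro sum.cong refl) (auto simp: Qev_def indicator_def)
    also have "\<dots> = real (card {t \<in> {1..card ?X}. t \<le> card (occ n ?X \<omega>)})"
      by (simp add: sum.If_cases Int_def)
    also have "{t \<in> {1..card ?X}. t \<le> card (occ n ?X \<omega>)} = {1..card (occ n ?X \<omega>)}"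
      using card_mono[OF finite_good_words occ_subset[of n ?X \<omega>]] by auto
    also have "real (card {1..card (occ n ?X \<omega>)}) = (\<Sum>x\<in>?X. if x \<in> occ n ?X \<omega> then 1 else 0)"
      using occ_subset[of n ?X \<omega>] by (simp add: sum.If_cases Int_absorb1 Int_absorb2)
    also have "\<dots> = (\<Sum>x\<in>?X. indicator (root_a \<inter> occ_event n x) \<omega>)"
      using True by (intro sum.cong refl) (auto simp: occ_mem_iff indicator_def)
    finally show ?thesis .
  next
    case False
    then show ?thesis by (auto simp: Qev_def intro!: trans[OF sum.neutral sum.neutral[symmetric]])
  qed
  have "pmf \<mu> la * (r ^ n * A n m / Dn n) = (\<Sum>x\<in>?X. pmf \<mu> la * (r ^ n * P n x / Dn n))"
    by (simp add: A_def sum_distrib_left sum_divide_distrib)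
  also have "\<dots> \<le> (\<Sum>x\<in>?X. measure \<E> (root_a \<inter> occ_event n x))"
    unfolding root_a_def by (intro sum_mono occupancy_lower)
  also have "\<dots> = (\<Sum>x\<in>?X. Env.expectation (indicator (root_a \<inter> occ_event n x)))"
    using sets_root_a sets_occ_event by (intro sum.cong refl) (simp add: sets.Int)
  also have "\<dots> = Env.expectation (\<lambda>\<omega>. \<Sum>x\<in>?X. indicator (root_a \<inter> occ_event n x) \<omega>)"
    using sets_root_a sets_occ_event
    by (intro Bochner_Integration.integral_sum[symmetric]) (simp add: sets.Int Env.emeasure_eq_measure integrable_real_indicator)
  also have "\<dots> = Env.expectation (\<lambda>\<omega>. \<Sum>t\<in>{1..card ?X}. indicator (Qev n m t) \<omega>)"
    by (simp only: pw)
  also have "\<dots> = (\<Sum>t\<in>{1..card ?X}. Env.expectation (indicator (Qev n m t)))"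
    using sets_Qev
    by (intro Bochner_Integration.integral_sum) (simp add: Env.emeasure_eq_measure integrable_real_indicator)
  also have "\<dots> = (\<Sum>t\<in>{1..card ?X}. measure \<E> (Qev n m t))"
    using sets_Qev by (intro sum.cong refl) simp
  finally show ?thesis .
qed

definition g2 :: real where "g2 = ln (2 * real CARD('g))"

lemma g2_pos: "0 < g2"
  using rank by (simp add: g2_def)

text \<open>If every layer \<open>B\<close> had probability below \<open>s / (h * B)\<close>, the
  layers would add up to less than \<open>s / h\<close> times a harmonic number, hence to less than
  their known total \<open>s\<close>. The harmonic number is logarithmic in the number of good words
  and so linear in \<open>m\<close>; at the level found, \<open>B\<close> times its probability
  equals the mean up to a polynomial factor.\<close>

lemma exists_typical_level:
  assumes "A n m > 0"
  shows "\<exists>B\<ge>1. pmf \<mu> la * (r ^ n * A n m / Dn n) / (1 + real m * g2) \<le> real B * measure \<E> (Qev n m B)"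
proof (rule ccontr)
  let ?M = "card (good_words m :: 'g free_group set)"
  define s where "s = pmf \<mu> la * (r ^ n * A n m / Dn n)"
  have s: "0 < s"
    using assms mu_letter_pos[of l0] Dn_ge(1)[of n] r_gt_1 by (simp add: s_def)
  define h where "h = 1 + real m * g2"
  have h: "0 < h" using g2_pos by (simp add: h_def add_pos_nonneg)
  assume neg: "\<not> ?thesis"
  have lt: "real B * measure \<E> (Qev n m B) < s / h" if "B \<ge> 1" for B
    unfolding s_def h_def using neg that by (meson not_le)
  have M: "0 < ?M"
  proof (rule ccontr)
    assume "\<not> 0 < ?M"
    then have "s \<le> 0" using sum_Qev[of n m] by (simp add: s_def)
    then show False using s by simp
  qed
  have harm: "harm ?M \<le> h"
  proof -
    have "harm ?M \<le> ln (real ?M) + 1"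
      using euler_mascheroni_sequence_decreasing[of 1 ?M] M by (simp add: harm_expand)
    also have "ln (real ?M) \<le> real m * g2"
    proof -
      have "?M \<le> card {x :: 'g free_group. word_length x = m}"
        by (rule card_mono) (auto simp: good_words_def)
      also have "\<dots> \<le> (2 * CARD('g)) ^ m" by (rule card_word_length_le)
      finally have "real ?M \<le> (2 * real CARD('g)) ^ m"
        by (metis of_nat_le_iff of_nat_mult of_nat_numeral of_nat_power)
      then have "ln (real ?M) \<le> ln ((2 * real CARD('g)) ^ m)"
        using M by (subst ln_le_cancel_iff) auto
      also have "\<dots> = real m * g2"
        unfolding g2_def by (rule ln_realpow)
      finally show ?thesis .
    qed
    finally show ?thesis by (simp add: h_def)
  qed
  have "s \<le> (\<Sum>t\<in>{1..?M}. measure \<E> (Qev n m t))"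
    using sum_Qev by (simp add: s_def)
  also have "\<dots> < (\<Sum>t\<in>{1..?M}. s / h * inverse (real t))"
  proof (rule sum_strict_mono)
    fix t assume "t \<in> {1..?M}"
    then have "real t * measure \<E> (Qev n m t) < s / h" "0 < real t" using lt by auto
    then have "measure \<E> (Qev n m t) < s / h / real t" by (simp only: pos_less_divide_eq mult.commute)
    then show "measure \<E> (Qev n m t) < s / h * inverse (real t)" by (simp only: divide_inverse)
  qed (use M in auto)
  also have "\<dots> = s / h * harm ?M"
    by (simp add: harm_def sum_distrib_left)
  also have "\<dots> \<le> s / h * h"
    using s h harm by (intro mult_left_mono) auto
  also have "\<dots> = s" using h by simp
  finally show False by simp
qed

lemma AE_offspring_pos: "AE \<omega> in \<E>. \<forall>u. 1 \<le> fst (\<omega> u)"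
proof (subst AE_all_countable, rule allI)
  fix u :: "nat list"
  have "emeasure \<E> {\<omega>. fst (\<omega> u) = 0} = emeasure (measure_pmf D) {b. fst b = 0}"
    using emeasure_env_cylinder'[of "{u}" D "\<lambda>_. {b. fst b = 0}"] by simp
  also have "\<dots> = emeasure (measure_pmf (map_pmf fst D)) {0}"
    by (simp add: vimage_def)
  also have "\<dots> = 0"
    by (simp add: map_fst_pair_pmf emeasure_pmf_single p0)
  finally have "emeasure \<E> {\<omega>. fst (\<omega> u) = 0} = 0" .
  moreover have "{\<omega>. fst (\<omega> u) = 0} \<in> sets \<E>"
    by (rule sets_env_finite[of "{u}"]) auto
  ultimately show "AE \<omega> in \<E>. 1 \<le> fst (\<omega> u)"
    by (intro AE_I[of _ _ "{\<omega>. fst (\<omega> u) = 0}"]) auto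
qed

lemma good_words_mult_a:
  "x \<in> good_words m \<Longrightarrow> x' \<in> good_words m' \<Longrightarrow> x * (la * x') \<in> good_words (m + 1 + m')"
  using good_words_mult[OF _ good_words_mult[OF good_words_l0], of x m x' m'] by (simp add: add.assoc)

text \<open>Sites of the continuation are glued to sites of the beginning by the letter
  \<open>a\<close>. Good words determine the factors of such a product, so the numbers of sites
  multiply.\<close>

lemma card_occ_kids:
  assumes N: "\<forall>u. 1 \<le> fst (\<omega> u)" and H: "H \<subseteq> Qev n' m' B'"
  shows "card (kids n (good_words m) H \<omega>) * B' \<le> card (occ (n + 1 + n') (good_words (m + 1 + m')) \<omega>)"
proof -
  let ?K = "kids n (good_words m) H \<omega>"
  define pick where "pick x = (SOME u. u \<in> tree \<omega> \<and> length u = n \<and> pos \<omega> u = x \<and> sh (u @ [0]) \<omega> \<in> H)" for x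
  have pick: "pick x \<in> tree \<omega> \<and> length (pick x) = n \<and> pos \<omega> (pick x) = x \<and> sh (pick x @ [0]) \<omega> \<in> H" if "x \<in> ?K" for x
  proof -
    have "\<exists>u. u \<in> tree \<omega> \<and> length u = n \<and> pos \<omega> u = x \<and> sh (u @ [0]) \<omega> \<in> H"
      using that by (auto simp: kids_def)
    then show ?thesis unfolding pick_def by (rule someI_ex)
  qed
  let ?O = "\<lambda>x. occ n' (good_words m') (sh (pick x @ [0]) \<omega>)"
  let ?T = "occ (n + 1 + n') (good_words (m + 1 + m')) \<omega>"
  have fin: "finite ?K" "finite (?O x)" "finite ?T" for x
    by (rule finite_subset[OF kids_subset finite_good_words] finite_subset[OF occ_subset finite_good_words])+
  have "card ?K * B' \<le> (\<Sum>x\<in>?K. card (?O x))"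
  proof -
    have "card ?K * B' = (\<Sum>x\<in>?K. B')" by simp
    also have "\<dots> \<le> (\<Sum>x\<in>?K. card (?O x))"
      using pick H by (intro sum_mono) (force simp: Qev_def)
    finally show ?thesis .
  qed
  also have "\<dots> = card (Sigma ?K ?O)"
    using fin by (simp add: card_SigmaI)
  also have "\<dots> \<le> card ?T"
  proof (rule card_inj_on_le)
    show "inj_on (\<lambda>(x, x'). x * (la * x')) (Sigma ?K ?O)"
    proof (rule inj_onI, clarify)
      fix x x' y y' assume h: "x \<in> ?K" "x' \<in> ?O x" "y \<in> ?K" "y' \<in> ?O y" "x * (la * x') = y * (la * y')"
      have "x \<in> good_words m" "y \<in> good_words m" "x' \<in> good_words m'" "y' \<in> good_words m'"
        using h by (auto simp: kids_def occ_def)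
      then have "x = y \<and> la * x' = la * y'"
        using good_words_mult_inj[of x m y "la * x'" "1 + m'" "la * y'"] good_words_mult[OF good_words_l0] h(5) by blast
      then show "x = y \<and> x' = y'" by simp
    qed
    show "(\<lambda>(x, x'). x * (la * x')) ` Sigma ?K ?O \<subseteq> ?T"
    proof clarify
      fix x x' assume h: "x \<in> ?K" "x' \<in> ?O x"
      obtain v where v: "v \<in> tree (sh (pick x @ [0]) \<omega>)" "length v = n'" "pos (sh (pick x @ [0]) \<omega>) v = x'"
        using h(2) by (auto simp: occ_def)
      note px = pick[OF h(1)]
      have sa: "snd (\<omega> (pick x @ [0])) = la"
        using px H by (auto simp: Qev_def root_a_def)
      have "0 < fst (\<omega> (pick x))" using N[rule_format, of "pick x"] by simp
      then have "pick x @ [0] \<in> tree \<omega>" using px by (simp add: tree_append)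
      then have t: "(pick x @ [0]) @ v \<in> tree \<omega>" using v by (simp only: tree_append simp_thms)
      have "pos \<omega> ((pick x @ [0]) @ v) = pos \<omega> (pick x @ [0]) * x'"
        using v by (simp only: pos_append)
      also have "\<dots> = x * (la * x')" using px sa by (simp add: pos_snoc mult.assoc)
      finally have p: "pos \<omega> ((pick x @ [0]) @ v) = x * (la * x')" .
      have "x * (la * x') \<in> good_words (m + 1 + m')"
        using h by (intro good_words_mult_a) (auto simp: kids_def occ_def)
      moreover have "length ((pick x @ [0]) @ v) = n + 1 + n'" using px v by simp
      ultimately show "x * (la * x') \<in> ?T"
        using t p unfolding occ_def by blast
    qed
  qed (rule fin)
  finally show ?thesis .
qed

text \<open>With probability \<open>2 * \<tau>\<close> there are \<open>B\<close> occupied sites,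
  each carrying a copy that is regular over \<open>j\<close> blocks with probability at least
  \<tau>. As \<open>\<tau> * B\<close> is at least 8, at least \<open>b\<close> of the copies
  succeed with conditional probability one half, which reproduces \<tau> for \<open>j + 1\<close>
  blocks.\<close>

lemma regular_subtree:
  assumes \<tau>: "\<tau> = measure \<E> (Qev n m B) / 2" and b: "real b \<le> \<tau> * real B / 2" and B: "8 \<le> \<tau> * real B"
  shows "\<tau> \<le> measure \<E> (Qev (j * (n + 1) + n) (j * (m + 1) + m) (b ^ Suc j))"
proof (induction j)
  case 0
  have "\<tau> \<le> 1 / 2" using \<tau> Env.prob_le_1[of "Qev n m B"] by simp
  then have "\<tau> * real B \<le> 1 / 2 * real B" by (intro mult_right_mono) auto
  then have "b \<le> B" using b by linarith
  have "\<tau> \<le> measure \<E> (Qev n m B)"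
    using \<tau> measure_nonneg[of \<E> "Qev n m B"] by linarith
  also have "\<dots> \<le> measure \<E> (Qev n m b)"
    by (intro Env.finite_measure_mono Qev_mono \<open>b \<le> B\<close> sets_Qev)
  finally show ?case by simp
next
  case (Suc j)
  let ?G = "Qev (j * (n + 1) + n) (j * (m + 1) + m) (b ^ Suc j)"
  let ?C = "Qev n m B \<inter> {\<omega>. real b \<le> real (card (kids n (good_words m) ?G \<omega>))}"
  have pos: "0 < \<tau>" "0 < B"
  proof -
    have "0 < \<tau> * real B" using B by linarith
    moreover have "0 \<le> \<tau>" using \<tau> measure_nonneg[of \<E> "Qev n m B"] by linarith
    ultimately show "0 < \<tau>" "0 < B" by (auto simp: zero_less_mult_iff)
  qed
  have "\<tau> \<le> measure \<E> (Qev n m B) * (1 - 4 / (\<tau> * real B))"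
  proof -
    have "4 / (\<tau> * real B) \<le> 4 / 8" using B by (intro divide_left_mono) auto
    then have "1 / 2 \<le> 1 - 4 / (\<tau> * real B)" by simp
    then have "measure \<E> (Qev n m B) * (1 / 2) \<le> measure \<E> (Qev n m B) * (1 - 4 / (\<tau> * real B))"
      by (intro mult_left_mono) auto
    then show ?thesis using \<tau> by linarith
  qed
  also have "\<dots> \<le> measure \<E> ?C"
  proof (rule measure_env_kids_ge)
    show "\<omega>' \<in> Qev n m B" if "\<omega> \<in> Qev n m B" "\<And>w. length w \<le> n \<Longrightarrow> \<omega> w = \<omega>' w" for \<omega> \<omega>'
      using that by (rule Qev_cong)
    show "B \<le> card (occ n (good_words m) \<omega>)" if "\<omega> \<in> Qev n m B" for \<omega>
      using that by (simp add: Qev_def)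
  qed (rule finite_good_words sets_Qev Suc pos b)+
  also have "\<dots> \<le> measure \<E> (Qev (Suc j * (n + 1) + n) (Suc j * (m + 1) + m) (b ^ Suc (Suc j)))"
  proof (rule Env.finite_measure_mono_AE[OF _ sets_Qev])
    show "AE \<omega> in \<E>. \<omega> \<in> ?C \<longrightarrow> \<omega> \<in> Qev (Suc j * (n + 1) + n) (Suc j * (m + 1) + m) (b ^ Suc (Suc j))"
      using AE_offspring_pos
    proof eventually_elim
      case (elim \<omega>)
      show ?case
      proof
        assume C: "\<omega> \<in> ?C"
        have e: "Suc j * (n + 1) + n = n + 1 + (j * (n + 1) + n)" "Suc j * (m + 1) + m = m + 1 + (j * (m + 1) + m)"
          by auto
        have "b \<le> card (kids n (good_words m) ?G \<omega>)" using C by simp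
        then have "b * b ^ Suc j \<le> card (kids n (good_words m) ?G \<omega>) * b ^ Suc j" by (rule mult_right_mono) simp
        also have "\<dots> \<le> card (occ (n + 1 + (j * (n + 1) + n)) (good_words (m + 1 + (j * (m + 1) + m))) \<omega>)"
          by (rule card_occ_kids[OF elim subset_refl])
        finally have "real (b ^ Suc (Suc j)) \<le> real (card (occ (Suc j * (n + 1) + n) (good_words (Suc j * (m + 1) + m)) \<omega>))"
          unfolding e by (simp only: of_nat_le_iff power_Suc)
        then show "\<omega> \<in> Qev (Suc j * (n + 1) + n) (Suc j * (m + 1) + m) (b ^ Suc (Suc j))"
          using C by (simp only: Qev_def Int_iff mem_Collect_eq simp_thms)
      qed
    qed
  qed
  finally show ?case .
qed

text \<open>A block of \<open>n + 1\<close> generations consists of \<open>n\<close> free steps followed by the step \<open>a\<close>. The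
  bound \<open>\<tau>\<close> does not depend on the number of blocks.\<close>

definition admissible :: "nat \<Rightarrow> nat \<Rightarrow> nat \<Rightarrow> bool" where
  "admissible n m b \<longleftrightarrow> 2 \<le> b \<and>
    (\<exists>\<tau>>0. \<forall>j. \<tau> \<le> measure \<E> (Qev (j * (n + 1) + n) (j * (m + 1) + m) (b ^ Suc j)))"

text \<open>The typical level yields \<open>\<tau> * B\<close> of the order
  \<open>r ^ n * A n m\<close> divided by a polynomial in \<open>n\<close>, and
  \<open>A_lower\<close> makes this almost \<open>exp (n * (ln r - y))\<close>. The polynomial is
  absorbed by a part of the error that the exponent tolerates.\<close>

lemma admissible_exists:
  assumes L: "L q \<le> ereal y" and y: "y < ln r" and e: "0 < \<epsilon>"
  obtains n m b where "admissible n m b" "\<bar>real (m + 1) / real (n + 1) - q\<bar> < \<epsilon>"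
    "real (n + 1) * (ln r - y - \<epsilon>) \<le> ln (real b)"
proof -
  \<comment> \<open>The cap keeps the exponent \<open>h\<close> positive.\<close>
  define \<epsilon>' where "\<epsilon>' = min \<epsilon> ((ln r - y) / 2)"
  have e': "0 < \<epsilon>'" "\<epsilon>' \<le> \<epsilon>" "\<epsilon>' < ln r - y" using e y by (auto simp: \<epsilon>'_def min_less_iff_disj)
  define h where "h = ln r - y - \<epsilon>'"
  have h: "0 < h" using e' by (simp add: h_def)
  have ma: "0 < pmf \<mu> la" by (rule mu_letter_pos)
  \<comment> \<open>\<open>A_lower\<close> will be used with error \<open>\<epsilon>' / 4\<close>;
    the remaining \<open>3 * \<epsilon>' / 4\<close> pays for \<open>Dn n\<close>, for the harmonic
    factor \<open>1 + n * g2\<close> and for the constants.\<close>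
  have "(\<lambda>n::nat. (4 * (1 + 2 * Kc + 2 * Kc * real n) * (1 + real n * g2) / pmf \<mu> la * (exp h + 19)) * exp (- (3 * \<epsilon>' / 4) * real n)) \<longlonglongrightarrow> 0"
  proof -
    let ?c = "3 * \<epsilon>' / 4"
    have c: "?c > 0" using e' by simp
    have "(\<lambda>n::nat. exp (- ?c * real n)) \<longlonglongrightarrow> 0" "(\<lambda>n::nat. real n * exp (- ?c * real n)) \<longlonglongrightarrow> 0"
      "(\<lambda>n::nat. (real n)\<^sup>2 * exp (- ?c * real n)) \<longlonglongrightarrow> 0"
      using c by real_asymp+
    then have "(\<lambda>n::nat. 4 / pmf \<mu> la * (exp h + 19) * ((1 + 2 * Kc) * exp (- ?c * real n)
        + (2 * Kc + (1 + 2 * Kc) * g2) * (real n * exp (- ?c * real n)) + 2 * Kc * g2 * ((real n)\<^sup>2 * exp (- ?c * real n))))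
      \<longlonglongrightarrow> 4 / pmf \<mu> la * (exp h + 19) * ((1 + 2 * Kc) * 0 + (2 * Kc + (1 + 2 * Kc) * g2) * 0 + 2 * Kc * g2 * 0)"
      by (intro tendsto_intros)
    moreover have "4 / pmf \<mu> la * (exp h + 19) * ((1 + 2 * Kc) * E + (2 * Kc + (1 + 2 * Kc) * g2) * (x * E) + 2 * Kc * g2 * (x\<^sup>2 * E))
      = (4 * (1 + 2 * Kc + 2 * Kc * x) * (1 + x * g2) / pmf \<mu> la * (exp h + 19)) * E" for x E :: real
      by (simp add: field_simps power2_eq_square)
    ultimately show ?thesis by (simp only: mult_zero_right add_0_right)
  qed
  then have "eventually (\<lambda>n::nat. (4 * (1 + 2 * Kc + 2 * Kc * real n) * (1 + real n * g2) / pmf \<mu> la * (exp h + 19)) * exp (- (3 * \<epsilon>' / 4) * real n) < 1) sequentially"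
    by (rule order_tendstoD) simp
  then have "eventually (\<lambda>n::nat. (4 * Dn n * (1 + real n * g2) / pmf \<mu> la * (exp h + 19)) * exp (- (3 * \<epsilon>' / 4) * real n) < 1 \<and> 1 / real (n + 1) < \<epsilon> / 2) sequentially"
  proof (rule eventually_elim2)
    show "eventually (\<lambda>n::nat. 1 / real (n + 1) < \<epsilon> / 2) sequentially" using e by real_asymp
  qed (simp add: Dn_def)
  then obtain n0 where n0: "\<And>n. n \<ge> n0 \<Longrightarrow> (4 * Dn n * (1 + real n * g2) / pmf \<mu> la * (exp h + 19)) * exp (- (3 * \<epsilon>' / 4) * real n) < 1 \<and> 1 / real (n + 1) < \<epsilon> / 2"
    by (auto simp: eventually_sequentially)
  obtain n m where nm: "n0 \<le> n" "0 < n" "0 < m" "\<bar>real m / real n - q\<bar> < \<epsilon> / 2" "exp (- real n * (y + \<epsilon>' / 4)) \<le> A n m"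
    using A_lower[OF L, of "\<epsilon> / 2" "\<epsilon>' / 4" n0] e e' by auto
  have A0: "0 < A n m" using nm(5) by (rule less_le_trans[OF exp_gt_zero])
  have mn: "m \<le> n" using A0 E_eq_0[of n m] A_le_E[of n m] by (cases "m \<le> n") auto
  obtain B where B: "B \<ge> 1" "pmf \<mu> la * (r ^ n * A n m / Dn n) / (1 + real m * g2) \<le> real B * measure \<E> (Qev n m B)"
    using exists_typical_level[OF A0] by blast
  define \<tau> where "\<tau> = measure \<E> (Qev n m B) / 2"
  define b where "b = nat \<lfloor>\<tau> * real B / 2\<rfloor>"
  have D1: "1 \<le> Dn n" by (rule Dn_ge)
  \<comment> \<open>The summand 19 leaves room for the integer part in \<open>b\<close> and for
    \<open>8 <= \<tau> * B\<close>.\<close>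
  have big: "exp (real (n + 1) * h) + 19 \<le> \<tau> * real B / 2"
  proof -
    define W where "W = Dn n * (1 + real n * g2)"
    have W: "0 < W" using D1 g2_pos by (simp add: W_def add_pos_nonneg)
    have "exp (real (n + 1) * h) + 19 \<le> exp (real n * h) * (exp h + 19)"
    proof -
      have "19 * 1 \<le> 19 * exp (real n * h)" using h by (intro mult_left_mono) auto
      then show ?thesis by (simp add: algebra_simps exp_add)
    qed
    also have "exp h + 19 \<le> pmf \<mu> la * exp (3 * \<epsilon>' / 4 * real n) / (4 * W)"
    proof -
      have "(4 * W / pmf \<mu> la * (exp h + 19)) * exp (- (3 * \<epsilon>' / 4) * real n) \<le> 1"
        using n0[OF nm(1)] by (simp add: W_def mult.assoc)
      then have "(4 * W / pmf \<mu> la * (exp h + 19)) * exp (- (3 * \<epsilon>' / 4) * real n) * exp (3 * \<epsilon>' / 4 * real n) \<le> 1 * exp (3 * \<epsilon>' / 4 * real n)"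
        by (intro mult_right_mono) auto
      then have "4 * W / pmf \<mu> la * (exp h + 19) \<le> exp (3 * \<epsilon>' / 4 * real n)"
        unfolding mult.assoc exp_add[symmetric] by simp
      then show ?thesis using W ma by (simp add: field_simps)
    qed
    also have "exp (real n * h) * (pmf \<mu> la * exp (3 * \<epsilon>' / 4 * real n) / (4 * W)) = pmf \<mu> la * (r ^ n * exp (- real n * (y + \<epsilon>' / 4))) / (4 * W)"
    proof -
      have "r ^ n = exp (real n * ln r)" using r_gt_1 by (simp add: exp_of_nat_mult)
      then have "r ^ n * exp (- real n * (y + \<epsilon>' / 4)) = exp (real n * h + 3 * \<epsilon>' / 4 * real n)"
        unfolding h_def by (simp add: exp_add[symmetric] algebra_simps)
      then show ?thesis by (simp add: exp_add)
    qed
    also have "\<dots> \<le> pmf \<mu> la * (r ^ n * A n m) / (4 * (Dn n * (1 + real m * g2)))"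
    proof (rule frac_le)
      show "pmf \<mu> la * (r ^ n * exp (- real n * (y + \<epsilon>' / 4))) \<le> pmf \<mu> la * (r ^ n * A n m)"
        using nm(5) r_gt_1 by (intro mult_left_mono) auto
      show "0 < 4 * (Dn n * (1 + real m * g2))" using D1 g2_pos by (simp add: add_pos_nonneg)
      show "4 * (Dn n * (1 + real m * g2)) \<le> 4 * W"
        unfolding W_def using D1 g2_pos mn by (intro mult_left_mono add_left_mono mult_right_mono) auto
    qed (use r_gt_1 ma A0 in auto)
    also have "\<dots> = (pmf \<mu> la * (r ^ n * A n m / Dn n) / (1 + real m * g2)) / 4"
      by (simp add: field_simps)
    also have "\<dots> \<le> \<tau> * real B / 2"
      using B(2) by (simp add: \<tau>_def mult.commute)
    finally show ?thesis using W by (simp add: mult_left_mono)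
  qed
  have e0: "0 < exp (real (n + 1) * h)" by simp
  have b1: "real b \<le> \<tau> * real B / 2" "exp (real (n + 1) * h) + 18 \<le> real b"
    using big e0 unfolding b_def by linarith+
  have "admissible n m b"
    unfolding admissible_def
  proof (intro conjI exI[of _ \<tau>] allI)
    show "2 \<le> b" using b1 e0 by linarith
    have "0 < \<tau> * real B" using big e0 by linarith
    then show "0 < \<tau>" using B(1) by (simp add: zero_less_mult_iff)
    show "\<tau> \<le> measure \<E> (Qev (j * (n + 1) + n) (j * (m + 1) + m) (b ^ Suc j))" for j
      using big e0 b1 by (intro regular_subtree[OF \<tau>_def]) linarith+
  qed
  moreover have "\<bar>real (m + 1) / real (n + 1) - q\<bar> < \<epsilon>"
  proof -
    have "real (m + 1) / real (n + 1) - real m / real n = (real n - real m) / (real n * real (n + 1))"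
      using nm(2) by (simp add: field_simps)
    moreover have "0 \<le> (real n - real m) / (real n * real (n + 1))" using mn by simp
    moreover have "(real n - real m) / (real n * real (n + 1)) \<le> real n / (real n * real (n + 1))"
      by (intro divide_right_mono) auto
    moreover have "real n / (real n * real (n + 1)) = 1 / real (n + 1)" using nm(2) by simp
    moreover have "1 / real (n + 1) < \<epsilon> / 2" using n0[OF nm(1)] by blast
    ultimately show ?thesis using nm(4) by linarith
  qed
  moreover have "real (n + 1) * (ln r - y - \<epsilon>) \<le> ln (real b)"
  proof -
    have "real (n + 1) * (ln r - y - \<epsilon>) \<le> real (n + 1) * h"
      unfolding h_def using e' by (intro mult_left_mono) auto
    also have "\<dots> = ln (exp (real (n + 1) * h))" by simp
    also have "\<dots> \<le> ln (real b)"
      using b1 e0 by (subst ln_le_cancel_iff) linarith+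
    finally show ?thesis .
  qed
  ultimately show thesis by (rule that)
qed

end

lemma prod_list_antimono_upt:
  fixes f :: "nat \<Rightarrow> real"
  assumes "\<And>k. 0 \<le> f k" "\<And>k. f k \<le> 1"
  shows "prod_list (map f [0..<Suc n]) \<le> prod_list (map f [0..<n])"
proof -
  have "0 \<le> prod_list (map f [0..<n])"
    by (rule prod_list_nonneg) (use assms in auto)
  then show ?thesis using assms(2)[of n] by (simp add: mult_left_le)
qed

text \<open>A decreasing sequence of subsets of a finite set is eventually constant;
  \<open>d x\<close> is the time at which \<open>x\<close> drops out.\<close>

lemma card_INT_decreasing:
  assumes X: "finite X" and K: "\<And>t. K t \<subseteq> X" "\<And>t. K (Suc t) \<subseteq> K t" and b: "\<And>t. b \<le> real (card (K t))"
  shows "b \<le> real (card (\<Inter>t. K t))"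
proof -
  have dec: "s \<le> t \<Longrightarrow> K t \<subseteq> K s" for s t
    by (induction t rule: nat_induct) (use K(2) in \<open>auto simp: le_Suc_eq\<close>)
  define d where "d x = (if x \<in> (\<Inter>t. K t) then 0 else (LEAST t. x \<notin> K t))" for x
  obtain N where N: "\<And>x. x \<in> X \<Longrightarrow> d x \<le> N"
    using X finite_nat_set_iff_bounded_le[of "d ` X"] by auto
  have "K N \<subseteq> (\<Inter>t. K t)"
  proof (rule ccontr)
    assume "\<not> ?thesis"
    then obtain x where x: "x \<in> K N" "x \<notin> (\<Inter>t. K t)" by blast
    then have "\<exists>t. x \<notin> K t" by blast
    then have "x \<notin> K (d x)"
      unfolding d_def using x(2) by (simp only: if_False) (rule LeastI_ex)
    moreover have "K N \<subseteq> K (d x)" using N x(1) K(1) by (intro dec) blast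
    ultimately show False using x(1) by blast
  qed
  then have "card (K N) \<le> card (\<Inter>t. K t)"
  proof (intro card_mono finite_subset[OF _ X])
    show "(\<Inter>t. K t) \<subseteq> X" using K(1)[of N] by blast
  qed
  then show ?thesis using b[of N] by linarith
qed

section \<open>All block types in one environment: enumeration, spine and length of the
  steps\<close>

context branching
begin

lemma exists_split: obtains k where "2 \<le> k" "0 < pmf p k"
proof -
  have "\<exists>k\<ge>2. 0 < pmf p k"
  proof (rule ccontr)
    assume "\<not> ?thesis"
    then have z: "pmf p k = 0" if "2 \<le> k" for k
      using that pmf_nonneg[of p k] by (metis less_eq_real_def)
    have "(\<lambda>k. real k * pmf p k) = pmf p"
    proof
      fix k show "real k * pmf p k = pmf p k"
        using z[of k] p0 by (cases "k \<ge> 2") (auto simp: not_le less_2_cases_iff)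
    qed
    then have "pmf p sums r" using mean by simp
    then have "r = 1" using p_sums by (rule sums_unique2)
    then show False using r_gt_1 by simp
  qed
  then show ?thesis using that by blast
qed

definition k2 :: nat where "k2 = (SOME k. 2 \<le> k \<and> 0 < pmf p k)"

lemma k2: "2 \<le> k2" "0 < pmf p k2"
proof -
  have "\<exists>k. 2 \<le> k \<and> 0 < pmf p k" using exists_split by blast
  then have "2 \<le> k2 \<and> 0 < pmf p k2" unfolding k2_def by (rule someI_ex)
  then show "2 \<le> k2" "0 < pmf p k2" by auto
qed

definition Adm :: "(nat \<times> nat \<times> nat) set" where "Adm = {(n, m, b). admissible n m b}"

lemma Adm_nonempty: "Adm \<noteq> {}"
proof -
  obtain q where q: "L q < ereal (ln r)" using L_less_ln_r by blast
  then obtain y where y: "L q < ereal y" "ereal y < ereal (ln r)" using ereal_dense2 by blast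
  obtain n m b where "admissible n m b"
    by (rule admissible_exists[OF less_imp_le[OF y(1)], of 1]) (use y(2) in auto)
  then show ?thesis by (auto simp: Adm_def)
qed

text \<open>An enumeration, possibly with repetitions, of all admissible triples. Countability of
  the types is what permits one environment to serve every pair of speeds.\<close>

definition cls :: "nat \<Rightarrow> nat \<times> nat \<times> nat" where "cls = from_nat_into Adm"
definition cn :: "nat \<Rightarrow> nat" where "cn c = fst (cls c)"
definition cm :: "nat \<Rightarrow> nat" where "cm c = fst (snd (cls c))"
definition cb :: "nat \<Rightarrow> nat" where "cb c = snd (snd (cls c))"

lemma cls_admissible: "admissible (cn c) (cm c) (cb c)"
  using from_nat_into[OF Adm_nonempty, of c] by (auto simp: cls_def cn_def cm_def cb_def Adm_def)

lemma cls_surj: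
  assumes "admissible n m b"
  obtains c where "cn c = n" "cm c = m" "cb c = b"
proof -
  have "(n, m, b) \<in> range cls"
    unfolding cls_def using assms Adm_nonempty by (subst range_from_nat_into) (auto simp: Adm_def)
  then show ?thesis using that by (auto simp: cn_def cm_def cb_def image_iff) (metis fst_conv snd_conv)
qed

lemma cb_ge_2: "2 \<le> cb c"
  using cls_admissible[of c] by (simp add: admissible_def)

definition tc :: "nat \<Rightarrow> real" where
  "tc c = (SOME \<tau>. 0 < \<tau> \<and> (\<forall>j. \<tau> \<le> measure \<E> (Qev (j * (cn c + 1) + cn c) (j * (cm c + 1) + cm c) (cb c ^ Suc j))))"

lemma tc: "0 < tc c" "tc c \<le> measure \<E> (Qev (j * (cn c + 1) + cn c) (j * (cm c + 1) + cm c) (cb c ^ Suc j))"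
proof -
  have "\<exists>\<tau>. 0 < \<tau> \<and> (\<forall>j. \<tau> \<le> measure \<E> (Qev (j * (cn c + 1) + cn c) (j * (cm c + 1) + cm c) (cb c ^ Suc j)))"
    using cls_admissible[of c] by (auto simp: admissible_def)
  then have "0 < tc c \<and> (\<forall>j. tc c \<le> measure \<E> (Qev (j * (cn c + 1) + cn c) (j * (cm c + 1) + cm c) (cb c ^ Suc j)))"
    unfolding tc_def by (rule someI_ex)
  then show "0 < tc c" "tc c \<le> measure \<E> (Qev (j * (cn c + 1) + cn c) (j * (cm c + 1) + cm c) (cb c ^ Suc j))" by auto
qed

lemma tc_le_1: "tc c \<le> 1"
  using tc(2)[of c 0] Env.prob_le_1 order_trans by blast

text \<open>Events for different block types at one and the same root would not be independent. Here
  they are hung on disjoint subtrees: the spine follows the children \<open>0\<close>, each entered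
  by \<open>a\<close>, and at every level the child \<open>1\<close> carries the next event, so the
  joint probability is at least a product.\<close>

fun spine :: "'g environment set list \<Rightarrow> 'g environment set" where
  "spine [] = root_a"
| "spine (Q # Qs) = root_a \<inter> {\<omega>. 2 \<le> fst (\<omega> [])} \<inter> {\<omega>. sh [1] \<omega> \<in> Q} \<inter> {\<omega>. sh [0] \<omega> \<in> spine Qs}"

lemma spine_root_a: "\<omega> \<in> spine Qs \<Longrightarrow> \<omega> \<in> root_a"
  by (cases Qs) auto

lemma sets_spine: "(\<And>Q. Q \<in> set Qs \<Longrightarrow> Q \<in> sets \<E>) \<Longrightarrow> spine Qs \<in> sets \<E>"
proof (induction Qs)
  case (Cons Q Qs)
  have "{\<omega>. 2 \<le> fst (\<omega> [])} \<in> sets \<E>" by (rule sets_env_finite[of "{[]}"]) auto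
  then show ?case
    using Cons by (auto intro!: sets.Int sets_root_a sets_env_sh)
qed (simp add: sets_root_a)

definition \<eta> :: real where "\<eta> = pmf p k2 * pmf \<mu> la"

lemma \<eta>: "0 < \<eta>" "\<eta> \<le> 1"
  using k2(2) mu_letter_pos[of l0] by (auto simp: \<eta>_def intro!: mult_le_one pmf_le_1)

lemma measure_root_a: "measure \<E> root_a = pmf \<mu> la"
proof -
  have "emeasure \<E> root_a = emeasure (measure_pmf D) {b. snd b = la}"
    using emeasure_env_cylinder'[of "{[]}" D "\<lambda>_. {b. snd b = la}"] by (simp add: root_a_def)
  also have "\<dots> = emeasure (measure_pmf (map_pmf snd D)) {la}"
    by (simp add: vimage_def)
  also have "\<dots> = ennreal (pmf \<mu> la)"
    by (simp add: map_snd_pair_pmf emeasure_pmf_single)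
  finally show ?thesis by (simp add: measure_def)
qed

lemma measure_spine_Cons:
  assumes Q: "Q \<in> sets \<E>" and Qs: "spine Qs \<in> sets \<E>" and s: "spine (Q # Qs) \<in> sets \<E>"
  shows "\<eta> * measure \<E> Q * measure \<E> (spine Qs) \<le> measure \<E> (spine (Q # Qs))"
proof -
  let ?A = "\<lambda>k::nat. if k = 0 then spine Qs else Q"
  let ?T = "{\<omega>. \<omega> [] = (k2, la) \<and> (\<forall>k\<in>{0, 1}. sh [k] \<omega> \<in> ?A k)}"
  have T: "?T \<in> sets \<E>" "emeasure \<E> ?T = ennreal (pmf D (k2, la) * (\<Prod>k\<in>{0, 1}. measure \<E> (?A k)))"
    by (rule emeasure_env_root; use Q Qs in auto)+
  have "pmf D (k2, la) * (\<Prod>k\<in>{0, 1}. measure \<E> (?A k)) = \<eta> * measure \<E> Q * measure \<E> (spine Qs)"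
    by (simp add: pmf_pair \<eta>_def)
  then have "\<eta> * measure \<E> Q * measure \<E> (spine Qs) = measure \<E> ?T"
    using T(2) \<eta>(1) unfolding measure_def[of _ ?T] by (simp only: enn2real_ennreal mult_nonneg_nonneg measure_nonneg less_imp_le)
  also have "\<dots> \<le> measure \<E> (spine (Q # Qs))"
    by (rule Env.finite_measure_mono[OF _ s]) (use k2 in \<open>auto simp: root_a_def\<close>)
  finally show ?thesis .
qed

lemma measure_spine:
  assumes "\<And>c. c \<in> set cs \<Longrightarrow> Q c \<in> sets \<E>" "\<And>c. c \<in> set cs \<Longrightarrow> t c \<le> measure \<E> (Q c)" "\<And>c. 0 \<le> t c"
  shows "pmf \<mu> la * prod_list (map (\<lambda>c. \<eta> * t c) cs) \<le> measure \<E> (spine (map Q cs))"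
  using assms(1,2)
proof (induction cs)
  case (Cons c cs)
  have "pmf \<mu> la * prod_list (map (\<lambda>c. \<eta> * t c) (c # cs)) = (\<eta> * t c) * (pmf \<mu> la * prod_list (map (\<lambda>c. \<eta> * t c) cs))"
    by simp
  also have "\<dots> \<le> (\<eta> * measure \<E> (Q c)) * measure \<E> (spine (map Q cs))"
    using Cons \<eta> assms(3) by (intro mult_mono mult_nonneg_nonneg prod_list_nonneg) auto
  also have "\<dots> \<le> measure \<E> (spine (map Q (c # cs)))"
    unfolding list.map using Cons(2) by (intro measure_spine_Cons sets_spine) auto
  finally show ?case .
qed (simp add: measure_root_a)

lemma occ_shift:
  assumes "i < fst (\<omega> [])" "sh [i] \<omega> \<in> Qev n m B"
  shows "B \<le> card (occ (Suc n) (good_words (Suc m)) \<omega>)"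
proof -
  let ?O = "occ n (good_words m) (sh [i] \<omega>)"
  have "B \<le> card ?O" using assms by (simp add: Qev_def)
  also have "\<dots> = card ((\<lambda>x. la * x) ` ?O)"
    by (rule card_image[symmetric]) (auto simp: inj_on_def)
  also have "\<dots> \<le> card (occ (Suc n) (good_words (Suc m)) \<omega>)"
  proof (rule card_mono[OF finite_subset[OF occ_subset finite_good_words]], rule image_subsetI)
    fix x assume "x \<in> ?O"
    then obtain u where u: "x \<in> good_words m" "u \<in> tree (sh [i] \<omega>)" "length u = n" "pos (sh [i] \<omega>) u = x"
      by (auto simp: occ_def)
    have "la * x \<in> good_words (Suc m)"
      using good_words_mult[OF good_words_l0 u(1)] by simp
    moreover have "[i] @ u \<in> tree \<omega>" using u assms(1) by (simp only: tree_append singleton_in_tree simp_thms)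
    moreover have "pos \<omega> ([i] @ u) = la * x"
      using u assms(2) by (simp only: pos_append pos_singleton) (simp add: Qev_def root_a_def)
    moreover have "length ([i] @ u) = Suc n" using u by simp
    ultimately show "la * x \<in> occ (Suc n) (good_words (Suc m)) \<omega>"
      unfolding occ_def by blast
  qed
  finally show ?thesis .
qed

text \<open>The event number \<open>d\<close> sits \<open>d + 1\<close> levels down, and each of
  these levels is entered by the letter \<open>a\<close>. Generation and word length are therefore
  shifted by the same amount.\<close>

lemma spine_occ:
  "\<omega> \<in> spine Qs \<Longrightarrow> d < length Qs \<Longrightarrow> Qs ! d = Qev n m B \<Longrightarrow> B \<le> card (occ (n + d + 1) (good_words (m + d + 1)) \<omega>)"
proof (induction Qs arbitrary: \<omega> d)
  case (Cons Q Qs)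
  have N: "2 \<le> fst (\<omega> [])" using Cons(2) by auto
  show ?case
  proof (cases d)
    case 0
    then have "sh [1] \<omega> \<in> Qev n m B" using Cons by auto
    then show ?thesis using occ_shift[of 1 \<omega> n m B] N 0 by simp
  next
    case (Suc d')
    have s: "sh [0] \<omega> \<in> spine Qs" using Cons(2) by auto
    then have "B \<le> card (occ (n + d' + 1) (good_words (m + d' + 1)) (sh [0] \<omega>))"
      using Cons Suc by auto
    then have "sh [0] \<omega> \<in> Qev (n + d' + 1) (m + d' + 1) B"
      using spine_root_a[OF s] by (simp add: Qev_def)
    then show ?thesis using occ_shift[of 0 \<omega> "n + d' + 1" "m + d' + 1" B] N Suc by simp
  qed
qed simp

text \<open>Half of the probability guaranteed for the spine of the types up to \<open>i\<close>;
  the other half absorbs the failures in \<open>tau_le_good\<close>.\<close>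

definition tau :: "nat \<Rightarrow> real" where
  "tau i = pmf \<mu> la * prod_list (map (\<lambda>c. \<eta> * tc c) [0..<Suc i]) / 2"

lemma tau_pos: "0 < tau i"
proof -
  have "0 < prod_list (map (\<lambda>c. \<eta> * tc c) cs)" for cs
    by (induction cs) (use \<eta> tc in auto)
  from this[of "[0..<Suc i]"] show ?thesis
    using mu_letter_pos[of l0] unfolding tau_def by (intro divide_pos_pos mult_pos_pos) auto
qed

lemma tau_antimono: "i \<le> j \<Longrightarrow> tau j \<le> tau i"
proof (induction j rule: nat_induct)
  case (Suc j)
  have "prod_list (map (\<lambda>c. \<eta> * tc c) [0..<Suc (Suc j)]) \<le> prod_list (map (\<lambda>c. \<eta> * tc c) [0..<Suc j])"
  proof (rule prod_list_antimono_upt)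
    show "0 \<le> \<eta> * tc k" for k using \<eta>(1) tc(1)[of k] by simp
    show "\<eta> * tc k \<le> 1" for k using \<eta> tc(1)[of k] tc_le_1[of k] by (intro mult_le_one) auto
  qed
  then have "tau (Suc j) \<le> tau j"
    unfolding tau_def using mu_letter_pos[of l0] by (intro divide_right_mono mult_left_mono) auto
  then show ?case using Suc by (auto simp: le_Suc_eq)
qed simp

definition speed :: "nat \<Rightarrow> real" where "speed c = real (cm c + 1) / real (cn c + 1)"
text \<open>The entropy per letter of a type: the logarithm of the number of new sites divided by
  the word length gained. It is the dimension that blocks of this type produce.\<close>

definition slope :: "nat \<Rightarrow> real" where "slope c = ln (real (cb c)) / real (cm c + 1)"

text \<open>The requirements on the number \<open>Suc j\<close> of repetitions of a block: so many
  sites \<open>B\<close> that thinning by subtrees of probability \<open>tau (Suc i)\<close> rarely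
  fails, and speed and entropy per letter nearly those of a single block, although
  \<open>c + 1\<close> levels are spent on the spine and only \<beta> of the \<open>B\<close> sites
  are kept.\<close>

definition good_steps :: "nat \<Rightarrow> nat \<Rightarrow> nat \<Rightarrow> bool" where
  "good_steps i c j \<longleftrightarrow>
     (let B = real (cb c ^ Suc j); \<beta> = real (nat \<lfloor>tau (Suc i) * B / 2\<rfloor>);
          k = real (Suc j * (cn c + 1) + c + 1); l = real (Suc j * (cm c + 1) + c + 1) in
       4 * real (Suc i) / (tau i * tau (Suc i)) \<le> B \<and> 2 \<le> \<beta> \<and>
       \<bar>l / k - speed c\<bar> \<le> 1 / real (Suc i) \<and> l * (slope c - 1 / real (Suc i)) \<le> ln \<beta>)"

text \<open>\<open>B\<close> grows exponentially in \<open>j\<close>, whereas the detour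
  \<open>c + 1\<close> and the factor lost by thinning are fixed.\<close>

lemma good_steps_exist: "\<exists>j. good_steps i c j"
proof -
  let ?t = "tau (Suc i)" and ?b = "real (cb c)"
  have b: "2 \<le> ?b" using cb_ge_2[of c] by simp
  have t: "0 < ?t" by (rule tau_pos)
  define \<epsilon> where "\<epsilon> = 1 / real (Suc i)"
  have e: "0 < \<epsilon>" by (simp add: \<epsilon>_def)
  define kk ll cc where "kk = real (cn c + 1)" and "ll = real (cm c + 1)" and "cc = real c + 1"
  have kl: "1 \<le> kk" "1 \<le> ll" "1 \<le> cc" by (auto simp: kk_def ll_def cc_def)
  have "filterlim (\<lambda>j. ?b ^ Suc j) at_top sequentially"
  proof (rule filterlim_at_top_mono)
    show "filterlim (\<lambda>j. real (Suc j)) at_top sequentially"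
      by (rule filterlim_compose[OF filterlim_real_sequentially filterlim_Suc])
    have "real n \<le> ?b ^ n" for n
    proof -
      have "real n \<le> 2 ^ n" using of_nat_less_two_power[of n, where 'a = real] by simp
      also have "\<dots> \<le> ?b ^ n" using b by (intro power_mono) auto
      finally show ?thesis .
    qed
    then show "eventually (\<lambda>j. real (Suc j) \<le> ?b ^ Suc j) sequentially" by (simp only: eventually_True)
  qed
  then have ev: "eventually (\<lambda>j. Z \<le> ?b ^ Suc j) sequentially" for Z
    by (simp add: filterlim_at_top)
  have 1: "eventually (\<lambda>j. 4 * real (Suc i) / (tau i * ?t) \<le> ?b ^ Suc j \<and> 8 / ?t \<le> ?b ^ Suc j) sequentially"
    using ev ev by (rule eventually_conj)
  have 2: "eventually (\<lambda>j. \<bar>(real (Suc j) * ll + cc) / (real (Suc j) * kk + cc) - ll / kk\<bar> \<le> \<epsilon>) sequentially"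
  proof -
    have "(\<lambda>j. (real (Suc j) * ll + cc) / (real (Suc j) * kk + cc)) \<longlonglongrightarrow> ll / kk"
    proof -
      have "(\<lambda>j. (ll + cc / real (Suc j)) / (kk + cc / real (Suc j))) \<longlonglongrightarrow> (ll + 0) / (kk + 0)"
        using kl by (intro tendsto_intros LIMSEQ_Suc[OF lim_const_over_n]) auto
      moreover have "(ll + cc / real (Suc j)) / (kk + cc / real (Suc j)) = (real (Suc j) * ll + cc) / (real (Suc j) * kk + cc)" for j
      proof -
        have "(real (Suc j) * ll + cc) = real (Suc j) * (ll + cc / real (Suc j))" "(real (Suc j) * kk + cc) = real (Suc j) * (kk + cc / real (Suc j))"
          by (simp_all add: field_simps del: of_nat_Suc)
        then show ?thesis by (simp only:) simp
      qed
      ultimately show ?thesis by simp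
    qed
    then have "(\<lambda>j. \<bar>(real (Suc j) * ll + cc) / (real (Suc j) * kk + cc) - ll / kk\<bar>) \<longlonglongrightarrow> 0"
      by (intro tendsto_rabs_zero) (simp add: LIM_zero)
    then have "eventually (\<lambda>j. \<bar>(real (Suc j) * ll + cc) / (real (Suc j) * kk + cc) - ll / kk\<bar> < \<epsilon>) sequentially"
      using e by (rule order_tendstoD)
    then show ?thesis by (rule eventually_mono) simp
  qed
  have 3: "eventually (\<lambda>j. cc * slope c - ln (?t / 4) \<le> real (Suc j) * (\<epsilon> * ll)) sequentially"
  proof -
    have "filterlim (\<lambda>j. real (Suc j) * (\<epsilon> * ll)) at_top sequentially"
      using e kl by (intro filterlim_at_top_mult_tendsto_pos[OF tendsto_const] filterlim_compose[OF filterlim_real_sequentially filterlim_Suc]) auto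
    then show ?thesis by (simp add: filterlim_at_top)
  qed
  have "eventually (\<lambda>j. good_steps i c j) sequentially"
    using 1 2 3
  proof eventually_elim
    case (elim j)
    let ?B = "?b ^ Suc j"
    define \<beta> where "\<beta> = real (nat \<lfloor>?t * ?B / 2\<rfloor>)"
    have tB: "8 \<le> ?t * ?B" using elim(1) t by (simp add: field_simps)
    have \<beta>: "2 \<le> \<beta>" "?t * ?B / 4 \<le> \<beta>" unfolding \<beta>_def using tB by linarith+
    have "(real (Suc j) * ll + cc) * (slope c - \<epsilon>) \<le> ln \<beta>"
    proof -
      have sl: "slope c * ll = ln ?b" using kl by (simp add: slope_def ll_def)
      have "(real (Suc j) * ll + cc) * (slope c - \<epsilon>) = real (Suc j) * (slope c * ll) + cc * slope c - real (Suc j) * (\<epsilon> * ll) - cc * \<epsilon>"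
        by (simp add: algebra_simps)
      also have "\<dots> \<le> real (Suc j) * ln ?b + ln (?t / 4)"
        unfolding sl using elim(3) mult_nonneg_nonneg[of cc \<epsilon>] e kl by linarith
      also have "\<dots> = ln (?t * ?B / 4)"
        using t b by (simp add: ln_mult ln_div ln_realpow del: power_Suc of_nat_Suc)
      also have "\<dots> \<le> ln \<beta>" using \<beta> tB by (subst ln_le_cancel_iff) auto
      finally show ?thesis .
    qed
    moreover have k: "real (Suc j * (cn c + 1) + c + 1) = real (Suc j) * kk + cc"
      and l: "real (Suc j * (cm c + 1) + c + 1) = real (Suc j) * ll + cc"
      unfolding kk_def ll_def cc_def of_nat_add of_nat_mult by simp_all
    moreover have "speed c = ll / kk" by (simp only: speed_def kk_def ll_def)
    ultimately show ?case
      using elim \<beta>(1) unfolding good_steps_def Let_def k l of_nat_power \<epsilon>_def[symmetric] \<beta>_def[symmetric]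
      by (simp only: simp_thms)
  qed
  then show ?thesis
    using eventually_happens'[OF trivial_limit_sequentially] by blast
qed

end

subsection \<open>Environments good for all classes\<close>

lemma kids_mono: "H \<subseteq> H' \<Longrightarrow> kids n X H \<omega> \<subseteq> kids n X H' \<omega>"
  by (auto simp: kids_def)

text \<open>A compactness argument: only finitely many vertices of generation \<open>n\<close> lie
  above \<open>x\<close>. If each of them failed at some index, all of them would fail at the
  largest one.\<close>

lemma kids_INT_decreasing:
  assumes "\<And>t. H (Suc t) \<subseteq> H t"
  shows "(\<Inter>t. kids n X (H t) \<omega>) = kids n X (\<Inter>t. H t) \<omega>"
proof (intro equalityI subsetI)
  have dec: "s \<le> t \<Longrightarrow> H t \<subseteq> H s" for s t :: nat
    by (induction t rule: nat_induct) (use assms in \<open>auto simp: le_Suc_eq\<close>)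
  fix x assume x: "x \<in> (\<Inter>t. kids n X (H t) \<omega>)"
  let ?U = "{u \<in> tree \<omega>. length u = n \<and> pos \<omega> u = x}"
  have fin: "finite ?U" by (rule finite_subset[OF _ finite_tree_level[of \<omega> n]]) auto
  have "\<exists>u\<in>?U. \<forall>t. sh (u @ [0]) \<omega> \<in> H t"
  proof (rule ccontr)
    assume "\<not> ?thesis"
    then have "\<forall>u\<in>?U. \<exists>t. sh (u @ [0]) \<omega> \<notin> H t" by blast
    from bchoice[OF this] obtain f where f: "\<forall>u\<in>?U. sh (u @ [0]) \<omega> \<notin> H (f u)" ..
    obtain N where N: "\<And>u. u \<in> ?U \<Longrightarrow> f u \<le> N"
      using fin finite_nat_set_iff_bounded_le[of "f ` ?U"] by auto
    have "x \<in> kids n X (H N) \<omega>" using x by blast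
    then obtain u where u: "u \<in> ?U" "sh (u @ [0]) \<omega> \<in> H N" by (auto simp: kids_def)
    have "H N \<subseteq> H (f u)" by (rule dec[OF N[OF u(1)]])
    then have "sh (u @ [0]) \<omega> \<in> H (f u)" using u(2) by (rule subsetD)
    with bspec[OF f u(1)] show False by (rule notE)
  qed
  then show "x \<in> kids n X (\<Inter>t. H t) \<omega>"
    using x by (auto simp: kids_def)
qed (auto simp: kids_def)

context branching
begin

definition jj :: "nat \<Rightarrow> nat \<Rightarrow> nat" where "jj i c = (SOME j. good_steps i c j)"

lemma jj: "good_steps i c (jj i c)"
  unfolding jj_def by (rule someI_ex[OF good_steps_exist])

text \<open>The step of type \<open>c\<close> at level \<open>i\<close> including the detour along
  the spine. The closing letter \<open>a\<close> is not counted in \<open>sn\<close> and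
  \<open>sm\<close>, so the step has \<open>sn + 1\<close> generations and \<open>sm + 1\<close>
  letters.\<close>

definition sn :: "nat \<Rightarrow> nat \<Rightarrow> nat" where "sn i c = jj i c * (cn c + 1) + cn c + c + 1"
definition sm :: "nat \<Rightarrow> nat \<Rightarrow> nat" where "sm i c = jj i c * (cm c + 1) + cm c + c + 1"
definition sB :: "nat \<Rightarrow> nat \<Rightarrow> nat" where "sB i c = cb c ^ Suc (jj i c)"
definition s\<beta> :: "nat \<Rightarrow> nat \<Rightarrow> nat" where "s\<beta> i c = nat \<lfloor>tau (Suc i) * real (sB i c) / 2\<rfloor>"

lemma step_props:
  "4 * real (Suc i) / (tau i * tau (Suc i)) \<le> real (sB i c)"
  "2 \<le> s\<beta> i c"
  "\<bar>real (sm i c + 1) / real (sn i c + 1) - speed c\<bar> \<le> 1 / real (Suc i)"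
  "real (sm i c + 1) * (slope c - 1 / real (Suc i)) \<le> ln (real (s\<beta> i c))"
proof -
  have "sn i c + 1 = Suc (jj i c) * (cn c + 1) + c + 1" "sm i c + 1 = Suc (jj i c) * (cm c + 1) + c + 1"
    by (simp_all add: sn_def sm_def)
  then show "4 * real (Suc i) / (tau i * tau (Suc i)) \<le> real (sB i c)"
    "2 \<le> s\<beta> i c"
    "\<bar>real (sm i c + 1) / real (sn i c + 1) - speed c\<bar> \<le> 1 / real (Suc i)"
    "real (sm i c + 1) * (slope c - 1 / real (Suc i)) \<le> ln (real (s\<beta> i c))"
    using jj[of i c] unfolding good_steps_def Let_def s\<beta>_def[symmetric] sB_def[symmetric] by simp_all
qed

lemma s\<beta>_le: "real (s\<beta> i c) \<le> tau (Suc i) * real (sB i c) / 2"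
  unfolding s\<beta>_def using tau_pos[of "Suc i"] by (intro of_nat_floor) simp

definition Ks :: "nat \<Rightarrow> nat" where "Ks i = Max ((\<lambda>c. sn i c + sm i c + 2) ` {..i})"

lemma Ks: "c \<le> i \<Longrightarrow> sn i c + sm i c + 2 \<le> Ks i"
  unfolding Ks_def by (intro Max_ge) auto

text \<open>At stage \<open>s\<close> only the classes up to \<open>kap s\<close> are in use; this bound grows so slowly that the
  length of the stage is negligible compared with \<open>s\<close>.\<close>

primrec kap :: "nat \<Rightarrow> nat" where
  "kap 0 = 0"
| "kap (Suc s) = (if (kap s + 2) * Ks (kap s + 1) \<le> s then kap s + 1 else kap s)"

lemma kap_Suc: "kap s \<le> kap (Suc s)" "kap (Suc s) \<le> Suc (kap s)"
  by auto

lemma kap_mono: "s \<le> t \<Longrightarrow> kap s \<le> kap t"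
  by (induction t rule: nat_induct) (auto simp: le_Suc_eq simp del: kap.simps intro: order_trans[OF _ kap_Suc(1)])

lemma kap_unbounded: "\<exists>s. i \<le> kap s"
proof (induction i)
  case (Suc i)
  then obtain s where s: "i \<le> kap s" by blast
  show ?case
  proof (rule ccontr)
    assume "\<not> ?thesis"
    then have "\<And>t. kap t \<le> i" by (simp add: not_le less_Suc_eq_le not_less_eq_eq)
    then have "kap t = i" if "s \<le> t" for t using kap_mono[OF that] s by (metis le_antisym order_trans)
    moreover define t where "t = max s ((i + 2) * Ks (i + 1))"
    ultimately have "kap t = i" "kap (Suc t) = i" "(i + 2) * Ks (i + 1) \<le> t"
      by (auto simp del: kap.simps mult_Suc)
    then show False by simp
  qed
qed simp

lemma kap_at_top: "filterlim kap at_top sequentially"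
proof (subst filterlim_at_top, rule allI)
  fix Z
  obtain s where "Z \<le> kap s" using kap_unbounded by blast
  then show "eventually (\<lambda>t. Z \<le> kap t) sequentially"
    using kap_mono order_trans by (intro eventually_sequentiallyI[of s]) blast
qed

lemma kap_Ks: "kap s = 0 \<or> (kap s + 1) * Ks (kap s) \<le> s"
  by (induction s) auto

text \<open>A finite-horizon version: \<open>t\<close> further stages, beginning with stage
  \<open>s\<close>, are under control. Every stage serves all the types up to \<open>kap s\<close>,
  so the schedule of types can be chosen after the environment has been fixed.\<close>

fun good :: "nat \<Rightarrow> nat \<Rightarrow> 'g environment set" where
  "good 0 s = root_a"
| "good (Suc t) s = root_a \<inter> {\<omega>. \<forall>c\<in>{..kap s}. real (s\<beta> (kap s) c) \<le>
     real (card (kids (sn (kap s) c) (good_words (sm (kap s) c)) (good t (Suc s)) \<omega>))}"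

lemma sets_good: "good t s \<in> sets \<E>"
proof (induction t arbitrary: s)
  case (Suc t)
  have "{\<omega> \<in> space \<E>. \<forall>c\<in>{..kap s}. real (s\<beta> (kap s) c) \<le>
     real (card (kids (sn (kap s) c) (good_words (sm (kap s) c)) (good t (Suc s)) \<omega>))} \<in> sets \<E>"
    unfolding space_env by (rule sets.sets_Collect_finite_All[of "{..kap s}" \<E>, unfolded space_env])
      (simp_all only: UNIV_I simp_thms sets_card_kids[OF finite_good_words Suc] finite_atMost)
  then show ?case by (simp add: sets_root_a sets.Int)
qed (simp add: sets_root_a)

lemma good_decreasing: "good (Suc t) s \<subseteq> good t s"
proof (induction t arbitrary: s)
  case (Suc t)
  have "card (kids n (good_words m) (good (Suc t) (Suc s)) \<omega>) \<le> card (kids n (good_words m) (good t (Suc s)) \<omega>)" for n m \<omega>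
    by (intro card_mono finite_subset[OF kids_subset finite_good_words] kids_mono Suc)
  note le = this
  show ?case
  proof
    fix \<omega> assume w: "\<omega> \<in> good (Suc (Suc t)) s"
    have "real (s\<beta> (kap s) c) \<le> real (card (kids (sn (kap s) c) (good_words (sm (kap s) c)) (good t (Suc s)) \<omega>))" if "c \<le> kap s" for c
    proof -
      have "real (s\<beta> (kap s) c) \<le> real (card (kids (sn (kap s) c) (good_words (sm (kap s) c)) (good (Suc t) (Suc s)) \<omega>))"
        using w that unfolding good.simps(2)[of "Suc t"] by blast
      also have "\<dots> \<le> real (card (kids (sn (kap s) c) (good_words (sm (kap s) c)) (good t (Suc s)) \<omega>))"
        by (simp only: of_nat_le_iff le)
      finally show ?thesis .
    qed
    moreover have "\<omega> \<in> root_a" using w by simp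
    ultimately show "\<omega> \<in> good (Suc t) s" by simp
  qed
qed simp

text \<open>Induction on the horizon. The spine supplies the sites of all types up to
  \<open>i\<close> together with probability \<open>2 * tau i\<close>. For each type, too few of
  these sites carry good subtrees with probability at most \<open>tau i / (i + 1)\<close>, and as
  there are \<open>i + 1\<close> types, \<open>tau i\<close> remains.\<close>

lemma tau_le_good: "tau (kap s) \<le> measure \<E> (good t s)"
proof (induction t arbitrary: s)
  case 0
  have "tau (kap s) \<le> pmf \<mu> la"
  proof -
    have "prod_list (map (\<lambda>c. \<eta> * tc c) cs) \<le> 1 \<and> 0 \<le> prod_list (map (\<lambda>c. \<eta> * tc c) cs)" for cs
    proof (induction cs)
      case (Cons c cs)
      have "0 \<le> \<eta> * tc c" "\<eta> * tc c \<le> 1"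
        using \<eta> tc(1)[of c] tc_le_1[of c] by (auto intro!: mult_le_one)
      then show ?case using Cons by (auto intro!: mult_le_one mult_nonneg_nonneg)
    qed simp
    from this[of "[0..<Suc (kap s)]"] have "pmf \<mu> la * prod_list (map (\<lambda>c. \<eta> * tc c) [0..<Suc (kap s)]) \<le> pmf \<mu> la * 1"
      by (intro mult_left_mono) auto
    then show ?thesis
      unfolding tau_def using pmf_nonneg[of \<mu> la] by linarith
  qed
  then show ?case by (simp add: measure_root_a)
next
  case (Suc t)
  define i where "i = kap s"
  define Q where "Q c = Qev (jj i c * (cn c + 1) + cn c) (jj i c * (cm c + 1) + cm c) (sB i c)" for c
  define J where "J = spine (map Q [0..<Suc i])"
  define Ac where "Ac c = Qev (sn i c) (sm i c) (sB i c)" for c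
  define Cc where "Cc c = {\<omega>. real (s\<beta> i c) \<le> real (card (kids (sn i c) (good_words (sm i c)) (good t (Suc s)) \<omega>))}" for c
  have sets: "Ac c \<in> sets \<E>" "Cc c \<in> sets \<E>" "J \<in> sets \<E>" for c
  proof -
    show "Ac c \<in> sets \<E>" unfolding Ac_def by (rule sets_Qev)
    show "Cc c \<in> sets \<E>" unfolding Cc_def by (rule sets_card_kids[OF finite_good_words sets_good])
    have "Q c \<in> sets \<E>" for c unfolding Q_def by (rule sets_Qev)
    then show "J \<in> sets \<E>" unfolding J_def by (intro sets_spine) auto
  qed
  have J: "2 * tau i \<le> measure \<E> J"
  proof -
    have "2 * tau i = pmf \<mu> la * prod_list (map (\<lambda>c. \<eta> * tc c) [0..<Suc i])"
      unfolding tau_def by linarith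
    also have "\<dots> \<le> measure \<E> (spine (map Q [0..<Suc i]))"
    proof (rule measure_spine)
      show "Q c \<in> sets \<E>" for c unfolding Q_def by (rule sets_Qev)
      show "tc c \<le> measure \<E> (Q c)" for c unfolding Q_def sB_def by (rule tc(2))
      show "0 \<le> tc c" for c using tc(1)[of c] by simp
    qed
    finally show ?thesis by (simp only: J_def)
  qed
  have JA: "J \<subseteq> Ac c" if "c \<le> i" for c
  proof
    fix \<omega> assume "\<omega> \<in> J"
    then have "\<omega> \<in> spine (map Q [0..<Suc i])" by (simp add: J_def)
    moreover have "map Q [0..<Suc i] ! c = Qev (jj i c * (cn c + 1) + cn c) (jj i c * (cm c + 1) + cm c) (sB i c)"
      using that by (subst nth_map) (auto simp: Q_def nth_upt simp del: upt_Suc)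
    moreover have "c < length (map Q [0..<Suc i])" using that by simp
    ultimately have "sB i c \<le> card (occ (jj i c * (cn c + 1) + cn c + c + 1) (good_words (jj i c * (cm c + 1) + cm c + c + 1)) \<omega>)"
      by (intro spine_occ)
    moreover have "\<omega> \<in> root_a" using \<open>\<omega> \<in> spine (map Q [0..<Suc i])\<close> by (rule spine_root_a)
    ultimately show "\<omega> \<in> Ac c"
      unfolding Ac_def Qev_def sn_def sm_def by (simp only: Int_iff mem_Collect_eq of_nat_le_iff simp_thms)
  qed
  have tt: "0 < tau i" "0 < tau (Suc i)" by (rule tau_pos)+
  have fail: "measure \<E> (Ac c - Cc c) \<le> tau i / real (Suc i)" for c
  proof -
    have B0: "0 < real (sB i c)" using cb_ge_2[of c] by (simp add: sB_def)
    have "measure \<E> (Ac c) * (1 - 4 / (tau (Suc i) * real (sB i c))) \<le> measure \<E> (Ac c \<inter> Cc c)"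
      unfolding Cc_def
    proof (rule measure_env_kids_ge)
      show "\<omega>' \<in> Ac c" if "\<omega> \<in> Ac c" "\<And>w. length w \<le> sn i c \<Longrightarrow> \<omega> w = \<omega>' w" for \<omega> \<omega>'
        using that unfolding Ac_def by (rule Qev_cong)
      show "sB i c \<le> card (occ (sn i c) (good_words (sm i c)) \<omega>)" if "\<omega> \<in> Ac c" for \<omega>
        using that by (simp add: Ac_def Qev_def)
      \<comment> \<open>\<open>kap\<close> increases by at most one from a stage to the next, so the
        subtrees have at least this probability.\<close>
      show "tau (Suc i) \<le> measure \<E> (good t (Suc s))"
        using Suc[of "Suc s"] tau_antimono[of "kap (Suc s)" "Suc i"] kap_Suc(2)[of s] by (simp add: i_def del: kap.simps)
    qed (use sets sets_good B0 tt s\<beta>_le in auto)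
    moreover have "measure \<E> (Ac c - Cc c) = measure \<E> (Ac c) - measure \<E> (Ac c \<inter> Cc c)"
    proof -
      have "Ac c - Cc c = Ac c - (Ac c \<inter> Cc c)" by blast
      then show ?thesis using Env.finite_measure_Diff[OF sets(1) sets.Int[OF sets(1,2)] Int_lower1] by simp
    qed
    ultimately have "measure \<E> (Ac c - Cc c) \<le> measure \<E> (Ac c) * (4 / (tau (Suc i) * real (sB i c)))"
      by (simp add: algebra_simps)
    also have "\<dots> \<le> 1 * (4 / (tau (Suc i) * real (sB i c)))"
      using tt by (intro mult_right_mono) auto
    also have "\<dots> \<le> tau i / real (Suc i)"
      using step_props(1)[of i c] tt B0 by (simp add: field_simps del: of_nat_Suc)
    finally show ?thesis .
  qed
  have sub: "J \<subseteq> good (Suc t) s \<union> (\<Union>c\<in>{..i}. Ac c - Cc c)"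
  proof
    fix \<omega> assume w: "\<omega> \<in> J"
    show "\<omega> \<in> good (Suc t) s \<union> (\<Union>c\<in>{..i}. Ac c - Cc c)"
    proof (cases "\<exists>c\<in>{..i}. \<omega> \<notin> Cc c")
      case True
      then show ?thesis using JA w by blast
    next
      case False
      moreover have "\<omega> \<in> root_a" using w spine_root_a unfolding J_def by blast
      ultimately show ?thesis by (simp add: Cc_def i_def)
    qed
  qed
  have "2 * tau i \<le> measure \<E> (good (Suc t) s \<union> (\<Union>c\<in>{..i}. Ac c - Cc c))"
    by (rule order_trans[OF J Env.finite_measure_mono[OF sub]]) (use sets sets_good in \<open>auto simp del: good.simps\<close>)
  also have "\<dots> \<le> measure \<E> (good (Suc t) s) + measure \<E> (\<Union>c\<in>{..i}. Ac c - Cc c)"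
    using sets by (intro measure_Un_le sets_good) auto
  also have "measure \<E> (\<Union>c\<in>{..i}. Ac c - Cc c) \<le> (\<Sum>c\<in>{..i}. measure \<E> (Ac c - Cc c))"
    using sets by (intro measure_UNION_le) auto
  also have "\<dots> \<le> (\<Sum>c\<in>{..i}. tau i / real (Suc i))"
    by (intro sum_mono fail)
  also have "\<dots> = tau i" by simp
  finally show ?case by (simp add: i_def)
qed

definition goodI :: "nat \<Rightarrow> 'g environment set" where "goodI s = (\<Inter>t. good t s)"

lemma sets_goodI: "goodI s \<in> sets \<E>"
  unfolding goodI_def using sets_good by (intro sets.countable_INT) auto

lemma measure_goodI_pos: "0 < measure \<E> (goodI s)"
proof -
  have "(\<lambda>t. measure \<E> (good t s)) \<longlonglongrightarrow> measure \<E> (\<Inter>t. good t s)"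
    using sets_good good_decreasing by (intro Env.finite_Lim_measure_decseq) (auto simp: decseq_Suc_iff simp del: good.simps)
  then have "tau (kap s) \<le> measure \<E> (\<Inter>t. good t s)"
    by (rule LIMSEQ_le_const) (use tau_le_good in blast)
  then show ?thesis using tau_pos[of "kap s"] by (simp add: goodI_def)
qed

lemma goodI_root_a: "goodI s \<subseteq> root_a"
  unfolding goodI_def using good.simps(1) by blast

lemma goodI_kids:
  assumes "\<omega> \<in> goodI s" "c \<le> kap s"
  shows "s\<beta> (kap s) c \<le> card (kids (sn (kap s) c) (good_words (sm (kap s) c)) (goodI (Suc s)) \<omega>)"
proof -
  let ?k = "\<lambda>H. kids (sn (kap s) c) (good_words (sm (kap s) c)) H \<omega>"
  have "real (s\<beta> (kap s) c) \<le> real (card (\<Inter>t. ?k (good t (Suc s))))"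
  proof (rule card_INT_decreasing[OF finite_good_words kids_subset])
    fix t
    show "?k (good (Suc t) (Suc s)) \<subseteq> ?k (good t (Suc s))"
      by (intro kids_mono good_decreasing)
    have "\<omega> \<in> good (Suc t) s" using assms(1) unfolding goodI_def by blast
    then show "real (s\<beta> (kap s) c) \<le> real (card (?k (good t (Suc s))))"
      using assms(2) by simp
  qed
  then show ?thesis
    using kids_INT_decreasing[of "\<lambda>t. good t (Suc s)", OF good_decreasing] by (simp add: goodI_def)
qed

text \<open>The two children start with different generators, so from every vertex one of the two good
  subtrees can be entered without cancellation.\<close>

definition seed :: "'g environment set" where
  "seed = {\<omega>. 2 \<le> fst (\<omega> []) \<and> sh [0] \<omega> \<in> goodI 0 \<and> snd (\<omega> [1]) = of_letter l1 \<and> sh [1, 0] \<omega> \<in> goodI 0}"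

lemma seed_pos: "0 < measure \<E> seed" and sets_seed: "seed \<in> sets \<E>"
proof -
  let ?R = "{(k, y). snd (k, y) = of_letter l1} :: (nat \<times> 'g free_group) set"
  let ?W = "{\<omega>. \<omega> [] \<in> ?R \<and> (\<forall>k\<in>{0}. sh [k] \<omega> \<in> goodI 0)}"
  let ?A = "\<lambda>k::nat. if k = 0 then goodI 0 else ?W"
  let ?R' = "{(k, y). 2 \<le> k} :: (nat \<times> 'g free_group) set"
  have W: "?W \<in> sets \<E>" "emeasure \<E> ?W = ennreal (measure D ?R * (\<Prod>k\<in>{0::nat}. measure \<E> (goodI 0)))"
    by (rule emeasure_env_root_in; use sets_goodI in auto)+
  have seed: "seed = {\<omega>. \<omega> [] \<in> ?R' \<and> (\<forall>k\<in>{0, 1}. sh [k] \<omega> \<in> ?A k)}"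
    by (auto simp: seed_def)
  have S: "seed \<in> sets \<E>" "emeasure \<E> seed = ennreal (measure D ?R' * (\<Prod>k\<in>{0, 1}. measure \<E> (?A k)))"
    unfolding seed by (rule emeasure_env_root_in; use sets_goodI W in auto)+
  show "seed \<in> sets \<E>" by (rule S)
  have pos: "0 < measure D T" if "b \<in> T" "0 < pmf D b" for b T
  proof -
    have "pmf D b = measure D {b}" by (simp add: measure_pmf_single)
    also have "\<dots> \<le> measure D T" using that by (intro measure_pmf.finite_measure_mono) auto
    finally show ?thesis using that by simp
  qed
  have "0 < measure D ?R" "0 < measure D ?R'"
    using k2 mu_letter_pos[of l1] by (intro pos[of "(k2, of_letter l1)"]; simp add: pmf_pair)+
  then have "0 < measure \<E> ?W"
    using W(2) measure_goodI_pos[of 0] by (simp add: measure_def)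
  then show "0 < measure \<E> seed"
    using S(2) measure_goodI_pos[of 0] \<open>0 < measure D ?R'\<close> by (simp add: measure_def)
qed

definition barren :: "'g environment set" where
  "barren = {\<omega>. \<forall>u. u \<in> tree \<omega> \<longrightarrow> sh u \<omega> \<notin> seed}"

lemma sets_barren: "barren \<in> sets \<E>"
proof -
  have "barren = (\<Inter>u. (space \<E> - {\<omega>. u \<in> tree \<omega> \<and> True}) \<union> (space \<E> - {\<omega>. sh u \<omega> \<in> seed}))"
    by (auto simp: barren_def)
  also have "\<dots> \<in> sets \<E>"
    by (intro sets.countable_INT' sets.Un sets.Diff sets.top sets_env_sh sets_seed sets_tree_pos[of _ "\<lambda>_. True"] image_subsetI) auto
  finally show ?thesis .
qed

text \<open>The probability \<zeta> of \<open>barren\<close> is at most the value of the offspring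
  generating function at \<zeta>, as every child of a barren root is barren. Without extinction and
  with some branching this leaves only 0 and 1, and 1 is excluded by
  \<open>seed_pos\<close>.\<close>

lemma AE_seed: "AE \<omega> in \<E>. \<exists>u. u \<in> tree \<omega> \<and> sh u \<omega> \<in> seed"
proof -
  define \<zeta> where "\<zeta> = measure \<E> barren"
  let ?C = "\<lambda>k. {\<omega>. \<omega> [] \<in> {b. fst b = k} \<and> (\<forall>i\<in>{..<k}. sh [i] \<omega> \<in> barren)}"
  have C: "?C k \<in> sets \<E>" "emeasure \<E> (?C k) = ennreal (pmf p k * \<zeta> ^ k)" for k
  proof -
    have "measure D {b. fst b = k} = pmf p k"
    proof -
      have "measure D {b. fst b = k} = measure (map_pmf fst D) {k}" by (simp add: vimage_def)
      then show ?thesis by (simp add: map_fst_pair_pmf measure_pmf_single)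
    qed
    then show "emeasure \<E> (?C k) = ennreal (pmf p k * \<zeta> ^ k)" "?C k \<in> sets \<E>"
      using emeasure_env_root_in[of "{..<k}" "\<lambda>_. barren" D "{b. fst b = k}"] sets_barren by (simp_all add: \<zeta>_def)
  qed
  have sub: "barren \<subseteq> (\<Union>k. ?C k)"
  proof
    fix \<omega> assume w: "\<omega> \<in> barren"
    have "sh [i] \<omega> \<in> barren" if "i < fst (\<omega> [])" for i
      unfolding barren_def
    proof (intro CollectI allI impI)
      fix u assume "u \<in> tree (sh [i] \<omega>)"
      then have "[i] @ u \<in> tree \<omega>" using that by (simp only: tree_append singleton_in_tree simp_thms)
      then have "sh ([i] @ u) \<omega> \<notin> seed" using w unfolding barren_def by blast
      then show "sh u (sh [i] \<omega>) \<notin> seed" by simp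
    qed
    then show "\<omega> \<in> (\<Union>k. ?C k)" by auto
  qed
  have z01: "0 \<le> \<zeta>" "\<zeta> < 1"
  proof -
    have "barren \<subseteq> space \<E> - seed"
    proof
      fix \<omega> assume "\<omega> \<in> barren"
      then have "sh [] \<omega> \<notin> seed" unfolding barren_def using Nil_in_tree[of \<omega>] by blast
      then show "\<omega> \<in> space \<E> - seed" by simp
    qed
    then have "\<zeta> \<le> measure \<E> (space \<E> - seed)"
      unfolding \<zeta>_def using sets_seed by (intro Env.finite_measure_mono sets.compl_sets)
    then show "\<zeta> < 1" using Env.prob_compl[OF sets_seed] seed_pos by simp
  qed (simp add: \<zeta>_def)
  have "emeasure \<E> barren \<le> emeasure \<E> (\<Union>k. ?C k)"
    by (rule emeasure_mono[OF sub]) (use C(1) in auto)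
  also have "\<dots> \<le> (\<Sum>k. emeasure \<E> (?C k))"
    by (rule emeasure_subadditive_countably) (use C(1) in auto)
  also have "\<dots> = (\<Sum>k. ennreal (pmf p k * \<zeta> ^ k))" by (simp only: C(2))
  finally have le: "ennreal \<zeta> \<le> (\<Sum>k. ennreal (pmf p k * \<zeta> ^ k))"
    by (simp add: \<zeta>_def Env.emeasure_eq_measure)
  have "\<zeta> = 0"
  proof (rule ccontr)
    assume "\<zeta> \<noteq> 0"
    then have z: "0 < \<zeta>" using z01 by simp
    \<comment> \<open>As \<open>p\<close> has no mass at 0, passing from \<zeta> to its powers never
      increases a term, and it gains strictly at \<open>k2\<close>, which is at least 2.\<close>
    have pw: "pmf p k * \<zeta> ^ k \<le> pmf p k * \<zeta> - (if k = k2 then pmf p k2 * (\<zeta> - \<zeta> ^ k2) else 0)" for k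
    proof (cases "k = 0 \<or> k = k2")
      case True
      then show ?thesis using p0 k2 by (auto simp: algebra_simps)
    next
      case False
      then have "\<zeta> ^ k \<le> \<zeta> ^ 1" using z01 by (intro power_decreasing) auto
      then show ?thesis using False by (simp add: mult_left_mono)
    qed
    have s1: "(\<lambda>k. pmf p k * \<zeta> - (if k = k2 then pmf p k2 * (\<zeta> - \<zeta> ^ k2) else 0)) sums (1 * \<zeta> - pmf p k2 * (\<zeta> - \<zeta> ^ k2))"
      by (intro sums_diff sums_mult2 p_sums sums_single)
    have nn: "0 \<le> pmf p k * \<zeta> ^ k" for k using z01 by simp
    have s2: "summable (\<lambda>k. pmf p k * \<zeta> ^ k)"
      by (rule summable_comparison_test'[OF sums_summable[OF s1], of 0]) (use pw nn in auto)
    have "(\<Sum>k. ennreal (pmf p k * \<zeta> ^ k)) = ennreal (\<Sum>k. pmf p k * \<zeta> ^ k)"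
      by (rule suminf_ennreal2[OF nn s2])
    then have "\<zeta> \<le> (\<Sum>k. pmf p k * \<zeta> ^ k)"
      using le by (simp add: ennreal_le_iff suminf_nonneg[OF s2 nn])
    also have "\<dots> \<le> 1 * \<zeta> - pmf p k2 * (\<zeta> - \<zeta> ^ k2)"
      using suminf_le[OF pw s2 sums_summable[OF s1]] s1 by (simp add: sums_iff)
    also have "\<dots> < \<zeta>"
    proof -
      have "\<zeta> ^ k2 \<le> \<zeta> ^ 2" using z01 k2 by (intro power_decreasing) auto
      also have "\<dots> < \<zeta>" using z z01 by (simp add: power2_eq_square)
      finally show ?thesis using k2 by simp
    qed
    finally show False by simp
  qed
  then have "emeasure \<E> barren = 0" by (simp add: \<zeta>_def Env.emeasure_eq_measure)
  then show ?thesis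
  proof (intro AE_I[of _ _ barren] sets_barren)
    show "{\<omega> \<in> space \<E>. \<not> (\<exists>u. u \<in> tree \<omega> \<and> sh u \<omega> \<in> seed)} \<subseteq> barren"
      unfolding barren_def by blast
  qed
qed

end

subsection \<open>The mass distribution principle\<close>

text \<open>Sequences of choices carry the uniform product measure. A set whose diameter lies
  between \<open>exp (- \<rho> (Suc s))\<close> and \<open>exp (- \<rho> s)\<close> meets the image
  of only one cylinder of \<open>s + 1\<close> choices, and the entropy bound compares the mass of
  this cylinder with the \<open>h\<close>-th power of the diameter. Preimages under \<Phi> are
  enclosed in measurable sets, so no measurability of \<Phi> enters.\<close>

lemma hausdorff_measure_pos:
  fixes \<Phi> :: "(nat \<Rightarrow> nat) \<Rightarrow> 'a::metric_space" and b :: "nat \<Rightarrow> nat" and \<rho> :: "nat \<Rightarrow> real"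
  assumes b: "\<And>s. 1 \<le> b s"
    and mem: "\<And>\<xi>. (\<And>s. \<xi> s < b s) \<Longrightarrow> \<Phi> \<xi> \<in> T"
    and sep: "\<And>\<xi> \<xi>' s i. (\<And>s. \<xi> s < b s) \<Longrightarrow> (\<And>s. \<xi>' s < b s) \<Longrightarrow> i \<le> s \<Longrightarrow> \<xi> i \<noteq> \<xi>' i
      \<Longrightarrow> exp (- \<rho> s) \<le> dist (\<Phi> \<xi>) (\<Phi> \<xi>')"
    and \<rho>: "filterlim \<rho> at_top sequentially"
    and h: "0 < h" and H: "\<And>s. h * \<rho> (Suc s) - C \<le> (\<Sum>i\<le>s. ln (real (b i)))"
  shows "hausdorff_measure h T \<noteq> 0"
proof -
  let ?M = "PiM UNIV (\<lambda>s. measure_pmf (pmf_of_set {..<b s}))"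
  interpret M: prob_space ?M by (intro prob_space_PiM prob_space_measure_pmf)
  have sp: "space ?M = UNIV" by (simp add: space_PiM PiE_UNIV_domain)
  have ne: "{..<b s} \<noteq> {}" for s using b[of s] by (metis lessThan_iff empty_iff less_le_trans zero_less_one)
  define cyl where "cyl x s = {\<xi>. \<forall>i\<in>{..s}. \<xi> i \<in> {x i}}" for x :: "nat \<Rightarrow> nat" and s :: nat
  have emb: "cyl x s = prod_emb UNIV (\<lambda>s. measure_pmf (pmf_of_set {..<b s})) {..s} (Pi\<^sub>E {..s} (\<lambda>i. {x i}))" for x s
    by (auto simp: cyl_def prod_emb_def PiE_UNIV_domain PiE_iff)
  have cyl_sets: "cyl x s \<in> sets ?M" for x s
    unfolding emb by (rule sets_PiM_I) auto
  have cyl_meas: "emeasure ?M (cyl x s) = ennreal (exp (- (\<Sum>i\<le>s. ln (real (b i)))))" if x: "\<And>s. x s < b s" for x s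
  proof -
    have "emeasure ?M (cyl x s) = (\<Prod>i\<in>{..s}. emeasure (measure_pmf (pmf_of_set {..<b i})) {x i})"
      unfolding emb by (rule emeasure_PiM_emb) (auto intro: prob_space_measure_pmf)
    also have "\<dots> = (\<Prod>i\<in>{..s}. ennreal (1 / real (b i)))"
      using ne x by (intro prod.cong refl) (simp add: emeasure_pmf_single)
    also have "\<dots> = ennreal (\<Prod>i\<in>{..s}. 1 / real (b i))"
      by (rule prod_ennreal) auto
    also have "(\<Prod>i\<in>{..s}. 1 / real (b i)) = exp (- (\<Sum>i\<le>s. ln (real (b i))))"
    proof -
      have "exp (\<Sum>i\<le>s. - ln (real (b i))) = (\<Prod>i\<in>{..s}. exp (- ln (real (b i))))"
        by (rule exp_sum) simp
      also have "\<dots> = (\<Prod>i\<in>{..s}. 1 / real (b i))"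
        using b by (intro prod.cong refl) (simp add: exp_minus inverse_eq_divide Suc_le_eq)
      finally show ?thesis by (simp add: sum_negf)
    qed
    finally show ?thesis .
  qed
  \<comment> \<open>The first term serves sets of diameter at least \<open>exp (- \<rho> 0)\<close>,
    which may carry the whole mass, the second one all smaller sets.\<close>
  define K where "K = max (exp (h * \<rho> 0)) (exp C)"
  have K: "0 < K" by (simp add: K_def less_max_iff_disj)
  have K_ge: "exp (h * \<rho> 0) \<le> K" "exp C \<le> K" by (simp_all add: K_def)
  have W: "\<exists>W. W \<in> sets ?M \<and> {\<xi>. (\<forall>s. \<xi> s < b s) \<and> \<Phi> \<xi> \<in> U} \<subseteq> W \<and> emeasure ?M W \<le> ennreal K * diam_power h U"
    if U: "bounded U" for U
  proof (cases "{\<xi>. (\<forall>s. \<xi> s < b s) \<and> \<Phi> \<xi> \<in> U} = {}")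
    case True
    then show ?thesis by (intro exI[of _ "{}"]) simp
  next
    case False
    then obtain x where x: "\<And>s. x s < b s" "\<Phi> x \<in> U" by blast
    define d where "d = diameter U"
    have dp: "diam_power h U = ennreal (d powr h)"
      using x h by (auto simp: diam_power_def d_def)
    have d0: "0 \<le> d" unfolding d_def by (rule diameter_ge_0[OF U])
    have in_cyl: "{\<xi>. (\<forall>s. \<xi> s < b s) \<and> \<Phi> \<xi> \<in> U} \<subseteq> cyl x s" if "d < exp (- \<rho> s)" for s
    proof
      fix \<xi> assume xi: "\<xi> \<in> {\<xi>. (\<forall>s. \<xi> s < b s) \<and> \<Phi> \<xi> \<in> U}"
      show "\<xi> \<in> cyl x s"
      proof (rule ccontr)
        assume "\<xi> \<notin> cyl x s"
        then obtain i where "i \<le> s" "\<xi> i \<noteq> x i" by (auto simp: cyl_def)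
        then have "exp (- \<rho> s) \<le> dist (\<Phi> \<xi>) (\<Phi> x)" using xi x by (intro sep[of \<xi> x i s]) auto
        also have "\<dots> \<le> d" unfolding d_def using xi x by (intro diameter_bounded_bound[OF U]) auto
        finally show False using that by simp
      qed
    qed
    consider "d = 0" | "0 < d" "exp (- \<rho> 0) \<le> d" | "0 < d" "d < exp (- \<rho> 0)" using d0 by linarith
    then show ?thesis
    proof cases
      case 1
      \<comment> \<open>A set of diameter 0 has weight 0, so its preimage must be null: it fixes all
        the choices, and the masses of the cylinders tend to 0.\<close>
      let ?W = "\<Inter>s. cyl x s"
      have "emeasure ?M ?W \<le> 0"
      proof (rule tendsto_lowerbound)
        have "filterlim (\<lambda>s. h * \<rho> (Suc s)) at_top sequentially"
          by (rule filterlim_tendsto_pos_mult_at_top[OF tendsto_const h filterlim_compose[OF \<rho> filterlim_Suc]])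
        then have "filterlim (\<lambda>s. - (h * \<rho> (Suc s))) at_bot sequentially"
          by (simp add: filterlim_uminus_at_bot)
        then have "(\<lambda>s. exp (- (h * \<rho> (Suc s)))) \<longlonglongrightarrow> 0"
          by (rule filterlim_compose[OF exp_at_bot])
        then have lim0: "(\<lambda>s. exp C * exp (- (h * \<rho> (Suc s)))) \<longlonglongrightarrow> 0"
          by (rule tendsto_mult_right_zero)
        have "(\<lambda>s. exp (- (\<Sum>i\<le>s. ln (real (b i))))) \<longlonglongrightarrow> 0"
        proof (rule tendsto_sandwich[OF _ _ tendsto_const lim0])
          show "eventually (\<lambda>s. exp (- (\<Sum>i\<le>s. ln (real (b i)))) \<le> exp C * exp (- (h * \<rho> (Suc s)))) sequentially"
          proof (rule always_eventually, rule allI)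
            fix s show "exp (- (\<Sum>i\<le>s. ln (real (b i)))) \<le> exp C * exp (- (h * \<rho> (Suc s)))"
              unfolding exp_add[symmetric] using H[of s] by simp
          qed
        qed simp
        then show "((\<lambda>s. ennreal (exp (- (\<Sum>i\<le>s. ln (real (b i)))))) \<longlongrightarrow> 0) sequentially"
          by (metis ennreal_0 tendsto_ennrealI)
        have "emeasure ?M ?W \<le> emeasure ?M (cyl x s)" for s
          by (intro emeasure_mono cyl_sets) auto
        then show "eventually (\<lambda>s. emeasure ?M ?W \<le> ennreal (exp (- (\<Sum>i\<le>s. ln (real (b i)))))) sequentially"
          using cyl_meas[OF x(1)] by simp
      qed simp
      moreover have "{\<xi>. (\<forall>s. \<xi> s < b s) \<and> \<Phi> \<xi> \<in> U} \<subseteq> ?W"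
        using in_cyl 1 by (auto simp del: Collect_mem_eq)
      moreover have "?W \<in> sets ?M" using cyl_sets by (intro sets.countable_INT) auto
      ultimately show ?thesis by (intro exI[of _ ?W]) (auto intro: order_trans)
    next
      case 2
      have "1 = exp (h * \<rho> 0) * exp (- \<rho> 0) powr h"
        by (simp add: powr_def exp_minus[symmetric] exp_add[symmetric])
      also have "\<dots> \<le> K * d powr h"
        using 2 h by (intro mult_mono powr_mono2) (use K K_ge in auto)
      finally have "ennreal 1 \<le> ennreal (K * d powr h)" by (rule ennreal_leI)
      then show ?thesis
        using K M.emeasure_space_1 sp by (intro exI[of _ UNIV]) (auto simp: dp ennreal_mult sets.top[of ?M, unfolded sp])
    next
      case 3
      have "eventually (\<lambda>s. - ln d < \<rho> s) sequentially"
        using \<rho> by (simp add: filterlim_at_top_dense)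
      then obtain s1 where "- ln d < \<rho> s1" by (metis eventually_happens' trivial_limit_sequentially)
      then have "exp (- \<rho> s1) < d" using 3 by (metis exp_less_cancel_iff exp_ln minus_less_iff)
      then have ex: "\<exists>s. \<not> d < exp (- \<rho> (Suc s))"
      proof (cases s1)
        case (Suc s)
        then have "\<not> d < exp (- \<rho> (Suc s))" using \<open>exp (- \<rho> s1) < d\<close> by simp
        then show ?thesis by blast
      qed (use 3 \<open>exp (- \<rho> s1) < d\<close> in auto)
      define s where "s = (LEAST s. \<not> d < exp (- \<rho> (Suc s)))"
      have s: "exp (- \<rho> (Suc s)) \<le> d" using LeastI_ex[OF ex] by (simp add: s_def)
      have s': "d < exp (- \<rho> s)"
        using 3 not_less_Least[of "s - 1" "\<lambda>s. \<not> d < exp (- \<rho> (Suc s))"] by (cases s) (auto simp: s_def[symmetric])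
      have "emeasure ?M (cyl x s) = ennreal (exp (- (\<Sum>i\<le>s. ln (real (b i)))))"
        by (rule cyl_meas[OF x(1)])
      also have "\<dots> \<le> ennreal (K * d powr h)"
      proof (rule ennreal_leI)
        have "exp (- (\<Sum>i\<le>s. ln (real (b i)))) \<le> exp (C - h * \<rho> (Suc s))" using H[of s] by simp
        also have "\<dots> = exp C * exp (- \<rho> (Suc s)) powr h" by (simp add: powr_def exp_add[symmetric])
        also have "\<dots> \<le> K * d powr h"
          using s h by (intro mult_mono powr_mono2) (use K K_ge in auto)
        finally show "exp (- (\<Sum>i\<le>s. ln (real (b i)))) \<le> K * d powr h" .
      qed
      finally show ?thesis
        using in_cyl[OF s'] cyl_sets[of x s] K by (intro exI[of _ "cyl x s"]) (simp add: dp ennreal_mult)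
    qed
  qed
  have valid: "emeasure ?M {\<xi>. \<forall>s. \<xi> s < b s} = 1"
  proof -
    have "AE \<xi> in ?M. \<xi> s < b s" for s
    proof (rule AE_PiM_component)
      show "AE y in measure_pmf (pmf_of_set {..<b s}). y < b s" using ne by (simp add: AE_measure_pmf_iff)
    qed (auto intro: prob_space_measure_pmf)
    then have "AE \<xi> in ?M. \<forall>s. \<xi> s < b s" by (simp add: AE_all_countable)
    moreover have "{\<xi> \<in> space ?M. \<forall>s. \<xi> s < b s} \<in> sets ?M"
    proof (intro sets.sets_Collect_countable_All)
      fix s
      have "(\<lambda>\<xi>. \<xi> s) -` {..<b s} \<inter> space ?M \<in> sets ?M"
        by (rule measurable_sets[OF measurable_component_singleton]) auto
      then show "{\<xi> \<in> space ?M. \<xi> s < b s} \<in> sets ?M" by (simp add: vimage_def Int_def conj_commute)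
    qed
    ultimately show ?thesis using M.emeasure_eq_1_AE[of "{\<xi>. \<forall>s. \<xi> s < b s}"] by (simp add: sp)
  qed
  have "ennreal (1 / K) \<le> hausdorff_premeasure 1 h T"
    unfolding hausdorff_premeasure_def
  proof (rule INF_greatest)
    fix U :: "nat \<Rightarrow> 'a set" assume U: "U \<in> {U. T \<subseteq> (\<Union>i. U i) \<and> (\<forall>i. bounded (U i) \<and> diameter (U i) \<le> 1)}"
    then have "\<forall>i. \<exists>W. W \<in> sets ?M \<and> {\<xi>. (\<forall>s. \<xi> s < b s) \<and> \<Phi> \<xi> \<in> U i} \<subseteq> W \<and> emeasure ?M W \<le> ennreal K * diam_power h (U i)"
      using W by blast
    from choice[OF this] obtain V where V: "\<And>i. V i \<in> sets ?M" "\<And>i. {\<xi>. (\<forall>s. \<xi> s < b s) \<and> \<Phi> \<xi> \<in> U i} \<subseteq> V i"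
      "\<And>i. emeasure ?M (V i) \<le> ennreal K * diam_power h (U i)" by blast
    have "{\<xi>. \<forall>s. \<xi> s < b s} \<subseteq> (\<Union>i. V i)"
    proof
      fix \<xi> assume xi: "\<xi> \<in> {\<xi>. \<forall>s. \<xi> s < b s}"
      then have "\<Phi> \<xi> \<in> T" by (intro mem) auto
      then obtain i where "\<Phi> \<xi> \<in> U i" using U by blast
      then show "\<xi> \<in> (\<Union>i. V i)" using V(2)[of i] xi by blast
    qed
    then have "1 \<le> emeasure ?M (\<Union>i. V i)"
      unfolding valid[symmetric] using V(1) by (intro emeasure_mono) auto
    also have "\<dots> \<le> (\<Sum>i. emeasure ?M (V i))"
      using V(1) by (intro emeasure_subadditive_countably) auto
    also have "\<dots> \<le> (\<Sum>i. ennreal K * diam_power h (U i))"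
      using V(3) by (intro suminf_le) auto
    also have "\<dots> = ennreal K * (\<Sum>i. diam_power h (U i))" by simp
    finally have "ennreal (1 / K) * 1 \<le> ennreal (1 / K) * (ennreal K * (\<Sum>i. diam_power h (U i)))"
      by (rule mult_left_mono) simp
    also have "\<dots> = (\<Sum>i. diam_power h (U i))"
      unfolding mult.assoc[symmetric] using K by (simp add: ennreal_mult[symmetric])
    finally show "ennreal (1 / K) \<le> (\<Sum>i. diam_power h (U i))" by simp
  qed
  also have "\<dots> \<le> hausdorff_measure h T"
    unfolding hausdorff_measure_def by (rule SUP_upper) simp
  finally show ?thesis using K by (auto simp: ennreal_eq_0_iff)
qed

text \<open>Multiplication by \<open>g\<close> erases at most \<open>word_length g\<close> letters
  from the end.\<close>

lemma take_word_mult: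
  "j + word_length g \<le> word_length x \<Longrightarrow> take j (word (x * g)) = take j (word x)"
proof (induction "word g" arbitrary: g x)
  case Nil
  then have "g = 1" by (metis word_eq_Nil_iff)
  then show ?case by simp
next
  case (Cons l w)
  obtain y z where yz: "g = y * z" "red_concat y z" "word y = [l]" "word z = w"
    using factor_word[of g "[l]" w] Cons(2) by auto
  have y: "y = of_letter l" using yz(3) by (metis word_inject word_of_letter)
  have lg: "word_length g = Suc (word_length z)" by (simp add: word_length_def Cons(2)[symmetric] yz(4))
  have lx: "word_length x \<le> Suc (word_length (x * y))" using word_length_mult_ge[of x y] by (simp add: y)
  have "take j (word (x * g)) = take j (word ((x * y) * z))" by (simp add: yz(1) mult.assoc)
  also have "\<dots> = take j (word (x * y))"
    using Cons(3) lg lx by (intro Cons(1)) (auto simp: yz(4))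
  also have "\<dots> = take j (word x)"
    using Cons(3) lg by (simp add: y word_mult_letter word_length_def take_butlast)
  finally show ?case .
qed

lemma liminf_ereal_eqI:
  fixes x :: "nat \<Rightarrow> real"
  assumes "\<And>\<epsilon>. 0 < \<epsilon> \<Longrightarrow> eventually (\<lambda>n. c - \<epsilon> \<le> x n) sequentially"
    and "\<And>\<epsilon>. 0 < \<epsilon> \<Longrightarrow> frequently (\<lambda>n. x n \<le> c + \<epsilon>) sequentially"
  shows "liminf (\<lambda>n. ereal (x n)) = ereal c"
proof (rule antisym)
  show "liminf (\<lambda>n. ereal (x n)) \<le> ereal c"
  proof (rule ereal_le_epsilon2)
    fix \<epsilon> :: real assume "0 < \<epsilon>"
    show "liminf (\<lambda>n. ereal (x n)) \<le> ereal c + ereal \<epsilon>"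
    proof (rule ccontr)
      assume "\<not> ?thesis"
      then have "ereal (c + \<epsilon>) < liminf (\<lambda>n. ereal (x n))" by simp
      then have "eventually (\<lambda>n. ereal (c + \<epsilon>) < ereal (x n)) sequentially" by (rule less_LiminfD)
      then have "\<not> frequently (\<lambda>n. x n \<le> c + \<epsilon>) sequentially" by (simp add: frequently_def not_le)
      then show False using assms(2)[OF \<open>0 < \<epsilon>\<close>] by simp
    qed
  qed
  show "ereal c \<le> liminf (\<lambda>n. ereal (x n))"
  proof (rule ereal_le_epsilon2)
    fix \<epsilon> :: real assume "0 < \<epsilon>"
    then have "ereal (c - \<epsilon>) \<le> liminf (\<lambda>n. ereal (x n))"
      using assms(1) by (intro Liminf_bounded) auto
    then have "ereal (c - \<epsilon>) + ereal \<epsilon> \<le> liminf (\<lambda>n. ereal (x n)) + ereal \<epsilon>" by (rule add_right_mono)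
    then show "ereal c \<le> liminf (\<lambda>n. ereal (x n)) + ereal \<epsilon>" by simp
  qed
qed

lemma limsup_ereal_eqI:
  fixes x :: "nat \<Rightarrow> real"
  assumes "\<And>\<epsilon>. 0 < \<epsilon> \<Longrightarrow> eventually (\<lambda>n. x n \<le> c + \<epsilon>) sequentially"
    and "\<And>\<epsilon>. 0 < \<epsilon> \<Longrightarrow> frequently (\<lambda>n. c - \<epsilon> \<le> x n) sequentially"
  shows "limsup (\<lambda>n. ereal (x n)) = ereal c"
proof -
  have "liminf (\<lambda>n. ereal (- x n)) = ereal (- c)"
  proof (rule liminf_ereal_eqI)
    fix \<epsilon> :: real assume e: "0 < \<epsilon>"
    show "eventually (\<lambda>n. - c - \<epsilon> \<le> - x n) sequentially"
      using assms(1)[OF e] by eventually_elim simp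
    show "frequently (\<lambda>n. - x n \<le> - c + \<epsilon>) sequentially"
      using assms(2)[OF e] by (rule frequently_elim1) simp
  qed
  moreover have "liminf (\<lambda>n. ereal (- x n)) = - limsup (\<lambda>n. ereal (x n))"
    using ereal_Liminf_uminus[of sequentially "\<lambda>n. ereal (x n)"] by simp
  ultimately show ?thesis by (metis ereal_uminus_uminus uminus_ereal.simps(1))
qed

lemma word_length_pos_le:
  assumes "\<And>u. word_length (snd (\<omega> u)) \<le> 1"
  shows "word_length (pos \<omega> w) \<le> length w"
proof (induction w rule: rev_induct)
  case (snoc k w)
  have "word_length (pos \<omega> (w @ [k])) \<le> word_length (pos \<omega> w) + word_length (snd (\<omega> (w @ [k])))"
    unfolding pos_snoc by (rule word_length_mult_le)
  also have "\<dots> \<le> length w + 1" using snoc assms by (intro add_mono) auto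
  finally show ?case by simp
qed simp

subsection \<open>Rays through good environments\<close>

definition LambdaE :: "'g environment \<Rightarrow> real \<Rightarrow> real \<Rightarrow> 'g boundary set" where
  "LambdaE \<omega> = Lambda (\<lambda>u. fst (\<omega> u)) (\<lambda>u. snd (\<omega> u))"

context branching
begin

lemma goodI_snd: "sh w \<omega> \<in> goodI s \<Longrightarrow> snd (\<omega> w) = la"
  using subsetD[OF goodI_root_a, of "sh w \<omega>" s] by (simp add: root_a_def)

end

text \<open>The schedule \<open>c\<close> of types is prescribed for a fixed environment. The
  position of \<open>v0\<close> ends with \<open>l0\<close>, so any good word can follow, and the
  closing letter of each step restores this situation.\<close>

locale regular_rays = branching \<mu> r L p for \<mu> :: "'g::finite free_group pmf" and r L p +
  fixes \<omega> :: "'g environment" and v0 :: "nat list" and c :: "nat \<Rightarrow> nat"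
  assumes N: "\<And>u. 1 \<le> fst (\<omega> u)" and Y: "\<And>u. word_length (snd (\<omega> u)) \<le> 1"
    and v0: "v0 \<in> tree \<omega>" "sh v0 \<omega> \<in> goodI 0" "pos \<omega> v0 \<noteq> 1" "last (word (pos \<omega> v0)) = l0"
    and c: "\<And>s. c s \<le> kap s"
begin

definition bs :: "nat \<Rightarrow> nat" where "bs s = s\<beta> (kap s) (c s)"
definition ns :: "nat \<Rightarrow> nat" where "ns s = sn (kap s) (c s)"
definition ms :: "nat \<Rightarrow> nat" where "ms s = sm (kap s) (c s)"

definition ext :: "nat \<Rightarrow> nat list \<Rightarrow> nat list \<Rightarrow> bool" where
  "ext s v w \<longleftrightarrow> (\<exists>u. w = v @ u @ [0] \<and> u \<in> tree (sh v \<omega>) \<and> length u = ns s \<and>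
     pos (sh v \<omega>) u \<in> good_words (ms s) \<and> sh w \<omega> \<in> goodI (Suc s))"

text \<open>The positions, and not only the vertices, are required to be different, since it is the
  limits in the boundary that have to be separated.\<close>

definition okf :: "nat \<Rightarrow> nat list \<Rightarrow> (nat \<Rightarrow> nat list) \<Rightarrow> bool" where
  "okf s v f \<longleftrightarrow> (\<forall>j<bs s. ext s v (f j)) \<and> inj_on (\<lambda>j. pos \<omega> (f j)) {..<bs s}"

definition nx :: "nat \<Rightarrow> nat list \<Rightarrow> nat \<Rightarrow> nat list" where
  "nx s v = (SOME f. okf s v f)"

lemma ext_pos:
  assumes "ext s v w" "v \<in> tree \<omega>" "pos \<omega> v \<noteq> 1" "last (word (pos \<omega> v)) = l0"
  shows "w \<in> tree \<omega>" "sh w \<omega> \<in> goodI (Suc s)" "pos \<omega> w \<noteq> 1" "last (word (pos \<omega> w)) = l0"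
    "length w = length v + ns s + 1" "word_length (pos \<omega> w) = word_length (pos \<omega> v) + ms s + 1"
    "prefix v w" "prefix (word (pos \<omega> v)) (word (pos \<omega> w))"
proof -
  obtain u where u: "w = v @ u @ [0]" "u \<in> tree (sh v \<omega>)" "length u = ns s"
     "pos (sh v \<omega>) u \<in> good_words (ms s)" "sh w \<omega> \<in> goodI (Suc s)"
    using assms(1) unfolding ext_def by blast
  let ?x = "pos (sh v \<omega>) u"
  have "v @ u \<in> tree \<omega>" using u assms by (simp add: tree_append)
  then show "w \<in> tree \<omega>"
    using N[of "v @ u"] tree_append[of "v @ u" "[0]" \<omega>] u(1) by simp
  show "sh w \<omega> \<in> goodI (Suc s)" by (rule u)
  then have "snd (\<omega> w) = la" by (rule goodI_snd)
  then have p: "pos \<omega> w = pos \<omega> v * (?x * la)"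
    using pos_snoc[of \<omega> "v @ u" 0] by (simp add: u(1) pos_append mult.assoc)
  have xa: "?x * la \<in> good_words (ms s + 1)" by (rule good_words_mult[OF u(4) good_words_l0])
  have wx: "word (?x * la) = word ?x @ [l0]"
    using word_mult_red[OF good_words_red_concat[OF u(4) good_words_l0]] by simp
  have "red_concat (pos \<omega> v) (?x * la)"
    using xa assms(4) by (auto simp: red_concat_iff good_words_def)
  then have w: "word (pos \<omega> w) = word (pos \<omega> v) @ word ?x @ [l0]"
    by (simp add: p word_mult_red wx)
  then show "pos \<omega> w \<noteq> 1" by (metis word_one Nil_is_append_conv list.distinct(1))
  show "last (word (pos \<omega> w)) = l0" "prefix (word (pos \<omega> v)) (word (pos \<omega> w))" by (simp_all add: w)
  show "length w = length v + ns s + 1" "prefix v w" using u by auto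
  show "word_length (pos \<omega> w) = word_length (pos \<omega> v) + ms s + 1"
    using u(4) by (simp add: word_length_def w good_words_def)
qed

lemma okf_nx:
  assumes "v \<in> tree \<omega>" "sh v \<omega> \<in> goodI s"
  shows "okf s v (nx s v)"
proof -
  let ?K = "kids (ns s) (good_words (ms s)) (goodI (Suc s)) (sh v \<omega>)"
  have card: "bs s \<le> card ?K"
    unfolding bs_def ns_def ms_def by (rule goodI_kids[OF assms(2) c])
  have fin: "finite ?K" by (rule finite_subset[OF kids_subset finite_good_words])
  obtain g where g: "bij_betw g {0..<card ?K} ?K"
    using ex_bij_betw_nat_finite[OF fin] by blast
  have "\<exists>u. u \<in> tree (sh v \<omega>) \<and> length u = ns s \<and> pos (sh v \<omega>) u = x \<and> sh (v @ u @ [0]) \<omega> \<in> goodI (Suc s)"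
    if "x \<in> ?K" for x
    using that by (auto simp: kids_def)
  then have "\<forall>x\<in>?K. \<exists>u. u \<in> tree (sh v \<omega>) \<and> length u = ns s \<and> pos (sh v \<omega>) u = x \<and> sh (v @ u @ [0]) \<omega> \<in> goodI (Suc s)"
    by blast
  from bchoice[OF this] obtain q where q: "\<forall>x\<in>?K. q x \<in> tree (sh v \<omega>) \<and> length (q x) = ns s \<and> pos (sh v \<omega>) (q x) = x \<and> sh (v @ q x @ [0]) \<omega> \<in> goodI (Suc s)" ..
  define f where "f j = v @ q (g j) @ [0]" for j
  have gK: "g j \<in> ?K" if "j < bs s" for j
    using g that card by (auto simp: bij_betw_def)
  have p: "pos \<omega> (f j) = pos \<omega> v * (g j * la)" if "j < bs s" for j
  proof -
    note qj = q[rule_format, OF gK[OF that]]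
    then have "snd (\<omega> (f j)) = la" using goodI_snd[of "f j" \<omega> "Suc s"] by (simp add: f_def)
    then have "snd (\<omega> ((v @ q (g j)) @ [0])) = la" by (simp add: f_def)
    moreover have "pos \<omega> (f j) = pos \<omega> ((v @ q (g j)) @ [0])" by (simp add: f_def)
    ultimately have "pos \<omega> (f j) = pos \<omega> (v @ q (g j)) * la" by (simp only: pos_snoc)
    moreover have "pos \<omega> (v @ q (g j)) = pos \<omega> v * g j"
      unfolding pos_append using qj by (simp only:)
    ultimately show ?thesis by (simp only: mult.assoc)
  qed
  have "okf s v f"
    unfolding okf_def
  proof (intro conjI allI impI inj_onI)
    fix j assume "j < bs s"
    note qj = q[rule_format, OF gK[OF this]] and gj = gK[OF this]
    show "ext s v (f j)"
      unfolding ext_def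
    proof (intro exI[of _ "q (g j)"] conjI)
      show "f j = v @ q (g j) @ [0]" by (rule f_def)
      show "pos (sh v \<omega>) (q (g j)) \<in> good_words (ms s)"
        using qj subsetD[OF kids_subset gj] by (simp only:)
      show "sh (f j) \<omega> \<in> goodI (Suc s)" using qj by (simp only: f_def)
    qed (use qj in \<open>simp_all only:\<close>)
  next
    fix j j' assume j: "j \<in> {..<bs s}" "j' \<in> {..<bs s}" "pos \<omega> (f j) = pos \<omega> (f j')"
    then have "g j = g j'" using p[of j] p[of j'] by simp
    moreover have "j \<in> {0..<card ?K}" "j' \<in> {0..<card ?K}" using j card by auto
    ultimately show "j = j'" using bij_betw_imp_inj_on[OF g] by (simp only: inj_on_eq_iff)
  qed
  then show ?thesis unfolding nx_def by (rule someI[of "okf s v"])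
qed

primrec vert :: "(nat \<Rightarrow> nat) \<Rightarrow> nat \<Rightarrow> nat list" where
  "vert \<xi> 0 = v0"
| "vert \<xi> (Suc s) = nx s (vert \<xi> s) (\<xi> s)"

definition W0 :: nat where "W0 = word_length (pos \<omega> v0)"
definition \<sigma> :: "nat \<Rightarrow> nat" where "\<sigma> s = (\<Sum>i<s. ms i + 1)"
definition \<kappa> :: "nat \<Rightarrow> nat" where "\<kappa> s = (\<Sum>i<s. ns i + 1)"

lemma \<sigma>_Suc: "\<sigma> (Suc s) = \<sigma> s + ms s + 1" and \<kappa>_Suc: "\<kappa> (Suc s) = \<kappa> s + ns s + 1"
  by (simp_all add: \<sigma>_def \<kappa>_def)

lemma \<sigma>_ge: "s \<le> \<sigma> s" and \<kappa>_ge: "s \<le> \<kappa> s"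
  by (induction s) (auto simp: \<sigma>_Suc \<kappa>_Suc \<sigma>_def \<kappa>_def)

text \<open>Each stage adds at least one letter, so the stage number \<open>m\<close> already
  determines \<open>m\<close> letters of the limit; the same device gives \<open>tr\<close> from the
  generations.\<close>

definition Rw :: "(nat \<Rightarrow> nat) \<Rightarrow> nat \<Rightarrow> 'g letter list" where
  "Rw \<xi> m = take m (word (pos \<omega> (vert \<xi> m)))"

definition bd :: "(nat \<Rightarrow> nat) \<Rightarrow> 'g boundary" where
  "bd \<xi> = Abs_boundary (\<lambda>m. Abs_free_group (Rw \<xi> m))"

definition tr :: "(nat \<Rightarrow> nat) \<Rightarrow> nat \<Rightarrow> nat list" where
  "tr \<xi> n = take n (vert \<xi> n)"

context
  fixes \<xi> :: "nat \<Rightarrow> nat"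
  assumes \<xi>: "\<And>s. \<xi> s < bs s"
begin

lemma vert_props:
  "vert \<xi> s \<in> tree \<omega> \<and> sh (vert \<xi> s) \<omega> \<in> goodI s \<and> pos \<omega> (vert \<xi> s) \<noteq> 1 \<and> last (word (pos \<omega> (vert \<xi> s))) = l0 \<and>
   length (vert \<xi> s) = length v0 + \<kappa> s \<and> word_length (pos \<omega> (vert \<xi> s)) = W0 + \<sigma> s"
proof (induction s)
  case 0
  then show ?case using v0 by (simp add: W0_def \<sigma>_def \<kappa>_def)
next
  case (Suc s)
  then have e: "ext s (vert \<xi> s) (vert \<xi> (Suc s))"
    using okf_nx[of "vert \<xi> s" s] \<xi>[of s] by (simp add: okf_def)
  show ?case
    using ext_pos[OF e] Suc by (simp add: \<sigma>_Suc \<kappa>_Suc)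
qed

lemma vert_ext: "ext s (vert \<xi> s) (vert \<xi> (Suc s))"
  using okf_nx[of "vert \<xi> s" s] \<xi>[of s] vert_props[of s] by (simp add: okf_def)

lemma vert_prefix: "s \<le> t \<Longrightarrow> prefix (vert \<xi> s) (vert \<xi> t)"
proof (induction t rule: nat_induct)
  case (Suc t)
  have "prefix (vert \<xi> t) (vert \<xi> (Suc t))" using ext_pos(7)[OF vert_ext[of t]] vert_props[of t] by simp
  then show ?case
    using Suc prefix_order.trans[of "vert \<xi> s" "vert \<xi> t" "vert \<xi> (Suc t)"]
    by (cases "s = Suc t") (simp_all del: vert.simps)
qed simp

lemma vert_word_prefix: "s \<le> t \<Longrightarrow> prefix (word (pos \<omega> (vert \<xi> s))) (word (pos \<omega> (vert \<xi> t)))"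
proof (induction t rule: nat_induct)
  case (Suc t)
  have "prefix (word (pos \<omega> (vert \<xi> t))) (word (pos \<omega> (vert \<xi> (Suc t))))" using ext_pos(8)[OF vert_ext[of t]] vert_props[of t] by simp
  then show ?case
    using Suc prefix_order.trans[of "word (pos \<omega> (vert \<xi> s))" "word (pos \<omega> (vert \<xi> t))" "word (pos \<omega> (vert \<xi> (Suc t)))"]
    by (cases "s = Suc t") (simp_all del: vert.simps)
qed simp

lemma length_vert_word: "length (word (pos \<omega> (vert \<xi> s))) = W0 + \<sigma> s"
  using vert_props[of s] by (simp add: word_length_def)

lemma Rw_eq: "m \<le> W0 + \<sigma> s \<Longrightarrow> take m (word (pos \<omega> (vert \<xi> s))) = Rw \<xi> m"
proof -
  assume m: "m \<le> W0 + \<sigma> s"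
  have *: "take m xs = take m ys" if "prefix xs ys" "m \<le> length xs" for xs ys :: "'g letter list"
    using that by (auto simp: prefix_def)
  show ?thesis
    unfolding Rw_def
  proof (cases "m \<le> s")
    case True
    then show "take m (word (pos \<omega> (vert \<xi> s))) = take m (word (pos \<omega> (vert \<xi> m)))"
      using \<sigma>_ge[of m] by (intro *[symmetric] vert_word_prefix) (auto simp: length_vert_word)
  next
    case False
    then show "take m (word (pos \<omega> (vert \<xi> s))) = take m (word (pos \<omega> (vert \<xi> m)))"
      using m by (intro * vert_word_prefix) (auto simp: length_vert_word)
  qed
qed

lemma length_Rw: "length (Rw \<xi> m) = m"
  unfolding Rw_def using \<sigma>_ge[of m] by (simp add: length_vert_word)

lemma reduced_Rw: "reduced (Rw \<xi> m)"
  using reduced_word[of "pos \<omega> (vert \<xi> m)"] reduced_append_iff[of "Rw \<xi> m" "drop m (word (pos \<omega> (vert \<xi> m)))"]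
  by (simp add: Rw_def)

lemma word_ray_bd: "word (ray (bd \<xi>) m) = Rw \<xi> m"
proof -
  have w: "word (Abs_free_group (Rw \<xi> m)) = Rw \<xi> m" for m
    by (rule word_Abs[OF reduced_Rw])
  have "(\<lambda>m. Abs_free_group (Rw \<xi> m)) \<in> {\<omega>. \<omega> 0 = 1 \<and> (\<forall>m. word_length (\<omega> m) = m \<and> is_prefix (\<omega> m) (\<omega> (Suc m)))}"
  proof (intro CollectI conjI allI)
    show "Abs_free_group (Rw \<xi> 0) = 1"
      using w[of 0] length_Rw[of 0] by (metis length_0_conv word_eq_Nil_iff)
    show "word_length (Abs_free_group (Rw \<xi> m)) = m" for m by (simp add: word_length_def w length_Rw)
    show "is_prefix (Abs_free_group (Rw \<xi> m)) (Abs_free_group (Rw \<xi> (Suc m)))" for m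
    proof -
      have "Rw \<xi> m = take m (word (pos \<omega> (vert \<xi> (Suc m))))" "Rw \<xi> (Suc m) = take (Suc m) (word (pos \<omega> (vert \<xi> (Suc m))))"
        using \<sigma>_ge[of "Suc m"] by (intro Rw_eq[symmetric]; simp)+
      then have "Rw \<xi> m = take m (Rw \<xi> (Suc m))" by simp
      then show ?thesis by (metis is_prefix_def take_is_prefix w)
    qed
  qed
  then show ?thesis unfolding bd_def by (simp only: Abs_boundary_inverse w)
qed

lemma tr_eq: "n \<le> length v0 + \<kappa> s \<Longrightarrow> tr \<xi> n = take n (vert \<xi> s)"
proof -
  assume n: "n \<le> length v0 + \<kappa> s"
  have len: "length (vert \<xi> t) = length v0 + \<kappa> t" for t using vert_props by blast
  have *: "take n xs = take n ys" if "prefix xs ys" "n \<le> length xs" for xs ys :: "nat list"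
    using that by (auto simp: prefix_def)
  show ?thesis
    unfolding tr_def
  proof (cases "n \<le> s")
    case True
    then show "take n (vert \<xi> n) = take n (vert \<xi> s)"
      using \<kappa>_ge[of n] by (intro * vert_prefix) (auto simp: len)
  next
    case False
    then show "take n (vert \<xi> n) = take n (vert \<xi> s)"
      using n by (intro *[symmetric] vert_prefix) (auto simp: len)
  qed
qed

lemma tr_rays: "tr \<xi> \<in> tree_rays (tree \<omega>)"
  unfolding tree_rays_def
proof (intro CollectI conjI allI)
  show "tr \<xi> 0 = []" by (simp add: tr_def)
  fix n
  show "tr \<xi> n \<in> tree \<omega>" unfolding tr_def using vert_props by (intro tree_take) blast
  have "n < length (vert \<xi> (Suc n))" using vert_props[of "Suc n"] \<kappa>_ge[of "Suc n"] by linarith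
  then have "take (Suc n) (vert \<xi> (Suc n)) = take n (vert \<xi> (Suc n)) @ [vert \<xi> (Suc n) ! n]"
    by (rule take_Suc_conv_app_nth)
  moreover have "tr \<xi> n = take n (vert \<xi> (Suc n))"
    using \<kappa>_ge[of "Suc n"] by (intro tr_eq) linarith
  ultimately show "\<exists>k. tr \<xi> (Suc n) = tr \<xi> n @ [k]" by (auto simp: tr_def[of \<xi> "Suc n"])
qed

lemma tr_stage:
  assumes "length v0 + \<kappa> s \<le> n" "n \<le> length v0 + \<kappa> (Suc s)"
  obtains g where "pos \<omega> (tr \<xi> n) = pos \<omega> (vert \<xi> s) * g" "word_length g \<le> ns s + 1"
proof -
  have len: "length (vert \<xi> t) = length v0 + \<kappa> t" for t using vert_props by blast
  obtain w where w: "vert \<xi> (Suc s) = vert \<xi> s @ w"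
    using vert_prefix[of s "Suc s"] by (auto simp: prefix_def simp del: vert.simps)
  have "length w = ns s + 1" using len[of s] len[of "Suc s"] by (simp add: w \<kappa>_Suc del: vert.simps)
  define w' where "w' = take (n - length (vert \<xi> s)) w"
  have "tr \<xi> n = vert \<xi> s @ w'"
    using tr_eq[OF assms(2)] assms(1) by (simp add: w w'_def len del: vert.simps)
  then have "pos \<omega> (tr \<xi> n) = pos \<omega> (vert \<xi> s) * pos (sh (vert \<xi> s) \<omega>) w'" by (simp add: pos_append)
  moreover have "word_length (pos (sh (vert \<xi> s) \<omega>) w') \<le> ns s + 1"
    using word_length_pos_le[of "sh (vert \<xi> s) \<omega>" w'] Y \<open>length w = ns s + 1\<close> by (simp add: sh_apply w'_def)
  ultimately show ?thesis using that by blast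
qed

lemma stage_exists:
  assumes "length v0 + \<kappa> s0 \<le> n"
  obtains s where "s0 \<le> s" "length v0 + \<kappa> s \<le> n" "n \<le> length v0 + \<kappa> (Suc s)"
proof -
  have ex: "\<exists>s. n < length v0 + \<kappa> s" using \<kappa>_ge[of "Suc n"] by (intro exI[of _ "Suc n"]) linarith
  define t where "t = (LEAST s. n < length v0 + \<kappa> s)"
  have t: "n < length v0 + \<kappa> t" unfolding t_def by (rule LeastI_ex[OF ex])
  have mono: "a \<le> b \<Longrightarrow> \<kappa> a \<le> \<kappa> b" for a b
    unfolding \<kappa>_def by (intro sum_mono2) auto
  have "s0 < t" using mono[of t s0] t assms by (cases "s0 < t") auto
  then obtain s where s: "t = Suc s" "s0 \<le> s" by (cases t) auto
  moreover have "\<not> n < length v0 + \<kappa> s" using not_less_Least[of s "\<lambda>s. n < length v0 + \<kappa> s"] s by (simp add: t_def[symmetric])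
  ultimately show ?thesis using that[of s] t by simp
qed

end

text \<open>By \<open>kap_Ks\<close> a step multiplied by \<open>kap s + 1\<close> is at most
  \<open>s\<close>, and \<open>kap\<close> is unbounded.\<close>

lemma steps_small:
  assumes "0 < \<epsilon>"
  shows "eventually (\<lambda>s. real (ns s + ms s + 2) \<le> \<epsilon> * real s) sequentially"
proof -
  obtain Z :: nat where Z: "1 / \<epsilon> \<le> real Z" using real_arch_simple by blast
  have "eventually (\<lambda>s. max 1 Z \<le> kap s) sequentially"
    using kap_at_top unfolding filterlim_at_top by blast
  then show ?thesis
  proof eventually_elim
    case (elim s)
    have "ns s + ms s + 2 \<le> Ks (kap s)" unfolding ns_def ms_def by (rule Ks[OF c])
    moreover have "(kap s + 1) * Ks (kap s) \<le> s" using kap_Ks[of s] elim by auto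
    ultimately have "(kap s + 1) * (ns s + ms s + 2) \<le> s"
      using mult_le_mono2[of "ns s + ms s + 2" "Ks (kap s)" "kap s + 1"] by linarith
    then have "real (kap s + 1) * real (ns s + ms s + 2) \<le> real s"
      by (metis of_nat_le_iff of_nat_mult)
    moreover have "1 / \<epsilon> \<le> real (kap s + 1)" using Z elim by simp
    ultimately have "1 / \<epsilon> * real (ns s + ms s + 2) \<le> real s"
      using mult_right_mono[of "1 / \<epsilon>" "real (kap s + 1)" "real (ns s + ms s + 2)"] by linarith
    then show ?case using assms by (simp add: field_simps)
  qed
qed

context
  fixes \<xi> :: "nat \<Rightarrow> nat"
  assumes \<xi>: "\<And>s. \<xi> s < bs s"
begin

text \<open>During stage \<open>s\<close> the path departs from its starting word by at most
  \<open>ns s + 1\<close> letters. Eventually this is at most half of \<open>s\<close>, while the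
  word has at least \<open>s\<close> letters, so a long prefix remains untouched.\<close>

lemma tends_to_bd: "tends_to_boundary (\<lambda>n. pos \<omega> (tr \<xi> n)) (bd \<xi>)"
  unfolding tends_to_boundary_def
proof
  fix m
  obtain s0 where s0: "\<And>s. s \<ge> s0 \<Longrightarrow> real (ns s + ms s + 2) \<le> 1 / 2 * real s"
    using steps_small[of "1 / 2"] by (auto simp: eventually_sequentially)
  show "eventually (\<lambda>n. is_prefix (ray (bd \<xi>) m) (pos \<omega> (tr \<xi> n))) sequentially"
  proof (rule eventually_sequentiallyI)
    fix n assume "length v0 + \<kappa> (max s0 (2 * m)) \<le> n"
    then obtain s where s: "max s0 (2 * m) \<le> s" "length v0 + \<kappa> s \<le> n" "n \<le> length v0 + \<kappa> (Suc s)"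
      by (rule stage_exists[OF \<xi>])
    obtain g where g: "pos \<omega> (tr \<xi> n) = pos \<omega> (vert \<xi> s) * g" "word_length g \<le> ns s + 1"
      by (rule tr_stage[OF \<xi> s(2,3)])
    have "real (m + word_length g) \<le> real s"
      using s0[of s] s(1) g(2) by auto
    then have "m + word_length g \<le> W0 + \<sigma> s" using \<sigma>_ge[of s] by linarith
    then have le: "m + word_length g \<le> word_length (pos \<omega> (vert \<xi> s))" "m \<le> W0 + \<sigma> s"
      using vert_props[OF \<xi>, of s] by auto
    have "take m (word (pos \<omega> (tr \<xi> n))) = Rw \<xi> m"
      unfolding g(1) take_word_mult[OF le(1)] by (rule Rw_eq[OF \<xi> le(2)])
    then show "is_prefix (ray (bd \<xi>) m) (pos \<omega> (tr \<xi> n))"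
      unfolding is_prefix_def word_ray_bd[OF \<xi>] by (metis take_is_prefix)
  qed
qed

text \<open>Within a stage, numerator and denominator of the speed change by at most the length of
  the step, up to constants coming from \<open>v0\<close>. This is negligible against the time, so
  the speeds at the ends of the stages decide.\<close>

lemma speed_close:
  assumes \<epsilon>: "0 < \<epsilon>"
  shows "eventually (\<lambda>s. \<forall>n. length v0 + \<kappa> s \<le> n \<longrightarrow> n \<le> length v0 + \<kappa> (Suc s) \<longrightarrow>
    \<bar>real (word_length (pos \<omega> (tr \<xi> n))) / real n - real (\<sigma> s) / real (\<kappa> s)\<bar> \<le> \<epsilon>) sequentially"
proof -
  define l where "l = real (length v0)"
  have l: "0 \<le> l" by (simp add: l_def)
  define \<delta> where "\<delta> = \<epsilon> / (2 * (2 + l))"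
  have \<delta>: "0 < \<delta>" using \<epsilon> l by (simp add: \<delta>_def)
  obtain Z :: nat where Z: "2 * (real W0 + (1 + l) * l) / \<epsilon> \<le> real Z" using real_arch_simple by blast
  show ?thesis
    using steps_small[OF \<delta>] eventually_ge_at_top[of "max 1 Z"]
  proof eventually_elim
    case (elim s)
    show ?case
    proof (intro allI impI)
      fix n assume n: "length v0 + \<kappa> s \<le> n" "n \<le> length v0 + \<kappa> (Suc s)"
      obtain g where g: "pos \<omega> (tr \<xi> n) = pos \<omega> (vert \<xi> s) * g" "word_length g \<le> ns s + 1"
        by (rule tr_stage[OF \<xi> n])
      define k where "k = real (ns s + 1)"
      define q where "q = real (word_length (pos \<omega> (tr \<xi> n)))"
      define x where "x = real (\<sigma> s)" define y where "y = real (\<kappa> s)"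
      have vp: "word_length (pos \<omega> (vert \<xi> s)) = W0 + \<sigma> s" "length (vert \<xi> s) = length v0 + \<kappa> s"
        using vert_props[OF \<xi>, of s] by auto
      have "word_length (pos \<omega> (tr \<xi> n)) \<le> W0 + \<sigma> s + (ns s + 1)"
        using word_length_mult_le[of "pos \<omega> (vert \<xi> s)" g] g vp by simp
      moreover have "W0 + \<sigma> s \<le> word_length (pos \<omega> (tr \<xi> n)) + (ns s + 1)"
        using word_length_mult_ge[of "pos \<omega> (vert \<xi> s)" g] g vp by simp
      ultimately have qx: "\<bar>q - x\<bar> \<le> real W0 + k"
        unfolding q_def x_def k_def by linarith
      have y1: "real s \<le> y" "1 \<le> y" using \<kappa>_ge[of s] elim by (auto simp: y_def)
      have ny: "y \<le> real n" "real n - y \<le> l + k"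
        using n unfolding y_def l_def k_def \<kappa>_Suc by linarith+
      have "W0 + \<sigma> s \<le> length v0 + \<kappa> s"
        using word_length_pos_le[of \<omega> "vert \<xi> s"] Y vp by simp
      then have "x \<le> l + y" unfolding x_def y_def l_def by linarith
      also have "\<dots> \<le> (1 + l) * y" using l mult_left_mono[of 1 y l] y1 by (simp add: algebra_simps)
      finally have xy: "x / y \<le> 1 + l" using y1 by (simp add: pos_divide_le_eq)
      have x0: "0 \<le> x" by (simp add: x_def)
      \<comment> \<open>The error is split into the change of the length and the change of the
        time.\<close>
      have "\<bar>q / real n - x / y\<bar> = \<bar>(q - x) / real n - (x / y) * ((real n - y) / real n)\<bar>"
        using y1 ny by (simp add: field_simps)
      also have "\<dots> \<le> \<bar>(q - x) / real n\<bar> + \<bar>(x / y) * ((real n - y) / real n)\<bar>" by (rule abs_triangle_ineq4)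
      also have "\<bar>(q - x) / real n\<bar> \<le> (real W0 + k) / y"
        using qx y1 ny by (simp add: abs_divide) (intro frac_le; simp)
      also have "\<bar>(x / y) * ((real n - y) / real n)\<bar> \<le> (1 + l) * ((l + k) / y)"
      proof -
        have "\<bar>(x / y) * ((real n - y) / real n)\<bar> = (x / y) * ((real n - y) / real n)"
          using x0 y1 ny by (intro abs_of_nonneg mult_nonneg_nonneg divide_nonneg_nonneg) auto
        also have "\<dots> \<le> (1 + l) * ((l + k) / y)"
          using x0 y1 ny xy l by (intro mult_mono frac_le divide_nonneg_nonneg) auto
        finally show ?thesis .
      qed
      also have "(real W0 + k) / y + (1 + l) * ((l + k) / y) = ((real W0 + (1 + l) * l) + (2 + l) * k) / y"
        by (simp add: add_divide_distrib[symmetric] algebra_simps)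
      also have "\<dots> \<le> \<epsilon>"
      proof -
        have "2 * (real W0 + (1 + l) * l) / \<epsilon> \<le> real s" using Z elim(2) by linarith
        then have "2 * (real W0 + (1 + l) * l) \<le> \<epsilon> * real s" using \<epsilon> by (simp add: field_simps)
        moreover have "k \<le> \<delta> * real s" using elim(1) unfolding k_def by linarith
        then have "(2 + l) * k \<le> (2 + l) * (\<delta> * real s)" using l by (intro mult_left_mono) auto
        moreover have "(2 + l) * (\<delta> * real s) = \<epsilon> / 2 * real s" unfolding \<delta>_def using l by (simp add: field_simps)
        ultimately have "(real W0 + (1 + l) * l) + (2 + l) * k \<le> \<epsilon> * real s" by argo
        also have "\<dots> \<le> \<epsilon> * y" using \<epsilon> y1 by (intro mult_left_mono) auto
        finally show ?thesis using y1 by (simp add: pos_divide_le_eq)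
      qed
      finally show "\<bar>real (word_length (pos \<omega> (tr \<xi> n))) / real n - real (\<sigma> s) / real (\<kappa> s)\<bar> \<le> \<epsilon>"
        by (simp add: q_def x_def y_def)
    qed
  qed
qed

text \<open>\<open>Q\<close> is a property with a tolerance; a perturbation of the size of the
  tolerance may double it. In this form one argument serves bounds from both sides.\<close>

lemma speed_eventually:
  assumes "\<And>\<epsilon>. 0 < \<epsilon> \<Longrightarrow> eventually (\<lambda>s. Q \<epsilon> (real (\<sigma> s) / real (\<kappa> s))) sequentially"
    and "\<And>\<epsilon> x y. Q \<epsilon> x \<Longrightarrow> \<bar>y - x\<bar> \<le> \<epsilon> \<Longrightarrow> Q (2 * \<epsilon>) y" and \<epsilon>: "0 < \<epsilon>"
  shows "eventually (\<lambda>n. Q \<epsilon> (real (word_length (pos \<omega> (tr \<xi> n))) / real n)) sequentially"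
proof -
  have e2: "0 < \<epsilon> / 2" using \<epsilon> by simp
  have "eventually (\<lambda>s. Q (\<epsilon> / 2) (real (\<sigma> s) / real (\<kappa> s)) \<and> (\<forall>n. length v0 + \<kappa> s \<le> n \<longrightarrow> n \<le> length v0 + \<kappa> (Suc s) \<longrightarrow>
    \<bar>real (word_length (pos \<omega> (tr \<xi> n))) / real n - real (\<sigma> s) / real (\<kappa> s)\<bar> \<le> \<epsilon> / 2)) sequentially"
    using assms(1)[OF e2] speed_close[OF e2] by (rule eventually_conj)
  then obtain s0 where s0: "\<And>s. s \<ge> s0 \<Longrightarrow> Q (\<epsilon> / 2) (real (\<sigma> s) / real (\<kappa> s)) \<and> (\<forall>n. length v0 + \<kappa> s \<le> n \<longrightarrow> n \<le> length v0 + \<kappa> (Suc s) \<longrightarrow>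
    \<bar>real (word_length (pos \<omega> (tr \<xi> n))) / real n - real (\<sigma> s) / real (\<kappa> s)\<bar> \<le> \<epsilon> / 2)"
    by (auto simp: eventually_sequentially)
  show ?thesis
  proof (rule eventually_sequentiallyI)
    fix n assume "length v0 + \<kappa> s0 \<le> n"
    then obtain s where s: "s0 \<le> s" "length v0 + \<kappa> s \<le> n" "n \<le> length v0 + \<kappa> (Suc s)"
      by (rule stage_exists[OF \<xi>])
    then have "Q (2 * (\<epsilon> / 2)) (real (word_length (pos \<omega> (tr \<xi> n))) / real n)"
      using s0[OF s(1)] by (intro assms(2)[of "\<epsilon> / 2" "real (\<sigma> s) / real (\<kappa> s)"]) auto
    then show "Q \<epsilon> (real (word_length (pos \<omega> (tr \<xi> n))) / real n)" by simp
  qed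
qed

lemma speed_frequently:
  assumes "\<And>\<epsilon>. 0 < \<epsilon> \<Longrightarrow> frequently (\<lambda>s. Q \<epsilon> (real (\<sigma> s) / real (\<kappa> s))) sequentially"
    and "\<And>\<epsilon> x y. Q \<epsilon> x \<Longrightarrow> \<bar>y - x\<bar> \<le> \<epsilon> \<Longrightarrow> Q (2 * \<epsilon>) y" and \<epsilon>: "0 < \<epsilon>"
  shows "frequently (\<lambda>n. Q \<epsilon> (real (word_length (pos \<omega> (tr \<xi> n))) / real n)) sequentially"
proof -
  have e2: "0 < \<epsilon> / 2" using \<epsilon> by simp
  obtain s0 where s0: "\<And>s n. s \<ge> s0 \<Longrightarrow> length v0 + \<kappa> s \<le> n \<Longrightarrow> n \<le> length v0 + \<kappa> (Suc s) \<Longrightarrow>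
    \<bar>real (word_length (pos \<omega> (tr \<xi> n))) / real n - real (\<sigma> s) / real (\<kappa> s)\<bar> \<le> \<epsilon> / 2"
    using speed_close[OF e2] by (auto simp: eventually_sequentially)
  show ?thesis
    unfolding frequently_sequentially
  proof
    fix n0
    obtain s where s: "s \<ge> max s0 n0" "Q (\<epsilon> / 2) (real (\<sigma> s) / real (\<kappa> s))"
      using assms(1)[OF e2] unfolding frequently_sequentially by blast
    let ?n = "length v0 + \<kappa> s"
    have "?n \<le> length v0 + \<kappa> (Suc s)" by (simp add: \<kappa>_Suc)
    then have "Q (2 * (\<epsilon> / 2)) (real (word_length (pos \<omega> (tr \<xi> ?n))) / real ?n)"
      using s0[of s ?n] s by (intro assms(2)[of "\<epsilon> / 2" "real (\<sigma> s) / real (\<kappa> s)"]) auto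
    moreover have "n0 \<le> ?n" using \<kappa>_ge[of s] s(1) by linarith
    ultimately show "\<exists>n\<ge>n0. Q \<epsilon> (real (word_length (pos \<omega> (tr \<xi> n))) / real n)" by auto
  qed
qed

lemma bd_in_Lambda:
  assumes "\<And>\<epsilon>. 0 < \<epsilon> \<Longrightarrow> eventually (\<lambda>s. \<alpha> - \<epsilon> \<le> real (\<sigma> s) / real (\<kappa> s) \<and> real (\<sigma> s) / real (\<kappa> s) \<le> \<beta> + \<epsilon>) sequentially"
    and "\<And>\<epsilon>. 0 < \<epsilon> \<Longrightarrow> frequently (\<lambda>s. real (\<sigma> s) / real (\<kappa> s) \<le> \<alpha> + \<epsilon>) sequentially"
    and "\<And>\<epsilon>. 0 < \<epsilon> \<Longrightarrow> frequently (\<lambda>s. \<beta> - \<epsilon> \<le> real (\<sigma> s) / real (\<kappa> s)) sequentially"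
  shows "bd \<xi> \<in> LambdaE \<omega> \<alpha> \<beta>"
proof -
  have ev: "eventually (\<lambda>n. \<alpha> - \<epsilon> \<le> real (word_length (pos \<omega> (tr \<xi> n))) / real n \<and> real (word_length (pos \<omega> (tr \<xi> n))) / real n \<le> \<beta> + \<epsilon>) sequentially"
    if "0 < \<epsilon>" for \<epsilon>
    by (rule speed_eventually[of "\<lambda>\<epsilon> x. \<alpha> - \<epsilon> \<le> x \<and> x \<le> \<beta> + \<epsilon>", OF assms(1) _ that]) auto
  have "liminf (\<lambda>n. ereal (real (word_length (pos \<omega> (tr \<xi> n))) / real n)) = ereal \<alpha>"
  proof (rule liminf_ereal_eqI)
    fix \<epsilon> :: real assume "0 < \<epsilon>"
    show "eventually (\<lambda>n. \<alpha> - \<epsilon> \<le> real (word_length (pos \<omega> (tr \<xi> n))) / real n) sequentially"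
      using ev[OF \<open>0 < \<epsilon>\<close>] by (rule eventually_mono) (rule conjunct1)
    show "frequently (\<lambda>n. real (word_length (pos \<omega> (tr \<xi> n))) / real n \<le> \<alpha> + \<epsilon>) sequentially"
      by (rule speed_frequently[of "\<lambda>\<epsilon> x. x \<le> \<alpha> + \<epsilon>", OF assms(2) _ \<open>0 < \<epsilon>\<close>]) auto
  qed
  moreover have "limsup (\<lambda>n. ereal (real (word_length (pos \<omega> (tr \<xi> n))) / real n)) = ereal \<beta>"
  proof (rule limsup_ereal_eqI)
    fix \<epsilon> :: real assume "0 < \<epsilon>"
    show "eventually (\<lambda>n. real (word_length (pos \<omega> (tr \<xi> n))) / real n \<le> \<beta> + \<epsilon>) sequentially"
      using ev[OF \<open>0 < \<epsilon>\<close>] by (rule eventually_mono) (rule conjunct2)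
    show "frequently (\<lambda>n. \<beta> - \<epsilon> \<le> real (word_length (pos \<omega> (tr \<xi> n))) / real n) sequentially"
      by (rule speed_frequently[of "\<lambda>\<epsilon> x. \<beta> - \<epsilon> \<le> x", OF assms(3) _ \<open>0 < \<epsilon>\<close>]) auto
  qed
  moreover have "tr \<xi> \<in> tree_rays (gw_tree (\<lambda>u. fst (\<omega> u)))"
    using tr_rays[OF \<xi>] by (simp add: tree_def)
  ultimately show ?thesis
    using tends_to_bd unfolding LambdaE_def Lambda_def pos_def by blast
qed

end

text \<open>Up to the first difference \<open>j\<close> the vertices coincide; just after it the
  positions are different words of equal length, and this length bounds the common prefix.\<close>

lemma bd_separated:
  assumes \<xi>: "\<And>s. \<xi> s < bs s" and \<xi>': "\<And>s. \<xi>' s < bs s" and i: "i \<le> s" "\<xi> i \<noteq> \<xi>' i"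
  shows "exp (- real (W0 + \<sigma> (Suc s))) \<le> dist (bd \<xi>) (bd \<xi>')"
proof -
  define j where "j = (LEAST j. \<xi> j \<noteq> \<xi>' j)"
  have j: "\<xi> j \<noteq> \<xi>' j" unfolding j_def using i(2) by (rule LeastI)
  have ji: "j \<le> i" unfolding j_def using i(2) by (rule Least_le)
  have same: "vert \<xi> t = vert \<xi>' t" if "t \<le> j" for t
    using that
  proof (induction t)
    case (Suc t)
    have "\<xi> t = \<xi>' t" using not_less_Least[of t "\<lambda>j. \<xi> j \<noteq> \<xi>' j"] Suc by (simp add: j_def[symmetric])
    then show ?case using Suc by simp
  qed simp
  have "okf j (vert \<xi> j) (nx j (vert \<xi> j))"
    using vert_props[OF \<xi>, of j] by (intro okf_nx) auto
  then have "pos \<omega> (vert \<xi> (Suc j)) \<noteq> pos \<omega> (vert \<xi>' (Suc j))"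
    using j \<xi>[of j] \<xi>'[of j] same[of j] by (auto simp: okf_def inj_on_def)
  then have "Rw \<xi> (W0 + \<sigma> (Suc j)) \<noteq> Rw \<xi>' (W0 + \<sigma> (Suc j))"
    using Rw_eq[OF \<xi>, of "W0 + \<sigma> (Suc j)" "Suc j"] Rw_eq[OF \<xi>', of "W0 + \<sigma> (Suc j)" "Suc j"]
      length_vert_word[OF \<xi>, of "Suc j"] length_vert_word[OF \<xi>', of "Suc j"]
    by (metis order_refl take_all word_inject)
  then have ne: "ray (bd \<xi>) (W0 + \<sigma> (Suc j)) \<noteq> ray (bd \<xi>') (W0 + \<sigma> (Suc j))"
    using word_ray_bd[OF \<xi>] word_ray_bd[OF \<xi>'] by metis
  then have neq: "bd \<xi> \<noteq> bd \<xi>'" by auto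
  have "\<sigma> (Suc j) \<le> \<sigma> (Suc s)" unfolding \<sigma>_def using ji i(1) by (intro sum_mono2) auto
  moreover have "word_length (meet (bd \<xi>) (bd \<xi>')) < W0 + \<sigma> (Suc j)"
    using le_meet_iff[OF neq, of "W0 + \<sigma> (Suc j)"] ne by simp
  ultimately show ?thesis
    using neq by (simp add: dist_boundary_def)
qed

theorem Lambda_rays:
  assumes "\<And>\<epsilon>. 0 < \<epsilon> \<Longrightarrow> eventually (\<lambda>s. \<alpha> - \<epsilon> \<le> real (\<sigma> s) / real (\<kappa> s) \<and> real (\<sigma> s) / real (\<kappa> s) \<le> \<beta> + \<epsilon>) sequentially"
    and "\<And>\<epsilon>. 0 < \<epsilon> \<Longrightarrow> frequently (\<lambda>s. real (\<sigma> s) / real (\<kappa> s) \<le> \<alpha> + \<epsilon>) sequentially"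
    and "\<And>\<epsilon>. 0 < \<epsilon> \<Longrightarrow> frequently (\<lambda>s. \<beta> - \<epsilon> \<le> real (\<sigma> s) / real (\<kappa> s)) sequentially"
  shows "LambdaE \<omega> \<alpha> \<beta> \<noteq> {}"
    and "0 < h \<Longrightarrow> (\<And>s. h * real (\<sigma> (Suc (Suc s))) - C \<le> (\<Sum>i\<le>s. ln (real (bs i)))) \<Longrightarrow> hausdorff_measure h (LambdaE \<omega> \<alpha> \<beta>) \<noteq> 0"
proof -
  have bs2: "2 \<le> bs s" for s unfolding bs_def by (rule step_props(2))
  have mem: "bd \<xi> \<in> LambdaE \<omega> \<alpha> \<beta>" if "\<And>s. \<xi> s < bs s" for \<xi>
    by (rule bd_in_Lambda[OF that assms])
  have "bd (\<lambda>_. 0) \<in> LambdaE \<omega> \<alpha> \<beta>"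
    by (rule mem) (use bs2 in \<open>metis less_le_trans zero_less_numeral\<close>)
  then show "LambdaE \<omega> \<alpha> \<beta> \<noteq> {}" by blast
  assume h: "0 < h" and H: "\<And>s. h * real (\<sigma> (Suc (Suc s))) - C \<le> (\<Sum>i\<le>s. ln (real (bs i)))"
  \<comment> \<open>The choices up to \<open>s\<close> are visible in the first
    \<open>W0 + \<sigma> (Suc s)\<close> letters; the constant \<open>W0\<close> goes into
    \<open>C\<close>.\<close>
  show "hausdorff_measure h (LambdaE \<omega> \<alpha> \<beta>) \<noteq> 0"
  proof (rule hausdorff_measure_pos[where \<Phi> = bd and b = bs and \<rho> = "\<lambda>s. real (W0 + \<sigma> (Suc s))" and C = "C + h * real W0"])
    show "1 \<le> bs s" for s using bs2[of s] by simp
    show "filterlim (\<lambda>s. real (W0 + \<sigma> (Suc s))) at_top sequentially"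
    proof (rule filterlim_at_top_mono[OF filterlim_real_sequentially])
      show "eventually (\<lambda>s. real s \<le> real (W0 + \<sigma> (Suc s))) sequentially"
      proof (rule always_eventually, rule allI)
        fix s show "real s \<le> real (W0 + \<sigma> (Suc s))" using \<sigma>_ge[of "Suc s"] by linarith
      qed
    qed
    show "h * real (W0 + \<sigma> (Suc (Suc s))) - (C + h * real W0) \<le> (\<Sum>i\<le>s. ln (real (bs i)))" for s
      using H[of s] by (simp add: algebra_simps)
  qed (use h mem bd_separated in auto)
qed

end

section \<open>Schedules alternating between two speeds\<close>

text \<open>The exponents triple, so that the last phase before a switch dominates all the earlier ones.\<close>

definition phase :: "nat \<Rightarrow> bool" where
  "phase s \<longleftrightarrow> even (LEAST j. s < 2 ^ 3 ^ j)"

lemma phase_eq: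
  assumes "2 ^ 3 ^ j \<le> s" "s < 2 ^ 3 ^ Suc j"
  shows "phase s = odd j"
proof -
  have "(LEAST j. s < 2 ^ 3 ^ j) = Suc j"
  proof (rule Least_equality)
    fix i assume "s < 2 ^ 3 ^ i"
    then have "(2::nat) ^ 3 ^ j < 2 ^ 3 ^ i" using assms(1) by linarith
    then have "(3::nat) ^ j < 3 ^ i" by (rule power_less_imp_less_exp[rotated]) simp
    then have "j < i" by (rule power_less_imp_less_exp[rotated]) simp
    then show "Suc j \<le> i" by simp
  qed (rule assms(2))
  then show ?thesis by (simp add: phase_def)
qed

lemma sum_nonpos_tail:
  fixes x :: "nat \<Rightarrow> real"
  assumes "s0 \<le> s" "\<And>i. s0 \<le> i \<Longrightarrow> i < s \<Longrightarrow> x i \<le> 0"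
  shows "sum x {..<s} \<le> sum x {..<s0}"
  using assms
proof (induction s rule: dec_induct)
  case (step n)
  then have "sum x {..<n} \<le> sum x {..<s0}" "x n \<le> 0" by (auto intro: step.IH)
  then show ?case by simp
qed simp

lemma sum_nonpos_eventually:
  fixes x :: "nat \<Rightarrow> real"
  assumes "eventually (\<lambda>i. x i \<le> 0) sequentially" "0 < \<epsilon>"
  shows "eventually (\<lambda>s. sum x {..<s} \<le> \<epsilon> * real s) sequentially"
proof -
  obtain s0 where s0: "\<And>i. s0 \<le> i \<Longrightarrow> x i \<le> 0" using assms(1) by (auto simp: eventually_sequentially)
  obtain k where k: "sum x {..<s0} / \<epsilon> \<le> real k" using real_arch_simple by blast
  show ?thesis
  proof (rule eventually_sequentiallyI[of "max s0 k"])
    fix s assume s: "max s0 k \<le> s"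
    then have "sum x {..<s} \<le> sum x {..<s0}" by (intro sum_nonpos_tail s0) auto
    also have "\<dots> \<le> \<epsilon> * real k" using k assms(2) by (simp add: field_simps)
    also have "\<dots> \<le> \<epsilon> * real s" using s assms(2) by (intro mult_left_mono) auto
    finally show "sum x {..<s} \<le> \<epsilon> * real s" .
  qed
qed

text \<open>A phase runs from \<open>T\<close> to \<open>T ^ 3\<close>. What was accumulated before
  is at most quadratic in \<open>T\<close>, hence small against the end of the phase, and during the
  phase nothing positive is added.\<close>

lemma phase_frequently:
  fixes x :: "nat \<Rightarrow> real"
  assumes ev: "eventually (\<lambda>i. phase i = b \<longrightarrow> x i \<le> 0) sequentially"
    and K: "\<And>s. sum x {..<s} \<le> K * (real s)\<^sup>2" and e: "0 < \<epsilon>"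
  shows "frequently (\<lambda>s. sum x {..<s} \<le> \<epsilon> * real s) sequentially"
  unfolding frequently_sequentially
proof
  fix n0
  obtain s0 where s0: "\<And>i. s0 \<le> i \<Longrightarrow> phase i = b \<Longrightarrow> x i \<le> 0" using ev by (auto simp: eventually_sequentially)
  obtain k where k: "K / \<epsilon> \<le> real k" using real_arch_simple by blast
  \<comment> \<open>The parity selects the kind of phase; the size makes the phase start beyond
    \<open>s0\<close>, \<open>n0\<close> and \<open>K / \<epsilon>\<close>.\<close>
  define j where "j = 2 * (s0 + n0 + k) + (if b then 1 else 0)"
  define T where "T = (2::nat) ^ 3 ^ j"
  have "j < 3 ^ j" "(3::nat) ^ j < 2 ^ 3 ^ j" by (rule less_exp[of j, THEN less_le_trans] power_mono | simp)+
  then have jT: "j \<le> T" unfolding T_def by linarith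
  have T': "2 ^ 3 ^ Suc j = T ^ 3" by (simp add: T_def power_mult[symmetric] mult.commute)
  have T1: "1 \<le> T" by (simp add: T_def)
  have TT: "T \<le> T ^ 3" using T1 by (intro self_le_power) auto
  have "sum x {..<T ^ 3} \<le> sum x {..<T}"
  proof (rule sum_nonpos_tail[OF TT])
    fix i assume i: "T \<le> i" "i < T ^ 3"
    have "phase i = odd j" by (rule phase_eq) (use i T' in \<open>simp_all only: T_def\<close>)
    also have "\<dots> = b" by (simp add: j_def)
    finally show "x i \<le> 0" using s0[of i] i jT by (simp add: j_def)
  qed
  also have "\<dots> \<le> K * (real T)\<^sup>2" by (rule K)
  also have "\<dots> \<le> (\<epsilon> * real T) * (real T)\<^sup>2"
  proof (rule mult_right_mono)
    have "K \<le> \<epsilon> * real k" using k e by (simp add: field_simps)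
    also have "\<dots> \<le> \<epsilon> * real T" using jT e by (intro mult_left_mono) (auto simp: j_def)
    finally show "K \<le> \<epsilon> * real T" .
  qed simp
  finally have "sum x {..<T ^ 3} \<le> \<epsilon> * real (T ^ 3)" by (simp add: power2_eq_square power3_eq_cube mult.assoc)
  moreover have "n0 \<le> T ^ 3" using jT TT by (simp add: j_def)
  ultimately show "\<exists>s\<ge>n0. sum x {..<s} \<le> \<epsilon> * real s" by blast
qed

lemma half_triangle: "2 * \<bar>a - b\<bar> \<le> e \<Longrightarrow> 2 * \<bar>b - c\<bar> \<le> e \<Longrightarrow> \<bar>a - c\<bar> \<le> (e :: real)"
  using abs_triangle_ineq[of "a - b" "b - c"] by simp

lemma between:
  assumes "(Q \<longrightarrow> \<bar>m - x\<bar> \<le> e) \<and> (\<not> Q \<longrightarrow> \<bar>m - y\<bar> \<le> e)" "x \<le> (y :: real)"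
  shows "m - (y + e) \<le> 0" "x - e - m \<le> 0" "Q \<Longrightarrow> m - (x + e) \<le> 0" "\<not> Q \<Longrightarrow> y - e - m \<le> 0"
  using assms by (cases Q; simp add: abs_le_iff)+

lemma eventually_le_shift:
  fixes f g :: "nat \<Rightarrow> real"
  assumes "eventually (\<lambda>s. f s \<le> g s + B) sequentially"
  obtains C where "\<And>s. f s - C \<le> g s"
proof -
  obtain s0 where s0: "\<And>s. s0 \<le> s \<Longrightarrow> f s \<le> g s + B" using assms by (auto simp: eventually_sequentially)
  define C where "C = \<bar>B\<bar> + (\<Sum>s<s0. \<bar>f s - g s\<bar>)"
  have "f s - C \<le> g s" for s
  proof (cases "s < s0")
    case True
    have "\<bar>f s - g s\<bar> \<le> (\<Sum>s<s0. \<bar>f s - g s\<bar>)" using True by (intro member_le_sum) auto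
    then show ?thesis by (simp add: C_def)
  next
    case False
    have "0 \<le> (\<Sum>s<s0. \<bar>f s - g s\<bar>)" by (intro sum_nonneg) auto
    then show ?thesis using s0[of s] False abs_ge_self[of B] unfolding C_def by linarith
  qed
  then show ?thesis using that by blast
qed

lemma hausdorff_measure_0_eq_0:
  fixes T :: "'a::metric_space set"
  assumes H: "hausdorff_measure 0 T = 0"
  shows "T = {}"
proof (rule ccontr)
  assume T: "T \<noteq> {}"
  have "1 \<le> hausdorff_premeasure 1 0 T"
    unfolding hausdorff_premeasure_def
  proof (rule INF_greatest, elim CollectE conjE)
    fix V :: "nat \<Rightarrow> 'a set" assume "T \<subseteq> (\<Union>i. V i)"
    then obtain i where "V i \<noteq> {}" using T by blast
    then have "1 = diam_power 0 (V i)" by (simp add: diam_power_def)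
    also have "\<dots> = sum (\<lambda>i. diam_power 0 (V i)) {i}" by simp
    also have "\<dots> \<le> (\<Sum>i. diam_power 0 (V i))" by (rule sum_le_suminf) auto
    finally show "1 \<le> (\<Sum>i. diam_power 0 (V i))" .
  qed
  also have "\<dots> \<le> hausdorff_measure 0 T"
    unfolding hausdorff_measure_def by (rule SUP_upper) simp
  finally show False using H by simp
qed

context branching
begin

text \<open>An entropy of \<open>ln r - y\<close> per generation becomes an entropy per letter on
  division by the speed, so the condition \<open>h * q' < ln r - y\<close> leaves a slope of at
  least \<open>h\<close> after all approximations.\<close>

lemma class_near:
  assumes q: "q \<in> I_set L r" and h: "0 \<le> h" "h = 0 \<or> ereal h < dim_bound L r q" and e: "0 < \<epsilon>"
  shows "\<exists>c. \<bar>speed c - q\<bar> < \<epsilon> \<and> h \<le> slope c"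
proof -
  obtain q' y where q': "0 < q'" "\<bar>q' - q\<bar> < \<epsilon> / 2" "L q' \<le> ereal y" "y < ln r" "h * q' < ln r - y"
    using approx_speed[OF q h, of "\<epsilon> / 2"] e by (metis half_gt_zero)
  \<comment> \<open>The second bound is the solution of
    \<open>h * (q' + \<delta>) <= ln r - y - \<delta>\<close>.\<close>
  define \<delta> where "\<delta> = min (\<epsilon> / 2) ((ln r - y - h * q') / (h + 1))"
  have d: "0 < \<delta>" using e q'(5) h(1) by (simp add: \<delta>_def)
  have d2: "\<delta> \<le> \<epsilon> / 2" unfolding \<delta>_def by (rule min.cobounded1)
  have "\<delta> \<le> (ln r - y - h * q') / (h + 1)" by (simp add: \<delta>_def)
  then have hd: "h * (q' + \<delta>) \<le> ln r - y - \<delta>" using h(1) by (simp add: field_simps)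
  obtain n m b where a: "admissible n m b" "\<bar>real (m + 1) / real (n + 1) - q'\<bar> < \<delta>"
    "real (n + 1) * (ln r - y - \<delta>) \<le> ln (real b)"
    using admissible_exists[OF q'(3,4) d] by blast
  obtain c where c: "cn c = n" "cm c = m" "cb c = b" by (rule cls_surj[OF a(1)])
  have "real (m + 1) / real (n + 1) \<le> q' + \<delta>" using a(2) by linarith
  then have "real (m + 1) \<le> (q' + \<delta>) * real (n + 1)" by (simp only: pos_divide_le_eq of_nat_0_less_iff zero_less_Suc Suc_eq_plus1[symmetric])
  then have "h * real (m + 1) \<le> h * ((q' + \<delta>) * real (n + 1))" using h(1) by (rule mult_left_mono)
  also have "\<dots> = real (n + 1) * (h * (q' + \<delta>))" by (simp only: mult_ac)
  also have "\<dots> \<le> real (n + 1) * (ln r - y - \<delta>)" by (rule mult_left_mono[OF hd]) simp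
  finally have "h * real (m + 1) \<le> ln (real b)" using a(3) by linarith
  then have "h \<le> slope c" by (simp add: slope_def c pos_le_divide_eq)
  moreover have "\<bar>speed c - q\<bar> < \<epsilon>" using a(2) q'(2) d2 unfolding speed_def c by linarith
  ultimately show ?thesis by blast
qed

text \<open>The good approximants \<open>e k\<close> may have large indices, while stage
  \<open>s\<close> offers only the types up to \<open>kap s\<close>. So \<open>f s\<close> points to
  the latest approximant available at stage \<open>s\<close>, and type 0 fills in until there is
  one.\<close>

lemma class_sequence:
  assumes q: "q \<in> I_set L r" and h: "0 \<le> h" "h = 0 \<or> ereal h < dim_bound L r q"
  obtains d where "\<And>s. d s \<le> kap s" "(\<lambda>s. speed (d s)) \<longlonglongrightarrow> q" "eventually (\<lambda>s. h \<le> slope (d s)) sequentially"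
proof -
  have "\<forall>k::nat. \<exists>c. \<bar>speed c - q\<bar> < 1 / real (Suc k) \<and> h \<le> slope c"
    using class_near[OF q h] by simp
  from choice[OF this] obtain e where e: "\<forall>k. \<bar>speed (e k) - q\<bar> < 1 / real (Suc k) \<and> h \<le> slope (e k)" ..
  define f where "f s = Max (insert 0 {k. k \<le> kap s \<and> e k \<le> kap s})" for s
  define d where "d s = (if e (f s) \<le> kap s then e (f s) else 0)" for s
  have fin: "finite (insert 0 {k. k \<le> kap s \<and> e k \<le> kap s})" for s by simp
  have big: "eventually (\<lambda>s. k \<le> f s \<and> d s = e (f s)) sequentially" if "1 \<le> k" for k
  proof -
    have "eventually (\<lambda>s. max k (e k) \<le> kap s) sequentially"
      using kap_at_top[unfolded filterlim_at_top] by (rule spec)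
    then show ?thesis
    proof (rule eventually_mono)
      fix s assume "max k (e k) \<le> kap s"
      then have k: "k \<le> f s" unfolding f_def by (intro Max_ge[OF fin]) auto
      have "f s \<in> insert 0 {k. k \<le> kap s \<and> e k \<le> kap s}" unfolding f_def by (rule Max_in[OF fin]) simp
      then have "e (f s) \<le> kap s" using k that by auto
      then show "k \<le> f s \<and> d s = e (f s)" using k by (simp add: d_def)
    qed
  qed
  show ?thesis
  proof (rule that)
    show "d s \<le> kap s" for s by (simp add: d_def)
    show "eventually (\<lambda>s. h \<le> slope (d s)) sequentially"
      using big[OF order_refl] by (rule eventually_mono) (use e in auto)
    show "(\<lambda>s. speed (d s)) \<longlonglongrightarrow> q"
    proof (rule tendstoI)
      fix \<epsilon> :: real assume "0 < \<epsilon>"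
      then obtain k where k: "1 / real (Suc k) < \<epsilon>" using nat_approx_posE by blast
      show "eventually (\<lambda>s. dist (speed (d s)) q < \<epsilon>) sequentially"
      proof (rule eventually_mono[OF big[of "Suc k"]])
        fix s assume s: "Suc k \<le> f s \<and> d s = e (f s)"
        have "\<bar>speed (e (f s)) - q\<bar> < 1 / real (Suc (f s))" using e by blast
        also have "\<dots> \<le> 1 / real (Suc k)" using s by (intro divide_left_mono) auto
        finally show "dist (speed (d s)) q < \<epsilon>" using k s by (simp add: dist_real_def)
      qed simp
    qed
  qed
qed

end

context regular_rays
begin

lemma \<sigma>_real: "real (\<sigma> s) = (\<Sum>i<s. real (ms i + 1))" and \<kappa>_real: "real (\<kappa> s) = (\<Sum>i<s. real (ns i + 1))"
  by (simp_all add: \<sigma>_def \<kappa>_def)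

lemma step_le_Ks: "ms s + 1 \<le> Ks (kap s)" "ns s + 1 \<le> Ks (kap s)"
  using Ks[OF c[of s]] by (auto simp: ms_def ns_def)

lemma Ks_le: "Ks (kap s) \<le> Ks 0 + s"
proof (cases "kap s = 0")
  case False
  with kap_Ks[of s] have "(kap s + 1) * Ks (kap s) \<le> s" by (elim disjE) simp_all
  then show ?thesis by simp
qed simp

lemma ms_slow:
  assumes "0 < \<epsilon>"
  shows "eventually (\<lambda>s. real (ms s + 1) \<le> \<epsilon> * real s) sequentially"
proof -
  obtain k where k: "1 / real (Suc k) < \<epsilon>" using nat_approx_posE[OF assms] by blast
  have "eventually (\<lambda>s. Suc k \<le> kap s) sequentially" using kap_at_top by (simp add: filterlim_at_top)
  then show ?thesis
  proof (rule eventually_mono)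
    fix s assume s: "Suc k \<le> kap s"
    have "Suc k * (ms s + 1) \<le> (kap s + 1) * Ks (kap s)"
      using s step_le_Ks(1)[of s] by (intro mult_mono) auto
    also have "\<dots> \<le> s" using kap_Ks[of s] s by auto
    finally have "real (Suc k) * real (ms s + 1) \<le> real s" by (simp only: of_nat_mult[symmetric] of_nat_le_iff)
    then have "real (ms s + 1) \<le> 1 / real (Suc k) * real s" by (simp add: field_simps)
    also have "\<dots> \<le> \<epsilon> * real s" using k by (intro mult_right_mono) auto
    finally show "real (ms s + 1) \<le> \<epsilon> * real s" .
  qed
qed

text \<open>A step at stage \<open>s\<close> has at most \<open>Ks 0 + s\<close> generations and
  letters. The resulting bound is the quadratic hypothesis of
  \<open>phase_frequently\<close>.\<close>

lemma \<sigma>\<kappa>_quadratic: "real (\<sigma> s) \<le> real (Ks 0 + 1) * (real s)\<^sup>2" "real (\<kappa> s) \<le> real (Ks 0 + 1) * (real s)\<^sup>2"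
proof -
  have "\<sigma> s \<le> (Ks 0 + s) * s \<and> \<kappa> s \<le> (Ks 0 + s) * s"
  proof (induction s)
    case (Suc s)
    have "ms s + 1 \<le> Ks 0 + s" "ns s + 1 \<le> Ks 0 + s"
      using step_le_Ks[of s] Ks_le[of s] by linarith+
    then show ?case using Suc by (auto simp: \<sigma>_Suc \<kappa>_Suc algebra_simps)
  qed (simp add: \<sigma>_def \<kappa>_def)
  moreover have "(Ks 0 + s) * s \<le> (Ks 0 + 1) * s\<^sup>2"
    by (cases s) (auto simp: power2_eq_square algebra_simps)
  ultimately have "\<sigma> s \<le> (Ks 0 + 1) * s\<^sup>2" "\<kappa> s \<le> (Ks 0 + 1) * s\<^sup>2" by linarith+
  then have "real (\<sigma> s) \<le> real ((Ks 0 + 1) * s\<^sup>2)" "real (\<kappa> s) \<le> real ((Ks 0 + 1) * s\<^sup>2)" by (simp_all only: of_nat_le_iff)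
  then show "real (\<sigma> s) \<le> real (Ks 0 + 1) * (real s)\<^sup>2" "real (\<kappa> s) \<le> real (Ks 0 + 1) * (real s)\<^sup>2"
    by (simp_all only: of_nat_mult of_nat_power)
qed

lemma \<kappa>_bound: "real (\<kappa> s) \<ge> real s"
  using \<kappa>_ge[of s] by simp

lemma step_speed:
  assumes "0 < \<epsilon>"
  shows "eventually (\<lambda>s. \<bar>real (ms s + 1) - speed (c s) * real (ns s + 1)\<bar> \<le> \<epsilon> * real (ns s + 1)) sequentially"
proof -
  obtain k where k: "1 / real (Suc k) < \<epsilon>" using nat_approx_posE[OF assms] by blast
  have "eventually (\<lambda>s. k \<le> kap s) sequentially" using kap_at_top by (simp add: filterlim_at_top)
  then show ?thesis
  proof (rule eventually_mono)
    fix s assume "k \<le> kap s"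
    then have "1 / real (Suc (kap s)) \<le> 1 / real (Suc k)" by (intro divide_left_mono) auto
    then have "\<bar>real (ms s + 1) / real (ns s + 1) - speed (c s)\<bar> \<le> \<epsilon>"
      using step_props(3)[of "kap s" "c s"] k unfolding ms_def ns_def by linarith
    then have "\<bar>real (ms s + 1) / real (ns s + 1) - speed (c s)\<bar> * real (ns s + 1) \<le> \<epsilon> * real (ns s + 1)"
      by (rule mult_right_mono) simp
    also have "\<bar>real (ms s + 1) / real (ns s + 1) - speed (c s)\<bar> * real (ns s + 1)
       = \<bar>(real (ms s + 1) / real (ns s + 1) - speed (c s)) * real (ns s + 1)\<bar>" by (simp add: abs_mult)
    also have "(real (ms s + 1) / real (ns s + 1) - speed (c s)) * real (ns s + 1) = real (ms s + 1) - speed (c s) * real (ns s + 1)"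
      by (simp add: field_simps)
    finally show "\<bar>real (ms s + 1) - speed (c s) * real (ns s + 1)\<bar> \<le> \<epsilon> * real (ns s + 1)" .
  qed
qed

text \<open>Every late step has a speed close to \<alpha> or to \<beta>, so the average speed stays
  near the interval, and at the end of a long phase it is close to the corresponding endpoint. The
  entropy per letter is at least \<open>h'\<close> in both kinds of phases, whatever the
  schedule.\<close>

lemma schedule_rays:
  assumes ab: "0 \<le> \<alpha>" "\<alpha> \<le> \<beta>" "\<beta> \<le> 1"
    and d: "\<And>s. c s = (if phase s then d s else d' s)"
    and lim: "(\<lambda>s. speed (d s)) \<longlonglongrightarrow> \<alpha>" "(\<lambda>s. speed (d' s)) \<longlonglongrightarrow> \<beta>"
    and sl: "eventually (\<lambda>s. h' \<le> slope (d s)) sequentially" "eventually (\<lambda>s. h' \<le> slope (d' s)) sequentially"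
  shows "LambdaE \<omega> \<alpha> \<beta> \<noteq> {}"
    and "0 < h \<Longrightarrow> h < h' \<Longrightarrow> hausdorff_measure h (LambdaE \<omega> \<alpha> \<beta>) \<noteq> 0"
proof -
  have near: "eventually (\<lambda>s. (phase s \<longrightarrow> \<bar>real (ms s + 1) - \<alpha> * real (ns s + 1)\<bar> \<le> \<epsilon> * real (ns s + 1)) \<and>
      (\<not> phase s \<longrightarrow> \<bar>real (ms s + 1) - \<beta> * real (ns s + 1)\<bar> \<le> \<epsilon> * real (ns s + 1))) sequentially"
    if e: "0 < \<epsilon>" for \<epsilon>
  proof -
    have e2: "0 < \<epsilon> / 2" using e by simp
    have *: "\<bar>m - q * n\<bar> \<le> \<epsilon> * n" if "\<bar>m - v * n\<bar> \<le> \<epsilon> / 2 * n" "dist v q < \<epsilon> / 2" "0 \<le> n" for m v n q :: real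
    proof -
      have "\<bar>v - q\<bar> * n \<le> \<epsilon> / 2 * n" using that by (intro mult_right_mono) (auto simp: dist_real_def)
      then have "2 * \<bar>v * n - q * n\<bar> \<le> \<epsilon> * n" using that(3) by (simp add: abs_mult flip: left_diff_distrib)
      moreover have "2 * \<bar>m - v * n\<bar> \<le> \<epsilon> * n" using that(1) by simp
      ultimately show ?thesis by (rule half_triangle[rotated])
    qed
    from step_speed[OF e2] tendstoD[OF lim(1) e2] tendstoD[OF lim(2) e2] show ?thesis
    proof eventually_elim
      case (elim s)
      show ?case
      proof (intro conjI impI)
        assume "phase s"
        then show "\<bar>real (ms s + 1) - \<alpha> * real (ns s + 1)\<bar> \<le> \<epsilon> * real (ns s + 1)"
          using elim(1,2) by (intro *[of _ "speed (c s)"]) (simp_all only: d if_True of_nat_0_le_iff)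
      next
        assume "\<not> phase s"
        then show "\<bar>real (ms s + 1) - \<beta> * real (ns s + 1)\<bar> \<le> \<epsilon> * real (ns s + 1)"
          using elim(1,3) by (intro *[of _ "speed (c s)"]) (simp_all only: d if_False of_nat_0_le_iff)
      qed
    qed
  qed
  have sm: "(\<Sum>i<s. real (ms i + 1) - a * real (ns i + 1)) = real (\<sigma> s) - a * real (\<kappa> s)"
     "(\<Sum>i<s. a * real (ns i + 1) - real (ms i + 1)) = a * real (\<kappa> s) - real (\<sigma> s)" for a s
    by (simp_all add: \<sigma>_real \<kappa>_real sum_subtractf sum_distrib_left del: of_nat_add)
  have \<kappa>_pos: "0 < real (\<kappa> s)" if "1 \<le> s" for s using \<kappa>_bound[of s] that by linarith
  have upper: "real (\<sigma> s) / real (\<kappa> s) \<le> a + 2 * \<epsilon>" if "real (\<sigma> s) - (a + \<epsilon>) * real (\<kappa> s) \<le> \<epsilon> * real s" "1 \<le> s" "0 < \<epsilon>" for a s \<epsilon>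
  proof -
    have "\<epsilon> * real s \<le> \<epsilon> * real (\<kappa> s)" using \<kappa>_bound that(3) by (intro mult_left_mono) auto
    then have "real (\<sigma> s) \<le> (a + 2 * \<epsilon>) * real (\<kappa> s)" using that(1) by (simp add: algebra_simps)
    then show ?thesis using \<kappa>_pos[OF that(2)] by (simp only: pos_divide_le_eq)
  qed
  have lower: "a - 2 * \<epsilon> \<le> real (\<sigma> s) / real (\<kappa> s)" if "(a - \<epsilon>) * real (\<kappa> s) - real (\<sigma> s) \<le> \<epsilon> * real s" "1 \<le> s" "0 < \<epsilon>" for a s \<epsilon>
  proof -
    have "\<epsilon> * real s \<le> \<epsilon> * real (\<kappa> s)" using \<kappa>_bound that(3) by (intro mult_left_mono) auto
    then have "(a - 2 * \<epsilon>) * real (\<kappa> s) \<le> real (\<sigma> s)" using that(1) by (simp add: algebra_simps)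
    then show ?thesis using \<kappa>_pos[OF that(2)] by (simp only: pos_le_divide_eq)
  qed
  have ev1: "eventually (\<lambda>s::nat. 1 \<le> s) sequentially" by (rule eventually_ge_at_top)
  have ab': "\<alpha> * real n \<le> \<beta> * real n" for n using ab by (intro mult_right_mono) auto
  have A: "eventually (\<lambda>s. \<alpha> - \<epsilon> \<le> real (\<sigma> s) / real (\<kappa> s) \<and> real (\<sigma> s) / real (\<kappa> s) \<le> \<beta> + \<epsilon>) sequentially"
    if e: "0 < \<epsilon>" for \<epsilon>
  proof -
    have e2: "0 < \<epsilon> / 2" using e by simp
    have "eventually (\<lambda>s. real (ms s + 1) - (\<beta> + \<epsilon> / 2) * real (ns s + 1) \<le> 0) sequentially"
      using near[OF e2]
    proof (rule eventually_mono, goal_cases)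
      case (1 s)
      then show ?case using between(1)[OF _ ab'[of "ns s + 1"]] unfolding distrib_right by blast
    qed
    from sum_nonpos_eventually[OF this e2]
    have 1: "eventually (\<lambda>s. real (\<sigma> s) - (\<beta> + \<epsilon> / 2) * real (\<kappa> s) \<le> \<epsilon> / 2 * real s) sequentially" by (simp only: sm)
    have "eventually (\<lambda>s. (\<alpha> - \<epsilon> / 2) * real (ns s + 1) - real (ms s + 1) \<le> 0) sequentially"
      using near[OF e2]
    proof (rule eventually_mono, goal_cases)
      case (1 s)
      then show ?case using between(2)[OF _ ab'[of "ns s + 1"]] unfolding left_diff_distrib by blast
    qed
    from sum_nonpos_eventually[OF this e2]
    have 2: "eventually (\<lambda>s. (\<alpha> - \<epsilon> / 2) * real (\<kappa> s) - real (\<sigma> s) \<le> \<epsilon> / 2 * real s) sequentially" by (simp only: sm)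
    from 1 2 ev1 show ?thesis
    proof eventually_elim
      case (elim s)
      show ?case using upper[OF elim(1,3) e2] lower[OF elim(2,3) e2] by simp
    qed
  qed
  have B: "frequently (\<lambda>s. real (\<sigma> s) / real (\<kappa> s) \<le> \<alpha> + \<epsilon>) sequentially" if e: "0 < \<epsilon>" for \<epsilon>
  proof -
    have e2: "0 < \<epsilon> / 2" using e by simp
    have 1: "eventually (\<lambda>s. phase s = True \<longrightarrow> real (ms s + 1) - (\<alpha> + \<epsilon> / 2) * real (ns s + 1) \<le> 0) sequentially"
      using near[OF e2]
    proof (rule eventually_mono, goal_cases)
      case (1 s)
      then show ?case using between(3)[OF _ ab'[of "ns s + 1"]] unfolding distrib_right by blast
    qed
    have 2: "(\<Sum>i<s. real (ms i + 1) - (\<alpha> + \<epsilon> / 2) * real (ns i + 1)) \<le> real (Ks 0 + 1) * (real s)\<^sup>2" for s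
    proof -
      have "0 \<le> (\<alpha> + \<epsilon> / 2) * real (\<kappa> s)" using ab e by (intro mult_nonneg_nonneg) auto
      then show ?thesis unfolding sm using \<sigma>\<kappa>_quadratic(1)[of s] by linarith
    qed
    have "frequently (\<lambda>s. real (\<sigma> s) - (\<alpha> + \<epsilon> / 2) * real (\<kappa> s) \<le> \<epsilon> / 2 * real s) sequentially"
      using phase_frequently[OF 1 2 e2] by (simp only: sm)
    then have "frequently (\<lambda>s. real (\<sigma> s) - (\<alpha> + \<epsilon> / 2) * real (\<kappa> s) \<le> \<epsilon> / 2 * real s \<and> 1 \<le> s) sequentially"
      by (rule frequently_eventually_frequently[OF _ ev1])
    then show ?thesis
    proof (rule frequently_elim1)
      fix s assume "real (\<sigma> s) - (\<alpha> + \<epsilon> / 2) * real (\<kappa> s) \<le> \<epsilon> / 2 * real s \<and> 1 \<le> s"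
      then show "real (\<sigma> s) / real (\<kappa> s) \<le> \<alpha> + \<epsilon>" using upper[of s \<alpha> "\<epsilon> / 2"] e2 by simp
    qed
  qed
  have B': "frequently (\<lambda>s. \<beta> - \<epsilon> \<le> real (\<sigma> s) / real (\<kappa> s)) sequentially" if e: "0 < \<epsilon>" for \<epsilon>
  proof -
    have e2: "0 < \<epsilon> / 2" using e by simp
    have 1: "eventually (\<lambda>s. phase s = False \<longrightarrow> (\<beta> - \<epsilon> / 2) * real (ns s + 1) - real (ms s + 1) \<le> 0) sequentially"
      using near[OF e2]
    proof (rule eventually_mono, goal_cases)
      case (1 s)
      then show ?case using between(4)[OF _ ab'[of "ns s + 1"]] unfolding left_diff_distrib by blast
    qed
    have 2: "(\<Sum>i<s. (\<beta> - \<epsilon> / 2) * real (ns i + 1) - real (ms i + 1)) \<le> real (Ks 0 + 1) * (real s)\<^sup>2" for s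
    proof -
      have "(\<beta> - \<epsilon> / 2) * real (\<kappa> s) \<le> 1 * real (\<kappa> s)" using ab e by (intro mult_right_mono) auto
      then show ?thesis unfolding sm using \<sigma>\<kappa>_quadratic(2)[of s] by linarith
    qed
    have "frequently (\<lambda>s. (\<beta> - \<epsilon> / 2) * real (\<kappa> s) - real (\<sigma> s) \<le> \<epsilon> / 2 * real s) sequentially"
      using phase_frequently[OF 1 2 e2] by (simp only: sm)
    then have "frequently (\<lambda>s. (\<beta> - \<epsilon> / 2) * real (\<kappa> s) - real (\<sigma> s) \<le> \<epsilon> / 2 * real s \<and> 1 \<le> s) sequentially"
      by (rule frequently_eventually_frequently[OF _ ev1])
    then show ?thesis
    proof (rule frequently_elim1)
      fix s assume "(\<beta> - \<epsilon> / 2) * real (\<kappa> s) - real (\<sigma> s) \<le> \<epsilon> / 2 * real s \<and> 1 \<le> s"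
      then show "\<beta> - \<epsilon> \<le> real (\<sigma> s) / real (\<kappa> s)" using lower[of \<beta> "\<epsilon> / 2" s] e2 by simp
    qed
  qed
  show "LambdaE \<omega> \<alpha> \<beta> \<noteq> {}" by (rule Lambda_rays(1)[OF A B B'])
  assume h: "0 < h" "h < h'"
  \<comment> \<open>An intermediate exponent: the gap to \<open>h'\<close> absorbs the errors
    \<open>1 / Suc (kap s)\<close> of the steps, the gap to \<open>h\<close> the letters of one
    additional step.\<close>
  define h2 where "h2 = (h + h') / 2"
  have h2: "h < h2" "h2 < h'" "0 < h2" using h by (auto simp: h2_def)
  have entropy: "eventually (\<lambda>s. h2 * real (ms s + 1) \<le> ln (real (bs s))) sequentially"
  proof -
    have "0 < h' - h2" using h2 by simp
    then obtain k where k: "1 / real (Suc k) < h' - h2" using nat_approx_posE by blast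
    have "eventually (\<lambda>s. k \<le> kap s) sequentially" using kap_at_top by (simp add: filterlim_at_top)
    with sl show ?thesis
    proof eventually_elim
      case (elim s)
      then have "1 / real (Suc (kap s)) \<le> 1 / real (Suc k)" by (intro divide_left_mono) auto
      moreover have "h' \<le> slope (c s)" using elim by (simp add: d)
      ultimately have "h2 \<le> slope (c s) - 1 / real (Suc (kap s))" using k by linarith
      then have "real (ms s + 1) * h2 \<le> real (ms s + 1) * (slope (c s) - 1 / real (Suc (kap s)))"
        by (rule mult_left_mono) simp
      also have "\<dots> \<le> ln (real (bs s))" unfolding ms_def bs_def by (rule step_props(4))
      finally show ?case by (simp only: mult.commute)
    qed
  qed
  then obtain s0 where s0: "\<And>i. s0 \<le> i \<Longrightarrow> h2 * real (ms i + 1) - ln (real (bs i)) \<le> 0"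
    by (auto simp: eventually_sequentially)
  define B0 where "B0 = (\<Sum>i<s0. h2 * real (ms i + 1) - ln (real (bs i)))"
  have tail: "h2 * real (\<sigma> s) - (\<Sum>i<s. ln (real (bs i))) \<le> B0" if "s0 \<le> s" for s
  proof -
    have "(\<Sum>i<s. h2 * real (ms i + 1) - ln (real (bs i))) \<le> B0"
      unfolding B0_def using that s0 by (intro sum_nonpos_tail) auto
    then show ?thesis by (simp add: sum_subtractf \<sigma>_real sum_distrib_left del: of_nat_add)
  qed
  \<comment> \<open>The scale in the mass distribution principle is one step ahead of the choices
    already made; the letters of this step are paid from \<open>h2 - h\<close>.\<close>
  have slow: "eventually (\<lambda>s. real (ms (Suc s) + 1) \<le> (h2 - h) / h * real (Suc s)) sequentially"
    using ms_slow[of "(h2 - h) / h"] h2 h by (intro eventually_sequentially_Suc[THEN iffD2]) auto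
  have "eventually (\<lambda>s. h * real (\<sigma> (Suc (Suc s))) \<le> (\<Sum>i\<le>s. ln (real (bs i))) + B0) sequentially"
    using slow eventually_ge_at_top[of s0]
  proof eventually_elim
    case (elim s)
    have "real (Suc s) \<le> real (\<sigma> (Suc s))" using \<sigma>_ge[of "Suc s"] by (simp only: of_nat_le_iff)
    then have "(h2 - h) / h * real (Suc s) \<le> (h2 - h) / h * real (\<sigma> (Suc s))" using h h2 by (intro mult_left_mono) auto
    then have "h * real (ms (Suc s) + 1) \<le> h * ((h2 - h) / h * real (\<sigma> (Suc s)))"
      using elim(1) h by (intro mult_left_mono) auto
    also have "\<dots> = (h2 - h) * real (\<sigma> (Suc s))" using h by simp
    finally have 1: "h * real (ms (Suc s) + 1) \<le> (h2 - h) * real (\<sigma> (Suc s))" .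
    have "real (\<sigma> (Suc (Suc s))) = real (\<sigma> (Suc s)) + real (ms (Suc s) + 1)" using \<sigma>_Suc[of "Suc s"] by simp
    then have "h * real (\<sigma> (Suc (Suc s))) = h * real (\<sigma> (Suc s)) + h * real (ms (Suc s) + 1)" by (simp only: distrib_left)
    also have "\<dots> \<le> h * real (\<sigma> (Suc s)) + (h2 - h) * real (\<sigma> (Suc s))" using 1 by (rule add_left_mono)
    also have "\<dots> = h2 * real (\<sigma> (Suc s))" by (simp add: algebra_simps)
    finally show ?case using tail[of "Suc s"] elim(2) by (simp add: lessThan_Suc_atMost)
  qed
  then obtain C where C: "\<And>s. h * real (\<sigma> (Suc (Suc s))) - C \<le> (\<Sum>i\<le>s. ln (real (bs i)))"
    by (rule eventually_le_shift) blast
  show "hausdorff_measure h (LambdaE \<omega> \<alpha> \<beta>) \<noteq> 0"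
    by (rule Lambda_rays(2)[OF A B B' h(1) C])
qed

end

context branching
begin

lemma Lambda_lower:
  assumes N: "\<And>w. 1 \<le> fst (\<omega> w)" and Y: "\<And>w. word_length (snd (\<omega> w)) \<le> 1"
    and s: "w0 \<in> tree \<omega>" "sh w0 \<omega> \<in> seed"
    and ab: "\<alpha> \<le> \<beta>" "{\<alpha>..\<beta>} \<subseteq> I_set L r"
  shows "LambdaE \<omega> \<alpha> \<beta> \<noteq> {}" "(MIN q\<in>{\<alpha>, \<beta>}. dim_bound L r q) \<le> hausdorff_dim (LambdaE \<omega> \<alpha> \<beta>)"
proof -
  let ?m = "MIN q\<in>{\<alpha>, \<beta>}. dim_bound L r q"
  have I: "\<alpha> \<in> I_set L r" "\<beta> \<in> I_set L r" using ab by auto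
  then have ab': "0 \<le> \<alpha>" "\<beta> \<le> 1" by (auto simp: I_set_def)
  have seed: "2 \<le> fst (\<omega> w0)" "sh (w0 @ [0]) \<omega> \<in> goodI 0" "snd (\<omega> (w0 @ [1])) = of_letter l1" "sh (w0 @ [1, 0]) \<omega> \<in> goodI 0"
    using s(2) by (auto simp: seed_def sh_def)
  define v0 where "v0 = (if pos \<omega> w0 \<noteq> 1 \<and> last (word (pos \<omega> w0)) = flip l0 then w0 @ [1, 0] else w0 @ [0])"
  have v0: "v0 \<in> tree \<omega> \<and> sh v0 \<omega> \<in> goodI 0 \<and> pos \<omega> v0 \<noteq> 1 \<and> last (word (pos \<omega> v0)) = l0"
  proof (cases "pos \<omega> w0 \<noteq> 1 \<and> last (word (pos \<omega> w0)) = flip l0")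
    case True
    have snd: "snd (\<omega> (w0 @ [1, 0])) = la" using goodI_snd[OF seed(4)] .
    have p1: "pos \<omega> (w0 @ [1]) = pos \<omega> w0 * of_letter l1" using pos_snoc[of \<omega> w0 1] seed(3) by simp
    have "word (pos \<omega> w0 * of_letter l1) = word (pos \<omega> w0) @ [l1]"
      using True by (simp add: word_mult_letter)
    moreover have "pos \<omega> (w0 @ [1, 0]) = pos \<omega> w0 * of_letter l1 * la"
      using pos_snoc[of \<omega> "w0 @ [1]" 0] p1 snd by simp
    ultimately have w: "word (pos \<omega> (w0 @ [1, 0])) = word (pos \<omega> w0) @ [l1, l0]"
      by (auto simp: word_mult_letter[of "pos \<omega> w0 * of_letter l1"])
    have "w0 @ [1, 0] \<in> tree \<omega>"
      using s(1) seed(1) N[of "w0 @ [1]"] tree_append[of w0 "[1, 0]" \<omega>] tree_append[of "[1]" "[0]" "sh w0 \<omega>"]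
      by (simp add: sh_apply)
    moreover have "pos \<omega> (w0 @ [1, 0]) \<noteq> 1" using w by (metis word_one Nil_is_append_conv list.distinct(1))
    ultimately show ?thesis using seed(4) True w by (simp add: v0_def)
  next
    case False
    have snd: "snd (\<omega> (w0 @ [0])) = la" using goodI_snd[OF seed(2)] .
    have w: "word (pos \<omega> (w0 @ [0])) = word (pos \<omega> w0) @ [l0]"
      using False unfolding pos_snoc snd word_mult_letter by (rule if_not_P)
    have "w0 @ [0] \<in> tree \<omega>" using s(1) seed(1) by (simp add: tree_append)
    moreover have "pos \<omega> (w0 @ [0]) \<noteq> 1" using w by (metis word_one Nil_is_append_conv list.distinct(1))
    moreover have "v0 = w0 @ [0]" unfolding v0_def using False by (rule if_not_P)
    ultimately show ?thesis using seed(2) w by simp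
  qed
  \<comment> \<open>The case \<open>h' = 0\<close> is separate because nonemptiness is also claimed
    where a dimension bound is 0.\<close>
  have main: "LambdaE \<omega> \<alpha> \<beta> \<noteq> {} \<and> (\<forall>h. 0 < h \<and> h < h' \<longrightarrow> hausdorff_measure h (LambdaE \<omega> \<alpha> \<beta>) \<noteq> 0)"
    if h': "0 \<le> h'" "h' = 0 \<or> ereal h' < dim_bound L r \<alpha>" "h' = 0 \<or> ereal h' < dim_bound L r \<beta>" for h'
  proof -
    obtain d where d: "\<And>s. d s \<le> kap s" "(\<lambda>s. speed (d s)) \<longlonglongrightarrow> \<alpha>" "eventually (\<lambda>s. h' \<le> slope (d s)) sequentially"
      using class_sequence[OF I(1) h'(1,2)] by blast
    obtain d' where d': "\<And>s. d' s \<le> kap s" "(\<lambda>s. speed (d' s)) \<longlonglongrightarrow> \<beta>" "eventually (\<lambda>s. h' \<le> slope (d' s)) sequentially"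
      using class_sequence[OF I(2) h'(1,3)] by blast
    define c where "c s = (if phase s then d s else d' s)" for s
    interpret regular_rays \<mu> r L p \<omega> v0 c
      by unfold_locales (use N Y v0 d(1) d'(1) in \<open>auto simp: c_def\<close>)
    show ?thesis
      using schedule_rays[OF ab'(1) ab(1) ab'(2) c_def d(2) d'(2) d(3) d'(3)] by blast
  qed
  show ne: "LambdaE \<omega> \<alpha> \<beta> \<noteq> {}" using main[of 0] by simp
  show "?m \<le> hausdorff_dim (LambdaE \<omega> \<alpha> \<beta>)"
    unfolding hausdorff_dim_def
  proof (rule INF_greatest, rule ccontr)
    fix h assume h: "h \<in> {s. 0 \<le> s \<and> hausdorff_measure s (LambdaE \<omega> \<alpha> \<beta>) = 0}" and "\<not> ?m \<le> ereal h"
    then have "ereal h < ?m" by (simp only: not_le)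
    then have hm: "ereal h < dim_bound L r \<alpha>" "ereal h < dim_bound L r \<beta>" by (auto simp: min_less_iff_conj)
    have "h \<noteq> 0" using h ne hausdorff_measure_0_eq_0[of "LambdaE \<omega> \<alpha> \<beta>"] by auto
    then have h0: "0 < h" using h by simp
    obtain h' where h': "ereal h < ereal h'" "ereal h' < min (dim_bound L r \<alpha>) (dim_bound L r \<beta>)"
      using ereal_dense2[of "ereal h" "min (dim_bound L r \<alpha>) (dim_bound L r \<beta>)"] hm by auto
    then have "hausdorff_measure h (LambdaE \<omega> \<alpha> \<beta>) \<noteq> 0"
      using main[of h'] h0 by auto
    then show False using h by simp
  qed
qed

end

subsection \<open>The many-to-one formula\<close>

text \<open>The whole list of increments is kept, since the isotropic covers depend on an
  intermediate position as well as on the final one.\<close>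

definition incs :: "'g environment \<Rightarrow> nat list \<Rightarrow> 'g free_group list" where
  "incs \<omega> w = map (\<lambda>k. snd (\<omega> (take k w))) [1..<Suc (length w)]"

lemma pos_incs: "pos \<omega> w = prod_list (incs \<omega> w)"
  by (simp add: pos_def position_def incs_def)

lemma length_incs [simp]: "length (incs \<omega> w) = length w"
  by (simp add: incs_def del: upt_Suc)

lemma nth_incs: "k < length w \<Longrightarrow> incs \<omega> w ! k = snd (\<omega> (take (Suc k) w))"
  by (simp add: incs_def del: upt_Suc)

lemma take_incs: "k \<le> length w \<Longrightarrow> take k (incs \<omega> w) = incs \<omega> (take k w)"
  by (rule nth_equalityI) (auto simp: nth_incs min_absorb2)

lemma nn_integral_count_space_fibres:
  fixes k :: "'i \<Rightarrow> nat"
  shows "(\<integral>\<^sup>+x. f x \<partial>count_space UNIV) = (\<Sum>n. \<integral>\<^sup>+x. f x \<partial>count_space {x. k x = n})"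
proof -
  have "(\<integral>\<^sup>+x. f x \<partial>count_space UNIV) = (\<integral>\<^sup>+x\<in>(\<Union>n. {x. k x = n}). f x \<partial>count_space UNIV)"
    by (intro nn_integral_cong) (auto simp: indicator_def)
  also have "\<dots> = (\<Sum>n. \<integral>\<^sup>+x\<in>{x. k x = n}. f x \<partial>count_space UNIV)"
    by (rule nn_integral_disjoint_family) (auto simp: disjoint_family_on_def)
  finally show ?thesis by (simp add: nn_integral_count_space_indicator)
qed

lemma borel_measurable_count_space_nn_integral:
  assumes "countable I" "\<And>i. i \<in> I \<Longrightarrow> f i \<in> borel_measurable N"
  shows "(\<lambda>x. \<integral>\<^sup>+i. f i x \<partial>count_space I) \<in> borel_measurable N"
proof -
  interpret sigma_finite_measure "count_space I"
    by (rule sigma_finite_measure_count_space_countable[OF assms(1)])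
  have "(\<lambda>(x, i). f i x) \<in> borel_measurable (N \<Otimes>\<^sub>M count_space I)"
    unfolding split_def
    by (rule measurable_compose_countable'[where f="\<lambda>i z. f i (fst z)" and g=snd, OF _ _ assms(1)])
      (use assms(2) in \<open>auto intro: measurable_compose[OF measurable_fst]\<close>)
  then show ?thesis by (rule borel_measurable_nn_integral)
qed

lemma pmf_replicate_pmf:
  "pmf (replicate_pmf n q) xs = (if length xs = n then (\<Prod>k<n. pmf q (xs ! k)) else 0)"
proof (induction n arbitrary: xs)
  case (Suc n)
  have eq: "replicate_pmf (Suc n) q = map_pmf (\<lambda>(x, xs). x # xs) (pair_pmf q (replicate_pmf n q))"
    by (simp add: pair_pmf_def map_bind_pmf)
  have inj: "inj (\<lambda>(x, xs). x # xs)" by (auto simp: inj_def)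
  show ?case
  proof (cases xs)
    case Nil
    have "[] \<notin> set_pmf (replicate_pmf (Suc n) q)" unfolding set_replicate_pmf by simp
    then show ?thesis unfolding Nil pmf_eq_0_set_pmf by (simp add: pmf_eq_0_set_pmf del: replicate_pmf.simps)
  next
    case (Cons y ys)
    have "pmf (replicate_pmf (Suc n) q) xs = pmf (pair_pmf q (replicate_pmf n q)) (y, ys)"
      unfolding eq Cons using pmf_map_inj'[OF inj, of _ "(y, ys)"] by simp
    then show ?thesis using Suc[of ys] by (simp add: pmf_pair Cons prod.lessThan_Suc_shift del: replicate_pmf.simps prod.lessThan_Suc)
  qed
qed (simp add: indicator_def)

lemma nn_integral_lists_Suc:
  "(\<integral>\<^sup>+w. f w \<partial>count_space {w :: nat list. length w = Suc n})
    = (\<integral>\<^sup>+k. \<integral>\<^sup>+w. f (k # w) \<partial>count_space {w. length w = n} \<partial>count_space UNIV)"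
proof -
  have "bij_betw (\<lambda>(k, w). k # w) (UNIV \<times> {w. length w = n}) {w :: nat list. length w = Suc n}"
    by (auto simp: bij_betw_def inj_on_def image_iff length_Suc_conv)
  then have "(\<integral>\<^sup>+w. f w \<partial>count_space {w :: nat list. length w = Suc n})
      = (\<integral>\<^sup>+x. f (case x of (k, w) \<Rightarrow> k # w) \<partial>count_space (UNIV \<times> {w. length w = n}))"
    by (rule nn_integral_bij_count_space[symmetric])
  also have "\<dots> = (\<integral>\<^sup>+x. f (case x of (k, w) \<Rightarrow> k # w) \<partial>(count_space UNIV \<Otimes>\<^sub>M count_space {w. length w = n}))"
    by (subst pair_measure_countable) auto
  also have "\<dots> = (\<integral>\<^sup>+k. \<integral>\<^sup>+w. f (k # w) \<partial>count_space {w. length w = n} \<partial>count_space UNIV)"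
    by (subst sigma_finite_measure.nn_integral_fst[symmetric])
      (auto intro!: sigma_finite_measure_count_space_countable simp: pair_measure_countable)
  finally show ?thesis .
qed

lemma nn_integral_lists_prod:
  fixes g :: "nat \<Rightarrow> ennreal"
  shows "(\<integral>\<^sup>+w. (\<Prod>k<n. g (w ! k)) \<partial>count_space {w. length w = n}) = (\<integral>\<^sup>+k. g k \<partial>count_space UNIV) ^ n"
proof (induction n)
  case (Suc n)
  have "(\<integral>\<^sup>+w. (\<Prod>k<Suc n. g (w ! k)) \<partial>count_space {w. length w = Suc n})
      = (\<integral>\<^sup>+k. \<integral>\<^sup>+w. g k * (\<Prod>k<n. g (w ! k)) \<partial>count_space {w. length w = n} \<partial>count_space UNIV)"
    unfolding nn_integral_lists_Suc by (simp add: prod.lessThan_Suc_shift del: prod.lessThan_Suc)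
  also have "\<dots> = (\<integral>\<^sup>+k. g k \<partial>count_space UNIV) * (\<integral>\<^sup>+k. g k \<partial>count_space UNIV) ^ n"
    by (simp add: nn_integral_cmult nn_integral_multc Suc)
  finally show ?case by simp
qed (simp add: nn_integral_count_space_finite)

text \<open>The mean as a sum of tail probabilities: the child with number \<open>j\<close> exists
  when there are more than \<open>j\<close> children.\<close>

lemma sum_tails:
  fixes p :: "nat pmf"
  assumes mean: "(\<lambda>k. real k * pmf p k) sums r"
  shows "(\<integral>\<^sup>+j. ennreal (measure p {j<..}) \<partial>count_space UNIV) = ennreal r"
proof -
  have "ennreal (measure p {j<..}) = (\<Sum>k. ennreal (pmf p k) * indicator {j<..} k)" for j
  proof -
    have "ennreal (measure p {j<..}) = emeasure p {j<..}" by (simp add: measure_pmf.emeasure_eq_measure)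
    also have "\<dots> = (\<integral>\<^sup>+k. ennreal (pmf p k) * indicator {j<..} k \<partial>count_space UNIV)"
      by (simp add: nn_integral_indicator[symmetric] nn_integral_measure_pmf del: nn_integral_indicator)
    finally show ?thesis by (simp add: nn_integral_count_space_nat)
  qed
  then have "(\<integral>\<^sup>+j. ennreal (measure p {j<..}) \<partial>count_space UNIV) = (\<Sum>j. \<Sum>k. ennreal (pmf p k) * indicator {j<..} k)"
    by (simp add: nn_integral_count_space_nat)
  also have "\<dots> = (\<Sum>k. \<Sum>j. ennreal (pmf p k) * indicator {j<..} k)" by (rule ennreal_suminf_swap)
  also have "\<dots> = (\<Sum>k. ennreal (real k * pmf p k))"
  proof (rule suminf_cong)
    fix k
    have "(\<Sum>j. ennreal (pmf p k) * indicator {j<..} k) = (\<Sum>j<k. ennreal (pmf p k) * indicator {j<..} k)"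
      by (rule suminf_finite) auto
    also have "\<dots> = (\<Sum>j<k. ennreal (pmf p k))" by (rule sum.cong) auto
    finally show "(\<Sum>j. ennreal (pmf p k) * indicator {j<..} k) = ennreal (real k * pmf p k)"
      by (simp add: ennreal_mult' ennreal_of_nat_eq_real_of_nat)
  qed
  also have "\<dots> = ennreal r" by (rule suminf_ennreal_eq[OF _ mean]) auto
  finally show ?thesis .
qed

context branching
begin

abbreviation (input) tail :: "nat \<Rightarrow> real" where "tail j \<equiv> measure p {j<..}"

lemma path_event:
  assumes "length ys = length w"
  shows "emeasure \<E> {\<omega>. w \<in> tree \<omega> \<and> incs \<omega> w = ys} = ennreal ((\<Prod>k<length w. tail (w ! k)) * pmf (replicate_pmf (length w) \<mu>) ys)"
    and "{\<omega>. w \<in> tree \<omega> \<and> incs \<omega> w = ys} \<in> sets \<E>"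
proof -
  let ?n = "length w"
  \<comment> \<open>At depth \<open>k\<close> of the path the offspring number is constrained for
    \<open>k < n\<close> and the increment for \<open>0 < k\<close>: the endpoint needs no child,
    and positions start below the root.\<close>
  define B where "B k = {j. k < ?n \<longrightarrow> w ! k < j} \<times> {y. 0 < k \<longrightarrow> y = ys ! (k - 1)}" for k
  let ?J = "(\<lambda>k. take k w) ` {..?n}"
  have inj: "inj_on (\<lambda>k. take k w) {..?n}" by (auto simp: inj_on_def dest: arg_cong[of _ _ length])
  have eq: "{\<omega>. w \<in> tree \<omega> \<and> incs \<omega> w = ys} = {\<omega>. \<forall>v\<in>?J. \<omega> v \<in> B (length v)}"
  proof (intro set_eqI, unfold mem_Collect_eq)
    fix \<omega> :: "'g environment"
    have "incs \<omega> w = ys \<longleftrightarrow> (\<forall>k<?n. snd (\<omega> (take (Suc k) w)) = ys ! k)"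
      using assms by (auto simp: list_eq_iff_nth_eq nth_incs)
    also have "\<dots> \<longleftrightarrow> (\<forall>k\<le>?n. 0 < k \<longrightarrow> snd (\<omega> (take k w)) = ys ! (k - 1))"
      by (auto simp: Suc_le_eq gr0_conv_Suc)
    finally have 1: "incs \<omega> w = ys \<longleftrightarrow> (\<forall>k\<le>?n. 0 < k \<longrightarrow> snd (\<omega> (take k w)) = ys ! (k - 1))" .
    have 2: "w \<in> tree \<omega> \<longleftrightarrow> (\<forall>k\<le>?n. k < ?n \<longrightarrow> w ! k < fst (\<omega> (take k w)))"
      by (auto simp: tree_def gw_tree_def)
    have 3: "(\<forall>v\<in>?J. \<omega> v \<in> B (length v)) \<longleftrightarrow> (\<forall>k\<le>?n. \<omega> (take k w) \<in> B k)"
    proof -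
      have "(\<forall>v\<in>?J. \<omega> v \<in> B (length v)) \<longleftrightarrow> (\<forall>k\<in>{..?n}. \<omega> (take k w) \<in> B (length (take k w)))"
        by (rule iffI, rule ballI, erule bspec, erule imageI, rule ballI, erule imageE, hypsubst, erule bspec)
      also have "\<dots> \<longleftrightarrow> (\<forall>k\<in>{..?n}. \<omega> (take k w) \<in> B k)"
        by (rule ball_cong) (simp_all add: min_absorb2)
      finally show ?thesis by (simp only: Ball_def atMost_iff)
    qed
    show "(w \<in> tree \<omega> \<and> incs \<omega> w = ys) = (\<forall>v\<in>?J. \<omega> v \<in> B (length v))"
      unfolding 1 2 3 unfolding B_def mem_Times_iff mem_Collect_eq by (simp only: imp_conjR all_conj_distrib)
  qed
  show "{\<omega>. w \<in> tree \<omega> \<and> incs \<omega> w = ys} \<in> sets \<E>"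
    unfolding eq by (rule sets_env_cylinder) simp
  have "emeasure \<E> {\<omega>. w \<in> tree \<omega> \<and> incs \<omega> w = ys} = (\<Prod>v\<in>?J. emeasure (measure_pmf D) (B (length v)))"
    unfolding eq by (rule emeasure_env_cylinder') simp
  also have "\<dots> = (\<Prod>k\<le>?n. emeasure (measure_pmf D) (B k))"
    by (subst prod.reindex[OF inj]) (auto intro!: prod.cong)
  also have "\<dots> = ennreal (\<Prod>k\<le>?n. measure D (B k))"
    by (simp add: measure_pmf.emeasure_eq_measure prod_ennreal)
  also have "(\<Prod>k\<le>?n. measure D (B k)) = (\<Prod>k\<le>?n. measure p {j. k < ?n \<longrightarrow> w ! k < j} * measure \<mu> {y. 0 < k \<longrightarrow> y = ys ! (k - 1)})"
    unfolding B_def by (intro prod.cong refl measure_pmf_prob_product) auto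
  also have "\<dots> = (\<Prod>k\<le>?n. measure p {j. k < ?n \<longrightarrow> w ! k < j}) * (\<Prod>k\<le>?n. measure \<mu> {y. 0 < k \<longrightarrow> y = ys ! (k - 1)})"
    by (rule prod.distrib)
  also have "(\<Prod>k\<le>?n. measure p {j. k < ?n \<longrightarrow> w ! k < j}) = (\<Prod>k<?n. tail (w ! k))"
    by (simp add: lessThan_Suc_atMost[symmetric] greaterThan_def)
  also have "(\<Prod>k\<le>?n. measure \<mu> {y. 0 < k \<longrightarrow> y = ys ! (k - 1)}) = (\<Prod>k<?n. pmf \<mu> (ys ! k))"
    by (simp add: lessThan_Suc_atMost[symmetric] prod.lessThan_Suc_shift measure_pmf_single del: prod.lessThan_Suc)
  also have "(\<Prod>k<?n. pmf \<mu> (ys ! k)) = pmf (replicate_pmf ?n \<mu>) ys"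
    using assms by (simp add: pmf_replicate_pmf)
  finally show "emeasure \<E> {\<omega>. w \<in> tree \<omega> \<and> incs \<omega> w = ys} = ennreal ((\<Prod>k<length w. tail (w ! k)) * pmf (replicate_pmf (length w) \<mu>) ys)" .
qed

lemma measurable_path: "(\<lambda>\<omega>. indicator (tree \<omega>) w * f (incs \<omega> w) :: ennreal) \<in> borel_measurable \<E>"
  and nn_integral_path: "(\<integral>\<^sup>+\<omega>. indicator (tree \<omega>) w * f (incs \<omega> w) \<partial>\<E>)
    = (\<Prod>k<length w. ennreal (tail (w ! k))) * (\<integral>\<^sup>+ys. f ys \<partial>replicate_pmf (length w) \<mu>)"
proof -
  let ?N = "count_space {ys :: 'g free_group list. length ys = length w}"
  have cnt: "countable {ys :: 'g free_group list. length ys = length w}" by simp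
  have eq: "indicator (tree \<omega>) w * f (incs \<omega> w) = (\<integral>\<^sup>+ys. f ys * indicator {\<omega>. w \<in> tree \<omega> \<and> incs \<omega> w = ys} \<omega> \<partial>?N)" for \<omega>
  proof -
    have "(\<integral>\<^sup>+ys. f ys * indicator {\<omega>. w \<in> tree \<omega> \<and> incs \<omega> w = ys} \<omega> \<partial>?N)
        = (\<integral>\<^sup>+ys. (indicator (tree \<omega>) w * f (incs \<omega> w)) * indicator {incs \<omega> w} ys \<partial>?N)"
      by (intro nn_integral_cong) (auto simp: indicator_def)
    also have "\<dots> = indicator (tree \<omega>) w * f (incs \<omega> w)"
      by (subst nn_integral_cmult_indicator) (auto simp: emeasure_count_space)
    finally show ?thesis by simp
  qed
  have m: "(\<lambda>\<omega>. f ys * indicator {\<omega>. w \<in> tree \<omega> \<and> incs \<omega> w = ys} \<omega>) \<in> borel_measurable \<E>"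
    if "length ys = length w" for ys
    using path_event(2)[OF that] by measurable
  show "(\<lambda>\<omega>. indicator (tree \<omega>) w * f (incs \<omega> w) :: ennreal) \<in> borel_measurable \<E>"
    unfolding eq by (rule borel_measurable_count_space_nn_integral[OF cnt]) (use m in auto)
  have "(\<integral>\<^sup>+\<omega>. indicator (tree \<omega>) w * f (incs \<omega> w) \<partial>\<E>)
      = (\<integral>\<^sup>+ys. \<integral>\<^sup>+\<omega>. f ys * indicator {\<omega>. w \<in> tree \<omega> \<and> incs \<omega> w = ys} \<omega> \<partial>\<E> \<partial>?N)"
    unfolding eq by (rule nn_integral_count_space_nn_integral[OF cnt]) (use m in auto)
  also have "\<dots> = (\<integral>\<^sup>+ys. (\<Prod>k<length w. ennreal (tail (w ! k))) * (f ys * ennreal (pmf (replicate_pmf (length w) \<mu>) ys)) \<partial>?N)"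
  proof (rule nn_integral_cong)
    fix ys :: "'g free_group list" assume "ys \<in> space ?N"
    then have l: "length ys = length w" by simp
    show "(\<integral>\<^sup>+\<omega>. f ys * indicator {\<omega>. w \<in> tree \<omega> \<and> incs \<omega> w = ys} \<omega> \<partial>\<E>)
      = (\<Prod>k<length w. ennreal (tail (w ! k))) * (f ys * ennreal (pmf (replicate_pmf (length w) \<mu>) ys))"
      using path_event[OF l]
      by (simp add: nn_integral_cmult_indicator ennreal_mult'' prod_ennreal prod_nonneg mult_ac)
  qed
  also have "\<dots> = (\<Prod>k<length w. ennreal (tail (w ! k))) * (\<integral>\<^sup>+ys. f ys * ennreal (pmf (replicate_pmf (length w) \<mu>) ys) \<partial>?N)"
    by (rule nn_integral_cmult) simp
  also have "(\<integral>\<^sup>+ys. f ys * ennreal (pmf (replicate_pmf (length w) \<mu>) ys) \<partial>?N)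
    = (\<integral>\<^sup>+ys. ennreal (pmf (replicate_pmf (length w) \<mu>) ys) * f ys \<partial>count_space UNIV)"
    by (subst nn_integral_count_space_indicator) (auto intro!: nn_integral_cong simp: indicator_def pmf_replicate_pmf mult.commute)
  also have "\<dots> = (\<integral>\<^sup>+ys. f ys \<partial>replicate_pmf (length w) \<mu>)"
    by (simp add: nn_integral_measure_pmf)
  finally show "(\<integral>\<^sup>+\<omega>. indicator (tree \<omega>) w * f (incs \<omega> w) \<partial>\<E>)
    = (\<Prod>k<length w. ennreal (tail (w ! k))) * (\<integral>\<^sup>+ys. f ys \<partial>replicate_pmf (length w) \<mu>)" .
qed

text \<open>The sum runs over all Ulam-Harris words. For words of length \<open>n\<close> the
  probabilities of lying in the tree are products of tails, which add up to \<open>r ^ n\<close>,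
  and the increments along a word form a path of the walk.\<close>

theorem many_to_one:
  "(\<integral>\<^sup>+\<omega>. \<integral>\<^sup>+w. indicator (tree \<omega>) w * f (incs \<omega> w) \<partial>count_space UNIV \<partial>\<E>)
    = (\<Sum>n. ennreal (r ^ n) * (\<integral>\<^sup>+ys. f ys \<partial>replicate_pmf n \<mu>))"
proof -
  have "(\<integral>\<^sup>+\<omega>. \<integral>\<^sup>+w. indicator (tree \<omega>) w * f (incs \<omega> w) \<partial>count_space UNIV \<partial>\<E>)
      = (\<integral>\<^sup>+w. \<integral>\<^sup>+\<omega>. indicator (tree \<omega>) w * f (incs \<omega> w) \<partial>\<E> \<partial>count_space UNIV)"
    by (rule nn_integral_count_space_nn_integral) (auto intro: measurable_path)
  also have "\<dots> = (\<Sum>n. \<integral>\<^sup>+w. (\<Prod>k<length w. ennreal (tail (w ! k))) * (\<integral>\<^sup>+ys. f ys \<partial>replicate_pmf (length w) \<mu>) \<partial>count_space {w. length w = n})"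
    unfolding nn_integral_path by (rule nn_integral_count_space_fibres)
  also have "\<dots> = (\<Sum>n. \<integral>\<^sup>+w. (\<Prod>k<n. ennreal (tail (w ! k))) * (\<integral>\<^sup>+ys. f ys \<partial>replicate_pmf n \<mu>) \<partial>count_space {w. length w = n})"
    by (intro suminf_cong nn_integral_cong) simp
  also have "\<dots> = (\<Sum>n. ennreal (r ^ n) * (\<integral>\<^sup>+ys. f ys \<partial>replicate_pmf n \<mu>))"
    using r_gt_1 by (simp add: nn_integral_multc nn_integral_lists_prod[where g = "\<lambda>j. ennreal (tail j)"] sum_tails[OF mean] ennreal_power)
  finally show ?thesis .
qed

corollary AE_sum_finite:
  assumes "(\<Sum>n. ennreal (r ^ n) * (\<integral>\<^sup>+ys. f ys \<partial>replicate_pmf n \<mu>)) < \<top>"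
  shows "AE \<omega> in \<E>. (\<integral>\<^sup>+w. indicator (tree \<omega>) w * f (incs \<omega> w) \<partial>count_space UNIV) < \<top>"
proof -
  have m: "(\<lambda>\<omega>. \<integral>\<^sup>+w. indicator (tree \<omega>) w * f (incs \<omega> w) \<partial>count_space UNIV) \<in> borel_measurable \<E>"
    by (rule borel_measurable_count_space_nn_integral) (auto intro: measurable_path)
  have "AE \<omega> in \<E>. (\<integral>\<^sup>+w. indicator (tree \<omega>) w * f (incs \<omega> w) \<partial>count_space UNIV) \<noteq> \<infinity>"
    by (rule nn_integral_PInf_AE[OF m]) (use assms many_to_one[of f] in \<open>simp add: less_top[symmetric]\<close>)
  then show ?thesis by (simp add: less_top[symmetric])
qed

end

subsection \<open>Covers by cylinders\<close>

definition cyl :: "'g free_group \<Rightarrow> 'g boundary set" where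
  "cyl x = {\<xi>. ray \<xi> (word_length x) = x}"

lemma dist_cyl: "\<xi> \<in> cyl x \<Longrightarrow> \<xi>' \<in> cyl x \<Longrightarrow> dist \<xi> \<xi>' \<le> exp (- real (word_length x))"
  using le_meet_iff[of \<xi> \<xi>' "word_length x"] by (auto simp: cyl_def dist_boundary_def)

lemma bounded_cyl: "bounded (cyl x)"
  unfolding bounded_def using dist_cyl by blast

lemma diameter_cyl: "diameter (cyl x) \<le> exp (- real (word_length x))"
proof (cases "cyl x = {}")
  case False
  then show ?thesis
    unfolding diameter_def using dist_cyl by (auto intro!: cSUP_least)
qed (simp add: diameter_def)

abbreviation weight :: "real \<Rightarrow> 'g free_group \<Rightarrow> ennreal" where
  "weight s x \<equiv> ennreal (exp (- s * real (word_length x)))"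

lemma diam_power_cyl: "0 < s \<Longrightarrow> diam_power s (cyl x) \<le> weight s x"
proof -
  assume s: "0 < s"
  have "diameter (cyl x) powr s \<le> exp (- real (word_length x)) powr s"
    using s by (intro powr_mono2 diameter_cyl diameter_ge_0 bounded_cyl) auto
  also have "\<dots> = exp (- s * real (word_length x))" by (simp add: powr_def)
  finally show ?thesis using s by (auto simp: diam_power_def)
qed

lemma nn_integral_countable_eq_suminf:
  fixes f :: "'i::countable \<Rightarrow> ennreal"
  shows "(\<integral>\<^sup>+i. f i \<partial>count_space UNIV) = (\<Sum>n. if n \<in> range (to_nat :: 'i \<Rightarrow> nat) then f (from_nat n) else 0)"
proof -
  have "(\<integral>\<^sup>+i. f i \<partial>count_space UNIV) = (\<integral>\<^sup>+i. f (from_nat (to_nat (i :: 'i))) \<partial>count_space UNIV)" by simp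
  also have "\<dots> = (\<integral>\<^sup>+n. f (from_nat n) \<partial>count_space (range (to_nat :: 'i \<Rightarrow> nat)))"
    by (rule nn_integral_bij_count_space) (simp add: bij_betw_def)
  also have "\<dots> = (\<integral>\<^sup>+n. (if n \<in> range (to_nat :: 'i \<Rightarrow> nat) then f (from_nat n) else 0) \<partial>count_space UNIV)"
    by (subst nn_integral_count_space_indicator) (auto intro!: nn_integral_cong simp: indicator_def)
  finally show ?thesis by (simp add: nn_integral_count_space_nat)
qed

text \<open>Omitting finitely many sets from the cover makes the sum arbitrarily small, and then each
  remaining set is small as well.\<close>

lemma hausdorff_null:
  fixes x :: "'i::countable \<Rightarrow> 'g free_group"
  assumes s: "0 < s" and fin: "(\<integral>\<^sup>+i. indicator J i * weight s (x i) \<partial>count_space UNIV) < \<top>"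
    and cov: "\<And>\<xi>. \<xi> \<in> T \<Longrightarrow> infinite {i \<in> J. \<xi> \<in> cyl (x i)}"
  shows "hausdorff_measure s T = 0"
proof -
  define c where "c n = (if n \<in> to_nat ` J then exp (- s * real (word_length (x (from_nat n)))) else 0)" for n
  have c0: "0 \<le> c n" for n by (simp add: c_def)
  have "(\<Sum>n. ennreal (c n)) = (\<integral>\<^sup>+i. indicator J i * weight s (x i) \<partial>count_space UNIV)"
    unfolding nn_integral_countable_eq_suminf by (intro suminf_cong) (auto simp: c_def indicator_def)
  then have sm: "summable c" using fin c0 by (intro summable_suminf_not_top) auto
  have small: "hausdorff_premeasure \<delta> s T \<le> ennreal \<epsilon>" if d: "0 < \<delta>" and e: "0 < \<epsilon>" for \<delta> \<epsilon>
  proof -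
    define \<epsilon>' where "\<epsilon>' = min \<epsilon> (\<delta> powr s)"
    have e': "0 < \<epsilon>'" using d e by (simp add: \<epsilon>'_def)
    obtain N where N: "norm (\<Sum>n. c (n + N)) < \<epsilon>'"
      using suminf_exist_split[OF e' sm] by blast
    define V where "V n = (if N \<le> n \<and> n \<in> to_nat ` J then cyl (x (from_nat n)) else {})" for n
    have tail: "summable (\<lambda>n. c (n + N))" using sm by (rule summable_ignore_initial_segment)
    have cN: "c n < \<epsilon>'" if "N \<le> n" for n
    proof -
      have "c n = sum (\<lambda>n. c (n + N)) {n - N}" using that by simp
      also have "\<dots> \<le> (\<Sum>n. c (n + N))" by (rule sum_le_suminf[OF tail]) (use c0 in auto)
      finally show ?thesis using N by simp
    qed
    have "T \<subseteq> (\<Union>n. V n)"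
    proof
      fix \<xi> assume "\<xi> \<in> T"
      then have "infinite (to_nat ` {i \<in> J. \<xi> \<in> cyl (x i)})"
        using cov by (subst finite_image_iff) (auto intro: inj_onI)
      then obtain n where "N \<le> n" "n \<in> to_nat ` {i \<in> J. \<xi> \<in> cyl (x i)}"
        using infinite_nat_iff_unbounded_le by blast
      then show "\<xi> \<in> (\<Union>n. V n)" by (auto simp: V_def)
    qed
    moreover have "bounded (V n) \<and> diameter (V n) \<le> \<delta>" for n
    proof (cases "N \<le> n \<and> n \<in> to_nat ` J")
      case True
      let ?m = "real (word_length (x (from_nat n)))"
      have "exp (- ?m) powr s = c n" using True by (simp add: c_def powr_def)
      also have "\<dots> < \<delta> powr s" using cN[of n] True by (simp add: \<epsilon>'_def)
      finally have "exp (- ?m) < \<delta>" using s d by (meson exp_ge_zero less_imp_le not_le powr_mono2)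
      then show ?thesis using diameter_cyl[of "x (from_nat n)"] bounded_cyl True by (auto simp: V_def)
    qed (use d in \<open>auto simp: V_def\<close>)
    ultimately have "hausdorff_premeasure \<delta> s T \<le> (\<Sum>n. diam_power s (V n))"
      unfolding hausdorff_premeasure_def by (intro INF_lower) auto
    also have "\<dots> \<le> (\<Sum>n. ennreal (if N \<le> n then c n else 0))"
      by (intro suminf_le) (use diam_power_cyl[OF s] in \<open>auto simp: V_def c_def diam_power_def[of s "{}"]\<close>)
    also have "\<dots> = (\<Sum>n. ennreal (c (n + N)))"
      by (subst suminf_offset[of _ N]) auto
    also have "\<dots> = ennreal (\<Sum>n. c (n + N))" by (rule suminf_ennreal2) (use c0 tail in auto)
    also have "\<dots> \<le> ennreal \<epsilon>" using N abs_ge_self[of "\<Sum>n. c (n + N)"] by (intro ennreal_leI) (simp add: \<epsilon>'_def)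
    finally show ?thesis .
  qed
  have "hausdorff_premeasure \<delta> s T = 0" if "0 < \<delta>" for \<delta>
  proof (rule ccontr)
    assume "hausdorff_premeasure \<delta> s T \<noteq> 0"
    then have "0 < hausdorff_premeasure \<delta> s T" by (simp add: zero_less_iff_neq_zero)
    then obtain y where y: "0 < y" "y < hausdorff_premeasure \<delta> s T" using dense by blast
    then obtain \<epsilon> where e: "y = ennreal \<epsilon>" "0 \<le> \<epsilon>" by (cases y) (auto simp: top.not_eq_extremum)
    then have "0 < \<epsilon>" using y(1) by simp
    from small[OF that this] show False using y(2) e(1) by simp
  qed
  then show ?thesis unfolding hausdorff_measure_def by (intro antisym SUP_least) auto
qed

lemma hausdorff_dim_le: "0 \<le> s \<Longrightarrow> hausdorff_measure s T = 0 \<Longrightarrow> hausdorff_dim T \<le> ereal s"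
  unfolding hausdorff_dim_def by (rule INF_lower) simp

lemma word_length_le_1_cases:
  assumes "word_length g \<le> 1"
  obtains "g = 1" | l where "g = of_letter l"
proof (cases "word g")
  case Nil
  then show ?thesis using that by simp
next
  case (Cons l ls)
  then have "word g = word (of_letter l)" using assms by (simp add: word_length_def)
  then show ?thesis using that word_inject by blast
qed

lemma first_change:
  assumes "n \<le> (n' :: nat)" "Q n" "\<not> Q n'"
  shows "\<exists>k\<ge>n. Q k \<and> \<not> Q (Suc k)"
proof (rule ccontr)
  assume *: "\<not> ?thesis"
  from assms(1) have "Q n'"
    by (induction n' rule: dec_induct) (use * assms(2) in auto)
  then show False using assms(3) by blast
qed

text \<open>In a tree the set of extensions of \<open>q\<close> can be entered only at
  \<open>q\<close>, coming from its parent.\<close>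

lemma step_enters:
  assumes g: "word_length g \<le> 1" and n: "\<not> is_prefix q x" and y: "is_prefix q (x * g)"
  shows "x * g = q" "word x = butlast (word q)"
proof -
  from g have "word (x * g) = word q \<and> word x = butlast (word q)"
  proof (cases rule: word_length_le_1_cases)
    case (2 l)
    have "\<not> prefix (word q) (butlast (word x))" using n prefix_order.trans prefixeq_butlast unfolding is_prefix_def by blast
    then have "word (x * g) = word x @ [l]" using y unfolding is_prefix_def 2 word_mult_letter by (auto split: if_splits)
    then show ?thesis using n y unfolding is_prefix_def by auto
  qed (use n y in simp)
  then show "x * g = q" "word x = butlast (word q)" by (simp_all add: word_inject)
qed

lemma prefix_ray:
  "word (ray \<xi> m) = take m (word (ray \<xi> (m + j)))"
proof (induction j)
  case 0
  show ?case using word_length_ray[of \<xi> m] by (simp add: word_length_def)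
next
  case (Suc j)
  have "word (ray \<xi> (m + j)) = take (m + j) (word (ray \<xi> (Suc (m + j))))"
    using is_prefix_ray[of \<xi> "m + j"] word_length_ray[of \<xi> "m + j"]
    by (auto simp: is_prefix_def word_length_def prefix_def)
  then show ?case using Suc by (simp add: min_def)
qed

lemma butlast_ray: "butlast (word (ray \<xi> (Suc m))) = word (ray \<xi> m)"
  using prefix_ray[of \<xi> m 1] word_length_ray[of \<xi> "Suc m"] by (simp add: butlast_conv_take word_length_def)

locale lazy_path =
  fixes X :: "nat \<Rightarrow> 'g free_group" and \<xi> :: "'g boundary"
  assumes X0: "X 0 = 1" and step: "\<And>n. \<exists>g. word_length g \<le> 1 \<and> X (Suc n) = X n * g"
    and lim: "tends_to_boundary X \<xi>"
begin

lemma word_length_le: "word_length (X n) \<le> n"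
proof (induction n)
  case (Suc n)
  obtain g where "word_length g \<le> 1" "X (Suc n) = X n * g" using step by blast
  then show ?case using Suc word_length_mult_le[of "X n" g] by simp
qed (simp add: X0)

lemma enters:
  assumes "\<not> is_prefix (ray \<xi> m) (X n)"
  obtains k where "n \<le> k" "X (Suc k) = ray \<xi> m" "word (X k) = butlast (word (ray \<xi> m))"
proof -
  have "\<exists>n'\<ge>n. is_prefix (ray \<xi> m) (X n')"
    using lim by (auto simp: tends_to_boundary_def eventually_sequentially) (meson nle_le)
  then obtain n' where n': "n \<le> n'" "is_prefix (ray \<xi> m) (X n')" by blast
  obtain k where k: "n \<le> k" "\<not> is_prefix (ray \<xi> m) (X k)" "is_prefix (ray \<xi> m) (X (Suc k))"
    using first_change[of n n' "\<lambda>k. \<not> is_prefix (ray \<xi> m) (X k)"] n' assms by auto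
  obtain g where g: "word_length g \<le> 1" "X (Suc k) = X k * g" using step by blast
  from step_enters[OF g(1) k(2)] k(3) show ?thesis using that[OF k(1)] g(2) by simp
qed

text \<open>If the position at time \<open>n\<close> is not itself on the limit ray, then it lies
  outside the subtree of the prefix of its own length. The path has to enter that subtree later, and
  it does so at this prefix.\<close>

lemma returns:
  obtains k where "n \<le> k" "X k = ray \<xi> (word_length (X n))"
proof (cases "is_prefix (ray \<xi> (word_length (X n))) (X n)")
  case True
  then have "take (length (word (ray \<xi> (word_length (X n))))) (word (X n)) = word (ray \<xi> (word_length (X n)))"
    by (auto simp: is_prefix_def elim!: prefixE)
  then have "word (ray \<xi> (word_length (X n))) = word (X n)"
    using word_length_ray[of \<xi> "word_length (X n)"] by (simp add: word_length_def)
  then show ?thesis using that[of n] by (simp add: word_inject)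
next
  case False
  then obtain k where "n \<le> k" "X (Suc k) = ray \<xi> (word_length (X n))" by (rule enters)
  then show ?thesis using that[of "Suc k"] by simp
qed

text \<open>Let \<open>m\<close> be the length of the common prefix of \<open>X n\<close> and the
  limit. The subtree of the next prefix is entered only after time \<open>n\<close>, and immediately
  before that the path is at \<open>ray \<xi> m\<close>.\<close>

lemma returns_to_meet:
  obtains k m where "n \<le> k" "X k = ray \<xi> m" "is_prefix (ray \<xi> m) (X n)"
proof -
  define m where "m = (GREATEST m. is_prefix (ray \<xi> m) (X n))"
  have bd: "m \<le> word_length (X n)" if "is_prefix (ray \<xi> m) (X n)" for m
    using that word_length_ray[of \<xi> m] by (auto simp: is_prefix_def word_length_def dest: prefix_length_le)
  have "is_prefix (ray \<xi> 0) (X n)" by (simp add: ray_0 is_prefix_def)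
  then have m: "is_prefix (ray \<xi> m) (X n)"
    unfolding m_def by (rule GreatestI_nat) (rule bd)
  have "\<not> is_prefix (ray \<xi> (Suc m)) (X n)"
  proof
    assume "is_prefix (ray \<xi> (Suc m)) (X n)"
    then have "Suc m \<le> m" unfolding m_def by (rule Greatest_le_nat) (rule bd)
    then show False by simp
  qed
  then obtain k where "n \<le> k" "word (X k) = butlast (word (ray \<xi> (Suc m)))" by (rule enters)
  then show ?thesis using that[OF _ _ m] by (simp add: butlast_ray word_inject)
qed

lemma visits:
  obtains k where "m \<le> k" "X k = ray \<xi> m"
proof (cases m)
  case 0
  then show ?thesis using that[of 0] by (simp add: X0 ray_0)
next
  case (Suc j)
  have "\<not> is_prefix (ray \<xi> m) (X 0)"
    using word_length_ray[of \<xi> m] Suc by (auto simp: X0 is_prefix_def)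
  then obtain k where k: "X (Suc k) = ray \<xi> m" by (rule enters)
  then have "m \<le> Suc k" using word_length_le[of "Suc k"] word_length_ray[of \<xi> m] by simp
  then show ?thesis using that k by blast
qed

definition v :: "nat \<Rightarrow> real" where "v n = real (word_length (X n)) / real n"

lemma v_Suc: "0 < n \<Longrightarrow> v (Suc n) \<le> v n + 1 / real n"
proof -
  assume n: "0 < n"
  obtain g where "word_length g \<le> 1" "X (Suc n) = X n * g" using step by blast
  then have "word_length (X (Suc n)) \<le> word_length (X n) + 1" using word_length_mult_le[of "X n" g] by simp
  then have "v (Suc n) \<le> real (word_length (X n) + 1) / real (Suc n)"
    unfolding v_def by (intro divide_right_mono) (simp_all only: of_nat_le_iff of_nat_0_le_iff)
  also have "\<dots> \<le> real (word_length (X n) + 1) / real n" using n by (intro divide_left_mono) auto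
  also have "\<dots> = v n + 1 / real n" by (simp add: v_def add_divide_distrib)
  finally show ?thesis .
qed

text \<open>In one step the speed rises by at most \<open>1 / n\<close>, so late upcrossings cannot
  jump over the interval from \<open>c\<close> to \<open>d\<close>, and the assumptions on liminf
  and limsup force the speed to be below \<open>d\<close> and above \<open>c\<close> again and
  again.\<close>

lemma frequently_speed:
  assumes li: "liminf (\<lambda>n. ereal (v n)) \<le> ereal q" and ls: "ereal q \<le> limsup (\<lambda>n. ereal (v n))" and cd: "c < q" "q < d"
  shows "\<exists>n\<ge>N. 0 < n \<and> v n \<in> {c..d}"
proof -
  have low: "\<exists>n\<ge>N. v n < d" for N
  proof (rule ccontr)
    assume "\<not> ?thesis"
    then have "eventually (\<lambda>n. ereal d \<le> ereal (v n)) sequentially"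
      by (intro eventually_sequentiallyI[of N]) (auto simp: not_less)
    then have "ereal d \<le> liminf (\<lambda>n. ereal (v n))" by (rule Liminf_bounded)
    then show False using li cd by (meson ereal_less_eq(3) not_le order_trans)
  qed
  have high: "\<exists>n\<ge>N. c < v n" for N
  proof (rule ccontr)
    assume "\<not> ?thesis"
    then have "eventually (\<lambda>n. ereal (v n) \<le> ereal c) sequentially"
      by (intro eventually_sequentiallyI[of N]) (auto simp: not_less)
    then have "limsup (\<lambda>n. ereal (v n)) \<le> ereal c" by (rule Limsup_bounded)
    then show False using ls cd by (meson ereal_less_eq(3) not_le order_trans)
  qed
  obtain M where M: "1 / (d - c) < real M" using reals_Archimedean2 by blast
  obtain n1 where n1: "n1 \<ge> max (N + 1) M" "v n1 < d" using low by blast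
  show ?thesis
  proof (cases "c \<le> v n1")
    case True
    then show ?thesis using n1 by (intro exI[of _ n1]) auto
  next
    case False
    obtain n2 where n2: "n1 \<le> n2" "c < v n2" using high by blast
    obtain k where k: "n1 \<le> k" "v k \<le> c" "c < v (Suc k)"
      using first_change[of n1 n2 "\<lambda>k. v k \<le> c"] n2 False by (auto simp: not_le)
    have k0: "0 < k" "M \<le> k" "N \<le> k" using k(1) n1(1) by linarith+
    have "1 / (d - c) \<le> real k" using M k0(2) by linarith
    then have "1 / real k \<le> d - c" using k0(1) cd by (simp add: field_simps)
    then have "v (Suc k) \<le> d" using v_Suc[OF k0(1)] k(2) by linarith
    then show ?thesis using k k0 by (intro exI[of _ "Suc k"]) auto
  qed
qed

end

locale vertex_path = lazy_path "\<lambda>n. pos \<omega> (t n)" \<xi>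
  for \<omega> :: "'g environment" and \<alpha> \<beta> :: real and \<xi> :: "'g boundary" and t :: "nat \<Rightarrow> nat list" +
  assumes t: "t n \<in> tree \<omega>" "length (t n) = n" "n \<le> k \<Longrightarrow> take n (t k) = t n"
    and speed_lim: "liminf (\<lambda>n. ereal (real (word_length (pos \<omega> (t n))) / real n)) = ereal \<alpha>"
      "limsup (\<lambda>n. ereal (real (word_length (pos \<omega> (t n))) / real n)) = ereal \<beta>"

lemma Lambda_path:
  assumes Y: "\<And>w. word_length (snd (\<omega> w)) \<le> 1" and \<xi>: "\<xi> \<in> LambdaE \<omega> \<alpha> \<beta>"
  obtains t where "vertex_path \<omega> \<alpha> \<beta> \<xi> t"
proof -
  obtain t where t: "t \<in> tree_rays (tree \<omega>)" "tends_to_boundary (\<lambda>n. pos \<omega> (t n)) \<xi>"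
    "liminf (\<lambda>n. ereal (real (word_length (pos \<omega> (t n))) / real n)) = ereal \<alpha>"
    "limsup (\<lambda>n. ereal (real (word_length (pos \<omega> (t n))) / real n)) = ereal \<beta>"
    using \<xi> unfolding LambdaE_def Lambda_def pos_def tree_def by blast
  have t0: "t 0 = []" and tT: "\<And>n. t n \<in> tree \<omega>" and tS: "\<And>n. \<exists>k. t (Suc n) = t n @ [k]"
    using t(1) by (auto simp: tree_rays_def)
  have len: "length (t n) = n" for n
  proof (induction n)
    case (Suc n)
    then show ?case using tS[of n] by auto
  qed (simp add: t0)
  have tk: "take n (t k) = t n" if "n \<le> k" for n k
    using that
  proof (induction k rule: dec_induct)
    case (step k)
    then show ?case using tS[of k] len[of k] by auto
  qed (simp add: len)
  have "lazy_path (\<lambda>n. pos \<omega> (t n)) \<xi>"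
  proof
    show "pos \<omega> (t 0) = 1" by (simp add: t0)
    show "\<exists>g. word_length g \<le> 1 \<and> pos \<omega> (t (Suc n)) = pos \<omega> (t n) * g" for n
      using tS[of n] pos_snoc[of \<omega> "t n"] Y by metis
  qed (rule t(2))
  then have "vertex_path \<omega> \<alpha> \<beta> \<xi> t"
    by (intro vertex_path.intro vertex_path_axioms.intro tT len tk t(3,4))
  then show ?thesis by (rule that)
qed

lemma infinite_path_image:
  fixes t :: "nat \<Rightarrow> nat list"
  assumes "\<And>n. length (t n) = n" "\<And>N. \<exists>n\<ge>N. Q (t n)"
  shows "infinite {w. Q w}"
proof
  assume "finite {w. Q w}"
  then have "finite (length ` {w. Q w})" by (rule finite_imageI)
  then obtain N where N: "\<And>w. Q w \<Longrightarrow> length w < N" using finite_nat_set_iff_bounded by auto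
  obtain n where "N \<le> n" "Q (t n)" using assms(2) by blast
  then show False using N[of "t n"] assms(1) by simp
qed

lemma Lambda_speeds:
  assumes Y: "\<And>w. word_length (snd (\<omega> w)) \<le> 1" and \<xi>: "\<xi> \<in> LambdaE \<omega> \<alpha> \<beta>" and q: "\<alpha> \<le> q" "q \<le> \<beta>" "c < q" "q < d"
  shows "infinite {w. w \<in> tree \<omega> \<and> real (word_length (pos \<omega> w)) / real (length w) \<in> {c..d}}"
proof -
  obtain t where "vertex_path \<omega> \<alpha> \<beta> \<xi> t" by (rule Lambda_path[OF Y \<xi>])
  interpret vertex_path \<omega> \<alpha> \<beta> \<xi> t by fact
  show ?thesis
  proof (rule infinite_path_image[OF t(2)])
    fix N
    obtain n where "n \<ge> N" "v n \<in> {c..d}"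
      using frequently_speed[of q c d N] speed_lim q unfolding v_def by auto
    then show "\<exists>n\<ge>N. t n \<in> tree \<omega> \<and> real (word_length (pos \<omega> (t n))) / real (length (t n)) \<in> {c..d}"
      using t(1,2) unfolding v_def by auto
  qed
qed

text \<open>At a time of speed close to \<alpha> the path may be off the ray. It returns to the ray
  later at the same length, hence with a speed that is no larger, and the liminf prevents the speed
  from being much smaller.\<close>

lemma Lambda_cover_liminf:
  assumes Y: "\<And>w. word_length (snd (\<omega> w)) \<le> 1" and \<xi>: "\<xi> \<in> LambdaE \<omega> \<alpha> \<beta>" and q: "\<alpha> \<le> \<beta>" "c < \<alpha>" "\<alpha> < d"
  shows "infinite {w. w \<in> tree \<omega> \<and> real (word_length (pos \<omega> w)) / real (length w) \<in> {c..d} \<and> \<xi> \<in> cyl (pos \<omega> w)}"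
proof -
  obtain t where "vertex_path \<omega> \<alpha> \<beta> \<xi> t" by (rule Lambda_path[OF Y \<xi>])
  interpret vertex_path \<omega> \<alpha> \<beta> \<xi> t by fact
  have "eventually (\<lambda>n. ereal c < ereal (v n)) sequentially"
    by (rule less_LiminfD) (use speed_lim(1) q(2) in \<open>simp add: v_def\<close>)
  then obtain N0 where N0: "\<And>n. N0 \<le> n \<Longrightarrow> c < v n" by (auto simp: eventually_sequentially)
  show ?thesis
  proof (rule infinite_path_image[OF t(2)])
    fix N
    obtain n where n: "n \<ge> max N N0" "0 < n" "v n \<in> {c..d}"
      using frequently_speed[of \<alpha> c d "max N N0"] speed_lim q unfolding v_def by auto
    obtain k where k: "n \<le> k" "pos \<omega> (t k) = ray \<xi> (word_length (pos \<omega> (t n)))" by (rule returns)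
    have wk: "word_length (pos \<omega> (t k)) = word_length (pos \<omega> (t n))" using k(2) by (simp add: word_length_ray)
    have "v k \<le> v n" unfolding v_def wk using k(1) n(2) by (intro divide_left_mono) auto
    then have "v k \<in> {c..d}" using n N0[of k] k(1) by auto
    moreover have "\<xi> \<in> cyl (pos \<omega> (t k))" unfolding cyl_def wk using k(2) by simp
    ultimately show "\<exists>n\<ge>N. t n \<in> tree \<omega> \<and> real (word_length (pos \<omega> (t n))) / real (length (t n)) \<in> {c..d} \<and> \<xi> \<in> cyl (pos \<omega> (t n))"
      using t(1,2) n(1) k(1) unfolding v_def by (intro exI[of _ k]) auto
  qed
qed

lemma Lambda_cover_all:
  assumes Y: "\<And>w. word_length (snd (\<omega> w)) \<le> 1" and \<xi>: "\<xi> \<in> LambdaE \<omega> \<alpha> \<beta>"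
  shows "infinite {w. w \<in> tree \<omega> \<and> \<xi> \<in> cyl (pos \<omega> w)}"
proof -
  obtain t where "vertex_path \<omega> \<alpha> \<beta> \<xi> t" by (rule Lambda_path[OF Y \<xi>])
  interpret vertex_path \<omega> \<alpha> \<beta> \<xi> t by fact
  show ?thesis
  proof (rule infinite_path_image[OF t(2)])
    fix N
    obtain k where k: "N \<le> k" "pos \<omega> (t k) = ray \<xi> N" by (rule visits)
    then have "\<xi> \<in> cyl (pos \<omega> (t k))" by (simp add: cyl_def word_length_ray)
    then show "\<exists>n\<ge>N. t n \<in> tree \<omega> \<and> \<xi> \<in> cyl (pos \<omega> (t n))" using k t(1) by blast
  qed
qed

text \<open>At speeds close to \<beta> a later return at the same length could have a much smaller
  speed. So the covering vertex is the one at the return to the common prefix, and the earlier time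
  \<open>n\<close> is recorded with it.\<close>

lemma Lambda_cover_limsup:
  assumes Y: "\<And>w. word_length (snd (\<omega> w)) \<le> 1" and \<xi>: "\<xi> \<in> LambdaE \<omega> \<alpha> \<beta>" and q: "\<alpha> \<le> \<beta>" "c < \<beta>" "\<beta> < d"
  shows "infinite {w. w \<in> tree \<omega> \<and> (\<exists>n\<le>length w. real (word_length (pos \<omega> (take n w))) / real n \<in> {c..d} \<and>
    is_prefix (pos \<omega> w) (pos \<omega> (take n w))) \<and> \<xi> \<in> cyl (pos \<omega> w)}"
proof -
  obtain t where "vertex_path \<omega> \<alpha> \<beta> \<xi> t" by (rule Lambda_path[OF Y \<xi>])
  interpret vertex_path \<omega> \<alpha> \<beta> \<xi> t by fact
  show ?thesis
  proof (rule infinite_path_image[OF t(2)])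
    fix N
    obtain n where n: "n \<ge> N" "v n \<in> {c..d}"
      using frequently_speed[of \<beta> c d N] speed_lim q unfolding v_def by auto
    obtain k m where k: "n \<le> k" "pos \<omega> (t k) = ray \<xi> m" "is_prefix (ray \<xi> m) (pos \<omega> (t n))" by (rule returns_to_meet)
    show "\<exists>k\<ge>N. t k \<in> tree \<omega> \<and> (\<exists>n\<le>length (t k). real (word_length (pos \<omega> (take n (t k)))) / real n \<in> {c..d} \<and>
      is_prefix (pos \<omega> (t k)) (pos \<omega> (take n (t k)))) \<and> \<xi> \<in> cyl (pos \<omega> (t k))"
      using t(1,2) t(3)[OF k(1)] k n by (intro exI[of _ k] conjI exI[of _ n]) (auto simp: v_def cyl_def word_length_ray)
  qed
qed

section \<open>Convergence of the mean covering sums\<close>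

lemma power_le_imp_le:
  fixes a b :: real
  assumes "0 \<le> a" "0 < b" and le: "\<And>j. a ^ Suc j \<le> C * b ^ Suc j"
  shows "a \<le> b"
proof (rule ccontr)
  assume "\<not> a \<le> b"
  then have "1 < a / b" using assms(2) by (simp add: field_simps)
  then obtain j where j: "C < (a / b) ^ j" using real_arch_pow by blast
  also have "(a / b) ^ j \<le> (a / b) ^ Suc j" using \<open>1 < a / b\<close> by (intro power_increasing) auto
  also have "\<dots> \<le> C" using le[of j] assms(2) by (simp add: power_divide field_simps)
  finally show False by simp
qed

lemma suminf_eventually_geometric:
  fixes f :: "nat \<Rightarrow> ennreal"
  assumes "eventually (\<lambda>n. f n \<le> ennreal (q ^ n)) sequentially" "0 \<le> q" "q < 1" "\<And>n. f n < \<top>"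
  shows "(\<Sum>n. f n) < \<top>"
proof -
  obtain N where N: "\<And>n. N \<le> n \<Longrightarrow> f n \<le> ennreal (q ^ n)" using assms(1) by (auto simp: eventually_sequentially)
  have "(\<Sum>n. f n) = (\<Sum>n. f (n + N)) + (\<Sum>n<N. f n)"
    by (rule suminf_offset) simp
  also have "(\<Sum>n. f (n + N)) \<le> (\<Sum>n. ennreal (q ^ (n + N)))" by (intro suminf_le N) auto
  also have "(\<Sum>n. ennreal (q ^ (n + N))) = ennreal (\<Sum>n. q ^ (n + N))"
    using assms by (intro suminf_ennreal2 summable_ignore_initial_segment summable_geometric) auto
  finally show ?thesis using assms(4) by (auto simp: less_top[symmetric] top_unique)
qed

lemma ereal_le_of_rats:
  assumes "\<And>h. x < ereal (of_rat h) \<Longrightarrow> y \<le> ereal (of_rat h)"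
  shows "y \<le> x"
proof (rule ccontr)
  assume "\<not> y \<le> x"
  then have "x < y" by simp
  then obtain h where "x < ereal (of_rat h)" "ereal (of_rat h) < y" using ereal_dense3 by blast
  then show False using assms[of h] by simp
qed

context rate_walk
begin

abbreviation (input) walk_weight :: "nat \<Rightarrow> real \<Rightarrow> real \<Rightarrow> real \<Rightarrow> ennreal" where
  "walk_weight n c d s \<equiv> \<integral>\<^sup>+x. indicator {c..d} (real (word_length x) / real n) * weight s x \<partial>walk \<mu> n"

text \<open>By the many-to-one formula, the mean total weight of the cylinders of all vertices with
  speed between \<open>c\<close> and \<open>d\<close>.\<close>

definition W :: "real \<Rightarrow> real \<Rightarrow> real \<Rightarrow> ennreal" where
  "W c d s = (\<Sum>n. ennreal (r ^ n) * walk_weight n c d s)"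

lemma W_term_le:
  assumes "0 < n" "0 \<le> s"
  shows "walk_weight n c d s
    \<le> ennreal (exp (- real n * (s * c)) * speed_prob n {c..d})"
proof -
  have "walk_weight n c d s
      \<le> (\<integral>\<^sup>+x. ennreal (exp (- real n * (s * c))) * indicator {x. real (word_length x) / real n \<in> {c..d}} x \<partial>walk \<mu> n)"
  proof (rule nn_integral_mono)
    fix x :: "'g free_group"
    show "indicator {c..d} (real (word_length x) / real n) * weight s x
       \<le> ennreal (exp (- real n * (s * c))) * indicator {x. real (word_length x) / real n \<in> {c..d}} x"
    proof (cases "real (word_length x) / real n \<in> {c..d}")
      case True
      then have "c * real n \<le> real (word_length x)" using assms(1) by (simp add: pos_le_divide_eq)
      then have "s * (c * real n) \<le> s * real (word_length x)" using assms(2) by (rule mult_left_mono)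
      then show ?thesis using True by (simp add: mult_ac)
    qed simp
  qed
  also have "\<dots> = ennreal (exp (- real n * (s * c)) * speed_prob n {c..d})"
    by (simp add: nn_integral_cmult_indicator speed_prob_def measure_pmf.emeasure_eq_measure ennreal_mult')
  finally show ?thesis .
qed

text \<open>The term of generation \<open>n\<close> is about
  \<open>exp (n * (ln r - s * q - L q))\<close>. Semicontinuity keeps the exponent negative on a
  small interval around \<open>q\<close>, whose ends are taken rational because only countably many
  covers can be controlled simultaneously.\<close>

lemma W_finite:
  assumes s: "0 \<le> s" and L: "ereal (ln r - s * q) < L q"
  obtains c d :: rat where "of_rat c < q" "q < of_rat d" "W (of_rat c) (of_rat d) s < \<top>"
proof -
  obtain y where y: "ereal (ln r - s * q) < ereal y" "ereal y < L q" using ereal_dense2[OF L] by blast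
  obtain \<delta> where \<delta>: "\<delta> > 0" "\<And>q'. \<bar>q' - q\<bar> \<le> \<delta> \<Longrightarrow> ereal y < L q'" using L_lsc[OF y(2)] by blast
  define \<rho> where "\<rho> = s * q - (ln r - y)"
  have \<rho>: "0 < \<rho>" using y(1) by (simp add: \<rho>_def)
  have "max (q - \<delta>) (q - \<rho> / (s + 1)) < q" using \<delta>(1) \<rho> s by auto
  then obtain c :: rat where c: "max (q - \<delta>) (q - \<rho> / (s + 1)) < of_rat c" "of_rat c < q" using of_rat_dense by blast
  obtain d :: rat where d: "q < of_rat d" "of_rat d < q + \<delta>" using of_rat_dense[of q "q + \<delta>"] \<delta>(1) by auto
  let ?c = "of_rat c :: real" and ?d = "of_rat d :: real"
  have "q - ?c < \<rho> / (s + 1)" using c by simp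
  then have "(q - ?c) * (s + 1) < \<rho>" using s by (simp add: pos_less_divide_eq)
  moreover have "s * (q - ?c) \<le> (q - ?c) * (s + 1)" using c(2) by (simp add: algebra_simps)
  ultimately have sc: "ln r - y < s * ?c" by (simp add: \<rho>_def algebra_simps)
  define \<theta> where "\<theta> = (y + s * ?c - ln r) / 2"
  have \<theta>: "0 < \<theta>" using sc by (simp add: \<theta>_def)
  have "eventually (\<lambda>n. speed_prob n {?c..?d} \<le> exp (- real n * (y - \<theta>))) sequentially"
    by (rule speed_prob_upper[OF _ \<theta>]) (use \<delta>(2) c d in \<open>force simp: less_imp_le\<close>)
  then have "eventually (\<lambda>n. ennreal (r ^ n) * walk_weight n ?c ?d s \<le> ennreal (exp (- \<theta>) ^ n)) sequentially"
    using eventually_gt_at_top[of 0]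
  proof eventually_elim
    case (elim n)
    have "ennreal (r ^ n) * walk_weight n ?c ?d s
        \<le> ennreal (r ^ n) * ennreal (exp (- real n * (s * ?c)) * speed_prob n {?c..?d})"
      by (intro mult_left_mono W_term_le elim s) auto
    also have "\<dots> \<le> ennreal (r ^ n) * ennreal (exp (- real n * (s * ?c)) * exp (- real n * (y - \<theta>)))"
      using elim by (intro mult_left_mono ennreal_leI) auto
    also have "\<dots> = ennreal (exp (real n * ln r) * (exp (- real n * (s * ?c)) * exp (- real n * (y - \<theta>))))"
      using r_gt_1 by (simp add: ennreal_mult' exp_of_nat_mult)
    also have "exp (real n * ln r) * (exp (- real n * (s * ?c)) * exp (- real n * (y - \<theta>))) = exp (real n * (- \<theta>))"
      unfolding exp_add[symmetric] by (rule arg_cong[of _ _ exp]) (simp add: \<theta>_def field_simps)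
    also have "\<dots> = exp (- \<theta>) ^ n" by (rule exp_of_nat_mult)
    finally show ?case .
  qed
  then have "W ?c ?d s < \<top>"
    unfolding W_def
  proof (rule suminf_eventually_geometric)
    fix n
    have "walk_weight n ?c ?d s
       \<le> (\<integral>\<^sup>+x. 1 \<partial>walk \<mu> n)"
      using s by (intro nn_integral_mono) (auto simp: indicator_def)
    also have "\<dots> < \<top>" by simp
    finally show "ennreal (r ^ n) * walk_weight n ?c ?d s < \<top>"
      by (simp only: ennreal_mult_less_top ennreal_less_top simp_thms)
  qed (use \<theta> in auto)
  then show ?thesis using that c(2) d(1) by blast
qed

definition Lv :: "nat \<Rightarrow> ennreal" where
  "Lv m = (\<Sum>x\<in>{x. word_length x = m}. F r x)"

lemma nn_integral_levels:
  "(\<integral>\<^sup>+x. f x \<partial>walk \<mu> n) = (\<Sum>m. \<Sum>x\<in>{x. word_length x = m}. ennreal (P n x) * f x)"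
proof -
  have "(\<integral>\<^sup>+x. f x \<partial>walk \<mu> n) = (\<integral>\<^sup>+x. ennreal (P n x) * f x \<partial>count_space UNIV)"
    by (simp add: nn_integral_measure_pmf P_def)
  also have "\<dots> = (\<Sum>m. \<integral>\<^sup>+x. ennreal (P n x) * f x \<partial>count_space {x. word_length x = m})"
    by (rule nn_integral_count_space_fibres)
  finally show ?thesis by (simp add: nn_integral_count_space_finite)
qed

lemma W_all_le: "W 0 1 s \<le> (\<Sum>m. ennreal (exp (- s * real m)) * (ennreal Gc * Lv m))"
proof -
  have "W 0 1 s \<le> (\<Sum>n. ennreal (r ^ n) * (\<integral>\<^sup>+x. weight s x \<partial>walk \<mu> n))"
    unfolding W_def by (intro suminf_le mult_left_mono nn_integral_mono) (auto simp: indicator_def)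
  also have "\<dots> = (\<Sum>n. \<Sum>m. ennreal (exp (- s * real m)) * (\<Sum>x\<in>{x. word_length x = m}. ennreal (r ^ n * P n x)))"
  proof (intro suminf_cong)
    fix n
    have "ennreal (r ^ n) * (\<integral>\<^sup>+x. weight s x \<partial>walk \<mu> n)
      = (\<Sum>m. ennreal (r ^ n) * (\<Sum>x\<in>{x. word_length x = m}. ennreal (P n x) * weight s x))"
      unfolding nn_integral_levels by simp
    also have "\<dots> = (\<Sum>m. ennreal (exp (- s * real m)) * (\<Sum>x\<in>{x. word_length x = m}. ennreal (r ^ n * P n x)))"
      using r_gt_1 by (intro suminf_cong) (auto simp: sum_distrib_left ennreal_mult mult_ac intro!: sum.cong)
    finally show "ennreal (r ^ n) * (\<integral>\<^sup>+x. weight s x \<partial>walk \<mu> n)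
      = (\<Sum>m. ennreal (exp (- s * real m)) * (\<Sum>x\<in>{x. word_length x = m}. ennreal (r ^ n * P n x)))" .
  qed
  also have "\<dots> = (\<Sum>m. \<Sum>n. ennreal (exp (- s * real m)) * (\<Sum>x\<in>{x. word_length x = m}. ennreal (r ^ n * P n x)))"
    by (rule ennreal_suminf_swap)
  also have "\<dots> = (\<Sum>m. ennreal (exp (- s * real m)) * (\<Sum>x\<in>{x. word_length x = m}. G r x))"
    by (simp add: suminf_sum_ennreal G_def)
  also have "\<dots> = (\<Sum>m. ennreal (exp (- s * real m)) * (ennreal Gc * Lv m))"
    using r_gt_1 by (simp add: G_eq[of r] G_eq_Gc Lv_def sum_distrib_left mult.commute)
  finally show ?thesis .
qed

lemma W_all_finite:
  assumes Lv: "\<And>m. Lv m \<le> ennreal (C * exp (k * real m))" and s: "k < s" and C: "0 \<le> C"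
  shows "W 0 1 s < \<top>"
proof -
  have "W 0 1 s \<le> (\<Sum>m. ennreal (exp (- s * real m)) * (ennreal Gc * Lv m))" by (rule W_all_le)
  also have "\<dots> \<le> (\<Sum>m. ennreal (exp (- s * real m)) * (ennreal Gc * ennreal (C * exp (k * real m))))"
    by (intro suminf_le mult_left_mono Lv) auto
  also have "\<dots> = (\<Sum>m. ennreal (Gc * C * exp (k - s) ^ m))"
  proof (intro suminf_cong)
    fix m
    have "exp (- s * real m) * exp (k * real m) = exp (k - s) ^ m"
      unfolding exp_add[symmetric] exp_of_nat_mult[symmetric] by (simp add: algebra_simps)
    then have "exp (- s * real m) * (Gc * (C * exp (k * real m))) = Gc * C * exp (k - s) ^ m" by (simp add: mult_ac)
    then show "ennreal (exp (- s * real m)) * (ennreal Gc * ennreal (C * exp (k * real m))) = ennreal (Gc * C * exp (k - s) ^ m)"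
      using Gc_ge_1 C by (simp add: ennreal_mult'[symmetric] del: ennreal_mult')
  qed
  also have "\<dots> = ennreal (\<Sum>m. Gc * C * exp (k - s) ^ m)"
    using s C Gc_ge_1 by (intro suminf_ennreal2 summable_mult summable_geometric) auto
  also have "\<dots> < \<top>" by simp
  finally show ?thesis .
qed

text \<open>The first passage sum of \<open>Lv\<close> restricted to good words and with free
  parameter \<open>s\<close>. Supermultiplicativity holds because \<open>F\<close> is multiplicative
  on products without cancellation.\<close>

definition Hs :: "real \<Rightarrow> nat \<Rightarrow> ennreal" where
  "Hs s m = (\<Sum>x\<in>good_words m. F s x)"

lemma Hs_supermult:
  assumes "0 \<le> s"
  shows "Hs s m * Hs s m' \<le> Hs s (m + m')"
proof -
  have inj: "inj_on (\<lambda>(x, y). x * y) (good_words m \<times> (good_words m' :: 'g free_group set))"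
    using good_words_mult_inj by (fastforce simp: inj_on_def)
  have "Hs s m * Hs s m' = (\<Sum>(x, y)\<in>good_words m \<times> good_words m'. F s x * F s y)"
    unfolding Hs_def by (simp add: sum_product sum.cartesian_product)
  also have "\<dots> = (\<Sum>(x, y)\<in>good_words m \<times> good_words m'. F s (x * y))"
    by (rule sum.cong) (auto simp: F_mult[OF assms good_words_red_concat])
  also have "\<dots> = (\<Sum>z\<in>(\<lambda>(x, y). x * y) ` (good_words m \<times> good_words m'). F s z)"
    by (subst sum.reindex[OF inj]) (simp add: case_prod_unfold)
  also have "\<dots> \<le> Hs s (m + m')"
    unfolding Hs_def by (rule sum_mono2) (use good_words_mult in auto)
  finally show ?thesis .
qed

lemma Hs_power: "0 \<le> s \<Longrightarrow> Hs s m ^ Suc j \<le> Hs s (Suc j * m)"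
proof (induction j)
  case (Suc j)
  have "Hs s m ^ Suc (Suc j) = Hs s m * Hs s m ^ Suc j" by simp
  also have "\<dots> \<le> Hs s m * Hs s (Suc j * m)" using Suc by (intro mult_left_mono) auto
  also have "\<dots> \<le> Hs s (m + Suc j * m)" by (rule Hs_supermult[OF Suc.prems])
  finally show ?case by simp
qed simp

text \<open>The linear lower bound on \<open>L\<close> controls each \<open>A n m\<close>. Below
  \<open>r\<close> the sum over \<open>n\<close> is geometric and costs a constant depending on
  \<open>s\<close>; taking powers by supermultiplicativity removes the constant, and only then can
  \<open>s\<close> tend to \<open>r\<close>.\<close>

lemma Hs_le:
  assumes L: "\<And>q. 0 < q \<Longrightarrow> ereal (ln r - k * q) \<le> L q" and m: "0 < m"
  shows "Hs r m \<le> ennreal (exp (k * real m))"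
proof -
  have A: "A n m' \<le> exp (k * real m') / r ^ n" if "0 < m'" for n m'
  proof (cases "n = 0")
    case True
    then show ?thesis using that by (simp add: A_def P_0 good_words_def)
  next
    case False
    have "A n m' \<le> exp (- real n * (ln r - k * (real m' / real n)))"
      using False that by (intro A_le_exp L) auto
    also have "- real n * (ln r - k * (real m' / real n)) = k * real m' - real n * ln r"
      using False by (simp add: field_simps)
    also have "exp \<dots> = exp (k * real m') / r ^ n"
      using r_gt_1 by (simp add: exp_diff exp_of_nat_mult)
    finally show ?thesis .
  qed
  have "Hs s m \<le> ennreal (exp (k * real m))" if s: "0 < s" "s < r" for s
  proof -
    define C where "C = (\<Sum>n. (s / r) ^ n)"
    have sr: "0 < s / r" "s / r < 1" using s by auto
    have C: "(\<Sum>n. ennreal ((s / r) ^ n)) = ennreal C" "0 \<le> C"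
      unfolding C_def using sr by (auto intro!: suminf_ennreal2 summable_geometric suminf_nonneg)
    have le: "Hs s m' \<le> ennreal (C * exp (k * real m'))" if m': "0 < m'" for m'
    proof -
      have "Hs s m' \<le> (\<Sum>x\<in>good_words m'. G s x)"
        unfolding Hs_def F_def G_def using s fp_le_P by (intro sum_mono suminf_le ennreal_leI mult_left_mono) auto
      also have "\<dots> = (\<Sum>n. \<Sum>x\<in>good_words m'. ennreal (s ^ n * P n x))"
        unfolding G_def by (simp add: suminf_sum_ennreal)
      also have "\<dots> = (\<Sum>n. ennreal (s ^ n * A n m'))"
        using s by (simp add: A_def sum_distrib_left)
      also have "\<dots> \<le> (\<Sum>n. ennreal (exp (k * real m')) * ennreal ((s / r) ^ n))"
      proof (intro suminf_le)
        fix n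
        have "s ^ n * A n m' \<le> s ^ n * (exp (k * real m') / r ^ n)" using s by (intro mult_left_mono A m') auto
        also have "\<dots> = exp (k * real m') * (s / r) ^ n" by (simp add: power_divide)
        finally show "ennreal (s ^ n * A n m') \<le> ennreal (exp (k * real m')) * ennreal ((s / r) ^ n)"
          using sr by (simp add: ennreal_mult'[symmetric] ennreal_leI del: ennreal_mult')
      qed auto
      also have "\<dots> = ennreal (C * exp (k * real m'))"
        using C by (simp add: ennreal_mult mult.commute)
      finally show ?thesis .
    qed
    then have "Hs s m < \<top>" using m by (meson ennreal_less_top order_le_less_trans)
    then obtain a where a: "Hs s m = ennreal a" "0 \<le> a" by (cases "Hs s m") auto
    have "a \<le> exp (k * real m)"
    proof (rule power_le_imp_le[where C = C])
      fix j
      have "ennreal (a ^ Suc j) = Hs s m ^ Suc j" using a by (simp only: ennreal_power)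
      also have "\<dots> \<le> Hs s (Suc j * m)" using s by (intro Hs_power) simp
      also have "\<dots> \<le> ennreal (C * exp (k * real (Suc j * m)))" using m by (intro le) simp
      finally have "a ^ Suc j \<le> C * exp (k * real (Suc j * m))"
        using C(2) by (subst (asm) ennreal_le_iff) auto
      also have "exp (k * real (Suc j * m)) = exp (k * real m) ^ Suc j"
        by (subst exp_of_nat_mult[symmetric]) (simp add: algebra_simps)
      finally show "a ^ Suc j \<le> C * exp (k * real m) ^ Suc j" .
    qed (use a in auto)
    then show ?thesis using a by (simp add: ennreal_leI)
  qed
  moreover have eq: "Hs s m = (\<Sum>n. ennreal (s ^ n * (\<Sum>x\<in>good_words m. fp n x)))" if "0 < s" for s
    using that unfolding Hs_def F_def by (simp add: suminf_sum_ennreal[symmetric] sum_distrib_left)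
  ultimately have *: "(\<Sum>n. ennreal (s ^ n * (\<Sum>x\<in>good_words m. fp n x))) \<le> ennreal (exp (k * real m))" if "0 < s" "s < r" for s
    using that by metis
  have "(\<Sum>n. ennreal (r ^ n * (\<Sum>x\<in>good_words m. fp n x))) \<le> ennreal (exp (k * real m))"
    by (rule ennreal_power_series_le[OF sum_nonneg _ *]) (use r_gt_1 in auto)
  then show ?thesis using eq[of r] r_gt_1 by simp
qed

text \<open>Padding by three letters, as for the probabilities: it multiplies \<open>F\<close> by a
  factor bounded below and makes every word good.\<close>

lemma Lv_le:
  assumes L: "\<And>q. 0 < q \<Longrightarrow> ereal (ln r - k * q) \<le> L q"
  shows "\<exists>C\<ge>0. \<forall>m. Lv m \<le> ennreal (C * exp (k * real m))"
proof -
  define f where "f = Min (range \<phi>)"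
  have f: "0 < f" "f \<le> \<phi> a" for a
    using \<phi>_pos by (auto simp: f_def intro: Min_le)
  have pad: "ennreal (f ^ 3) * F r x \<le> F r (pad x)" for x
  proof -
    have nn: "0 \<le> prod_list (map \<phi> (word x))" by (rule prod_list_nonneg) (use \<phi>_nonneg in auto)
    have "f ^ 3 * prod_list (map \<phi> (word x)) = f * (f * (prod_list (map \<phi> (word x)) * f))"
      by (simp add: power3_eq_cube mult_ac)
    also have "\<dots> \<le> \<phi> l0 * (\<phi> (pad_left x) * (prod_list (map \<phi> (word x)) * \<phi> (pad_right x)))"
      using f nn less_imp_le[OF f(1)] \<phi>_nonneg by (intro mult_mono mult_nonneg_nonneg) auto
    finally show ?thesis
      using f nn by (simp add: F_word word_pad ennreal_mult'[symmetric] ennreal_leI mult_ac del: ennreal_mult')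
  qed
  have "Lv m \<le> ennreal (exp (k * 3) / f ^ 3 * exp (k * real m))" for m
  proof -
    have "ennreal (f ^ 3) * Lv m = (\<Sum>x\<in>{x. word_length x = m}. ennreal (f ^ 3) * F r x)"
      by (simp add: Lv_def sum_distrib_left)
    also have "\<dots> \<le> (\<Sum>x\<in>{x. word_length x = m}. F r (pad x))" by (intro sum_mono pad)
    also have "\<dots> = (\<Sum>z\<in>pad ` {x. word_length x = m}. F r z)"
      by (subst sum.reindex) (auto intro: inj_on_subset[OF inj_pad])
    also have "\<dots> \<le> Hs r (m + 3)"
      unfolding Hs_def by (rule sum_mono2) (use pad_good in auto)
    also have "\<dots> \<le> ennreal (exp (k * real (m + 3)))" by (rule Hs_le[OF L]) auto
    finally have "ennreal (1 / f ^ 3) * (ennreal (f ^ 3) * Lv m) \<le> ennreal (1 / f ^ 3) * ennreal (exp (k * real (m + 3)))"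
      by (rule mult_left_mono) simp
    also have "ennreal (1 / f ^ 3) * (ennreal (f ^ 3) * Lv m) = Lv m"
      using f by (simp add: mult.assoc[symmetric] ennreal_mult'[symmetric] del: ennreal_mult')
    also have "ennreal (1 / f ^ 3) * ennreal (exp (k * real (m + 3))) = ennreal (exp (k * 3) / f ^ 3 * exp (k * real m))"
      using f by (simp add: ennreal_mult'[symmetric] algebra_simps exp_add del: ennreal_mult')
    finally show ?thesis .
  qed
  then show ?thesis using f by (intro exI[of _ "exp (k * 3) / f ^ 3"]) simp
qed

lemma W_all_finite_at_0:
  assumes L0: "L 0 = ereal (ln r)" and s: "dim_bound L r 0 < ereal s"
  shows "W 0 1 s < \<top>"
proof -
  obtain k where k: "dim_bound L r 0 < ereal k" "ereal k < ereal s" using ereal_dense2[OF s] by blast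
  have "ereal (ln r - k * q) \<le> L q" if q: "0 < q" for q
  proof (cases rule: L_cases[of q])
    case (1 y)
    have "slope0 q \<le> ereal k" using slope0_le_dim_bound[OF L0 q] k(1) by simp
    then have "(ln r - y) / q \<le> k" using L0 1 q by simp
    then show ?thesis using q 1 by (simp add: field_simps)
  qed simp
  then have "\<exists>C\<ge>0. \<forall>m. Lv m \<le> ennreal (C * exp (k * real m))" by (rule Lv_le)
  then obtain C where "0 \<le> C" "\<And>m. Lv m \<le> ennreal (C * exp (k * real m))" by blast
  then show ?thesis using k(2) by (intro W_all_finite[of C k]) auto
qed

end

context branching
begin

definition cover_sum :: "'g environment \<Rightarrow> real \<Rightarrow> real \<Rightarrow> real \<Rightarrow> ennreal" where
  "cover_sum \<omega> c d s = (\<integral>\<^sup>+w. indicator {w. w \<in> tree \<omega> \<and> real (word_length (pos \<omega> w)) / real (length w) \<in> {c..d}} w *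
     weight s (pos \<omega> w) \<partial>count_space UNIV)"

lemma AE_cover_sum:
  assumes "W c d s < \<top>"
  shows "AE \<omega> in \<E>. cover_sum \<omega> c d s < \<top>"
proof -
  let ?f = "\<lambda>ys. indicator {c..d} (real (word_length (prod_list ys)) / real (length ys)) * weight s (prod_list ys) :: ennreal"
  have "(\<integral>\<^sup>+ys. ?f ys \<partial>replicate_pmf n \<mu>)
      = walk_weight n c d s" for n
    unfolding walk_def nn_integral_map_pmf by (rule nn_integral_cong_AE) (auto simp: AE_measure_pmf_iff set_replicate_pmf)
  then have "(\<Sum>n. ennreal (r ^ n) * (\<integral>\<^sup>+ys. ?f ys \<partial>replicate_pmf n \<mu>)) < \<top>" using assms by (simp add: W_def)
  then have "AE \<omega> in \<E>. (\<integral>\<^sup>+w. indicator (tree \<omega>) w * ?f (incs \<omega> w) \<partial>count_space UNIV) < \<top>"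
    by (rule AE_sum_finite)
  moreover have "cover_sum \<omega> c d s = (\<integral>\<^sup>+w. indicator (tree \<omega>) w * ?f (incs \<omega> w) \<partial>count_space UNIV)" for \<omega>
    unfolding cover_sum_def by (rule nn_integral_cong) (auto simp: indicator_def pos_incs)
  ultimately show ?thesis by simp
qed

text \<open>Rational parameters suffice for the covers, and countably many almost sure statements
  have a common null set.\<close>

definition covered :: "'g environment \<Rightarrow> bool" where
  "covered \<omega> \<longleftrightarrow> (\<forall>c d s :: rat. W (of_rat c) (of_rat d) (of_rat s) < \<top> \<longrightarrow> cover_sum \<omega> (of_rat c) (of_rat d) (of_rat s) < \<top>)"

lemma AE_covered: "AE \<omega> in \<E>. covered \<omega>"
  unfolding covered_def by (simp add: AE_all_countable AE_cover_sum)

lemma W_finite_of_dim_bound: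
  assumes q: "0 < q" "q \<in> I_set L r" and h: "dim_bound L r q < ereal h"
  shows "0 < h" "ereal (ln r - h * q) < L q"
proof -
  obtain y where y: "L q = ereal y" "y \<le> ln r" using q(2) by (cases rule: L_cases[of q]) (auto simp: I_set_def)
  have hy: "(ln r - y) / q < h" using h y q(1) by (simp add: dim_bound_def)
  then have "ln r - h * q < y" using q(1) by (simp add: field_simps)
  then show "ereal (ln r - h * q) < L q" using y by simp
  show "0 < h" using hy y q(1) by (meson divide_nonneg_pos le_less_trans diff_ge_0_iff_ge)
qed

context
  fixes \<omega> :: "'g environment"
  assumes Y: "\<And>w. word_length (snd (\<omega> w)) \<le> 1" and cov: "covered \<omega>"
begin

text \<open>With exponent 0 the covering sum counts vertices. If \<open>L q\<close> exceeded
  \<open>ln r\<close>, only finitely many vertices would have a speed near \<open>q\<close>, whereas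
  a path realising \<alpha> and \<beta> has such speeds infinitely often for every \<open>q\<close>
  in between.\<close>

lemma Lambda_subset_I:
  assumes "LambdaE \<omega> \<alpha> \<beta> \<noteq> {}" "{\<alpha>..\<beta>} \<subseteq> {0..1}"
  shows "{\<alpha>..\<beta>} \<subseteq> I_set L r"
proof
  fix q assume q: "q \<in> {\<alpha>..\<beta>}"
  obtain \<xi> where \<xi>: "\<xi> \<in> LambdaE \<omega> \<alpha> \<beta>" using assms(1) by blast
  have "L q \<le> ereal (ln r)"
  proof (rule ccontr)
    assume "\<not> ?thesis"
    then have "ereal (ln r - of_rat 0 * q) < L q" by simp
    then obtain c d :: rat where cd: "of_rat c < q" "q < of_rat d" "W (of_rat c) (of_rat d) (of_rat 0) < \<top>"
      using W_finite[of "of_rat 0" q] by auto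
    then have "cover_sum \<omega> (of_rat c) (of_rat d) (of_rat 0) < \<top>" using cov unfolding covered_def by blast
    then have "finite {w. w \<in> tree \<omega> \<and> real (word_length (pos \<omega> w)) / real (length w) \<in> {of_rat c..of_rat d}}"
      unfolding cover_sum_def by (simp add: emeasure_count_space split: if_splits)
    then show False using Lambda_speeds[where \<omega> = \<omega>, OF Y \<xi> _ _ cd(1,2)] q by auto
  qed
  then show "q \<in> I_set L r" using q assms(2) by (auto simp: I_set_def)
qed

lemma dim_le_cover:
  fixes c d h :: rat
  assumes h0: "0 < (of_rat h :: real)" and Wf: "W (of_rat c) (of_rat d) (of_rat h) < \<top>"
    and inf: "\<And>\<xi>. \<xi> \<in> T \<Longrightarrow> infinite {w. w \<in> tree \<omega> \<and> real (word_length (pos \<omega> w)) / real (length w) \<in> {of_rat c..of_rat d} \<and> \<xi> \<in> cyl (pos \<omega> w)}"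
  shows "hausdorff_dim T \<le> ereal (of_rat h)"
proof -
  have "cover_sum \<omega> (of_rat c) (of_rat d) (of_rat h) < \<top>" using cov Wf unfolding covered_def by blast
  then have "hausdorff_measure (of_rat h) T = 0"
    unfolding cover_sum_def by (rule hausdorff_null[OF h0]) (use inf in auto)
  then show ?thesis using h0 by (intro hausdorff_dim_le) auto
qed

lemma dim_le_all:
  fixes h :: rat
  assumes h0: "0 < (of_rat h :: real)" and Wf: "W 0 1 (of_rat h) < \<top>"
  shows "hausdorff_dim (LambdaE \<omega> \<alpha> \<beta>) \<le> ereal (of_rat h)"
proof (rule dim_le_cover[OF h0, of 0 1])
  fix \<xi> assume \<xi>: "\<xi> \<in> LambdaE \<omega> \<alpha> \<beta>"
  have "real (word_length (pos \<omega> w)) / real (length w) \<in> {of_rat 0..of_rat 1}" for w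
    using word_length_pos_le[of \<omega> w, OF Y] by (simp add: divide_le_eq_1)
  then show "infinite {w. w \<in> tree \<omega> \<and> real (word_length (pos \<omega> w)) / real (length w) \<in> {of_rat 0..of_rat 1} \<and> \<xi> \<in> cyl (pos \<omega> w)}"
    using Lambda_cover_all[where \<omega> = \<omega>, OF Y \<xi>] by simp
qed (use Wf in simp)

lemma dim_upper:
  assumes ab: "\<alpha> \<le> \<beta>" and \<alpha>: "\<alpha> \<in> I_set L r"
  shows "hausdorff_dim (LambdaE \<omega> \<alpha> \<beta>) \<le> dim_bound L r \<alpha>"
proof (rule ereal_le_of_rats)
  fix h :: rat assume h: "dim_bound L r \<alpha> < ereal (of_rat h)"
  let ?h = "of_rat h :: real"
  have \<alpha>01: "0 \<le> \<alpha>" using \<alpha> by (auto simp: I_set_def)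
  show "hausdorff_dim (LambdaE \<omega> \<alpha> \<beta>) \<le> ereal ?h"
  proof (cases "\<alpha> = 0")
    case True
    have L0: "L 0 = ereal (ln r)" using \<alpha> I_set_0 True by simp
    \<comment> \<open>A speed of rate below \<open>ln r\<close> has a positive difference quotient,
      so the bound at 0, and with it \<open>h\<close>, is positive.\<close>
    obtain q where q: "q \<in> {0..1}" "L q < ereal (ln r)" using L_less_ln_r by blast
    then have q0: "0 < q" using L0 by (cases "q = 0") auto
    obtain y where y: "L q = ereal y" using q(2) by (cases rule: L_cases[of q]) auto
    have "0 < slope0 q" using y q q0 L0 by simp
    then have "0 < ereal ?h" using slope0_le_dim_bound[OF L0 q0] h True by (meson less_le_trans less_trans)
    then show ?thesis using W_all_finite_at_0[OF L0] h True by (intro dim_le_all) simp_all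
  next
    case False
    then have "0 < \<alpha>" using \<alpha>01 by simp
    note * = W_finite_of_dim_bound[OF this \<alpha> h]
    obtain c d :: rat where cd: "of_rat c < \<alpha>" "\<alpha> < of_rat d" "W (of_rat c) (of_rat d) ?h < \<top>"
      using W_finite[OF less_imp_le[OF *(1)] *(2)] by blast
    show ?thesis
      by (rule dim_le_cover[OF *(1) cd(3)]) (rule Lambda_cover_liminf[where \<omega> = \<omega>, OF Y _ ab cd(1,2)])
  qed
qed

end

end

subsection \<open>Isotropic walks\<close>

lemma truncated_product_le:
  fixes a b :: "nat \<Rightarrow> real"
  assumes "\<And>i. 0 \<le> a i" "\<And>i. 0 \<le> b i"
  shows "(\<Sum>n\<le>N. \<Sum>i\<le>n. a i * b (n - i)) \<le> (\<Sum>i\<le>N. a i) * (\<Sum>i\<le>N. b i)"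
proof -
  have "(\<Sum>n\<le>N. \<Sum>i\<le>n. a i * b (n - i)) = (\<Sum>(i, j)\<in>{(i, j). i + j \<le> N}. a i * b j)"
    by (rule sum.triangle_reindex_eq[symmetric])
  also have "\<dots> \<le> (\<Sum>(i, j)\<in>{..N} \<times> {..N}. a i * b j)"
    using assms by (intro sum_mono2) auto
  finally show ?thesis by (simp add: sum_product sum.cartesian_product)
qed

lemma suminf_triangle:
  fixes g :: "nat \<Rightarrow> nat \<Rightarrow> ennreal"
  shows "(\<Sum>N. \<Sum>n\<le>N. g n (N - n)) = (\<Sum>n. \<Sum>k. g n k)"
proof -
  have "(\<Sum>n\<le>N. g n (N - n)) = (\<Sum>n. if n \<le> N then g n (N - n) else 0)" for N
  proof -
    have "(\<Sum>n. if n \<le> N then g n (N - n) else 0) = (\<Sum>n\<le>N. if n \<le> N then g n (N - n) else 0)"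
      by (rule suminf_finite) auto
    then show ?thesis by simp
  qed
  then have "(\<Sum>N. \<Sum>n\<le>N. g n (N - n)) = (\<Sum>n. \<Sum>N. if n \<le> N then g n (N - n) else 0)"
    by (simp add: ennreal_suminf_swap[of "\<lambda>N n. if n \<le> N then g n (N - n) else 0"])
  then show ?thesis by (simp add: ennreal_suminf_offset)
qed

text \<open>After the first letter each letter has one forbidden value. The exponent
  \<open>m\<close>, one more than needed for nonempty words, gives a formula that includes the empty
  word.\<close>

lemma card_word_length_eq_le:
  "card {x :: 'g::finite free_group. word_length x = m} \<le> 2 * CARD('g) * (2 * CARD('g) - 1) ^ m"
proof -
  define R where "R m = {w :: 'g letter list. reduced w \<and> length w = m}" for m
  have fin: "finite (R m)" for m
    by (rule finite_subset[OF _ finite_lists_length_eq[of UNIV m]]) (auto simp: R_def)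
  have c: "0 < CARD('g)" by simp
  have step: "card (R (Suc m)) \<le> (2 * CARD('g) - 1) * card (R m)" if "0 < m" for m
  proof -
    have "R (Suc m) \<subseteq> (\<lambda>(w, x). x # w) ` (SIGMA w:R m. UNIV - {flip (hd w)})"
    proof
      fix w :: "'g letter list" assume w: "w \<in> R (Suc m)"
      then have len: "length w = Suc m" by (simp add: R_def)
      then obtain x v where v: "w = x # v" by (cases w) simp_all
      with len that obtain y ys where "v = y # ys" by (cases v) simp_all
      with v have xy: "w = x # y # ys" by simp
      have *: "y \<noteq> flip x" "reduced (y # ys)" "length (y # ys) = m" using w by (simp_all add: R_def xy reduced_Cons_Cons)
      then have "x \<noteq> flip y" by (metis flip_flip)
      then have "(y # ys, x) \<in> (SIGMA w:R m. UNIV - {flip (hd w)})" using * by (simp add: R_def)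
      then show "w \<in> (\<lambda>(w, x). x # w) ` (SIGMA w:R m. UNIV - {flip (hd w)})"
        unfolding xy by (rule rev_image_eqI) simp
    qed
    then have "card (R (Suc m)) \<le> card (SIGMA w:R m. UNIV - {flip (hd w)})"
      by (rule surj_card_le[rotated]) (use fin in auto)
    also have "\<dots> = (\<Sum>w\<in>R m. card (UNIV - {flip (hd w)}))" using fin by (subst card_SigmaI) auto
    also have "\<dots> = (2 * CARD('g) - 1) * card (R m)" by (simp add: card_Diff_singleton mult.commute)
    finally show ?thesis .
  qed
  have "card (R m) \<le> 2 * CARD('g) * (2 * CARD('g) - 1) ^ m"
  proof (induction m)
    case 0
    have "R 0 = {[]}" by (auto simp: R_def)
    then show ?case using c by simp
  next
    case (Suc m)
    show ?case
    proof (cases "m = 0")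
      case True
      have "R (Suc 0) \<subseteq> (\<lambda>x. [x]) ` UNIV" by (auto simp: R_def length_Suc_conv)
      then have "card (R (Suc 0)) \<le> 2 * CARD('g) * 1"
        using surj_card_le[of UNIV "R (Suc 0)" "\<lambda>x. [x]"] by simp
      also have "2 * CARD('g) * 1 \<le> 2 * CARD('g) * (2 * CARD('g) - 1)" using c by (intro mult_left_mono) linarith+
      finally show ?thesis using True by simp
    next
      case False
      then have "card (R (Suc m)) \<le> (2 * CARD('g) - 1) * card (R m)" by (intro step) simp
      also have "\<dots> \<le> (2 * CARD('g) - 1) * (2 * CARD('g) * (2 * CARD('g) - 1) ^ m)" using Suc by (rule mult_left_mono) simp
      finally show ?thesis by (simp add: mult_ac)
    qed
  qed
  moreover have "card {x :: 'g free_group. word_length x = m} \<le> card (R m)"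
    by (rule card_inj_on_le[OF _ _ fin, of word]) (auto simp: inj_on_def word_inject R_def word_length_def)
  ultimately show ?thesis by (rule order_trans[rotated])
qed

definition initial_words :: "'g free_group \<Rightarrow> 'g free_group set" where
  "initial_words x = {z. is_prefix z x}"

lemma inj_on_initial_words: "inj_on word_length (initial_words x)"
proof (rule inj_onI)
  fix y z assume yz: "y \<in> initial_words x" "z \<in> initial_words x" and l: "word_length y = word_length z"
  from yz obtain a b where "word x = word y @ a" "word x = word z @ b"
    by (auto simp: initial_words_def is_prefix_def prefix_def)
  then have "word y = word z" using l unfolding word_length_def by (metis append_eq_append_conv)
  then show "y = z" by (simp add: word_inject)
qed

lemma word_length_initial_words: "word_length ` initial_words x \<subseteq> {..word_length x}"
  by (auto simp: initial_words_def is_prefix_def word_length_def prefix_length_le)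

lemma finite_initial_words [simp]: "finite (initial_words x)"
  using inj_on_initial_words word_length_initial_words by (rule inj_on_finite) simp

lemma initial_words_factor:
  assumes "z \<in> initial_words x"
  obtains y where "x = z * y" "red_concat z y" "word_length x = word_length z + word_length y"
proof -
  obtain zs where "word x = word z @ zs" using assms by (auto simp: initial_words_def is_prefix_def prefix_def)
  then obtain z' y where *: "x = z' * y" "red_concat z' y" "word z' = word z" by (rule factor_word)
  then have "z' = z" by (simp add: word_inject)
  then show ?thesis using * that word_length_mult_red[OF *(2)] by simp
qed

locale isotropic_branching = branching \<mu> r L p for \<mu> :: "'g::finite free_group pmf" and r L p +
  assumes iso: "pmf \<mu> (gen i) = (1 - pmf \<mu> 1) / (2 * real CARD('g))"
    "pmf \<mu> (inverse (gen i)) = (1 - pmf \<mu> 1) / (2 * real CARD('g))"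
begin

definition pp :: real where "pp = (1 - pmf \<mu> 1) / (2 * real CARD('g))"
definition q0 :: real where "q0 = r * pp"
definition e0 :: real where "e0 = r * pmf \<mu> 1"
definition f :: real where "f = \<phi> l0"
definition dd :: real where "dd = 2 * real CARD('g) - 1"

lemma mu_letter: "pmf \<mu> (of_letter a) = pp"
  using iso[of "fst a"] by (cases a; cases "snd a") (auto simp: gen_eq_of_letter inverse_of_letter flip_def pp_def)

lemma q0_pos: "0 < q0" and e0_nonneg: "0 \<le> e0" and dd_ge: "3 \<le> dd"
  using mu_letter_pos[of l0] r_gt_1 rank by (simp_all add: q0_def e0_def dd_def mu_letter)

lemma f_pos: "0 < f" and f_less_1: "f < 1"
  by (simp_all add: f_def \<phi>_pos \<phi>_less_1)

text \<open>All letters satisfy the same quadratic equation, whose roots have product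
  \<open>-1\<close>, so there is only one positive root.\<close>

lemma phi_eq_f: "\<phi> a = f"
proof -
  have "\<phi> a + q0 * (\<phi> a)\<^sup>2 = q0 + u * \<phi> a" "f + q0 * f\<^sup>2 = q0 + u * f"
    using \<phi>_eq[of a] \<phi>_eq[of l0] by (simp_all add: mu_letter q0_def f_def)
  then have "(\<phi> a - f) * ((1 - u) + q0 * (\<phi> a + f)) = 0" by (simp add: algebra_simps power2_eq_square)
  moreover have "0 < (1 - u) + q0 * (\<phi> a + f)"
    using u_less_1 q0_pos \<phi>_pos[of a] f_pos by (intro add_pos_pos mult_pos_pos) auto
  ultimately show ?thesis by simp
qed

lemma F_f: "F r x = ennreal (f ^ word_length x)"
proof -
  have "map \<phi> ys = replicate (length ys) f" for ys by (induction ys) (auto simp: phi_eq_f)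
  then show ?thesis by (simp add: F_word word_length_def)
qed

lemma sum_letters: "(\<Sum>y\<in>generators. h y) = (\<Sum>a\<in>UNIV. h (of_letter a))"
  unfolding generators_eq by (subst sum.reindex) (auto simp: inj_def)

lemma sum_S: "(\<Sum>y\<in>S. h y) = h 1 + (\<Sum>a\<in>UNIV. h (of_letter a))"
proof -
  have "1 \<notin> (generators :: 'g free_group set)" by (auto simp: generators_eq)
  then show ?thesis by (simp add: sum_letters)
qed

lemma u_eq: "u = e0 + (dd + 1) * q0 * f"
proof -
  have "ennreal u = (\<Sum>y\<in>S. ennreal (r * pmf \<mu> y) * F r (inverse y))" by (simp add: U_def U_eq_u[symmetric])
  also have "\<dots> = ennreal e0 + (\<Sum>a\<in>(UNIV :: 'g letter set). ennreal q0 * ennreal f)"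
    by (subst sum_S) (simp add: F_f mu_letter q0_def e0_def)
  also have "(\<Sum>a\<in>(UNIV :: 'g letter set). ennreal q0 * ennreal f) = ennreal ((dd + 1) * q0 * f)"
    using q0_pos f_pos dd_ge
    by (simp add: dd_def ennreal_of_nat_eq_real_of_nat ennreal_mult'[symmetric] mult.assoc del: ennreal_mult')
  also have "ennreal e0 + ennreal ((dd + 1) * q0 * f) = ennreal (e0 + (dd + 1) * q0 * f)"
    using q0_pos f_pos e0_nonneg dd_ge by (intro ennreal_plus[symmetric]) auto
  finally show ?thesis using u_nonneg q0_pos f_pos e0_nonneg dd_ge by (subst (asm) ennreal_inj) auto
qed

lemma f_quadratic: "f = q0 + e0 * f + dd * q0 * f\<^sup>2"
proof -
  have "f + q0 * f\<^sup>2 = q0 + u * f" using \<phi>_eq[of l0] by (simp add: mu_letter q0_def f_def)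
  then show ?thesis unfolding u_eq by (simp add: algebra_simps power2_eq_square)
qed

definition Tr :: "nat \<Rightarrow> 'g free_group \<Rightarrow> real" where
  "Tr N x = (\<Sum>n\<le>N. r ^ n * fp n x)"

lemma Tr_nonneg: "0 \<le> Tr N x"
  unfolding Tr_def using r_gt_1 by (intro sum_nonneg) auto

lemma Tr_mult: "red_concat x y \<Longrightarrow> Tr N (x * y) \<le> Tr N x * Tr N y"
proof -
  assume xy: "red_concat x y"
  have "Tr N (x * y) = (\<Sum>n\<le>N. \<Sum>i\<le>n. (r ^ i * fp i x) * (r ^ (n - i) * fp (n - i) y))"
    unfolding Tr_def fp_mult[OF xy] sum_distrib_left
  proof (intro sum.cong refl)
    fix n i :: nat assume "i \<in> {..n}"
    then have "r ^ n = r ^ i * r ^ (n - i)" by (simp add: power_add[symmetric])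
    then show "r ^ n * (fp i x * fp (n - i) y) = r ^ i * fp i x * (r ^ (n - i) * fp (n - i) y)"
      by (simp only: mult_ac)
  qed
  also have "\<dots> \<le> Tr N x * Tr N y"
    unfolding Tr_def using r_gt_1 by (intro truncated_product_le) auto
  finally show ?thesis .
qed

lemma Tr_Suc: "x \<noteq> 1 \<Longrightarrow> Tr (Suc N) x = (\<Sum>z\<in>S. r * pmf \<mu> z * Tr N (inverse z * x))"
proof -
  assume x: "x \<noteq> 1"
  have "Tr (Suc N) x = (\<Sum>n\<le>N. r ^ Suc n * fp (Suc n) x)"
    unfolding Tr_def using x by (subst sum.atMost_Suc_shift) simp
  also have "\<dots> = (\<Sum>n\<le>N. \<Sum>z\<in>S. r * pmf \<mu> z * (r ^ n * fp n (inverse z * x)))"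
    unfolding fp.simps if_not_P[OF x] sum_distrib_left by (intro sum.cong refl) (simp add: mult_ac)
  also have "\<dots> = (\<Sum>z\<in>S. r * pmf \<mu> z * Tr N (inverse z * x))"
    unfolding Tr_def sum_distrib_left by (rule sum.swap)
  finally show ?thesis .
qed

lemma Tr_letter_le:
  assumes y: "0 \<le> y" "q0 + e0 * y + dd * q0 * y\<^sup>2 \<le> y"
  shows "Tr N (of_letter a) \<le> y"
proof (induction N arbitrary: a)
  case 0
  then show ?case using y by (simp add: Tr_def)
next
  case (Suc N)
  have T1: "Tr N 1 = 1" by (simp add: Tr_def fp_one if_distrib[of "(*) _"] cong: if_cong)
  have other: "Tr N (of_letter (flip b) * of_letter a) \<le> y\<^sup>2" if "b \<noteq> a" for b
  proof -
    have "red_concat (of_letter (flip b)) (of_letter a)" using that by (simp add: red_concat_iff)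
    then have "Tr N (of_letter (flip b) * of_letter a) \<le> Tr N (of_letter (flip b)) * Tr N (of_letter a)" by (rule Tr_mult)
    also have "\<dots> \<le> y * y" by (intro mult_mono Suc y Tr_nonneg)
    finally show ?thesis by (simp add: power2_eq_square)
  qed
  have "Tr (Suc N) (of_letter a) = e0 * Tr N (of_letter a) + (\<Sum>b\<in>UNIV. q0 * Tr N (of_letter (flip b) * of_letter a))"
    by (simp add: Tr_Suc sum_S e0_def q0_def mu_letter inverse_of_letter)
  also have "(\<Sum>b\<in>UNIV. q0 * Tr N (of_letter (flip b) * of_letter a))
      = q0 * Tr N (of_letter (flip a) * of_letter a) + (\<Sum>b\<in>UNIV - {a}. q0 * Tr N (of_letter (flip b) * of_letter a))"
    by (rule sum.remove) auto
  also have "of_letter (flip a) * of_letter a = 1" by (simp flip: inverse_of_letter)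
  also have "e0 * Tr N (of_letter a) + (q0 * Tr N 1 + (\<Sum>b\<in>UNIV - {a}. q0 * Tr N (of_letter (flip b) * of_letter a)))
      \<le> e0 * y + (q0 * 1 + (\<Sum>b\<in>UNIV - {a}. q0 * y\<^sup>2))"
    unfolding T1 using q0_pos e0_nonneg by (intro add_mono mult_left_mono sum_mono Suc other) auto
  also have "\<dots> = q0 + e0 * y + dd * q0 * y\<^sup>2"
    by (simp add: card_Diff_singleton dd_def of_nat_diff)
  finally show ?case using y(2) by linarith
qed

text \<open>The truncated generating functions stay below every supersolution of the quadratic equation, so
  \<open>f\<close> is its smaller root; the other one is \<open>1 / (dd * f)\<close>.\<close>

lemma dd_f_square: "dd * f\<^sup>2 \<le> 1"
proof -
  define y where "y = 1 / (dd * f)"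
  have y0: "0 < y" using dd_ge f_pos by (simp add: y_def)
  have yf: "y * (dd * f) = 1" using dd_ge f_pos by (simp add: y_def)
  have "(q0 + e0 * y + dd * q0 * y\<^sup>2 - y) * (dd * f\<^sup>2) = q0 * (dd * f\<^sup>2) + (e0 - 1) * f * (y * (dd * f)) + q0 * (y * (dd * f))\<^sup>2"
    by (simp add: algebra_simps power2_eq_square)
  also have "\<dots> = 0" unfolding yf using f_quadratic by (simp add: algebra_simps)
  finally have "q0 + e0 * y + dd * q0 * y\<^sup>2 - y = 0" using dd_ge f_pos by simp
  then have Tr: "Tr N (of_letter l0) \<le> y" for N using y0 by (intro Tr_letter_le) auto
  have "ennreal f = (\<Sum>n. ennreal (r ^ n * fp n (of_letter l0)))"
    using F_f[of "of_letter l0"] by (simp add: F_def)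
  also have "\<dots> \<le> ennreal y"
  proof (rule suminf_le_const)
    fix N
    have "(\<Sum>n<N. ennreal (r ^ n * fp n (of_letter l0))) \<le> (\<Sum>n\<le>N. ennreal (r ^ n * fp n (of_letter l0)))"
      by (intro sum_mono2) auto
    also have "\<dots> = ennreal (Tr N (of_letter l0))" unfolding Tr_def using r_gt_1 by (intro sum_ennreal) auto
    also have "\<dots> \<le> ennreal y" by (intro ennreal_leI Tr)
    finally show "(\<Sum>n<N. ennreal (r ^ n * fp n (of_letter l0))) \<le> ennreal y" .
  qed simp
  finally have "f \<le> y" using y0 by simp
  then have "f * (dd * f) \<le> y * (dd * f)" using dd_ge f_pos by (intro mult_right_mono) auto
  then show ?thesis unfolding yf by (simp add: power2_eq_square mult_ac)
qed

lemma Lv_isotropic: "Lv m \<le> ennreal ((dd + 1) * exp (ln (dd * f) * real m))"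
proof -
  have "Lv m = of_nat (card {x :: 'g free_group. word_length x = m}) * ennreal (f ^ m)"
  proof -
    have "Lv m = (\<Sum>x\<in>{x :: 'g free_group. word_length x = m}. ennreal (f ^ m))"
      unfolding Lv_def by (rule sum.cong) (simp_all add: F_f)
    then show ?thesis by (simp only: sum_constant)
  qed
  also have "\<dots> = ennreal (real (card {x :: 'g free_group. word_length x = m}) * f ^ m)"
    using f_pos by (simp add: ennreal_of_nat_eq_real_of_nat ennreal_mult'[symmetric] del: ennreal_mult')
  also have "\<dots> \<le> ennreal (((dd + 1) * dd ^ m) * f ^ m)"
  proof (intro ennreal_leI mult_right_mono)
    have "real (card {x :: 'g free_group. word_length x = m}) \<le> real (2 * CARD('g) * (2 * CARD('g) - 1) ^ m)"
      using card_word_length_eq_le[where 'g = 'g, of m] by (simp only: of_nat_le_iff)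
    also have "\<dots> = (dd + 1) * dd ^ m" by (simp add: dd_def of_nat_diff)
    finally show "real (card {x :: 'g free_group. word_length x = m}) \<le> (dd + 1) * dd ^ m" .
  qed (use f_pos in auto)
  also have "((dd + 1) * dd ^ m) * f ^ m = (dd + 1) * (dd * f) ^ m" by (simp add: power_mult_distrib)
  also have "(dd * f) ^ m = exp (real m * ln (dd * f))" using dd_ge f_pos by (simp add: exp_of_nat_mult)
  finally show ?thesis by (simp add: mult.commute)
qed

definition hw :: "real \<Rightarrow> real \<Rightarrow> real \<Rightarrow> nat \<Rightarrow> 'g free_group \<Rightarrow> 'g free_group \<Rightarrow> ennreal" where
  "hw c d s n x z = indicator {c..d} (real (word_length x) / real n) * (indicator (initial_words x) z * weight s z)"

text \<open>Starting from \<open>x\<close>, the return to the prefix \<open>j\<close> letters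
  shorter has Green weight \<open>f ^ j * Gc\<close>, while the larger cylinder has weight
  \<open>exp (s * j)\<close> times that of \<open>x\<close>. The sum over \<open>j\<close> is
  geometric with ratio \<open>f * exp s\<close>, which is the origin of the threshold
  \<open>- ln f\<close>.\<close>

lemma return_weight:
  assumes s: "f * exp s < 1"
  shows "(\<Sum>k. ennreal (r ^ k) * (\<integral>\<^sup>+y. indicator (initial_words x) (x * y) * weight s (x * y) \<partial>walk \<mu> k))
    \<le> ennreal (Gc / (1 - f * exp s)) * weight s x"
proof -
  let ?e = "\<lambda>z. weight s z"
  have I: "(\<integral>\<^sup>+y. indicator (initial_words x) (x * y) * ?e (x * y) \<partial>walk \<mu> k)
      = (\<Sum>z\<in>initial_words x. ennreal (P k (inverse x * z)) * ?e z)" for k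
  proof -
    have "(\<integral>\<^sup>+y. indicator (initial_words x) (x * y) * ?e (x * y) \<partial>walk \<mu> k)
        = (\<integral>\<^sup>+y. ennreal (P k (inverse x * (x * y))) * (indicator (initial_words x) (x * y) * ?e (x * y)) \<partial>count_space UNIV)"
      by (simp add: nn_integral_measure_pmf P_def)
    also have "\<dots> = (\<integral>\<^sup>+z. ennreal (P k (inverse x * z)) * (indicator (initial_words x) z * ?e z) \<partial>count_space UNIV)"
      by (rule nn_integral_bij_count_space) (auto intro!: bij_betwI[of _ _ _ "\<lambda>z. inverse x * z"])
    also have "\<dots> = (\<integral>\<^sup>+z. ennreal (P k (inverse x * z)) * ?e z \<partial>count_space (initial_words x))"
      by (subst (2) nn_integral_count_space_indicator) (auto intro!: nn_integral_cong simp: indicator_def)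
    finally show ?thesis by (simp add: nn_integral_count_space_finite)
  qed
  have "(\<Sum>k. ennreal (r ^ k) * (\<integral>\<^sup>+y. indicator (initial_words x) (x * y) * ?e (x * y) \<partial>walk \<mu> k))
      = (\<Sum>k. \<Sum>z\<in>initial_words x. ?e z * ennreal (r ^ k * P k (inverse x * z)))"
    unfolding I sum_distrib_left using r_gt_1 by (intro suminf_cong sum.cong refl) (simp add: ennreal_mult mult_ac)
  also have "\<dots> = (\<Sum>z\<in>initial_words x. ?e z * G r (inverse x * z))"
    by (simp add: suminf_sum_ennreal G_def)
  also have "\<dots> = (\<Sum>z\<in>initial_words x. ennreal (exp (- s * real (word_length z)) * (f ^ (word_length x - word_length z) * Gc)))"
  proof (rule sum.cong[OF refl])
    fix z assume "z \<in> initial_words x"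
    then obtain y where y: "x = z * y" "word_length x = word_length z + word_length y" by (rule initial_words_factor)
    have "inverse x * z = inverse y" by (simp add: y(1) inverse_mult_free mult.assoc)
    then have "G r (inverse x * z) = ennreal (f ^ (word_length x - word_length z)) * ennreal Gc"
      using r_gt_1 y(2) by (simp add: G_eq[of r] F_f G_eq_Gc)
    then show "?e z * G r (inverse x * z) = ennreal (exp (- s * real (word_length z)) * (f ^ (word_length x - word_length z) * Gc))"
      using f_pos by (simp add: ennreal_mult'[symmetric] del: ennreal_mult')
  qed
  also have "\<dots> = (\<Sum>j\<in>word_length ` initial_words x. ennreal (exp (- s * real j) * (f ^ (word_length x - j) * Gc)))"
    by (subst sum.reindex[OF inj_on_initial_words]) simp
  also have "\<dots> \<le> (\<Sum>j\<le>word_length x. ennreal (exp (- s * real j) * (f ^ (word_length x - j) * Gc)))"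
    by (rule sum_mono2[OF _ word_length_initial_words]) auto
  also have "\<dots> = (\<Sum>i\<le>word_length x. ennreal (exp (- s * real (word_length x - i)) * (f ^ i * Gc)))"
    by (rule sum.reindex_bij_witness[of _ "\<lambda>i. word_length x - i" "\<lambda>i. word_length x - i"]) auto
  also have "\<dots> = (\<Sum>i\<le>word_length x. ennreal (exp (- s * real (word_length x)) * Gc * (f * exp s) ^ i))"
  proof (rule sum.cong[OF refl])
    fix i assume "i \<in> {..word_length x}"
    then have "exp (- s * real (word_length x - i)) = exp (- s * real (word_length x)) * exp s ^ i"
      unfolding exp_of_nat_mult[symmetric] exp_add[symmetric] by (simp add: of_nat_diff algebra_simps)
    then show "ennreal (exp (- s * real (word_length x - i)) * (f ^ i * Gc)) = ennreal (exp (- s * real (word_length x)) * Gc * (f * exp s) ^ i)"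
      by (simp add: power_mult_distrib mult_ac)
  qed
  also have "\<dots> \<le> (\<Sum>i. ennreal (exp (- s * real (word_length x)) * Gc * (f * exp s) ^ i))"
    by (rule sum_le_suminf) auto
  also have "\<dots> = ennreal (exp (- s * real (word_length x)) * Gc * (1 / (1 - f * exp s)))"
    using s f_pos Gc_ge_1 by (intro suminf_ennreal_eq sums_mult geometric_sums) auto
  also have "\<dots> = ennreal (Gc / (1 - f * exp s)) * weight s x"
    using s Gc_ge_1 by (simp add: ennreal_mult'[symmetric] mult_ac del: ennreal_mult')
  finally show ?thesis .
qed

definition iso_sum :: "'g environment \<Rightarrow> real \<Rightarrow> real \<Rightarrow> real \<Rightarrow> ennreal" where
  "iso_sum \<omega> c d s = (\<integral>\<^sup>+w. indicator (tree \<omega>) w * (\<Sum>n\<le>length w. hw c d s n (pos \<omega> (take n w)) (pos \<omega> w)) \<partial>count_space UNIV)"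

text \<open>The path is split at the recorded time \<open>n\<close>. By \<open>return_weight\<close>
  the remaining part contributes at most a constant times the weight of the position at time
  \<open>n\<close>, so the mean is bounded by a multiple of \<open>W c d s\<close>.\<close>

lemma AE_iso_sum:
  assumes W: "W c d s < \<top>" and s: "f * exp s < 1"
  shows "AE \<omega> in \<E>. iso_sum \<omega> c d s < \<top>"
proof -
  let ?f = "\<lambda>ys. \<Sum>n\<le>length ys. hw c d s n (prod_list (take n ys)) (prod_list ys)"
  let ?I = "\<lambda>n x. indicator {c..d} (real (word_length x) / real n) :: ennreal"
  have split: "(\<integral>\<^sup>+ys. hw c d s n (prod_list (take n ys)) (prod_list ys) \<partial>replicate_pmf (n + k) \<mu>)
      = (\<integral>\<^sup>+x. \<integral>\<^sup>+y. hw c d s n x (x * y) \<partial>walk \<mu> k \<partial>walk \<mu> n)" for n k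
  proof -
    have "(\<integral>\<^sup>+ys. hw c d s n (prod_list (take n ys)) (prod_list ys) \<partial>replicate_pmf (n + k) \<mu>)
        = (\<integral>\<^sup>+xs. \<integral>\<^sup>+ys. hw c d s n (prod_list (take n (xs @ ys))) (prod_list (xs @ ys)) \<partial>replicate_pmf k \<mu> \<partial>replicate_pmf n \<mu>)"
      unfolding replicate_pmf_distrib nn_integral_bind_pmf by simp
    also have "\<dots> = (\<integral>\<^sup>+xs. \<integral>\<^sup>+ys. hw c d s n (prod_list xs) (prod_list xs * prod_list ys) \<partial>replicate_pmf k \<mu> \<partial>replicate_pmf n \<mu>)"
      by (rule nn_integral_cong_AE) (auto simp: AE_measure_pmf_iff set_replicate_pmf)
    finally show ?thesis by (simp add: walk_def)
  qed
  have "(\<Sum>N. ennreal (r ^ N) * (\<integral>\<^sup>+ys. ?f ys \<partial>replicate_pmf N \<mu>))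
      = (\<Sum>N. \<Sum>n\<le>N. ennreal (r ^ n * r ^ (N - n)) * (\<integral>\<^sup>+x. \<integral>\<^sup>+y. hw c d s n x (x * y) \<partial>walk \<mu> (N - n) \<partial>walk \<mu> n))"
  proof (intro suminf_cong)
    fix N
    have "(\<integral>\<^sup>+ys. ?f ys \<partial>replicate_pmf N \<mu>) = (\<integral>\<^sup>+ys. (\<Sum>n\<le>N. hw c d s n (prod_list (take n ys)) (prod_list ys)) \<partial>replicate_pmf N \<mu>)"
      by (rule nn_integral_cong_AE) (auto simp: AE_measure_pmf_iff set_replicate_pmf)
    also have "\<dots> = (\<Sum>n\<le>N. \<integral>\<^sup>+ys. hw c d s n (prod_list (take n ys)) (prod_list ys) \<partial>replicate_pmf N \<mu>)"
      by (rule nn_integral_sum) simp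
    also have "\<dots> = (\<Sum>n\<le>N. \<integral>\<^sup>+x. \<integral>\<^sup>+y. hw c d s n x (x * y) \<partial>walk \<mu> (N - n) \<partial>walk \<mu> n)"
    proof (rule sum.cong[OF refl])
      fix n assume "n \<in> {..N}"
      then show "(\<integral>\<^sup>+ys. hw c d s n (prod_list (take n ys)) (prod_list ys) \<partial>replicate_pmf N \<mu>)
        = (\<integral>\<^sup>+x. \<integral>\<^sup>+y. hw c d s n x (x * y) \<partial>walk \<mu> (N - n) \<partial>walk \<mu> n)"
        using split[of n "N - n"] by simp
    qed
    finally show "ennreal (r ^ N) * (\<integral>\<^sup>+ys. ?f ys \<partial>replicate_pmf N \<mu>)
      = (\<Sum>n\<le>N. ennreal (r ^ n * r ^ (N - n)) * (\<integral>\<^sup>+x. \<integral>\<^sup>+y. hw c d s n x (x * y) \<partial>walk \<mu> (N - n) \<partial>walk \<mu> n))"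
      by (simp add: sum_distrib_left power_add[symmetric])
  qed
  also have "\<dots> = (\<Sum>n. \<Sum>k. ennreal (r ^ n * r ^ k) * (\<integral>\<^sup>+x. \<integral>\<^sup>+y. hw c d s n x (x * y) \<partial>walk \<mu> k \<partial>walk \<mu> n))"
    by (rule suminf_triangle)
  also have "\<dots> = (\<Sum>n. ennreal (r ^ n) * (\<integral>\<^sup>+x. ?I n x * (\<Sum>k. ennreal (r ^ k) *
      (\<integral>\<^sup>+y. indicator (initial_words x) (x * y) * weight s (x * y) \<partial>walk \<mu> k)) \<partial>walk \<mu> n))"
  proof (rule suminf_cong)
    fix n
    let ?H = "\<lambda>k x. \<integral>\<^sup>+y. indicator (initial_words x) (x * y) * weight s (x * y) \<partial>walk \<mu> k"
    have "(\<Sum>k. ennreal (r ^ n * r ^ k) * (\<integral>\<^sup>+x. \<integral>\<^sup>+y. hw c d s n x (x * y) \<partial>walk \<mu> k \<partial>walk \<mu> n))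
        = (\<Sum>k. ennreal (r ^ n) * (\<integral>\<^sup>+x. ?I n x * (ennreal (r ^ k) * ?H k x) \<partial>walk \<mu> n))"
    proof (rule suminf_cong)
      fix k
      have "(\<integral>\<^sup>+x. ?I n x * (ennreal (r ^ k) * ?H k x) \<partial>walk \<mu> n) = ennreal (r ^ k) * (\<integral>\<^sup>+x. ?I n x * ?H k x \<partial>walk \<mu> n)"
        by (subst nn_integral_cmult[symmetric]) (simp_all add: mult.left_commute)
      moreover have "(\<integral>\<^sup>+x. \<integral>\<^sup>+y. hw c d s n x (x * y) \<partial>walk \<mu> k \<partial>walk \<mu> n) = (\<integral>\<^sup>+x. ?I n x * ?H k x \<partial>walk \<mu> n)"
        unfolding hw_def by (intro nn_integral_cong nn_integral_cmult) simp
      ultimately show "ennreal (r ^ n * r ^ k) * (\<integral>\<^sup>+x. \<integral>\<^sup>+y. hw c d s n x (x * y) \<partial>walk \<mu> k \<partial>walk \<mu> n)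
        = ennreal (r ^ n) * (\<integral>\<^sup>+x. ?I n x * (ennreal (r ^ k) * ?H k x) \<partial>walk \<mu> n)"
        using r_gt_1 by (simp only: ennreal_mult mult.assoc zero_le_power less_imp_le[OF less_trans[OF zero_less_one r_gt_1]])
    qed
    also have "\<dots> = ennreal (r ^ n) * (\<integral>\<^sup>+x. (\<Sum>k. ?I n x * (ennreal (r ^ k) * ?H k x)) \<partial>walk \<mu> n)"
      by (subst nn_integral_suminf) simp_all
    finally show "(\<Sum>k. ennreal (r ^ n * r ^ k) * (\<integral>\<^sup>+x. \<integral>\<^sup>+y. hw c d s n x (x * y) \<partial>walk \<mu> k \<partial>walk \<mu> n))
        = ennreal (r ^ n) * (\<integral>\<^sup>+x. ?I n x * (\<Sum>k. ennreal (r ^ k) * ?H k x) \<partial>walk \<mu> n)" by simp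
  qed
  also have "\<dots> \<le> (\<Sum>n. ennreal (r ^ n) * (\<integral>\<^sup>+x. ?I n x * (ennreal (Gc / (1 - f * exp s)) * weight s x) \<partial>walk \<mu> n))"
    by (intro suminf_le mult_left_mono nn_integral_mono return_weight[OF s]) auto
  also have "\<dots> = ennreal (Gc / (1 - f * exp s)) * W c d s"
    unfolding W_def ennreal_suminf_cmult[symmetric]
  proof (rule suminf_cong)
    fix n
    have "(\<integral>\<^sup>+x. ?I n x * (ennreal (Gc / (1 - f * exp s)) * weight s x) \<partial>walk \<mu> n)
      = ennreal (Gc / (1 - f * exp s)) * (\<integral>\<^sup>+x. ?I n x * weight s x \<partial>walk \<mu> n)"
      by (subst nn_integral_cmult[symmetric]) (simp_all add: mult.left_commute)
    then show "ennreal (r ^ n) * (\<integral>\<^sup>+x. ?I n x * (ennreal (Gc / (1 - f * exp s)) * weight s x) \<partial>walk \<mu> n)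
      = ennreal (Gc / (1 - f * exp s)) * (ennreal (r ^ n) * (\<integral>\<^sup>+x. ?I n x * weight s x \<partial>walk \<mu> n))"
      by (simp only: mult.left_commute)
  qed
  also have "\<dots> < \<top>" using W by (simp add: ennreal_mult_less_top)
  finally have "AE \<omega> in \<E>. (\<integral>\<^sup>+w. indicator (tree \<omega>) w * ?f (incs \<omega> w) \<partial>count_space UNIV) < \<top>"
    by (rule AE_sum_finite)
  moreover have "iso_sum \<omega> c d s = (\<integral>\<^sup>+w. indicator (tree \<omega>) w * ?f (incs \<omega> w) \<partial>count_space UNIV)" for \<omega>
    unfolding iso_sum_def by (intro nn_integral_cong arg_cong2[where f = "(*)"] refl sum.cong) (simp_all add: pos_incs take_incs)
  ultimately show ?thesis by simp
qed

definition iso_covered :: "'g environment \<Rightarrow> bool" where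
  "iso_covered \<omega> \<longleftrightarrow> (\<forall>c d s :: rat. W (of_rat c) (of_rat d) (of_rat s) < \<top> \<and> f * exp (of_rat s) < 1 \<longrightarrow> iso_sum \<omega> (of_rat c) (of_rat d) (of_rat s) < \<top>)"

lemma AE_iso_covered: "AE \<omega> in \<E>. iso_covered \<omega>"
  unfolding iso_covered_def by (simp add: AE_all_countable AE_iso_sum)

lemma dim_upper_isotropic:
  assumes Y: "\<And>w. word_length (snd (\<omega> w)) \<le> 1" and cov: "covered \<omega>" and iso: "iso_covered \<omega>"
    and ab: "\<alpha> \<le> \<beta>" and \<alpha>: "\<alpha> \<in> I_set L r" and \<beta>: "\<beta> \<in> I_set L r"
  shows "hausdorff_dim (LambdaE \<omega> \<alpha> \<beta>) \<le> dim_bound L r \<beta>"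
proof (cases "\<beta> = 0")
  case True
  then have "\<alpha> = \<beta>" using ab \<alpha> by (auto simp: I_set_def)
  then show ?thesis using dim_upper[OF Y cov ab \<alpha>] by simp
next
  case False
  then have \<beta>0: "0 < \<beta>" using \<beta> by (auto simp: I_set_def)
  have lnf: "0 < - ln f" using f_pos f_less_1 by simp
  show ?thesis
  proof (rule ereal_le_of_rats)
    fix h :: rat assume h: "dim_bound L r \<beta> < ereal (of_rat h)"
    let ?h = "of_rat h :: real"
    show "hausdorff_dim (LambdaE \<omega> \<alpha> \<beta>) \<le> ereal ?h"
    proof (cases "dim_bound L r \<beta> < ereal (- ln f)")
      case True
      then have "dim_bound L r \<beta> < min (ereal ?h) (ereal (- ln f))" using h by simp
      \<comment> \<open>The exponent is lowered below \<open>- ln f\<close>, where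
        \<open>return_weight\<close> applies; a bound by \<open>h'\<close> is stronger than the one
        by \<open>h\<close>.\<close>
      then obtain h' :: rat where h': "dim_bound L r \<beta> < ereal (of_rat h')" "ereal (of_rat h') < min (ereal ?h) (ereal (- ln f))"
        using ereal_dense3 by blast
      let ?s = "of_rat h' :: real"
      note * = W_finite_of_dim_bound[OF \<beta>0 \<beta> h'(1)]
      obtain c d :: rat where cd: "of_rat c < \<beta>" "\<beta> < of_rat d" "W (of_rat c) (of_rat d) ?s < \<top>"
        using W_finite[OF less_imp_le[OF *(1)] *(2)] by blast
      have "exp (ln f + ?s) < 1" using h'(2) by simp
      then have "f * exp ?s < 1" using f_pos by (simp add: exp_add)
      then have fin: "iso_sum \<omega> (of_rat c) (of_rat d) ?s < \<top>" using iso cd(3) unfolding iso_covered_def by blast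
      define J where "J = {w. w \<in> tree \<omega> \<and> (\<exists>n\<le>length w. real (word_length (pos \<omega> (take n w))) / real n \<in> {of_rat c..of_rat d} \<and> is_prefix (pos \<omega> w) (pos \<omega> (take n w)))}"
      have "(\<integral>\<^sup>+w. indicator J w * weight ?s (pos \<omega> w) \<partial>count_space UNIV) \<le> iso_sum \<omega> (of_rat c) (of_rat d) ?s"
        unfolding iso_sum_def
      proof (rule nn_integral_mono)
        fix w
        show "indicator J w * weight ?s (pos \<omega> w)
          \<le> indicator (tree \<omega>) w * (\<Sum>n\<le>length w. hw (of_rat c) (of_rat d) ?s n (pos \<omega> (take n w)) (pos \<omega> w))"
        proof (cases "w \<in> J")
          case True
          then obtain n where n: "w \<in> tree \<omega>" "n \<le> length w" "real (word_length (pos \<omega> (take n w))) / real n \<in> {of_rat c..of_rat d}" "is_prefix (pos \<omega> w) (pos \<omega> (take n w))"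
            unfolding J_def by blast
          have "weight ?s (pos \<omega> w) = hw (of_rat c) (of_rat d) ?s n (pos \<omega> (take n w)) (pos \<omega> w)"
            using n(3,4) by (simp add: hw_def initial_words_def)
          also have "\<dots> \<le> (\<Sum>n\<le>length w. hw (of_rat c) (of_rat d) ?s n (pos \<omega> (take n w)) (pos \<omega> w))"
            by (rule member_le_sum) (use n(2) in auto)
          finally show ?thesis using True n(1) by simp
        qed simp
      qed
      then have "hausdorff_measure ?s (LambdaE \<omega> \<alpha> \<beta>) = 0"
        by (rule hausdorff_null[OF *(1) le_less_trans[OF _ fin]])
          (use Lambda_cover_limsup[where \<omega> = \<omega>, OF Y _ ab cd(1,2)] in \<open>simp add: J_def\<close>)
      then have "hausdorff_dim (LambdaE \<omega> \<alpha> \<beta>) \<le> ereal ?s" using *(1) by (intro hausdorff_dim_le) auto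
      then show ?thesis using h'(2) by (meson less_imp_le min_less_iff_conj order_trans)
    next
      case False
      \<comment> \<open>Since \<open>dd * f\<close> is at most \<open>1 / f\<close>, such an
        \<open>h\<close> exceeds the growth rate \<open>ln (dd * f)\<close> of the level
        sums.\<close>
      then have hf: "- ln f < ?h" using h by (metis ereal_less(2) le_less_trans less_ereal.simps(1) not_le)
      have "ln (dd * f) + ln f = ln (dd * f\<^sup>2)" using dd_ge f_pos by (simp add: ln_mult power2_eq_square)
      also have "\<dots> \<le> 0" using dd_f_square dd_ge f_pos by simp
      finally have "ln (dd * f) < ?h" using hf by simp
      then have "W 0 1 ?h < \<top>" using dd_ge by (intro W_all_finite[OF Lv_isotropic]) auto
      moreover have "0 < ?h" using hf lnf by linarith
      ultimately show ?thesis by (intro dim_le_all[OF Y cov])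
    qed
  qed
qed

end

section \<open>Transfer to an arbitrary probability space and conclusion\<close>

text \<open>Independence of the labels says that their joint law is the product measure
  \<open>env\<close>, so almost sure statements about environments can be pulled back.\<close>

lemma branching_walk_env:
  fixes N :: "'w \<Rightarrow> nat list \<Rightarrow> nat" and Y :: "'w \<Rightarrow> nat list \<Rightarrow> 'g free_group"
  assumes brw: "branching_walk M p \<mu> N Y" and Q: "AE \<omega> in env (pair_pmf p \<mu>). Q \<omega>"
  shows "AE x in M. Q (\<lambda>w. (N x w, Y x w))"
proof -
  let ?Z = "\<lambda>x w. (N x w, Y x w)"
  have brw': "prob_space M" "prob_space.indep_vars M (\<lambda>_. count_space UNIV) (\<lambda>w x. (N x w, Y x w)) UNIV"
    "\<And>w. distr M (count_space UNIV) (\<lambda>x. (N x w, Y x w)) = measure_pmf (pair_pmf p \<mu>)"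
    using brw by (simp_all add: branching_walk_def)
  interpret prob_space M by (rule brw')
  have rv: "(\<lambda>x. (N x w, Y x w)) \<in> M \<rightarrow>\<^sub>M count_space UNIV" for w
    using brw'(2) by (simp add: indep_vars_def)
  have "distr M (PiM UNIV (\<lambda>_. count_space UNIV)) (\<lambda>x. \<lambda>w\<in>UNIV. (N x w, Y x w)) = PiM UNIV (\<lambda>w. distr M (count_space UNIV) (\<lambda>x. (N x w, Y x w)))"
    using indep_vars_iff_distr_eq_PiM[of UNIV "\<lambda>w x. (N x w, Y x w)" "\<lambda>_. count_space UNIV", OF _ rv] brw'(2) by simp
  then have "distr M (PiM UNIV (\<lambda>_. count_space UNIV)) ?Z = env (pair_pmf p \<mu>)"
    by (simp add: brw'(3) env_def restrict_def)
  moreover have "distr M (env (pair_pmf p \<mu>)) ?Z = distr M (PiM UNIV (\<lambda>_. count_space UNIV)) ?Z"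
    by (rule distr_cong) (auto simp: env_def intro!: sets_PiM_cong)
  ultimately have "distr M (env (pair_pmf p \<mu>)) ?Z = env (pair_pmf p \<mu>)" by simp
  with Q have "AE \<omega> in distr M (env (pair_pmf p \<mu>)) ?Z. Q \<omega>" by (simp only:)
  then show ?thesis
    by (rule AE_distrD[rotated]) (rule measurable_into_env[OF rv])
qed

context branching
begin

lemma AE_steps: "AE \<omega> in \<E>. \<forall>w. word_length (snd (\<omega> w)) \<le> 1"
proof (subst AE_all_countable, rule allI)
  fix w :: "nat list"
  let ?B = "{b :: nat \<times> 'g free_group. \<not> word_length (snd b) \<le> 1}"
  have "set_pmf D \<inter> ?B = {}"
    using supp by (auto simp: generators_eq)
  then have "emeasure (measure_pmf D) ?B = 0" by (simp add: measure_pmf.emeasure_eq_measure measure_pmf_zero_iff)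
  then have "emeasure \<E> {\<omega>. \<not> word_length (snd (\<omega> w)) \<le> 1} = 0"
    using emeasure_env_cylinder'[of "{w}" D "\<lambda>_. ?B"] by simp
  moreover have "{\<omega>. \<not> word_length (snd (\<omega> w)) \<le> 1} \<in> sets \<E>"
    by (rule sets_env_finite[of "{w}"]) auto
  ultimately show "AE \<omega> in \<E>. word_length (snd (\<omega> w)) \<le> 1"
    by (intro AE_I[of _ _ "{\<omega>. \<not> word_length (snd (\<omega> w)) \<le> 1}"]) auto
qed

lemma AE_Lambda:
  "AE \<omega> in \<E>. \<forall>\<alpha> \<beta>. \<alpha> \<le> \<beta> \<and> {\<alpha>..\<beta>} \<subseteq> {0..1} \<longrightarrow>
     (LambdaE \<omega> \<alpha> \<beta> \<noteq> {} \<longleftrightarrow> {\<alpha>..\<beta>} \<subseteq> I_set L r) \<and>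
     ({\<alpha>..\<beta>} \<subseteq> I_set L r \<longrightarrow> (MIN q\<in>{\<alpha>, \<beta>}. dim_bound L r q) \<le> hausdorff_dim (LambdaE \<omega> \<alpha> \<beta>) \<and>
       hausdorff_dim (LambdaE \<omega> \<alpha> \<beta>) \<le> dim_bound L r \<alpha>)"
  using AE_offspring_pos AE_steps AE_seed AE_covered
proof eventually_elim
  case (elim \<omega>)
  then obtain w where w: "w \<in> tree \<omega>" "sh w \<omega> \<in> seed" by blast
  have N: "1 \<le> fst (\<omega> w)" and Y: "word_length (snd (\<omega> w)) \<le> 1" for w using elim by auto
  show ?case
  proof (intro allI impI)
    fix \<alpha> \<beta> assume ab: "\<alpha> \<le> \<beta> \<and> {\<alpha>..\<beta>} \<subseteq> {0..1 :: real}"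
    have "\<alpha> \<in> I_set L r" if "{\<alpha>..\<beta>} \<subseteq> I_set L r" using that ab by auto
    then show "(LambdaE \<omega> \<alpha> \<beta> \<noteq> {} \<longleftrightarrow> {\<alpha>..\<beta>} \<subseteq> I_set L r) \<and>
       ({\<alpha>..\<beta>} \<subseteq> I_set L r \<longrightarrow> (MIN q\<in>{\<alpha>, \<beta>}. dim_bound L r q) \<le> hausdorff_dim (LambdaE \<omega> \<alpha> \<beta>) \<and>
         hausdorff_dim (LambdaE \<omega> \<alpha> \<beta>) \<le> dim_bound L r \<alpha>)"
      using ab Lambda_subset_I[OF Y elim(4), of \<alpha> \<beta>] Lambda_lower[OF N Y w, of \<alpha> \<beta>] dim_upper[OF Y elim(4), of \<alpha> \<beta>]
      by (intro conjI impI iffI) simp_all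
  qed
qed

end

lemma (in isotropic_branching) AE_Lambda_isotropic:
  "AE \<omega> in \<E>. \<forall>\<alpha> \<beta>. \<alpha> \<le> \<beta> \<and> {\<alpha>..\<beta>} \<subseteq> I_set L r \<longrightarrow>
     hausdorff_dim (LambdaE \<omega> \<alpha> \<beta>) = (MIN q\<in>{\<alpha>, \<beta>}. dim_bound L r q)"
  using AE_offspring_pos AE_steps AE_seed AE_covered AE_iso_covered
proof eventually_elim
  case (elim \<omega>)
  then obtain w where w: "w \<in> tree \<omega>" "sh w \<omega> \<in> seed" by blast
  have N: "1 \<le> fst (\<omega> w)" and Y: "word_length (snd (\<omega> w)) \<le> 1" for w using elim by auto
  show ?case
  proof (intro allI impI antisym)
    fix \<alpha> \<beta> assume ab: "\<alpha> \<le> \<beta> \<and> {\<alpha>..\<beta>} \<subseteq> I_set L r"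
    then have I: "\<alpha> \<in> I_set L r" "\<beta> \<in> I_set L r" by auto
    show "(MIN q\<in>{\<alpha>, \<beta>}. dim_bound L r q) \<le> hausdorff_dim (LambdaE \<omega> \<alpha> \<beta>)"
      using ab by (intro Lambda_lower(2)[OF N Y w]) auto
    show "hausdorff_dim (LambdaE \<omega> \<alpha> \<beta>) \<le> (MIN q\<in>{\<alpha>, \<beta>}. dim_bound L r q)"
      using ab dim_upper[OF Y elim(4) _ I(1), of \<beta>] dim_upper_isotropic[OF Y elim(4,5) _ I] by simp
  qed
qed

theorem theorem1p2:
  fixes \<mu> :: "'g::finite free_group pmf"
    and L :: "real \<Rightarrow> ereal"
    and p :: "nat pmf"
    and r :: real
    and M :: "'w measure"
    and N :: "'w \<Rightarrow> nat list \<Rightarrow> nat"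
    and Y :: "'w \<Rightarrow> nat list \<Rightarrow> 'g free_group"
  assumes rank: "CARD('g) \<ge> 2"
    and supp: "set_pmf \<mu> \<subseteq> insert 1 generators"
    and sym: "\<forall>a\<in>generators. pmf \<mu> a = pmf \<mu> (inverse a) \<and> pmf \<mu> a > 0"
    and rate: "is_rate_function \<mu> L"
    and p0: "pmf p 0 = 0"
    and exp_moment: "\<exists>s>0. summable (\<lambda>k. exp (s * real k) * pmf p k)"
    and mean: "(\<lambda>k. real k * pmf p k) sums r"
    and r: "1 < r" "ereal r \<le> inverse (spectral_radius \<mu>)"
    and brw: "branching_walk M p \<mu> N Y"
  shows
    "(AE x in M. \<forall>\<alpha> \<beta>. \<alpha> \<le> \<beta> \<and> {\<alpha>..\<beta>} \<subseteq> {0..1} \<longrightarrow>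
        (Lambda (N x) (Y x) \<alpha> \<beta> \<noteq> {} \<longleftrightarrow> {\<alpha>..\<beta>} \<subseteq> I_set L r) \<and>
        ({\<alpha>..\<beta>} \<subseteq> I_set L r \<longrightarrow>
           (MIN q\<in>{\<alpha>, \<beta>}. dim_bound L r q) \<le> hausdorff_dim (Lambda (N x) (Y x) \<alpha> \<beta>) \<and>
           hausdorff_dim (Lambda (N x) (Y x) \<alpha> \<beta>) \<le> dim_bound L r \<alpha>)) \<and>
     ((\<forall>i. pmf \<mu> (gen i) = (1 - pmf \<mu> 1) / (2 * real CARD('g)) \<and>
           pmf \<mu> (inverse (gen i)) = (1 - pmf \<mu> 1) / (2 * real CARD('g))) \<longrightarrow>
      (AE x in M. \<forall>\<alpha> \<beta>. \<alpha> \<le> \<beta> \<and> {\<alpha>..\<beta>} \<subseteq> I_set L r \<longrightarrow>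
         hausdorff_dim (Lambda (N x) (Y x) \<alpha> \<beta>) = (MIN q\<in>{\<alpha>, \<beta>}. dim_bound L r q)))"
proof -
  interpret branching \<mu> r L p
    by unfold_locales (use assms in auto)
  have LambdaE: "LambdaE (\<lambda>w. (N x w, Y x w)) = Lambda (N x) (Y x)" for x
    by (simp add: LambdaE_def)
  show ?thesis
  proof (intro conjI impI)
    assume iso: "\<forall>i. pmf \<mu> (gen i) = (1 - pmf \<mu> 1) / (2 * real CARD('g)) \<and>
      pmf \<mu> (inverse (gen i)) = (1 - pmf \<mu> 1) / (2 * real CARD('g))"
    interpret isotropic_branching \<mu> r L p
      by unfold_locales (use iso in auto)
    show "AE x in M. \<forall>\<alpha> \<beta>. \<alpha> \<le> \<beta> \<and> {\<alpha>..\<beta>} \<subseteq> I_set L r \<longrightarrow>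
       hausdorff_dim (Lambda (N x) (Y x) \<alpha> \<beta>) = (MIN q\<in>{\<alpha>, \<beta>}. dim_bound L r q)"
      using branching_walk_env[OF brw AE_Lambda_isotropic] unfolding LambdaE .
  qed (use branching_walk_env[OF brw AE_Lambda] in \<open>unfold LambdaE\<close>)
qed

end
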